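(* Let $\mathbb{X}$ be a quasi-Banach space with a Schauder basis $\mathcal{X}=(\boldsymbol{x}_n)_{n=1}^\infty$, and let $\mathbb{S}$ be a superreflexive subsymmetric sequence space. Let $\delta\colon[0,\infty)\to[0,\infty)$ be a non-decreasing map such that $\widetilde{\boldsymbol{k}}_m[\mathcal{X},\mathbb{X}]=\delta(m)$ for all $m\in\mathbb{N}$. Suppose that $\mathbb{X}$ is (locally) $p$-convex, $0<p\le 1$. Let $1<s<\infty$ be such that $\mathbb{S}$ satisfies an upper $s$-estimate, and let $1<q<\infty$ be such that $\mathbb{S}$ satisfies a lower $q$-estimate. Let $\varphi\colon[0,\infty)\to[1,\infty)$ be a concave increasing function. Then $\mathbb{X}\oplus\mathbb{S}$ has an almost greedy Schauder basis $\mathcal{B}=(\boldsymbol{b}_n)_{n=1}^\infty$ with the following properties: (i) $\boldsymbol{\varphi_u^s}[\mathcal{B},\mathbb{X}\oplus\mathbb{S}](m)\approx\Lambda_m[\mathbb{S}]$ for $m\in\mathbb{N}$. (ii) $\mathcal{B}$ is asymptotically suppression unconditional. (iii) Put $\mathbb{X}^{(N)}=[\boldsymbol{x}_n\colon 1\le n\le N]$, $\mathbb{B}^{(N)}=[\boldsymbol{b}_n\colon 1\le n\le N]$ and $\mathbb{S}^{(N)}=[\boldsymbol{e}_n\colon 1\le n\le N]\subseteq\mathbb{S}$ for $N\in\mathbb{N}$. There are increasing sequences $(K_r)_{r=1}^\infty$, $(L_r)_{r=1}^\infty$ and $(P_r)_{r=1}^\infty$ in $\mathbb{N}$ such that, for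 $r\in\mathbb{N}$, (1) $\mathbb{X}^{(r)}\oplus\mathbb{S}^{(K_r)}$ is, uniformly in $r$, complemented in $\mathbb{B}^{(L_r)}$, and (2) $\mathbb{B}^{(L_r)}$ is, uniformly in $r$, complemented in $\mathbb{X}^{(r)}\oplus\mathbb{S}^{(P_r)}$. (iv) $\widetilde{\boldsymbol{k}}_m[\mathcal{B},\mathbb{X}\oplus\mathbb{S}]\gtrsim\delta(\log m)$ for $m\ge 2$. Further, in the case when $\widetilde{\boldsymbol{k}}_m[\mathcal{X},\mathbb{X}]\gtrsim m^{\max\{1/s,\,1/p-1/q\}}$ for $m\in\mathbb{N}$, one can choose $\mathcal{B}$ satisfying, instead of (iv) (and together with (i), (ii), (iii)), (v) $\widetilde{\boldsymbol{k}}_m[\mathcal{B},\mathbb{X}\oplus\mathbb{S}]\approx\delta(\varphi(\log m))$ for $m\in\mathbb{N}$.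
   Context: $\mathbb{F}$ is the real or complex field, and $\mathbb{E}$ is the set of scalars of modulus $1$. $a_m\lesssim b_m$ means $a_m\le Cb_m$ for a constant $C$ independent of $m$; $\gtrsim$ is the reverse, and $\approx$ means both. $[\cdot]$ denotes closed linear span. Sequence spaces. $(\boldsymbol{e}_n)$ is the unit vector system of $\mathbb{F}^{\mathbb{N}}$. A sequence space is a quasi-Banach space $\mathbb{S}\subseteq\mathbb{F}^{\mathbb{N}}$ for which $(\boldsymbol{e}_n)$ is a Schauder basis. A subsymmetric (locally convex) sequence space is a Banach sequence space such that $\|\sum_n\varepsilon_na_n\boldsymbol{e}_{\phi(n)}\|=\|f\|$ for all $f=\sum_na_n\boldsymbol{e}_n\in\mathbb{S}$, all $(\varepsilon_n)\in\mathbb{E}^{\mathbb{N}}$ and all increasing $\phi\colon\mathbb{N}\to\mathbb{N}$. Then $\Lambda_m[\mathbb{S}]=\|\sum_{n\in A}\varepsilon_n\boldsymbol{e}_n\|_{\mathbb{S}}$ for any $A$ with $|A|=m$ and any signs $\varepsilon$. $\mathbb{S}$ satisfies an upper (resp. lower) $r$-estimate if there is $C$ such that $\|\sum_jf_j\|\le C(\sum_j\|f_j\|^r)^{1/r}$ (resp. $(\sum_j\|f_j\|^r)^{1/r}\le C\|\sum_jf_j\|$) for all finite families $(f_j)$ of disjointly supported vectors in $\mathbb{S}$. A quasi-Banach space is (locally) $p$-convex if it has an equivalent quasi-norm with $\|f+g\|^p\le\|f\|^p+\|g\|^p$. Bases. Let $\mathcal{Y}=(\boldsymbol{y}_n)$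 be a Schauder basis of a quasi-Banach space $\mathbb{Y}$ with coordinate functionals $(\boldsymbol{y}_n^* )$. For $A\subseteq\mathbb{N}$, $S_A(f)=\sum_{n\in A}\boldsymbol{y}_n^*(f)\boldsymbol{y}_n$. - $\widetilde{\boldsymbol{k}}_m[\mathcal{Y},\mathbb{Y}]=\sup\{\|S_A(f)\|\colon\|f\|\le1,\ f\in[\boldsymbol{y}_j\colon1\le j\le m],\ A\subseteq\mathbb{N}\}$. - $\boldsymbol{\varphi_u^s}[\mathcal{Y},\mathbb{Y}](m)=\sup\{\|\sum_{n\in A}\varepsilon_n\boldsymbol{y}_n\|\colon|A|\le m,\ \varepsilon\in\mathbb{E}^A\}$ (fundamental function). - A finite set $A$ is a greedy set of $f$ if $|\boldsymbol{y}_k^*(f)|\le|\boldsymbol{y}_j^*(f)|$ for all $j\in A$, $k\notin A$. - $\mathcal{Y}$ is almost greedy if there is $C$ with $\|f-S_A(f)\|\le C\|f-S_B(f)\|$ for all $f$, all greedy sets $A$ of $f$ and all $B$ with $|B|\le|A|$ (equivalently, it is quasi-greedy and democratic). - $\mathcal{Y}$ is asymptotically suppression unconditional if there is $D$ such that $\|S_A\|\le D$ whenever $|A|<\min A$. "$\mathbb{U}_r$ is uniformly complemented in $\mathbb{W}_r$" means that there are operators $J_r\colon\mathbb{U}_r\to\mathbb{W}_r$ and $T_r\colon\mathbb{W}_r\to\mathbb{U}_r$ with $T_rJ_r=\mathrm{Id}$ and $\sup_r\|J_r\|\,\|T_r\|<\infty$.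
   Formalization: The function φ is additionally assumed to tend to infinity; for bounded φ, (v) is false (X = ℓ₁ with basis e₁, eₙ−eₙ₋₁ and S = ℓ₂ would give ℓ₁⊕ℓ₂ a greedy basis). Parts (i)–(iv) do not involve φ and are unaffected. *)

theory Defs
  imports "HOL-Analysis.Analysis" "HOL-Library.Function_Algebras"
begin

section \<open>Scalars\<close>

text \<open>The scalar field is the real or the complex field with its usual modulus.\<close>

class real_or_complex = real_normed_field +
  assumes real_or_complex:
    "(\<forall>z. \<exists>x. z = x *\<^sub>R 1) \<or>
     (\<exists>i. i * i = - 1 \<and>
       (\<forall>z. \<exists>x y. z = x *\<^sub>R 1 + y *\<^sub>R i \<and> norm z = sqrt (x\<^sup>2 + y\<^sup>2)))"

instance real :: real_or_complex
  by standard auto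

instance complex :: real_or_complex
proof
  have "z = Re z *\<^sub>R 1 + Im z *\<^sub>R \<i> \<and> cmod z = sqrt ((Re z)\<^sup>2 + (Im z)\<^sup>2)" for z
    by (simp add: complex_eq_iff cmod_def)
  then show "(\<forall>z::complex. \<exists>x. z = x *\<^sub>R 1) \<or>
     (\<exists>i::complex. i * i = - 1 \<and>
       (\<forall>z. \<exists>x y. z = x *\<^sub>R 1 + y *\<^sub>R i \<and> norm z = sqrt (x\<^sup>2 + y\<^sup>2)))"
    using i_squared by blast
qed


section \<open>Quasi-Banach spaces\<close>

text \<open>Spaces have an explicit carrier, which is a linear subspace of the ambient type, because
  sequence spaces, spans of basis vectors and dual spaces all occur as such subspaces.\<close>

record ('k, 'v) qspace =
  car :: "'v set"
  smul :: "'k \<Rightarrow> 'v \<Rightarrow> 'v"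
  qnorm :: "'v \<Rightarrow> real"

definition lin_space :: "('k::real_or_complex, 'v::ab_group_add) qspace \<Rightarrow> bool" where
  "lin_space E \<longleftrightarrow> vector_space (smul E) \<and> module.subspace (smul E) (car E)"

definition quasi_norm_on ::
  "('k::real_or_complex, 'v::ab_group_add) qspace \<Rightarrow> ('v \<Rightarrow> real) \<Rightarrow> bool" where
  "quasi_norm_on E N \<longleftrightarrow>
     (\<forall>v\<in>car E. 0 \<le> N v \<and> (N v = 0 \<longleftrightarrow> v = 0)) \<and>
     (\<forall>c. \<forall>v\<in>car E. N (smul E c v) = norm c * N v) \<and>
     (\<exists>\<kappa>. \<forall>u\<in>car E. \<forall>v\<in>car E. N (u + v) \<le> \<kappa> * (N u + N v))"

definition converges_to ::
  "('k::real_or_complex, 'v::ab_group_add) qspace \<Rightarrow> (nat \<Rightarrow> 'v) \<Rightarrow> 'v \<Rightarrow> bool" where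
  "converges_to E u v \<longleftrightarrow> (\<lambda>n. qnorm E (u n - v)) \<longlonglongrightarrow> 0"

definition cauchy_in ::
  "('k::real_or_complex, 'v::ab_group_add) qspace \<Rightarrow> (nat \<Rightarrow> 'v) \<Rightarrow> bool" where
  "cauchy_in E u \<longleftrightarrow> (\<forall>e>0. \<exists>M. \<forall>m\<ge>M. \<forall>n\<ge>M. qnorm E (u m - u n) < e)"

definition quasi_banach :: "('k::real_or_complex, 'v::ab_group_add) qspace \<Rightarrow> bool" where
  "quasi_banach E \<longleftrightarrow> lin_space E \<and> quasi_norm_on E (qnorm E) \<and>
     (\<forall>u. (\<forall>n. u n \<in> car E) \<and> cauchy_in E u \<longrightarrow> (\<exists>v\<in>car E. converges_to E u v))"

definition banach_space :: "('k::real_or_complex, 'v::ab_group_add) qspace \<Rightarrow> bool" where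
  "banach_space E \<longleftrightarrow> quasi_banach E \<and>
     (\<forall>u\<in>car E. \<forall>v\<in>car E. qnorm E (u + v) \<le> qnorm E u + qnorm E v)"

definition p_convex ::
  "real \<Rightarrow> ('k::real_or_complex, 'v::ab_group_add) qspace \<Rightarrow> bool" where
  "p_convex p E \<longleftrightarrow> (\<exists>N. quasi_norm_on E N \<and>
     (\<exists>c>0. \<exists>C>0. \<forall>v\<in>car E. c * qnorm E v \<le> N v \<and> N v \<le> C * qnorm E v) \<and>
     (\<forall>u\<in>car E. \<forall>v\<in>car E. N (u + v) powr p \<le> N u powr p + N v powr p))"

definition subspace_of ::
  "('k::real_or_complex, 'v::ab_group_add) qspace \<Rightarrow> 'v set \<Rightarrow> ('k, 'v) qspace" where
  "subspace_of E V = \<lparr>car = V, smul = smul E, qnorm = qnorm E\<rparr>"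

definition closed_span ::
  "('k::real_or_complex, 'v::ab_group_add) qspace \<Rightarrow> 'v set \<Rightarrow> 'v set" where
  "closed_span E B =
     {v \<in> car E. \<exists>u. (\<forall>n. u n \<in> module.span (smul E) B) \<and> converges_to E u v}"

text \<open>Any of the usual equivalent quasi-norms may be used on the direct sum, since everything
  below that involves the direct sum is stated up to multiplicative constants.\<close>

definition direct_sum ::
  "('k::real_or_complex, 'v::ab_group_add) qspace \<Rightarrow> ('k, 'w::ab_group_add) qspace \<Rightarrow>
   ('k, 'v \<times> 'w) qspace" (infixr "\<oplus>\<^sub>q" 65) where
  "E \<oplus>\<^sub>q F = \<lparr>car = car E \<times> car F,
     smul = (\<lambda>c (v, w). (smul E c v, smul F c w)),
     qnorm = (\<lambda>(v, w). max (qnorm E v) (qnorm F w))\<rparr>"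


section \<open>Operators\<close>

definition linear_op ::
  "('k::real_or_complex, 'v::ab_group_add) qspace \<Rightarrow> ('k, 'w::ab_group_add) qspace \<Rightarrow>
   ('v \<Rightarrow> 'w) \<Rightarrow> bool" where
  "linear_op E F T \<longleftrightarrow> T ` car E \<subseteq> car F \<and>
     (\<forall>u\<in>car E. \<forall>v\<in>car E. T (u + v) = T u + T v) \<and>
     (\<forall>c. \<forall>v\<in>car E. T (smul E c v) = smul F c (T v))"

definition op_norm ::
  "('k::real_or_complex, 'v::ab_group_add) qspace \<Rightarrow> ('k, 'w::ab_group_add) qspace \<Rightarrow>
   ('v \<Rightarrow> 'w) \<Rightarrow> ennreal" where
  "op_norm E F T = (SUP v \<in> {v \<in> car E. qnorm E v \<le> 1}. ennreal (qnorm F (T v)))"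

definition bounded_op ::
  "('k::real_or_complex, 'v::ab_group_add) qspace \<Rightarrow> ('k, 'w::ab_group_add) qspace \<Rightarrow>
   ('v \<Rightarrow> 'w) \<Rightarrow> bool" where
  "bounded_op E F T \<longleftrightarrow> linear_op E F T \<and> op_norm E F T < \<infinity>"

text \<open>Indices run over the positive integers.\<close>

definition uniformly_complemented ::
  "(nat \<Rightarrow> ('k::real_or_complex, 'v::ab_group_add) qspace) \<Rightarrow>
   (nat \<Rightarrow> ('k, 'w::ab_group_add) qspace) \<Rightarrow> bool" where
  "uniformly_complemented U W \<longleftrightarrow> (\<exists>J T.
     (\<forall>r\<ge>1. bounded_op (U r) (W r) (J r) \<and> bounded_op (W r) (U r) (T r) \<and>
        (\<forall>u\<in>car (U r). T r (J r u) = u)) \<and>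
     (SUP r\<in>{1..}. op_norm (U r) (W r) (J r) * op_norm (W r) (U r) (T r)) < \<infinity>)"


section \<open>Superreflexivity\<close>

definition scalar_space :: "('k::real_or_complex, 'k) qspace" where
  "scalar_space = \<lparr>car = UNIV, smul = (*), qnorm = norm\<rparr>"

text \<open>Functionals are normalised to vanish off the carrier, so that equality of functionals
  is equality of HOL functions.\<close>

definition dual_space ::
  "('k::real_or_complex, 'v::ab_group_add) qspace \<Rightarrow> ('k, 'v \<Rightarrow> 'k) qspace" where
  "dual_space E = \<lparr>
     car = {f. bounded_op E scalar_space f \<and> (\<forall>v. v \<notin> car E \<longrightarrow> f v = 0)},
     smul = (\<lambda>c f v. c * f v),
     qnorm = (\<lambda>f. enn2real (op_norm E scalar_space f))\<rparr>"

definition reflexive :: "('k::real_or_complex, 'v::ab_group_add) qspace \<Rightarrow> bool" where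
  "reflexive E \<longleftrightarrow> (\<forall>\<Phi>\<in>car (dual_space (dual_space E)).
     \<exists>v\<in>car E. \<forall>f\<in>car (dual_space E). \<Phi> f = f v)"

definition finitely_representable ::
  "('k::real_or_complex, 'v::ab_group_add) qspace \<Rightarrow> ('k, 'w::ab_group_add) qspace \<Rightarrow> bool" where
  "finitely_representable Y E \<longleftrightarrow>
     (\<forall>B e. finite B \<and> B \<subseteq> car Y \<and> e > 0 \<longrightarrow>
       (\<exists>T. linear_op (subspace_of Y (module.span (smul Y) B)) E T \<and>
         (\<forall>v\<in>module.span (smul Y) B.
            qnorm Y v \<le> qnorm E (T v) \<and> qnorm E (T v) \<le> (1 + e) * qnorm Y v)))"

text \<open>Every Banach space finitely representable in \<open>E\<close> is reflexive. HOL cannot quantify over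
  types, so \<open>Y\<close> ranges over the Banach spaces whose carrier is a linear subspace of the space
  of scalar sequences, with an arbitrary complete norm. This loses nothing: every separable
  Banach space has this form up to isometry (apply a separating sequence of functionals), and
  a non-reflexive Banach space has a separable closed non-reflexive subspace, which is finitely
  representable in whatever the whole space is finitely representable in.\<close>

definition superreflexive :: "('k::real_or_complex, 'v::ab_group_add) qspace \<Rightarrow> bool" where
  "superreflexive E \<longleftrightarrow> banach_space E \<and>
     (\<forall>Y :: ('k, nat \<Rightarrow> 'k) qspace.
        banach_space Y \<and> finitely_representable Y E \<longrightarrow> reflexive Y)"


section \<open>Schauder bases\<close>

text \<open>Sequences are indexed from \<open>0\<close>: \<open>y n\<close> is the vector usually written with index \<open>n + 1\<close>,
  and the first \<open>m\<close> vectors are \<open>y ` {..<m}\<close>.\<close>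

definition expansion ::
  "('k::real_or_complex, 'v::ab_group_add) qspace \<Rightarrow> (nat \<Rightarrow> 'v) \<Rightarrow> (nat \<Rightarrow> 'k) \<Rightarrow> 'v \<Rightarrow> bool" where
  "expansion E y a f \<longleftrightarrow> converges_to E (\<lambda>N. \<Sum>n<N. smul E (a n) (y n)) f"

definition schauder_basis ::
  "('k::real_or_complex, 'v::ab_group_add) qspace \<Rightarrow> (nat \<Rightarrow> 'v) \<Rightarrow> bool" where
  "schauder_basis E y \<longleftrightarrow> range y \<subseteq> car E \<and> (\<forall>f\<in>car E. \<exists>!a. expansion E y a f)"

definition coord ::
  "('k::real_or_complex, 'v::ab_group_add) qspace \<Rightarrow> (nat \<Rightarrow> 'v) \<Rightarrow> nat \<Rightarrow> 'v \<Rightarrow> 'k" where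
  "coord E y n f = (THE a. expansion E y a f) n"

text \<open>Only used when \<open>A\<close> is finite or \<open>f\<close> has finitely many non-zero coordinates, so the
  index set of the sum is finite.\<close>

definition coord_proj ::
  "('k::real_or_complex, 'v::ab_group_add) qspace \<Rightarrow> (nat \<Rightarrow> 'v) \<Rightarrow> nat set \<Rightarrow> 'v \<Rightarrow> 'v" where
  "coord_proj E y A f = (\<Sum>n | n \<in> A \<and> coord E y n f \<noteq> 0. smul E (coord E y n f) (y n))"

definition initial_space ::
  "('k::real_or_complex, 'v::ab_group_add) qspace \<Rightarrow> (nat \<Rightarrow> 'v) \<Rightarrow> nat \<Rightarrow> ('k, 'v) qspace" where
  "initial_space E y m = subspace_of E (closed_span E (y ` {..<m}))"

definition k_tilde ::
  "('k::real_or_complex, 'v::ab_group_add) qspace \<Rightarrow> (nat \<Rightarrow> 'v) \<Rightarrow> nat \<Rightarrow> ennreal" where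
  "k_tilde E y m =
     (SUP (f, A) \<in> {f \<in> car (initial_space E y m). qnorm E f \<le> 1} \<times> UNIV.
        ennreal (qnorm E (coord_proj E y A f)))"

definition fundamental_function ::
  "('k::real_or_complex, 'v::ab_group_add) qspace \<Rightarrow> (nat \<Rightarrow> 'v) \<Rightarrow> nat \<Rightarrow> ennreal" where
  "fundamental_function E y m =
     (SUP (A, \<epsilon>) \<in> {(A, \<epsilon>). finite A \<and> card A \<le> m \<and> (\<forall>n\<in>A. norm (\<epsilon> n) = 1)}.
        ennreal (qnorm E (\<Sum>n\<in>A. smul E (\<epsilon> n) (y n))))"

definition greedy_set ::
  "('k::real_or_complex, 'v::ab_group_add) qspace \<Rightarrow> (nat \<Rightarrow> 'v) \<Rightarrow> 'v \<Rightarrow> nat set \<Rightarrow> bool" where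
  "greedy_set E y f A \<longleftrightarrow> finite A \<and>
     (\<forall>j\<in>A. \<forall>k. k \<notin> A \<longrightarrow> norm (coord E y k f) \<le> norm (coord E y j f))"

definition almost_greedy ::
  "('k::real_or_complex, 'v::ab_group_add) qspace \<Rightarrow> (nat \<Rightarrow> 'v) \<Rightarrow> bool" where
  "almost_greedy E y \<longleftrightarrow> (\<exists>C. \<forall>f\<in>car E. \<forall>A B.
     greedy_set E y f A \<and> finite B \<and> card B \<le> card A \<longrightarrow>
     qnorm E (f - coord_proj E y A f) \<le> C * qnorm E (f - coord_proj E y B f))"

text \<open>\<open>Suc (Min A)\<close> is the minimum of \<open>A\<close> when indices are counted from \<open>1\<close>.\<close>

definition asymptotically_suppression_unconditional ::
  "('k::real_or_complex, 'v::ab_group_add) qspace \<Rightarrow> (nat \<Rightarrow> 'v) \<Rightarrow> bool" where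
  "asymptotically_suppression_unconditional E y \<longleftrightarrow> (\<exists>D::real. \<forall>A.
     finite A \<and> A \<noteq> {} \<and> card A < Suc (Min A) \<longrightarrow>
     op_norm E E (coord_proj E y A) \<le> ennreal D)"


section \<open>Sequence spaces\<close>

definition unit_seq :: "nat \<Rightarrow> nat \<Rightarrow> 'k::real_or_complex" where
  "unit_seq n = (\<lambda>k. if k = n then 1 else 0)"

definition sequence_space :: "('k::real_or_complex, nat \<Rightarrow> 'k) qspace \<Rightarrow> bool" where
  "sequence_space S \<longleftrightarrow> smul S = (\<lambda>c f n. c * f n) \<and> quasi_banach S \<and> schauder_basis S unit_seq"

definition subsymmetric :: "('k::real_or_complex, nat \<Rightarrow> 'k) qspace \<Rightarrow> bool" where
  "subsymmetric S \<longleftrightarrow> sequence_space S \<and> banach_space S \<and>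
     (\<forall>f\<in>car S. \<forall>a \<epsilon> \<phi>. expansion S unit_seq a f \<and> (\<forall>n. norm (\<epsilon> n) = 1) \<and> strict_mono \<phi> \<longrightarrow>
        (\<exists>g\<in>car S. expansion S (\<lambda>n. unit_seq (\<phi> n)) (\<lambda>n. \<epsilon> n * a n) g \<and> qnorm S g = qnorm S f))"

text \<open>For subsymmetric \<open>S\<close> the norm below does not depend on the choice of the \<open>m\<close> indices
  nor on signs in front of the unit vectors.\<close>

definition \<Lambda> :: "('k::real_or_complex, nat \<Rightarrow> 'k) qspace \<Rightarrow> nat \<Rightarrow> ennreal" where
  "\<Lambda> S m = ennreal (qnorm S (\<Sum>n<m. unit_seq n))"

definition supp :: "('k::real_or_complex, nat \<Rightarrow> 'k) qspace \<Rightarrow> (nat \<Rightarrow> 'k) \<Rightarrow> nat set" where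
  "supp S f = {n. coord S unit_seq n f \<noteq> 0}"

definition disjoint_family_in ::
  "('k::real_or_complex, nat \<Rightarrow> 'k) qspace \<Rightarrow> nat \<Rightarrow> (nat \<Rightarrow> nat \<Rightarrow> 'k) \<Rightarrow> bool" where
  "disjoint_family_in S n f \<longleftrightarrow> (\<forall>j<n. f j \<in> car S) \<and>
     disjoint_family_on (\<lambda>j. supp S (f j)) {..<n}"

definition upper_estimate :: "real \<Rightarrow> ('k::real_or_complex, nat \<Rightarrow> 'k) qspace \<Rightarrow> bool" where
  "upper_estimate r S \<longleftrightarrow> (\<exists>C. \<forall>n f. disjoint_family_in S n f \<longrightarrow>
     qnorm S (\<Sum>j<n. f j) \<le> C * (\<Sum>j<n. qnorm S (f j) powr r) powr (1 / r))"

definition lower_estimate :: "real \<Rightarrow> ('k::real_or_complex, nat \<Rightarrow> 'k) qspace \<Rightarrow> bool" where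
  "lower_estimate r S \<longleftrightarrow> (\<exists>C. \<forall>n f. disjoint_family_in S n f \<longrightarrow>
     (\<Sum>j<n. qnorm S (f j) powr r) powr (1 / r) \<le> C * qnorm S (\<Sum>j<n. f j))"


section \<open>Comparisons up to constants\<close>

definition lesssim :: "nat set \<Rightarrow> (nat \<Rightarrow> ennreal) \<Rightarrow> (nat \<Rightarrow> ennreal) \<Rightarrow> bool" where
  "lesssim M a b \<longleftrightarrow> (\<exists>C::real. \<forall>m\<in>M. a m \<le> ennreal C * b m)"

definition equivalent :: "nat set \<Rightarrow> (nat \<Rightarrow> ennreal) \<Rightarrow> (nat \<Rightarrow> ennreal) \<Rightarrow> bool" where
  "equivalent M a b \<longleftrightarrow> lesssim M a b \<and> lesssim M b a"


section \<open>Local structure of the new basis\<close>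

text \<open>A strictly increasing sequence of positive integers \<open>(K r)\<close> with \<open>r \<ge> 1\<close> is the same as the
  restriction to \<open>r \<ge> 1\<close> of a strictly monotone \<open>K :: nat \<Rightarrow> nat\<close> (put \<open>K 0 = 0\<close>).\<close>

definition same_local_structure ::
  "('k::real_or_complex, 'v::ab_group_add) qspace \<Rightarrow> (nat \<Rightarrow> 'v) \<Rightarrow>
   ('k, nat \<Rightarrow> 'k) qspace \<Rightarrow> (nat \<Rightarrow> 'v \<times> (nat \<Rightarrow> 'k)) \<Rightarrow> bool" where
  "same_local_structure X x S b \<longleftrightarrow> (\<exists>K L P. strict_mono K \<and> strict_mono L \<and> strict_mono P \<and>
     uniformly_complemented
       (\<lambda>r. initial_space X x r \<oplus>\<^sub>q initial_space S unit_seq (K r))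
       (\<lambda>r. initial_space (X \<oplus>\<^sub>q S) b (L r)) \<and>
     uniformly_complemented
       (\<lambda>r. initial_space (X \<oplus>\<^sub>q S) b (L r))
       (\<lambda>r. initial_space X x r \<oplus>\<^sub>q initial_space S unit_seq (P r)))"

end

(* The construction follows the method of Dilworth, Kalton and Kutzarova.  Choose disjoint blocks
   sigma_k of geometrically growing lengths in N.  A sequence a determines the vector sum_k c_k x_k
   of X, where c_k is Lambda(|sigma_k|) times the average of a over sigma_k, and the element of S
   left over when these averages are removed.  The unit vectors thereby become a basis of the sum of
   X and the kernel of the averaging projection.  To identify this kernel with S, cut the remaining
   indices into pieces such that each block is followed by infinitely many pieces of its own length:
   moving all averages one piece back along these chains fills the missing ones, and by
   subsymmetry it is an isomorphism.

   A block average that is comparable with the threshold t of a greedy set occurs only where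
   t Lambda(|sigma_k|) is at most a multiple of the norm.  Geometric growth of Lambda(|sigma_k|)
   makes sums over such blocks comparable with their largest term, and on the later blocks the
   S-part dominates; hence greedy projections are bounded however conditional (x_k) is. *)

theory Submission
  imports Defs
begin

section \<open>Quasi-normed and p-normed spaces\<close>

text \<open>Since \<open>x\<close> may be arbitrarily conditional, the positions of coefficients in
  X give no cancellation. In greedy projections everything that is not a partial sum of the given
  vector of X must therefore be summed by p-convexity alone, against a two-sided geometric series.
  Two exponents supply the decay. The lower q-estimate makes \<open>Lam (len k)\<close> grow
  geometrically in k. The upper s-estimate, as s > 1, bounds \<open>Lam d / d\<close> by a negative
  power of d, so that a set short in comparison with its block has a negligible block mean. If the
  lengths grow at rate \<open>1 / \<eta>\<close>, the two ratios are
  \<open>\<eta> powr (1 / q)\<close> and \<open>\<eta> powr (1 - 1 / s)\<close>. The conditionality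
  of the new basis at m sees only the number r of blocks up to m. With \<open>len r\<close> about
  \<open>exp (t r)\<close>, this r is about the inverse of t at \<open>ln m\<close>; t is linear for
  the logarithmic lower bound and inverse to \<open>\<phi>\<close> for the two-sided one. Beyond the
  constant of x on r vectors, cutting through r blocks costs \<open>r powr (1 / s)\<close> in S and
  \<open>r powr (1 / p - 1 / q)\<close> in X; this is the origin of the exponent in the additional
  hypothesis.\<close>

lemma real_or_complex_Cauchy_convergent:
  fixes X :: "nat \<Rightarrow> 'k::real_or_complex"
  assumes "Cauchy X"
  obtains l where "X \<longlonglongrightarrow> l"
proof -
  \<comment> \<open>The scalar class asserts no completeness, so both alternatives are reduced to
    real Cauchy sequences. Limits of scalar coefficients are taken later in the proof of Banach's
    theorem on partial sums.\<close>
  consider "\<forall>z::'k. \<exists>x. z = x *\<^sub>R 1" |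
    i :: 'k where "i * i = - 1" "\<forall>z. \<exists>x y. z = x *\<^sub>R 1 + y *\<^sub>R i \<and> norm z = sqrt (x\<^sup>2 + y\<^sup>2)"
    using real_or_complex by blast
  then show thesis
  proof cases
    case 1
    then have "\<forall>n. \<exists>x. X n = of_real x"
      unfolding of_real_def by blast
    then obtain x where x: "\<And>n. X n = of_real (x n)"
      by metis
    have "Cauchy x"
      using assms unfolding Cauchy_def x dist_norm by (simp flip: of_real_diff)
    then obtain l where "x \<longlonglongrightarrow> l" by (auto simp: Cauchy_convergent_iff convergent_def)
    then have "X \<longlonglongrightarrow> of_real l" unfolding x by (rule tendsto_of_real)
    then show thesis by (rule that)
  next
    case (2 i)
    \<comment> \<open>The class axiom grants the norm formula only for some representation of z.
      Squaring \<open>x = - y * i\<close> gives \<open>x * x + y * y = 0\<close>; hence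
      representations are unique and the formula holds for each of them.\<close>
    have rep0: "x = 0 \<and> y = 0" if "of_real x + of_real y * i = 0" for x y :: real
    proof -
      have "of_real x * of_real x = of_real y * of_real y * (i * i)"
        using that by (metis (no_types, lifting) add_eq_0_iff minus_mult_minus mult.assoc mult.commute)
      then have "of_real (x * x + y * y) = (0 :: 'k)"
        using 2(1) by simp
      then have "x * x + y * y = 0" unfolding of_real_eq_0_iff .
      then show ?thesis by (simp add: sum_squares_eq_zero_iff)
    qed
    have nrm: "norm (of_real x + of_real y * i) = sqrt (x\<^sup>2 + y\<^sup>2)" for x y
    proof -
      obtain x' y' where *: "of_real x + of_real y * i = x' *\<^sub>R 1 + y' *\<^sub>R i"
        "norm (of_real x + of_real y * i) = sqrt (x'\<^sup>2 + y'\<^sup>2)"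
        using 2(2) by blast
      have "of_real (x - x') + of_real (y - y') * i = 0"
        using *(1) by (simp add: scaleR_conv_of_real algebra_simps)
      then show ?thesis using rep0[of "x - x'" "y - y'"] *(2) by simp
    qed
    obtain x y where X: "\<And>n. X n = of_real (x n) + of_real (y n) * i"
    proof -
      have "\<forall>n. \<exists>a b. X n = of_real a + of_real b * i"
        using 2(2) by (simp add: scaleR_conv_of_real) blast
      then show thesis using that by metis
    qed
    have df: "norm (X m - X n) = sqrt ((x m - x n)\<^sup>2 + (y m - y n)\<^sup>2)" for m n
      using nrm[of "x m - x n" "y m - y n"] by (simp add: X algebra_simps)
    have "\<bar>x m - x n\<bar> \<le> norm (X m - X n)" "\<bar>y m - y n\<bar> \<le> norm (X m - X n)" for m n
      unfolding df by (auto intro: real_le_rsqrt)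
    then have "Cauchy x" "Cauchy y"
      using assms unfolding Cauchy_def dist_norm real_norm_def by (meson order_le_less_trans)+
    then obtain a b where "x \<longlonglongrightarrow> a" "y \<longlonglongrightarrow> b" by (auto simp: Cauchy_convergent_iff convergent_def)
    then have "X \<longlonglongrightarrow> of_real a + of_real b * i"
      unfolding X by (intro tendsto_intros)
    then show thesis by (rule that)
  qed
qed

section \<open>Quasi-normed spaces and their limits\<close>

locale quasi_normed =
  fixes E :: "('k::real_or_complex, 'v::ab_group_add) qspace"
  assumes lin: "lin_space E" and quasi_norm: "quasi_norm_on E (qnorm E)"
begin

sublocale vector_space "smul E"
  using lin by (simp add: lin_space_def)

lemma subspace_car: "subspace (car E)"
  using lin by (simp add: lin_space_def)

lemmas car_0 [simp] = subspace_0[OF subspace_car]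
  and car_add [simp] = subspace_add[OF subspace_car]
  and car_diff [simp] = subspace_diff[OF subspace_car]
  and car_scale [simp] = subspace_scale[OF subspace_car]
  and car_sum = subspace_sum[OF subspace_car]
  and car_neg [simp] = subspace_neg[OF subspace_car]

lemma qnorm_nonneg [simp]: "v \<in> car E \<Longrightarrow> 0 \<le> qnorm E v"
  and qnorm_eq_0 [simp]: "v \<in> car E \<Longrightarrow> qnorm E v = 0 \<longleftrightarrow> v = 0"
  and qnorm_scale: "v \<in> car E \<Longrightarrow> qnorm E (smul E c v) = norm c * qnorm E v"
  using quasi_norm by (auto simp: quasi_norm_on_def)

lemma qnorm_0 [simp]: "qnorm E 0 = 0"
  by simp

lemma qnorm_neg: "v \<in> car E \<Longrightarrow> qnorm E (- v) = qnorm E v"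
  using qnorm_scale[of v "- 1"] by simp

lemma qnorm_commute: "u \<in> car E \<Longrightarrow> v \<in> car E \<Longrightarrow> qnorm E (u - v) = qnorm E (v - u)"
  using qnorm_neg[of "u - v"] by simp

text \<open>The modulus of concavity. The lower bound 1 is built into the choice so that
  \<open>kap\<close> can be inserted on the larger side of any estimate.\<close>

definition kap :: real where
  "kap = (SOME \<kappa>. 1 \<le> \<kappa> \<and> (\<forall>u\<in>car E. \<forall>v\<in>car E. qnorm E (u + v) \<le> \<kappa> * (qnorm E u + qnorm E v)))"

lemma kap_ge: "1 \<le> kap"
  and qnorm_add: "u \<in> car E \<Longrightarrow> v \<in> car E \<Longrightarrow> qnorm E (u + v) \<le> kap * (qnorm E u + qnorm E v)"
proof -
  obtain \<kappa> where k: "\<forall>u\<in>car E. \<forall>v\<in>car E. qnorm E (u + v) \<le> \<kappa> * (qnorm E u + qnorm E v)"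
    using quasi_norm by (auto simp: quasi_norm_on_def)
  have "1 \<le> max \<kappa> 1 \<and> (\<forall>u\<in>car E. \<forall>v\<in>car E. qnorm E (u + v) \<le> max \<kappa> 1 * (qnorm E u + qnorm E v))"
    using k by (auto intro!: order_trans[OF bspec[OF bspec[OF k]]] mult_right_mono)
  then have *: "1 \<le> kap \<and> (\<forall>u\<in>car E. \<forall>v\<in>car E. qnorm E (u + v) \<le> kap * (qnorm E u + qnorm E v))"
    unfolding kap_def by (rule someI)
  show "1 \<le> kap" using * by simp
  show "qnorm E (u + v) \<le> kap * (qnorm E u + qnorm E v)" if "u \<in> car E" "v \<in> car E"
    using * that by blast
qed

lemma qnorm_diff: "u \<in> car E \<Longrightarrow> v \<in> car E \<Longrightarrow> qnorm E (u - v) \<le> kap * (qnorm E u + qnorm E v)"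
  using qnorm_add[of u "- v"] qnorm_neg[of v] by simp

text \<open>A quasi-norm need not be continuous, so limits are always obtained by domination with a
  null sequence and never by passing to the limit inside the quasi-norm.\<close>

lemma converges_toI:
  assumes "\<And>n. u n \<in> car E" "v \<in> car E" "g \<longlonglongrightarrow> 0" "\<And>n. qnorm E (u n - v) \<le> g n"
  shows "converges_to E u v"
  unfolding converges_to_def
  by (rule tendsto_sandwich[OF _ _ tendsto_const assms(3)]) (use assms in auto)

lemma converges_to_add:
  assumes "\<And>n. u n \<in> car E" "\<And>n. u' n \<in> car E" "v \<in> car E" "v' \<in> car E"
    and "converges_to E u v" "converges_to E u' v'"
  shows "converges_to E (\<lambda>n. u n + u' n) (v + v')"
proof (rule converges_toI)
  show "(\<lambda>n. kap * (qnorm E (u n - v) + qnorm E (u' n - v'))) \<longlonglongrightarrow> 0"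
    using assms(5,6) unfolding converges_to_def by (auto intro!: tendsto_eq_intros)
  show "qnorm E (u n + u' n - (v + v')) \<le> kap * (qnorm E (u n - v) + qnorm E (u' n - v'))" for n
    using qnorm_add[of "u n - v" "u' n - v'"] assms(1-4) by (simp add: add_diff_add)
qed (use assms in auto)

lemma converges_to_scale:
  assumes "\<And>n. u n \<in> car E" "v \<in> car E" "converges_to E u v"
  shows "converges_to E (\<lambda>n. smul E c (u n)) (smul E c v)"
proof (rule converges_toI)
  show "(\<lambda>n. norm c * qnorm E (u n - v)) \<longlonglongrightarrow> 0"
    using assms(3) unfolding converges_to_def by (auto intro!: tendsto_eq_intros)
  show "qnorm E (smul E c (u n) - smul E c v) \<le> norm c * qnorm E (u n - v)" for n
    using qnorm_scale[of "u n - v" c] assms by (simp add: scale_right_diff_distrib)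
qed (use assms in auto)

lemma converges_to_const [simp]: "v \<in> car E \<Longrightarrow> converges_to E (\<lambda>n. v) v"
  by (simp add: converges_to_def)

lemma converges_to_unique:
  assumes "\<And>n. u n \<in> car E" "v \<in> car E" "v' \<in> car E" "converges_to E u v" "converges_to E u v'"
  shows "v = v'"
proof -
  have "(\<lambda>n. kap * (qnorm E (u n - v) + qnorm E (u n - v'))) \<longlonglongrightarrow> 0"
    using assms(4,5) unfolding converges_to_def by (auto intro!: tendsto_eq_intros)
  moreover have "qnorm E (v' - v) \<le> kap * (qnorm E (u n - v) + qnorm E (u n - v'))" for n
    using qnorm_diff[of "u n - v" "u n - v'"] assms by simp
  ultimately have "qnorm E (v' - v) \<le> 0"
    by (intro tendsto_lowerbound[of _ 0 sequentially]) auto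
  moreover have "0 \<le> qnorm E (v' - v)" using assms(2,3) by simp
  ultimately have "qnorm E (v' - v) = 0" by simp
  then show ?thesis using assms(2,3) by simp
qed

lemma converges_to_eventually_const:
  assumes "v \<in> car E" "\<And>n. M \<le> n \<Longrightarrow> u n = v"
  shows "converges_to E u v"
  unfolding converges_to_def
  by (rule tendsto_eventually) (use assms in \<open>auto simp: eventually_sequentially intro!: exI[of _ M]\<close>)

end

section \<open>Equivalent p-norms\<close>

locale p_normed = quasi_normed E for E :: "('k::real_or_complex, 'v::ab_group_add) qspace" +
  fixes N :: "'v \<Rightarrow> real" and p c C :: real
  assumes quasi_norm_N: "quasi_norm_on E N" and p_pos: "0 < p" and c_pos: "0 < c" and C_pos: "0 < C"
    and N_lower: "v \<in> car E \<Longrightarrow> c * qnorm E v \<le> N v"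
    and N_upper: "v \<in> car E \<Longrightarrow> N v \<le> C * qnorm E v"
    and N_add: "u \<in> car E \<Longrightarrow> v \<in> car E \<Longrightarrow> N (u + v) powr p \<le> N u powr p + N v powr p"
begin

text \<open>The triangle inequality for \<open>N\<close> holds only after raising to the power p.
  The result is subadditive and homogeneous of degree p, so \<open>fn (u - v)\<close> is a
  translation-invariant metric, which Baire's theorem requires and the quasi-norm need not
  provide.\<close>

definition fn :: "'v \<Rightarrow> real" where "fn v = N v powr p"

lemma N_nonneg: "v \<in> car E \<Longrightarrow> 0 \<le> N v" and N_eq_0: "v \<in> car E \<Longrightarrow> N v = 0 \<longleftrightarrow> v = 0"
  and N_scale: "v \<in> car E \<Longrightarrow> N (smul E a v) = norm a * N v"
  using quasi_norm_N by (auto simp: quasi_norm_on_def)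

lemma fn_nonneg [simp]: "0 \<le> fn v"
  by (simp add: fn_def)

lemma fn_eq_0 [simp]: "v \<in> car E \<Longrightarrow> fn v = 0 \<longleftrightarrow> v = 0"
  by (simp add: fn_def N_eq_0)

lemma fn_0 [simp]: "fn 0 = 0"
  by simp

lemma fn_add: "u \<in> car E \<Longrightarrow> v \<in> car E \<Longrightarrow> fn (u + v) \<le> fn u + fn v"
  by (simp add: fn_def N_add)

lemma fn_scale: "v \<in> car E \<Longrightarrow> fn (smul E a v) = norm a powr p * fn v"
  by (simp add: fn_def N_scale powr_mult N_nonneg)

lemma fn_neg: "v \<in> car E \<Longrightarrow> fn (- v) = fn v"
  using fn_scale[of v "- 1"] by simp

lemma fn_commute: "u \<in> car E \<Longrightarrow> v \<in> car E \<Longrightarrow> fn (u - v) = fn (v - u)"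
  using fn_neg[of "u - v"] by simp

lemma fn_diff: "u \<in> car E \<Longrightarrow> v \<in> car E \<Longrightarrow> fn (u - v) \<le> fn u + fn v"
  using fn_add[of u "- v"] fn_neg[of v] by simp

lemma fn_sum: "finite F \<Longrightarrow> (\<And>i. i \<in> F \<Longrightarrow> u i \<in> car E) \<Longrightarrow> fn (\<Sum>i\<in>F. u i) \<le> (\<Sum>i\<in>F. fn (u i))"
proof (induction F rule: finite_induct)
  case (insert i F)
  then show ?case using fn_add[of "u i" "\<Sum>i\<in>F. u i"] car_sum[of F u] by fastforce
qed simp

lemma fn_triangle: "u \<in> car E \<Longrightarrow> v \<in> car E \<Longrightarrow> w \<in> car E \<Longrightarrow> fn (u - w) \<le> fn (u - v) + fn (v - w)"
  using fn_add[of "u - v" "v - w"] by simp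

lemma fn_le_qnorm: "v \<in> car E \<Longrightarrow> fn v \<le> C powr p * qnorm E v powr p"
  unfolding fn_def using N_upper[of v] N_nonneg[of v] C_pos p_pos
  by (simp flip: powr_mult add: powr_mono2)

lemma qnorm_le_fn: "v \<in> car E \<Longrightarrow> c powr p * qnorm E v powr p \<le> fn v"
  unfolding fn_def using N_lower[of v] N_nonneg[of v] c_pos p_pos
  by (simp flip: powr_mult add: powr_mono2)

lemma qnorm_le_fn': 
  assumes "v \<in> car E" shows "qnorm E v \<le> (1 / c) * fn v powr (1 / p)"
  using N_lower[OF assms] N_nonneg[OF assms] c_pos p_pos
  by (simp add: fn_def powr_powr field_simps)

lemma fn_tendsto_iff:
  assumes "\<And>n. u n \<in> car E"
  shows "(\<lambda>n. fn (u n)) \<longlonglongrightarrow> 0 \<longleftrightarrow> (\<lambda>n. qnorm E (u n)) \<longlonglongrightarrow> 0"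
proof
  assume "(\<lambda>n. fn (u n)) \<longlonglongrightarrow> 0"
  then have "(\<lambda>n. (1 / c) * fn (u n) powr (1 / p)) \<longlonglongrightarrow> (1 / c) * 0"
    using p_pos by (intro tendsto_intros tendsto_zero_powrI[of _ _ _ "1 / p"]) auto
  then have *: "(\<lambda>n. (1 / c) * fn (u n) powr (1 / p)) \<longlonglongrightarrow> 0" by simp
  show "(\<lambda>n. qnorm E (u n)) \<longlonglongrightarrow> 0"
    by (rule tendsto_sandwich[OF _ _ tendsto_const *]) (use assms qnorm_le_fn' in auto)
next
  assume "(\<lambda>n. qnorm E (u n)) \<longlonglongrightarrow> 0"
  then have "(\<lambda>n. C powr p * qnorm E (u n) powr p) \<longlonglongrightarrow> C powr p * 0"
    using p_pos assms by (intro tendsto_intros tendsto_zero_powrI[of _ _ _ p]) auto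
  then have *: "(\<lambda>n. C powr p * qnorm E (u n) powr p) \<longlonglongrightarrow> 0" by simp
  show "(\<lambda>n. fn (u n)) \<longlonglongrightarrow> 0"
    by (rule tendsto_sandwich[OF _ _ tendsto_const *]) (use assms fn_le_qnorm in auto)
qed

text \<open>Passing through \<open>fn\<close> makes the constant independent of the number of
  summands; iterating the quasi-triangle inequality would accumulate powers of
  \<open>kap\<close>.\<close>

lemma qnorm_sum_powr:
  assumes "finite F" "\<And>i. i \<in> F \<Longrightarrow> u i \<in> car E"
  shows "qnorm E (\<Sum>i\<in>F. u i) powr p \<le> (C / c) powr p * (\<Sum>i\<in>F. qnorm E (u i) powr p)"
proof -
  have "c powr p * qnorm E (\<Sum>i\<in>F. u i) powr p \<le> fn (\<Sum>i\<in>F. u i)"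
    by (intro qnorm_le_fn car_sum assms)
  also have "\<dots> \<le> (\<Sum>i\<in>F. fn (u i))" by (intro fn_sum assms)
  also have "\<dots> \<le> (\<Sum>i\<in>F. C powr p * qnorm E (u i) powr p)"
    by (intro sum_mono fn_le_qnorm assms)
  finally show ?thesis
    using c_pos C_pos by (simp add: powr_divide pos_le_divide_eq mult.commute flip: sum_distrib_left)
qed

end

section \<open>Continuity of the partial sum projections\<close>

context quasi_normed
begin

lemma expansion_car:
  assumes "range x \<subseteq> car E"
  shows "(\<Sum>n<N. smul E (a n) (x n)) \<in> car E"
  using assms by (intro car_sum car_scale) auto

lemma expansion_add:
  assumes "range x \<subseteq> car E" "u \<in> car E" "v \<in> car E" "expansion E x a u" "expansion E x b v"
  shows "expansion E x (\<lambda>n. a n + b n) (u + v)"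
  using converges_to_add[OF _ _ assms(2,3) assms(4,5)[unfolded expansion_def]] expansion_car[OF assms(1)]
  by (simp add: expansion_def scale_left_distrib sum.distrib)

lemma expansion_scale:
  assumes "range x \<subseteq> car E" "u \<in> car E" "expansion E x a u"
  shows "expansion E x (\<lambda>n. c * a n) (smul E c u)"
  using converges_to_scale[OF _ assms(2) assms(3)[unfolded expansion_def]] expansion_car[OF assms(1)]
  by (simp add: expansion_def scale_sum_right)

lemma expansion_finite:
  assumes "range x \<subseteq> car E" "finite A" "\<And>n. n \<notin> A \<Longrightarrow> a n = 0"
  shows "expansion E x a (\<Sum>n\<in>A. smul E (a n) (x n))"
  unfolding expansion_def
proof (rule converges_to_eventually_const)
  show "(\<Sum>n\<in>A. smul E (a n) (x n)) \<in> car E" using assms(1) by (intro car_sum car_scale) auto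
  fix N assume N: "Suc (Max (insert 0 A)) \<le> N"
  have "A \<subseteq> {..<N}"
  proof
    fix n assume "n \<in> A"
    then have "n \<le> Max (insert 0 A)" using assms(2) by simp
    then show "n \<in> {..<N}" using N by simp
  qed
  then show "(\<Sum>n<N. smul E (a n) (x n)) = (\<Sum>n\<in>A. smul E (a n) (x n))"
    using assms(3) by (intro sum.mono_neutral_right) auto
qed

section \<open>Coordinates with respect to a Schauder basis\<close>

lemma
  assumes "schauder_basis E x"
  shows basis_car: "range x \<subseteq> car E"
    and coord_expansion: "v \<in> car E \<Longrightarrow> expansion E x (\<lambda>n. coord E x n v) v"
    and coord_unique: "v \<in> car E \<Longrightarrow> expansion E x a v \<Longrightarrow> a = (\<lambda>n. coord E x n v)"
proof -
  show "range x \<subseteq> car E" using assms by (simp add: schauder_basis_def)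
  have ex: "\<exists>!a. expansion E x a v" if "v \<in> car E" for v
    using assms that by (simp add: schauder_basis_def)
  show *: "expansion E x (\<lambda>n. coord E x n v) v" if "v \<in> car E"
    using theI'[OF ex[OF that]] by (simp add: coord_def)
  show "a = (\<lambda>n. coord E x n v)" if "v \<in> car E" "expansion E x a v"
    using ex[OF that(1)] that(2) *[OF that(1)] by blast
qed

lemma
  assumes "schauder_basis E x"
  shows coord_add: "u \<in> car E \<Longrightarrow> v \<in> car E \<Longrightarrow> coord E x n (u + v) = coord E x n u + coord E x n v"
    and coord_scale: "u \<in> car E \<Longrightarrow> coord E x n (smul E c u) = c * coord E x n u"
    and coord_finite: "finite A \<Longrightarrow>
      coord E x n (\<Sum>k\<in>A. smul E (a k) (x k)) = (if n \<in> A then a n else 0)"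
proof -
  note B = basis_car[OF assms]
  show "coord E x n (u + v) = coord E x n u + coord E x n v" if uv: "u \<in> car E" "v \<in> car E"
    using coord_unique[OF assms _ expansion_add[OF B uv coord_expansion[OF assms uv(1)] coord_expansion[OF assms uv(2)]]]
      uv by (metis car_add)
  show "coord E x n (smul E c u) = c * coord E x n u" if u: "u \<in> car E"
    using coord_unique[OF assms _ expansion_scale[OF B u coord_expansion[OF assms u]], of c] u
    by (metis car_scale)
  show "coord E x n (\<Sum>k\<in>A. smul E (a k) (x k)) = (if n \<in> A then a n else 0)" if "finite A"
  proof -
    let ?a = "\<lambda>n. if n \<in> A then a n else 0"
    have "(\<Sum>k\<in>A. smul E (a k) (x k)) = (\<Sum>k\<in>A. smul E (?a k) (x k))" by simp
    moreover have "(\<Sum>k\<in>A. smul E (?a k) (x k)) \<in> car E" using B by (intro car_sum car_scale) auto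
    ultimately show ?thesis
      using coord_unique[OF assms _ expansion_finite[OF B that, of ?a]] by metis
  qed
qed

lemma coord_basis: "schauder_basis E x \<Longrightarrow> coord E x n (x m) = (if n = m then 1 else 0)"
  using coord_finite[of x "{m}" n "\<lambda>_. 1"] by simp

lemma basis_nonzero:
  assumes "schauder_basis E x" shows "x n \<noteq> 0"
  using coord_basis[OF assms, of n n] coord_finite[OF assms, of "{}" n] by force

lemma coord_diff:
  assumes "schauder_basis E x" "u \<in> car E" "v \<in> car E"
  shows "coord E x n (u - v) = coord E x n u - coord E x n v"
  using coord_add[OF assms(1,2), of "smul E (- 1) v" n] coord_scale[OF assms(1,3), of n "- 1"] assms
  by simp

end

context p_normed
begin

text \<open>The locale \<open>Metric_space\<close> demands nonnegativity and symmetry on the whole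
  type, hence a default value off the carrier.\<close>

definition fdist :: "'v \<Rightarrow> 'v \<Rightarrow> real" where
  "fdist u v = (if u \<in> car E \<and> v \<in> car E then fn (u - v) else 0)"

lemma Metric_space_fdist: "Metric_space (car E) fdist"
  by unfold_locales (auto simp: fdist_def fn_commute fn_triangle)

text \<open>Banach's theorem on the continuity of the partial sum projections. By Baire's theorem the
  vectors with partial sums bounded by some \<open>m\<close> are dense in a ball; a vector near the origin is
  then the sum of a rapidly converging series of vectors with geometrically small partial sums.\<close>

lemma fn_partial_sums_bounded:
  assumes "quasi_banach E" and x: "schauder_basis E x"
  obtains K where "0 \<le> K" "\<And>v n. v \<in> car E \<Longrightarrow> fn (\<Sum>k<n. smul E (coord E x k v) (x k)) \<le> K * fn v"
proof -
  interpret M: Metric_space "car E" fdist by (rule Metric_space_fdist)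
  define P where "P n v = (\<Sum>k<n. smul E (coord E x k v) (x k))" for n v
  note B = basis_car[OF x]
  have xc [simp]: "x k \<in> car E" for k using B by auto
  have Pc [simp]: "P n v \<in> car E" for n v unfolding P_def by (rule expansion_car[OF B])
  have Plim: "(\<lambda>n. fn (P n v - v)) \<longlonglongrightarrow> 0" if "v \<in> car E" for v
    using coord_expansion[OF x that] that
    by (subst fn_tendsto_iff) (auto simp: expansion_def converges_to_def simp flip: P_def)
  have Padd: "P n (u + v) = P n u + P n v" if "u \<in> car E" "v \<in> car E" for n u v
    using that by (simp add: P_def coord_add[OF x] scale_left_distrib sum.distrib)
  have Pdiff: "P n (u - v) = P n u - P n v" if "u \<in> car E" "v \<in> car E" for n u v
    using that by (simp add: P_def coord_diff[OF x] scale_left_diff_distrib sum_subtractf)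
  have Pscale: "P n (smul E a u) = smul E a (P n u)" if "u \<in> car E" for n a u
    using that by (simp add: P_def coord_scale[OF x] scale_sum_right)
  define A where "A r = {v \<in> car E. \<forall>n. fn (P n v) \<le> r}" for r :: real
  have Asub: "A r \<subseteq> car E" for r by (auto simp: A_def)
  have mcomp: "M.mcomplete"
    unfolding M.mcomplete_def
  proof (intro allI impI)
    fix u assume "M.MCauchy u"
    then have u: "u n \<in> car E" and
      cau: "\<And>e. e > 0 \<Longrightarrow> \<exists>N. \<forall>m n. N \<le> m \<longrightarrow> N \<le> n \<longrightarrow> fn (u m - u n) < e" for n
      unfolding M.MCauchy_def fdist_def by (auto simp: subset_iff)
    have "cauchy_in E u"
      unfolding cauchy_in_def
    proof (intro allI impI)
      fix e :: real assume e: "e > 0"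
      obtain N where N: "\<forall>m n. N \<le> m \<longrightarrow> N \<le> n \<longrightarrow> fn (u m - u n) < (c * e) powr p"
        using cau[of "(c * e) powr p"] e c_pos by auto
      have "qnorm E (u m - u n) < e" if "m \<ge> N" "n \<ge> N" for m n
      proof (rule ccontr)
        assume "\<not> qnorm E (u m - u n) < e"
        then have "(c * e) powr p \<le> (c * qnorm E (u m - u n)) powr p"
          using e c_pos p_pos by (intro powr_mono2) auto
        also have "\<dots> \<le> fn (u m - u n)"
          using qnorm_le_fn[of "u m - u n"] u c_pos by (simp add: powr_mult)
        finally show False using N that by (metis not_le)
      qed
      then show "\<exists>M. \<forall>m\<ge>M. \<forall>n\<ge>M. qnorm E (u m - u n) < e" by blast
    qed
    then obtain v where v: "v \<in> car E" "converges_to E u v"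
      using assms(1) u unfolding quasi_banach_def by blast
    have "(\<lambda>n. fn (u n - v)) \<longlonglongrightarrow> 0"
      using v u by (subst fn_tendsto_iff) (auto simp: converges_to_def)
    then show "\<exists>v. limitin M.mtopology u v sequentially"
      unfolding M.limitin_metric_dist_null using u v by (auto simp: fdist_def)
  qed
  have cover: "\<exists>m::nat. v \<in> A (real m)" if v: "v \<in> car E" for v
  proof -
    have "Bseq (\<lambda>n. fn (P n v - v))" using Plim[OF v] by (intro convergent_imp_Bseq convergentI)
    then obtain b where b: "\<And>n. fn (P n v - v) \<le> b" unfolding Bseq_def by fastforce
    obtain m where "b + fn v \<le> real m" using real_arch_simple by blast
    moreover have "fn (P n v) \<le> fn (P n v - v) + fn v" for n
      using fn_add[of "P n v - v" v] v by simp
    ultimately have "v \<in> A (real m)" using b v unfolding A_def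
      by (auto intro: order_trans[OF _ \<open>b + fn v \<le> real m\<close>] add_mono order_trans[OF _ add_right_mono[OF b]])
    then show ?thesis ..
  qed
  obtain m where m: "M.mtopology interior_of (M.mtopology closure_of (A (real m))) \<noteq> {}"
  proof (rule ccontr)
    assume "\<not> thesis"
    then have e: "M.mtopology interior_of (M.mtopology closure_of (A (real m))) = {}" for m
      using that by blast
    let ?G = "range (\<lambda>m. M.mtopology closure_of (A (real m)))"
    have "M.mtopology interior_of \<Union>?G = {}"
      by (rule M.metric_Baire_category_alt[OF mcomp]) (auto simp: e)
    moreover have "\<Union>?G = car E"
    proof
      show "\<Union>?G \<subseteq> car E" using closure_of_subset_topspace[of M.mtopology] by auto
      show "car E \<subseteq> \<Union>?G"
      proof
        fix v assume "v \<in> car E"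
        then obtain m where "v \<in> A (real m)" using cover by blast
        then have "v \<in> M.mtopology closure_of (A (real m))"
          using closure_of_subset[of "A (real m)" M.mtopology] Asub by auto
        then show "v \<in> \<Union>?G" by blast
      qed
    qed
    ultimately show False
      using interior_of_topspace[of M.mtopology] car_0 by auto
  qed
  then obtain y0 \<epsilon> where y0: "y0 \<in> car E" "\<epsilon> > 0" "M.mball y0 \<epsilon> \<subseteq> M.mtopology closure_of (A (real m))"
    unfolding M.metric_interior_of by blast
  \<comment> \<open>The closure of \<open>A (real m)\<close> contains a ball about
    \<open>y0\<close>. Approximating both \<open>y0\<close> and \<open>y0 + v\<close> and
    subtracting moves the ball to the origin, at the price of doubling the bound on the partial
    sums.\<close>
  define R where "R = 2 * real m"
  have R0: "0 \<le> R" by (simp add: R_def)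
  have near0: "\<exists>z\<in>A R. fn (v - z) < \<eta>" if v: "v \<in> car E" "fn v < \<epsilon>" and \<eta>: "\<eta> > 0" for v \<eta>
  proof -
    have "y0 \<in> M.mball y0 \<epsilon>" "y0 + v \<in> M.mball y0 \<epsilon>"
      using y0 v by (auto simp: M.in_mball fdist_def fn_neg)
    then have cl: "y0 \<in> M.mtopology closure_of (A (real m))" "y0 + v \<in> M.mtopology closure_of (A (real m))"
      using y0(3) by auto
    have "\<eta> / 2 > 0" using \<eta> by simp
    have dense: "\<exists>z\<in>A (real m). fdist u z < \<eta> / 2" if "u \<in> M.mtopology closure_of (A (real m))" for u
      using that \<open>\<eta> / 2 > 0\<close> unfolding M.metric_closure_of M.in_mball by blast
    obtain z1 z2 where z: "z1 \<in> A (real m)" "z2 \<in> A (real m)"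
      "fdist y0 z1 < \<eta> / 2" "fdist (y0 + v) z2 < \<eta> / 2"
      using dense[OF cl(1)] dense[OF cl(2)] by blast
    have zc: "z1 \<in> car E" "z2 \<in> car E" using z Asub by auto
    have "fn (P n (z2 - z1)) \<le> R" for n
    proof -
      have "fn (P n z1) \<le> real m" "fn (P n z2) \<le> real m" using z(1,2) by (auto simp: A_def)
      then show ?thesis using fn_diff[of "P n z2" "P n z1"] zc by (simp add: Pdiff R_def)
    qed
    then have "z2 - z1 \<in> A R" using zc by (simp add: A_def)
    moreover have "fn (v - (z2 - z1)) < \<eta>"
      using fn_diff[of "(y0 + v) - z2" "y0 - z1"] z(3,4) zc y0(1) v(1)
      by (simp add: fdist_def algebra_simps)
    ultimately show ?thesis by blast
  qed
  have near: "\<exists>z\<in>A (R / 2 ^ j). fn (v - z) < \<eta>"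
    if v: "v \<in> car E" "fn v < \<epsilon> / 2 ^ j" and \<eta>: "\<eta> > 0" for v \<eta> and j :: nat
  proof -
    \<comment> \<open>As \<open>fn\<close> is homogeneous of degree p, multiplication by this t
      multiplies \<open>fn\<close> by exactly \<open>2 ^ j\<close>.\<close>
    define t where "t = (2 ^ j :: real) powr (1 / p)"
    have t: "t > 0" "t powr p = 2 ^ j" using p_pos by (auto simp: t_def powr_powr)
    have sc: "fn (smul E (of_real t) u) = 2 ^ j * fn u" "fn (smul E (of_real (1 / t)) u) = fn u / 2 ^ j"
      if "u \<in> car E" for u
      using that t by (simp_all add: fn_scale powr_divide norm_divide del: of_real_divide)
    have "smul E (of_real t) v \<in> car E" "fn (smul E (of_real t) v) < \<epsilon>" "\<eta> * 2 ^ j > 0"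
      using v sc \<eta> by (auto simp: field_simps)
    from near0[OF this] obtain z where z: "z \<in> A R" "fn (smul E (of_real t) v - z) < \<eta> * 2 ^ j"
      by blast
    let ?z = "smul E (of_real (1 / t)) z"
    have zc: "z \<in> car E" using z Asub by auto
    have "fn (P n ?z) \<le> R / 2 ^ j" for n
      using z zc unfolding A_def by (simp add: Pscale sc divide_right_mono del: of_real_divide)
    then have "?z \<in> A (R / 2 ^ j)" using zc by (simp add: A_def)
    moreover have "fn (v - ?z) < \<eta>"
    proof -
      have "v - ?z = smul E (of_real (1 / t)) (smul E (of_real t) v - z)"
        using t by (simp add: scale_right_diff_distrib flip: of_real_mult)
      then have "fn (v - ?z) = fn (smul E (of_real t) v - z) / 2 ^ j"
        using sc(2)[of "smul E (of_real t) v - z"] v(1) zc by simp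
      also have "\<dots> < \<eta>" using z(2) by (simp add: pos_divide_less_eq)
      finally show ?thesis .
    qed
    ultimately show ?thesis by blast
  qed
  have main: "fn (P n v) \<le> 2 * R" if v: "v \<in> car E" "fn v < \<epsilon>" for v n
  proof -
    define z where "z j u = (SOME z. z \<in> A (R / 2 ^ j) \<and> fn (u - z) < \<epsilon> / 2 ^ Suc j)" for j u
    have z: "z j u \<in> A (R / 2 ^ j)" "fn (u - z j u) < \<epsilon> / 2 ^ Suc j"
      if "u \<in> car E" "fn u < \<epsilon> / 2 ^ j" for j u
    proof -
      have "\<exists>z. z \<in> A (R / 2 ^ j) \<and> fn (u - z) < \<epsilon> / 2 ^ Suc j"
        using near[OF that, of "\<epsilon> / 2 ^ Suc j"] y0(2) by auto
      then have "z j u \<in> A (R / 2 ^ j) \<and> fn (u - z j u) < \<epsilon> / 2 ^ Suc j"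
        unfolding z_def by (rule someI_ex)
      then show "z j u \<in> A (R / 2 ^ j)" "fn (u - z j u) < \<epsilon> / 2 ^ Suc j" by auto
    qed
    \<comment> \<open>Residuals of successive approximation: each step subtracts a vector with
      partial sums at most \<open>R / 2 ^ j\<close> and halves the bound on what is left, so the
      subtracted vectors sum to v.\<close>
    define r where "r = rec_nat v (\<lambda>j u. u - z j u)"
    have r0: "r 0 = v" and rS: "r (Suc j) = r j - z j (r j)" for j by (auto simp: r_def)
    have rr: "r j \<in> car E \<and> fn (r j) < \<epsilon> / 2 ^ j" for j
    proof (induction j)
      case 0 then show ?case using v by (simp add: r0)
    next
      case (Suc j)
      then show ?case using z[of "r j" j] subsetD[OF Asub z(1)[of "r j" j]] by (auto simp: rS)
    qed
    define y where "y j = z j (r j)" for j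
    have y: "y j \<in> A (R / 2 ^ j)" for j using z[of "r j" j] rr[of j] by (simp add: y_def)
    then have yc [simp]: "y j \<in> car E" for j using Asub by blast
    have yP: "fn (P n (y j)) \<le> R / 2 ^ j" for n j using y[of j] by (simp add: A_def)
    define w where "w J = (\<Sum>j<J. y j)" for J
    have wc [simp]: "w J \<in> car E" for J by (auto simp: w_def intro: car_sum)
    have wr: "w J = v - r J" for J
      by (induction J) (auto simp: w_def r0 rS y_def)
    have geo: "(\<Sum>j\<in>{J..<J'}. R / 2 ^ j) \<le> 2 * R / 2 ^ J" for J J' :: nat
    proof -
      have "(\<Sum>j\<in>{J..<J'}. R / 2 ^ j) + 2 * R / 2 ^ J' \<le> 2 * R / 2 ^ J" if "J \<le> J'"
        using that by (induction J' rule: dec_induct) (auto simp: field_simps)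
      moreover have "0 \<le> 2 * R / 2 ^ J'" using R0 by simp
      moreover have "0 \<le> 2 * R / 2 ^ J" using R0 by simp
      ultimately show ?thesis by (cases "J \<le> J'") (linarith, simp)
    qed
    have Pw: "fn (P n (w J') - P n (w J)) \<le> 2 * R / 2 ^ J" if "J \<le> J'" for n J J'
    proof -
      have "P n (w J') - P n (w J) = (\<Sum>j\<in>{J..<J'}. P n (y j))"
        using that
      proof (induction J' rule: dec_induct)
        case (step J')
        have "w (Suc J') = w J' + y J'" by (simp add: w_def)
        then have "P n (w (Suc J')) = P n (w J') + P n (y J')" by (simp add: Padd)
        then show ?case using step by (simp add: algebra_simps)
      qed simp
      then have "fn (P n (w J') - P n (w J)) \<le> (\<Sum>j\<in>{J..<J'}. fn (P n (y j)))"
        by (simp add: fn_sum)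
      also have "\<dots> \<le> (\<Sum>j\<in>{J..<J'}. R / 2 ^ j)" by (intro sum_mono yP)
      finally show ?thesis using geo order_trans by blast
    qed
    \<comment> \<open>A single coordinate is the difference of two neighbouring partial sums, and
      these change by geometrically small amounts. The limits are only candidates for the
      coordinates of v, since continuity of the coordinate functionals is not yet available.\<close>
    have conv: "\<exists>l. (\<lambda>J. coord E x k (w J)) \<longlonglongrightarrow> l" for k
    proof -
      have fx: "fn (x k) > 0" using basis_nonzero[OF x, of k] fn_nonneg[of "x k"] fn_eq_0[of "x k"]
        by (metis less_eq_real_def xc)
      have dif: "norm (coord E x k (w J') - coord E x k (w J)) powr p \<le> 4 * R / 2 ^ J / fn (x k)"
        if "J \<le> J'" for J J'
      proof -
        let ?u = "w J' - w J"
        have e: "smul E (coord E x k ?u) (x k) = P (Suc k) ?u - P k ?u"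
          by (simp add: P_def)
        have "norm (coord E x k ?u) powr p * fn (x k) = fn (P (Suc k) ?u - P k ?u)"
          using fn_scale[of "x k" "coord E x k ?u"] e by simp
        also have "\<dots> \<le> fn (P (Suc k) ?u) + fn (P k ?u)" by (rule fn_diff) auto
        also have "\<dots> \<le> 2 * R / 2 ^ J + 2 * R / 2 ^ J"
          using Pw[OF that] by (intro add_mono) (auto simp: Pdiff)
        finally show ?thesis using fx by (simp add: coord_diff[OF x] field_simps)
      qed
      have "Cauchy (\<lambda>J. coord E x k (w J))"
      proof (rule CauchyI')
        fix e :: real assume e: "e > 0"
        have "(\<lambda>J. 4 * R / fn (x k) * (1 / 2) ^ J) \<longlonglongrightarrow> 4 * R / fn (x k) * 0"
          by (intro tendsto_intros LIMSEQ_power_zero) simp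
        then have "eventually (\<lambda>J. 4 * R / fn (x k) * (1 / 2) ^ J < e powr p) sequentially"
          using e by (intro order_tendstoD(2)[of _ "4 * R / fn (x k) * 0"]) auto
        then obtain J where J: "\<And>J'. J' \<ge> J \<Longrightarrow> 4 * R / fn (x k) * (1 / 2) ^ J' < e powr p"
          unfolding eventually_sequentially by blast
        have "dist (coord E x k (w m)) (coord E x k (w n)) < e" if "m \<ge> J" "n > m" for m n
        proof (rule ccontr)
          assume "\<not> ?thesis"
          then have "e powr p \<le> norm (coord E x k (w n) - coord E x k (w m)) powr p"
            using e p_pos by (intro powr_mono2) (auto simp: dist_norm norm_minus_commute)
          also have "\<dots> \<le> 4 * R / fn (x k) * (1 / 2) ^ m"
            using dif[of m n] that by (simp add: power_divide field_simps)
          finally show False using J[OF that(1)] by simp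
        qed
        then show "\<exists>M. \<forall>m\<ge>M. \<forall>n>m. dist (coord E x k (w m)) (coord E x k (w n)) < e" by blast
      qed
      then show ?thesis using real_or_complex_Cauchy_convergent by blast
    qed
    then obtain \<alpha> where \<alpha>: "\<And>k. (\<lambda>J. coord E x k (w J)) \<longlonglongrightarrow> \<alpha> k" by metis
    define Q where "Q n = (\<Sum>k<n. smul E (\<alpha> k) (x k))" for n
    have Qc [simp]: "Q n \<in> car E" for n unfolding Q_def by (rule expansion_car[OF B])
    have PQ: "(\<lambda>J. fn (P n (w J) - Q n)) \<longlonglongrightarrow> 0" for n
    proof -
      have le: "fn (P n (w J) - Q n) \<le> (\<Sum>k<n. norm (coord E x k (w J) - \<alpha> k) powr p * fn (x k))" for J
      proof -
        have "P n (w J) - Q n = (\<Sum>k<n. smul E (coord E x k (w J) - \<alpha> k) (x k))"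
          by (simp add: P_def Q_def scale_left_diff_distrib sum_subtractf)
        then show ?thesis
          using fn_sum[of "{..<n}" "\<lambda>k. smul E (coord E x k (w J) - \<alpha> k) (x k)"] by (simp add: fn_scale)
      qed
      have "(\<lambda>J. norm (coord E x k (w J) - \<alpha> k)) \<longlonglongrightarrow> 0" for k
        using \<alpha>[of k] by (simp add: LIM_zero tendsto_norm_zero)
      then have "(\<lambda>J. norm (coord E x k (w J) - \<alpha> k) powr p) \<longlonglongrightarrow> 0" for k
        using p_pos by (intro tendsto_zero_powrI[of _ _ _ p]) auto
      then have "(\<lambda>J. \<Sum>k<n. norm (coord E x k (w J) - \<alpha> k) powr p * fn (x k)) \<longlonglongrightarrow> (\<Sum>k<n. 0 * fn (x k))"
        by (intro tendsto_intros)
      then have "(\<lambda>J. \<Sum>k<n. norm (coord E x k (w J) - \<alpha> k) powr p * fn (x k)) \<longlonglongrightarrow> 0" by simp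
      from tendsto_sandwich[OF _ _ tendsto_const this] le show ?thesis by auto
    qed
    have Qw: "fn (P n (w J) - Q n) \<le> 2 * R / 2 ^ J" for n J
    proof -
      have "(\<lambda>J'. 2 * R / 2 ^ J + fn (P n (w J') - Q n)) \<longlonglongrightarrow> 2 * R / 2 ^ J + 0"
        by (intro tendsto_intros PQ)
      moreover have "fn (P n (w J) - Q n) \<le> 2 * R / 2 ^ J + fn (P n (w J') - Q n)" if "J' \<ge> J" for J'
        using fn_triangle[of "P n (w J)" "P n (w J')" "Q n"] Pw[OF that, of n]
          fn_commute[of "P n (w J)" "P n (w J')"] by simp
      ultimately have "fn (P n (w J) - Q n) \<le> 2 * R / 2 ^ J + 0"
        by (intro tendsto_lowerbound[of _ _ sequentially]) (auto simp: eventually_sequentially)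
      then show ?thesis by simp
    qed
    \<comment> \<open>Interchange of the limits in n and J: the bound \<open>Qw\<close> is uniform
      in n. The candidates thereby expand v, and uniqueness of the expansion identifies them with
      the coordinates of v.\<close>
    have "(\<lambda>n. fn (Q n - v)) \<longlonglongrightarrow> 0"
    proof (rule LIMSEQ_I)
      fix e :: real assume e: "e > 0"
      have "(\<lambda>J. (2 * R + \<epsilon>) * (1 / 2) ^ J) \<longlonglongrightarrow> (2 * R + \<epsilon>) * 0"
        by (intro tendsto_intros LIMSEQ_power_zero) simp
      then have "eventually (\<lambda>J. (2 * R + \<epsilon>) * (1 / 2) ^ J < e / 2) sequentially"
        using e by (intro order_tendstoD(2)[of _ "(2 * R + \<epsilon>) * 0"]) auto
      then obtain J where J: "(2 * R + \<epsilon>) * (1 / 2) ^ J < e / 2"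
        unfolding eventually_sequentially by blast
      have "eventually (\<lambda>n. fn (P n (w J) - w J) < e / 2) sequentially"
        using e Plim[of "w J"] by (intro order_tendstoD(2)) auto
      then obtain n0 where n0: "\<And>n. n \<ge> n0 \<Longrightarrow> fn (P n (w J) - w J) < e / 2"
        unfolding eventually_sequentially by blast
      have "fn (Q n - v) < e" if "n \<ge> n0" for n
      proof -
        have "fn (Q n - v) \<le> fn (Q n - P n (w J)) + (fn (P n (w J) - w J) + fn (w J - v))"
          using fn_triangle[of "Q n" "P n (w J)" v] fn_triangle[of "P n (w J)" "w J" v] v(1) by simp
        moreover have "fn (Q n - P n (w J)) \<le> 2 * R / 2 ^ J"
          using Qw[of n J] fn_commute[of "Q n"] by simp
        moreover have "fn (w J - v) \<le> \<epsilon> / 2 ^ J"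
          using rr[of J] v(1) by (simp add: wr fn_neg)
        moreover have "(2 * R + \<epsilon>) * (1 / 2) ^ J = 2 * R / 2 ^ J + \<epsilon> / 2 ^ J"
          by (simp add: power_divide field_simps)
        ultimately show ?thesis using J n0[OF that] by linarith
      qed
      then show "\<exists>no. \<forall>n\<ge>no. norm (fn (Q n - v) - 0) < e" by auto
    qed
    then have "expansion E x \<alpha> v"
      unfolding expansion_def converges_to_def Q_def[symmetric]
      using fn_tendsto_iff[of "\<lambda>n. Q n - v"] v(1) by simp
    then have "\<alpha> = (\<lambda>n. coord E x n v)" by (rule coord_unique[OF x v(1)])
    then have "P n v = Q n" by (simp add: P_def Q_def)
    moreover have "P n (w 0) = 0" by (simp add: w_def P_def coord_finite[OF x, of "{}", simplified])
    ultimately show ?thesis using Qw[of n 0] by (simp add: fn_neg)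
  qed
  \<comment> \<open>A nonzero v is scaled to \<open>fn\<close> equal to half of
    \<open>\<epsilon>\<close>, where the bound \<open>2 * R\<close> applies; scaling back gives
    \<open>4 * R / \<epsilon>\<close>.\<close>
  define K where "K = 4 * R / \<epsilon>"
  have "fn (P n v) \<le> K * fn v" if v: "v \<in> car E" for v n
  proof (cases "v = 0")
    case True
    then show ?thesis by (simp add: P_def coord_finite[OF x, of "{}", simplified])
  next
    case False
    then have fv: "fn v > 0" using v fn_nonneg[of v] fn_eq_0[OF v] by linarith
    define t where "t = (\<epsilon> / (2 * fn v)) powr (1 / p)"
    have t: "t \<ge> 0" "t powr p = \<epsilon> / (2 * fn v)" using p_pos y0(2) fv by (auto simp: t_def powr_powr)
    have "fn (smul E (of_real t) v) < \<epsilon>"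
      using v t y0(2) fv by (simp add: fn_scale)
    then have "fn (P n (smul E (of_real t) v)) \<le> 2 * R" using v by (intro main) auto
    then have "\<epsilon> / (2 * fn v) * fn (P n v) \<le> 2 * R"
      using v t by (simp add: Pscale fn_scale)
    then show ?thesis using fv y0(2) by (simp add: K_def field_simps)
  qed
  moreover have "0 \<le> K" using R0 y0(2) by (simp add: K_def)
  ultimately show thesis using that by (simp add: P_def)
qed

lemma partial_sums_bounded:
  assumes "quasi_banach E" and x: "schauder_basis E x"
  obtains K where "1 \<le> K"
    "\<And>v n. v \<in> car E \<Longrightarrow> qnorm E (\<Sum>k<n. smul E (coord E x k v) (x k)) \<le> K * qnorm E v"
proof -
  obtain K where K: "0 \<le> K" 
    "\<And>v n. v \<in> car E \<Longrightarrow> fn (\<Sum>k<n. smul E (coord E x k v) (x k)) \<le> K * fn v"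
    using fn_partial_sums_bounded[OF assms] by blast
  let ?K = "K powr (1 / p) * C / c"
  have "qnorm E (\<Sum>k<n. smul E (coord E x k v) (x k)) \<le> max 1 ?K * qnorm E v" if v: "v \<in> car E" for v n
  proof -
    let ?P = "\<Sum>k<n. smul E (coord E x k v) (x k)"
    have Pc: "?P \<in> car E" by (rule expansion_car[OF basis_car[OF x]])
    have "N ?P = fn ?P powr (1 / p)" using p_pos N_nonneg[OF Pc] by (simp add: fn_def powr_powr)
    also have "\<dots> \<le> (K * fn v) powr (1 / p)" using p_pos K(2)[OF v] by (intro powr_mono2) auto
    also have "\<dots> = K powr (1 / p) * N v"
      using p_pos N_nonneg[OF v] K(1) by (simp add: fn_def powr_powr powr_mult)
    also have "\<dots> \<le> K powr (1 / p) * (C * qnorm E v)"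
      using N_upper[OF v] by (intro mult_left_mono) auto
    finally have "c * qnorm E ?P \<le> K powr (1 / p) * (C * qnorm E v)"
      using N_lower[OF Pc] by simp
    then have "qnorm E ?P \<le> ?K * qnorm E v" using c_pos by (simp add: field_simps)
    also have "\<dots> \<le> max 1 ?K * qnorm E v" using v by (intro mult_right_mono) auto
    finally show ?thesis .
  qed
  then show thesis by (rule that[rotated]) auto
qed

end

section \<open>Subsymmetric norms on finitely supported sequences\<close>

text \<open>By unconditionality the norm of a finite combination depends only on the moduli of its
  coefficients. Working with real coefficients on finite sets removes the scalar field and all
  questions of convergence from the combinatorial estimates. In \<open>nu_mono\<close> the index
  sets may differ: coefficients outside a set count as zero.\<close>

locale subsym_functional =
  fixes nu :: "nat set \<Rightarrow> (nat \<Rightarrow> real) \<Rightarrow> real" and s q Cs Cq :: real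
  assumes nu_mono: "finite A \<Longrightarrow> finite B \<Longrightarrow>
      (\<And>n. n \<in> A \<Longrightarrow> \<bar>a n\<bar> \<le> (if n \<in> B then \<bar>b n\<bar> else 0)) \<Longrightarrow> nu A a \<le> nu B b"
    and nu_add: "finite A \<Longrightarrow> nu A (\<lambda>n. a n + b n) \<le> nu A a + nu A b"
    and nu_scale: "finite A \<Longrightarrow> nu A (\<lambda>n. c * a n) = \<bar>c\<bar> * nu A a"
    and nu_spread: "finite A \<Longrightarrow> strict_mono_on A f \<Longrightarrow> nu (f ` A) a = nu A (\<lambda>n. a (f n))"
    and nu_pos: "0 < nu {0} (\<lambda>_. 1)"
    and nu_upper: "disjoint_family_on F {..<n::nat} \<Longrightarrow> (\<And>i. i < n \<Longrightarrow> finite (F i)) \<Longrightarrow>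
      nu (\<Union>i<n. F i) a \<le> Cs * (\<Sum>i<n. nu (F i) a powr s) powr (1 / s)"
    and nu_lower: "disjoint_family_on F {..<n::nat} \<Longrightarrow> (\<And>i. i < n \<Longrightarrow> finite (F i)) \<Longrightarrow>
      (\<Sum>i<n. nu (F i) a powr q) powr (1 / q) \<le> Cq * nu (\<Union>i<n. F i) a"
    and s_gt: "1 < s" and q_gt: "1 < q" and Cs_ge: "1 \<le> Cs" and Cq_ge: "1 \<le> Cq"
begin

lemma nu_nonneg: "finite A \<Longrightarrow> 0 \<le> nu A a"
  using nu_mono[of A A "\<lambda>n. 0 * a n" a] nu_scale[of A 0 a] by simp

lemma nu_cong: "finite A \<Longrightarrow> (\<And>n. n \<in> A \<Longrightarrow> \<bar>a n\<bar> = \<bar>b n\<bar>) \<Longrightarrow> nu A a = nu A b"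
  by (intro antisym nu_mono) auto

lemma nu_subset: "finite B \<Longrightarrow> A \<subseteq> B \<Longrightarrow> nu A a \<le> nu B a"
  by (rule nu_mono) (auto simp: finite_subset)

lemma nu_abs_mono: "finite A \<Longrightarrow> (\<And>n. n \<in> A \<Longrightarrow> \<bar>a n\<bar> \<le> \<bar>b n\<bar>) \<Longrightarrow> nu A a \<le> nu A b"
  by (rule nu_mono) auto

lemma nu_zero: "finite A \<Longrightarrow> (\<And>n. n \<in> A \<Longrightarrow> a n = 0) \<Longrightarrow> nu A a = 0"
  using nu_cong[of A a "\<lambda>n. 0 * 1"] nu_scale[of A 0 "\<lambda>_. 1"] by simp

lemma nu_sum:
  assumes "finite A" "finite I"
  shows "nu A (\<lambda>n. \<Sum>i\<in>I. a i n) \<le> (\<Sum>i\<in>I. nu A (a i))"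
  using assms(2)
proof (induction I rule: finite_induct)
  case empty
  then show ?case using nu_zero[OF assms(1), of "\<lambda>_. 0"] by simp
next
  case (insert i I)
  then show ?case
    using nu_add[OF assms(1), of "a i" "\<lambda>n. \<Sum>i\<in>I. a i n"] by simp
qed

lemma nu_union:
  assumes "finite A" "finite B"
  shows "nu (A \<union> B) a \<le> nu A a + nu B a"
proof -
  let ?f = "\<lambda>n. if n \<in> A then a n else 0" and ?g = "\<lambda>n. if n \<in> A then 0 else a n"
  have "nu (A \<union> B) a = nu (A \<union> B) (\<lambda>n. ?f n + ?g n)"
    using assms by (intro nu_cong) auto
  also have "\<dots> \<le> nu (A \<union> B) ?f + nu (A \<union> B) ?g"
    using assms by (intro nu_add) auto
  also have "\<dots> \<le> nu A a + nu B a"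
    using assms by (intro add_mono nu_mono) auto
  finally show ?thesis .
qed

lemma nu_Union:
  assumes "finite I" "\<And>i. i \<in> I \<Longrightarrow> finite (A i)"
  shows "nu (\<Union>i\<in>I. A i) a \<le> (\<Sum>i\<in>I. nu (A i) a)"
  using assms
proof (induction I rule: finite_induct)
  case empty
  then show ?case using nu_zero[of "{}" a] by simp
next
  case (insert i I)
  then show ?case
    using nu_union[of "A i" "\<Union>i\<in>I. A i" a] by (simp add: order_trans)
qed

text \<open>Averaging over all simultaneous cyclic shifts of the pieces gives the averaging projection.
  Each shift is increasing on two sets that cover everything, whence the factor \<open>2\<close>.\<close>

lemma nu_average:
  assumes A: "finite A"
    and P: "\<And>n. n \<in> A \<Longrightarrow> {lo n..<lo n + wd n} \<subseteq> A \<and> n \<in> {lo n..<lo n + wd n}"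
    and eq: "\<And>m n. n \<in> A \<Longrightarrow> m \<in> {lo n..<lo n + wd n} \<Longrightarrow> lo m = lo n \<and> wd m = (wd n :: nat)"
  shows "nu A (\<lambda>n. (\<Sum>m = lo n..<lo n + wd n. \<bar>a m\<bar>) / real (wd n)) \<le> 2 * nu A a"
proof -
  \<comment> \<open>A common multiple of all piece widths. Over \<open>T\<close> shifts every piece
    is run through completely the same number of times at each of its positions, so the mean over
    the shifts is the piece average.\<close>
  define T where "T = (\<Prod>n\<in>A. wd n)"
  define sh where "sh = (\<lambda>t n. lo n + (n - lo n + t) mod wd n)"
  have lnpos: "0 < wd n" if "n \<in> A" for n
    using P[OF that] by auto
  have Tpos: "0 < T"
    unfolding T_def using lnpos A by (simp add: prod_pos)
  have avg: "(\<Sum>t<T. \<bar>a (sh t n)\<bar>) = real T * ((\<Sum>m = lo n..<lo n + wd n. \<bar>a m\<bar>) / real (wd n))"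
    if n: "n \<in> A" for n
  proof -
    define l where "l = wd n"
    have l: "0 < l" using lnpos n by (simp add: l_def)
    obtain c where c: "T = c * l"
      using dvd_prodI[OF A n, of wd] unfolding T_def l_def by (metis dvd_def mult.commute)
    define h where "h = (\<lambda>t. \<bar>a (lo n + t mod l)\<bar>)"
    have per: "(\<Sum>t\<in>{i..<i + l}. h t) = (\<Sum>t<l. h t)" for i
    proof (induction i)
      case 0
      then show ?case by (simp add: atLeast0LessThan)
    next
      case (Suc i)
      have "(\<Sum>t\<in>{Suc i..<Suc i + l}. h t) + h i = (\<Sum>t\<in>{i..<Suc i + l}. h t)"
        using l by (subst sum.atLeast_Suc_lessThan[of i]) auto
      also have "\<dots> = (\<Sum>t\<in>{i..<i + l}. h t) + h (i + l)"
        by simp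
      also have "h (i + l) = h i"
        by (simp add: h_def)
      finally show ?case using Suc by simp
    qed
    have "(\<Sum>t<T. \<bar>a (sh t n)\<bar>) = (\<Sum>t<T. h (t + (n - lo n)))"
      by (simp add: sh_def h_def l_def add.commute)
    also have "\<dots> = (\<Sum>m<c. \<Sum>t\<in>{m * l..<m * l + l}. h (t + (n - lo n)))"
      unfolding c by (rule sum.nat_group[symmetric])
    also have "\<dots> = (\<Sum>m<c. \<Sum>t\<in>{m * l + (n - lo n)..<m * l + (n - lo n) + l}. h t)"
      proof (rule sum.cong[OF refl])
      fix m
      show "(\<Sum>t\<in>{m * l..<m * l + l}. h (t + (n - lo n)))
          = (\<Sum>t\<in>{m * l + (n - lo n)..<m * l + (n - lo n) + l}. h t)"
        using sum.shift_bounds_nat_ivl[of h "m * l" "n - lo n" "m * l + l"] by (simp add: add_ac)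
    qed
    also have "\<dots> = real c * (\<Sum>t<l. h t)"
      by (simp only: per) simp
    also have "(\<Sum>t<l. h t) = (\<Sum>t<l. \<bar>a (lo n + t)\<bar>)"
      by (simp add: h_def)
    also have "\<dots> = (\<Sum>m = lo n..<lo n + l. \<bar>a m\<bar>)"
      using sum.shift_bounds_nat_ivl[of "\<lambda>m. \<bar>a m\<bar>" 0 "lo n" l]
      by (simp add: atLeast0LessThan add.commute)
    finally show ?thesis
      using l by (simp add: l_def[symmetric] c)
  qed
  have shift: "nu A (\<lambda>n. \<bar>a (sh t n)\<bar>) \<le> 2 * nu A a" for t
  proof -
    \<comment> \<open>\<open>A1\<close> holds the indices whose shift does not wrap round the end of
      their piece. On \<open>A1\<close>, and likewise on the rest, the shift restricted to one piece
      is a translation; as pieces are mapped to themselves, it is increasing throughout the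
      set.\<close>
    define A1 where "A1 = {n \<in> A. n - lo n + t mod wd n < wd n}"
    define A2 where "A2 = A - A1"
    have sep: "lo n + wd n \<le> lo m" if "n \<in> A" "m \<in> A" "n < m" "lo n \<noteq> lo m" for n m
    proof (rule ccontr)
      assume "\<not> lo n + wd n \<le> lo m"
      moreover have "lo m > n"
        using that(3,4) eq[OF that(2), of n] P[OF that(2)] by (cases "lo m \<le> n") auto
      ultimately have "lo m \<in> {lo n..<lo n + wd n}"
        using P[OF that(1)] by auto
      then have "lo (lo m) = lo n" using eq that by blast
      moreover have "lo (lo m) = lo m" using eq[of m "lo m"] P[of m] that by force
      ultimately show False using that by simp
    qed
    have s1: "sh t n = n + t mod wd n" if "n \<in> A1" for n
    proof -
      have n: "n \<in> A" "n - lo n + t mod wd n < wd n" using that by (auto simp: A1_def)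
      have "(n - lo n + t) mod wd n = (n - lo n + t mod wd n) mod wd n"
        by (simp add: mod_add_right_eq)
      then show ?thesis using n P[OF n(1)] by (simp add: sh_def)
    qed
    have s2: "sh t n + wd n = n + t mod wd n" if "n \<in> A2" for n
    proof -
      have n: "n \<in> A" "\<not> n - lo n + t mod wd n < wd n" using that by (auto simp: A2_def A1_def)
      then have n': "n - lo n < wd n" "lo n \<le> n" using P[OF n(1)] by auto
      have l: "t mod wd n < wd n" using lnpos[OF n(1)] by simp
      have "(n - lo n + t) mod wd n = (n - lo n + t mod wd n) mod wd n"
        by (simp add: mod_add_right_eq)
      also have "\<dots> = n - lo n + t mod wd n - wd n"
        using n n' l le_mod_geq[of "wd n" "n - lo n + t mod wd n"]
          mod_less[of "n - lo n + t mod wd n - wd n" "wd n"] by linarith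
      finally show ?thesis using n n' l by (simp add: sh_def)
    qed
    have inA: "sh t n \<in> A" and inP: "lo n \<le> sh t n \<and> sh t n < lo n + wd n" if "n \<in> A" for n
    proof -
      show "lo n \<le> sh t n \<and> sh t n < lo n + wd n"
        using lnpos[OF that] by (simp add: sh_def)
      then show "sh t n \<in> A" using P[OF that] by auto
    qed
    have mono: "strict_mono_on Ai (sh t)" if "Ai = A1 \<or> Ai = A2" for Ai
    proof (rule strict_mono_onI)
      fix n m assume nm: "n \<in> Ai" "m \<in> Ai" "n < m"
      then have A': "n \<in> A" "m \<in> A" using that by (auto simp: A1_def A2_def)
      show "sh t n < sh t m"
      proof (cases "lo n = lo m")
        case True
        then have "n \<in> {lo m..<lo m + wd m} \<or> m \<in> {lo n..<lo n + wd n}"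
          using P[OF A'(1)] P[OF A'(2)] nm by auto
        then have "wd n = wd m" using eq A' by metis
        then show ?thesis using that nm s1[of n] s1[of m] s2[of n] s2[of m] by auto
      next
        case False
        then show ?thesis using sep[OF A' nm(3)] inP[OF A'(1)] inP[OF A'(2)] by linarith
      qed
    qed
    have le: "nu Ai (\<lambda>n. \<bar>a (sh t n)\<bar>) \<le> nu A a" if "Ai = A1 \<or> Ai = A2" for Ai
    proof -
      have f: "finite Ai" "Ai \<subseteq> A" using that A by (auto simp: A1_def A2_def)
      have "nu Ai (\<lambda>n. \<bar>a (sh t n)\<bar>) = nu Ai (\<lambda>n. a (sh t n))" using f by (intro nu_cong) auto
      also have "\<dots> = nu (sh t ` Ai) a" using nu_spread[OF f(1) mono[OF that], of a] by simp
      also have "\<dots> \<le> nu A a" using f inA by (intro nu_subset A) auto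
      finally show ?thesis .
    qed
    have "nu A (\<lambda>n. \<bar>a (sh t n)\<bar>) \<le> nu A1 (\<lambda>n. \<bar>a (sh t n)\<bar>) + nu A2 (\<lambda>n. \<bar>a (sh t n)\<bar>)"
    proof -
      have "A1 \<union> A2 = A" "finite A1" "finite A2" using A by (auto simp: A1_def A2_def)
      then show ?thesis using nu_union[of A1 A2 "\<lambda>n. \<bar>a (sh t n)\<bar>"] by simp
    qed
    also have "\<dots> \<le> 2 * nu A a" using le[of A1] le[of A2] by simp
    finally show ?thesis .
  qed
  have "real T * nu A (\<lambda>n. (\<Sum>m = lo n..<lo n + wd n. \<bar>a m\<bar>) / real (wd n))
      = nu A (\<lambda>n. real T * ((\<Sum>m = lo n..<lo n + wd n. \<bar>a m\<bar>) / real (wd n)))"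
    using nu_scale[OF A, of "real T" "\<lambda>n. (\<Sum>m = lo n..<lo n + wd n. \<bar>a m\<bar>) / real (wd n)"]
    by simp
  also have "\<dots> = nu A (\<lambda>n. \<Sum>t<T. \<bar>a (sh t n)\<bar>)"
    using avg by (intro nu_cong A) simp
  also have "\<dots> \<le> (\<Sum>t<T. nu A (\<lambda>n. \<bar>a (sh t n)\<bar>))"
    by (intro nu_sum A) simp
  also have "\<dots> \<le> (\<Sum>t<T. 2 * nu A a)"
    by (intro sum_mono shift)
  finally show ?thesis using Tpos by simp
qed

section \<open>Growth of the fundamental function of S\<close>

definition Lam :: "nat \<Rightarrow> real" where "Lam m = nu {..<m} (\<lambda>_. 1)"

lemma Lam_nonneg: "0 \<le> Lam m"
  by (simp add: Lam_def nu_nonneg)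

lemma Lam_0: "Lam 0 = 0"
  unfolding Lam_def using nu_zero[of "{}"] by simp

lemma Lam_mono: "m \<le> n \<Longrightarrow> Lam m \<le> Lam n"
  unfolding Lam_def by (rule nu_subset) auto

lemma Lam_pos: "0 < m \<Longrightarrow> 0 < Lam m"
  using nu_pos Lam_mono[of 1 m] by (simp add: Lam_def lessThan_Suc)

lemma enumerate_obtain:
  assumes "finite (A :: nat set)"
  obtains f where "strict_mono_on {..<card A} f" "A = f ` {..<card A}"
proof -
  obtain f where f: "strict_mono_on {..<card A} f" "\<forall>n<card A. f n \<in> A"
    using finite_enumerate[OF assms] by blast
  have "f ` {..<card A} = A"
    using f assms by (intro card_subset_eq) (auto simp: card_image strict_mono_on_imp_inj_on)
  with f show thesis by (intro that) auto
qed

lemma nu_const: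
  assumes "finite A"
  shows "nu A (\<lambda>_. c) = \<bar>c\<bar> * Lam (card A)"
proof -
  obtain f where f: "strict_mono_on {..<card A} f" "A = f ` {..<card A}"
    using enumerate_obtain[OF assms] .
  have "nu A (\<lambda>_. c) = nu {..<card A} (\<lambda>_. c * 1)"
    by (subst f(2)) (use nu_spread[OF _ f(1)] in simp)
  then show ?thesis by (simp only: nu_scale[OF finite_lessThan] Lam_def)
qed

lemma nu_ge_const:
  assumes "finite A" "0 \<le> t" "\<And>n. n \<in> A \<Longrightarrow> t \<le> \<bar>a n\<bar>"
  shows "t * Lam (card A) \<le> nu A a"
proof -
  have "nu A (\<lambda>_. t) \<le> nu A a"
    by (rule nu_abs_mono) (use assms in auto)
  then show ?thesis using assms by (simp add: nu_const)
qed

lemma nu_le_const: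
  assumes "finite A" "\<And>n. n \<in> A \<Longrightarrow> \<bar>a n\<bar> \<le> t" "card A \<le> m" "0 \<le> t"
  shows "nu A a \<le> t * Lam m"
proof -
  have "nu A a \<le> nu A (\<lambda>_. t)"
    by (rule nu_abs_mono) (use assms in auto)
  also have "\<dots> \<le> t * Lam m"
    using assms Lam_mono[of "card A" m] by (simp add: nu_const mult_left_mono)
  finally show ?thesis .
qed

text \<open>Averaging with all of D as a single piece: the averaged sequence is constant, so its
  norm is the mean times \<open>Lam (card D)\<close>. In other words, summation over D is a
  functional of norm at most \<open>2 * card D / Lam (card D)\<close>.\<close>

lemma sum_le_nu:
  assumes D: "finite D"
  shows "(\<Sum>n\<in>D. \<bar>a n\<bar>) * Lam (card D) \<le> 2 * real (card D) * nu D a"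
proof (cases "D = {}")
  case True
  then show ?thesis by (simp add: nu_zero)
next
  case False
  define d where "d = card D"
  have d: "0 < d" using False D by (simp add: d_def card_gt_0_iff)
  obtain f where f: "strict_mono_on {..<d} f" "D = f ` {..<d}"
    unfolding d_def using enumerate_obtain[OF D] .
  have "(\<Sum>n\<in>D. \<bar>a n\<bar>) = (\<Sum>m<d. \<bar>a (f m)\<bar>)"
    by (subst f(2), subst sum.reindex) (use strict_mono_on_imp_inj_on[OF f(1)] in auto)
  moreover have "nu D a = nu {..<d} (\<lambda>m. a (f m))"
    by (subst f(2)) (use nu_spread[OF _ f(1)] in simp)
  moreover have "nu {..<d} (\<lambda>n. (\<Sum>m<d. \<bar>a (f m)\<bar>) / real d) \<le> 2 * nu {..<d} (\<lambda>m. a (f m))"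
    using nu_average[of "{..<d}" "\<lambda>_. 0" "\<lambda>_. d" "\<lambda>m. a (f m)"] by (simp add: atLeast0LessThan)
  moreover have "nu {..<d} (\<lambda>n. (\<Sum>m<d. \<bar>a (f m)\<bar>) / real d) = (\<Sum>m<d. \<bar>a (f m)\<bar>) / real d * Lam d"
    by (subst nu_const) (auto simp: sum_nonneg)
  ultimately show ?thesis using d by (simp add: d_def[symmetric] field_simps)
qed

lemma
  assumes "1 \<le> (j::nat)" 
  shows Lam_mult_upper: "Lam (j * m) \<le> Cs * real j powr (1 / s) * Lam m"
    and Lam_mult_lower: "real j powr (1 / q) * Lam m \<le> Cq * Lam (j * m)"
proof -
  define A where "A i = {i * m..<i * m + m}" for i
  have dj: "disjoint_family_on A {..<j}"
  proof (unfold disjoint_family_on_def, intro ballI impI)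
    fix i k :: nat assume "i \<noteq> k"
    then have "Suc i \<le> k \<or> Suc k \<le> i" by linarith
    then have "Suc i * m \<le> k * m \<or> Suc k * m \<le> i * m"
      using mult_le_mono1 by blast
    then show "A i \<inter> A k = {}" by (auto simp: A_def)
  qed
  have un: "(\<Union>i<j. A i) = {..<j * m}"
  proof (induction j)
    case (Suc j)
    have "(\<Union>i<Suc j. A i) = {..<j * m} \<union> A j" by (simp only: lessThan_Suc UN_insert Suc Un_commute)
    also have "\<dots> = {..<Suc j * m}" by (auto simp: A_def)
    finally show ?case .
  qed simp
  have nA: "nu (A i) (\<lambda>_. 1) = Lam m" for i
    by (simp add: A_def nu_const)
  have pw: "(\<Sum>i<j. nu (A i) (\<lambda>_. 1) powr r) powr (1 / r) = real j powr (1 / r) * Lam m" if "r > 1" for r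
    using that Lam_nonneg[of m] by (simp add: nA powr_mult powr_powr)
  show "Lam (j * m) \<le> Cs * real j powr (1 / s) * Lam m"
    using nu_upper[OF dj, of "\<lambda>_. 1"] pw[OF s_gt] unfolding un by (simp add: A_def nu_const mult.assoc)
  show "real j powr (1 / q) * Lam m \<le> Cq * Lam (j * m)"
    using nu_lower[OF dj, of "\<lambda>_. 1"] pw[OF q_gt] unfolding un by (simp add: A_def nu_const)
qed

text \<open>With \<open>j = n div m\<close> the ratio \<open>n / m\<close> lies between j and
  \<open>2 * j\<close>. The exponents \<open>1 / s\<close> and \<open>1 / q\<close> are below 1, so
  this rounding costs at most the factor 2 in each estimate.\<close>

lemma
  assumes "1 \<le> m" "m \<le> n"
  shows Lam_upper: "Lam n \<le> 2 * Cs * (real n / real m) powr (1 / s) * Lam m"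
    and Lam_lower: "(real n / real m) powr (1 / q) * Lam m \<le> 2 * Cq * Lam n"
proof -
  define j where "j = n div m"
  have j: "1 \<le> j" using assms by (simp add: j_def div_greater_zero_iff Suc_le_eq)
  have jm: "j * m \<le> n" by (simp add: j_def)
  have "n < Suc j * m"
    using dividend_less_div_times[of m n] assms by (simp add: j_def)
  then have nj: "n \<le> (2 * j) * m" 
    using j mult_le_mono1[of "Suc j" "2 * j" m] by linarith
  have r1: "real j \<le> real n / real m"
    using jm assms by (simp add: field_simps flip: of_nat_mult)
  have "real n / real m \<le> real ((2 * j) * m) / real m"
    using nj by (intro divide_right_mono) (auto simp del: of_nat_mult)
  then have r2: "real n / real m \<le> 2 * real j" using assms by simp
  have two: "(2::real) powr (1 / r) \<le> 2" if "r > 1" for r :: real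
    using powr_mono[of "1 / r" 1 "2::real"] that by simp
  have "Lam n \<le> Cs * real (2 * j) powr (1 / s) * Lam m"
    using Lam_mono[OF nj] Lam_mult_upper[of "2 * j" m] j by linarith
  also have "\<dots> \<le> Cs * (2 * (real n / real m) powr (1 / s)) * Lam m"
  proof (intro mult_right_mono mult_left_mono Lam_nonneg)
    have "real (2 * j) powr (1 / s) = 2 powr (1 / s) * real j powr (1 / s)"
      by (simp add: powr_mult)
    also have "\<dots> \<le> 2 * (real n / real m) powr (1 / s)"
      using r1 s_gt by (intro mult_mono two powr_mono2) auto
    finally show "real (2 * j) powr (1 / s) \<le> 2 * (real n / real m) powr (1 / s)" .
  qed (use Cs_ge in auto)
  finally show "Lam n \<le> 2 * Cs * (real n / real m) powr (1 / s) * Lam m" by (simp add: mult_ac)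
  have "(real n / real m) powr (1 / q) \<le> (2 * real j) powr (1 / q)"
    using r2 q_gt by (intro powr_mono2) auto
  also have "\<dots> \<le> 2 * real j powr (1 / q)"
    using two[OF q_gt] by (simp add: powr_mult mult_right_mono)
  finally have "(real n / real m) powr (1 / q) * Lam m \<le> 2 * real j powr (1 / q) * Lam m"
    by (intro mult_right_mono Lam_nonneg)
  also have "\<dots> \<le> 2 * (Cq * Lam (j * m))"
    using Lam_mult_lower[OF j, of m] by simp
  also have "\<dots> \<le> 2 * Cq * Lam n"
    using Lam_mono[OF jm] Cq_ge by simp
  finally show "(real n / real m) powr (1 / q) * Lam m \<le> 2 * Cq * Lam n" .
qed

end

section \<open>Bases and subsymmetric sequence spaces\<close>

context quasi_normed
begin

text \<open>Uniqueness is the point: applied to the partial sums of any expansion of v, the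
  functional \<open>G n\<close> is eventually constant with value \<open>a n\<close>, and
  boundedness lets it pass to the limit v.\<close>

lemma
  assumes y: "range y \<subseteq> car E"
    and add: "\<And>n u v. u \<in> car E \<Longrightarrow> v \<in> car E \<Longrightarrow> G n (u + v) = G n u + (G n v :: 'k)"
    and scale: "\<And>n c v. v \<in> car E \<Longrightarrow> G n (smul E c v) = c * G n v"
    and bound: "\<And>n v. v \<in> car E \<Longrightarrow> norm (G n v) \<le> D n * qnorm E v"
    and biorth: "\<And>n m. G n (y m) = (if n = m then 1 else 0)"
    and expn: "\<And>v. v \<in> car E \<Longrightarrow> expansion E y (\<lambda>n. G n v) v"
  shows schauder_basis_functionals: "schauder_basis E y"
    and coord_functionals: "v \<in> car E \<Longrightarrow> coord E y n v = G n v"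
proof -
  have uniq: "a = (\<lambda>n. G n v)" if v: "v \<in> car E" and a: "expansion E y a v" for a v
  proof
    fix n
    have G0: "G n 0 = 0" using add[of 0 0 n] by simp
    have Gs: "G n (\<Sum>k<N. smul E (a k) (y k)) = (if n < N then a n else 0)" for N
    proof (induction N)
      case 0 then show ?case by (simp add: G0)
    next
      case (Suc N)
      have "y N \<in> car E" using y by auto
      then have "smul E (a N) (y N) \<in> car E" "G n (smul E (a N) (y N)) = a N * G n (y N)"
        by (auto intro!: scale)
      then show ?case
        using Suc add[OF expansion_car[OF y, where N = N]] by (auto simp: biorth less_Suc_eq)
    qed
    have le: "norm (a n - G n v) \<le> D n * qnorm E ((\<Sum>k<N. smul E (a k) (y k)) - v)" if "n < N" for N
    proof -
      have "(\<Sum>k<N. smul E (a k) (y k)) - v \<in> car E" using expansion_car[OF y] v by simp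
      moreover have "G n ((\<Sum>k<N. smul E (a k) (y k)) - v) = a n - G n v"
        using add[OF expansion_car[OF y, where N = N], of "smul E (- 1) v" n a] scale[OF v, of n "- 1"] Gs[of N] that v
        by simp
      ultimately show ?thesis using bound by metis
    qed
    have "(\<lambda>N. D n * qnorm E ((\<Sum>k<N. smul E (a k) (y k)) - v)) \<longlonglongrightarrow> D n * 0"
      using a unfolding expansion_def converges_to_def by (intro tendsto_intros)
    then have "norm (a n - G n v) \<le> D n * 0"
      by (rule tendsto_lowerbound) (use le in \<open>auto simp: eventually_sequentially intro!: exI[of _ "Suc n"]\<close>)
    then show "a n = G n v" by simp
  qed
  then have "\<forall>v\<in>car E. \<exists>!a. expansion E y a v" using expn by blast
  with y show sb: "schauder_basis E y" by (simp add: schauder_basis_def)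
  show "coord E y n v = G n v" if "v \<in> car E" for v n
    using coord_unique[OF sb that expn[OF that]] by metis
qed

text \<open>Coordinates from m on vanish on the span and, being bounded, on its closure. So taking
  the closure adds nothing, and membership becomes a finite identity.\<close>

lemma car_initial_space:
  assumes y: "schauder_basis E y"
    and bound: "\<And>n v. v \<in> car E \<Longrightarrow> norm (coord E y n v) \<le> D n * qnorm E v"
  shows "car (initial_space E y m) = {v \<in> car E. v = (\<Sum>n<m. smul E (coord E y n v) (y n))}"
proof -
  note B = basis_car[OF y]
  have span0: "u \<in> car E \<and> (\<forall>n\<ge>m. coord E y n u = 0)" if "u \<in> span (y ` {..<m})" for u
    using that
  proof (induction rule: span_induct_alt)
    case base
    then show ?case using coord_finite[OF y, of "{}"] by simp
  next
    case (step c v u)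
    then obtain k where "k < m" "v = y k" by auto
    moreover have "y k \<in> car E" using B by auto
    ultimately show ?case using step
      by (auto simp: coord_add[OF y] coord_scale[OF y] coord_basis[OF y])
  qed
  show ?thesis
    unfolding initial_space_def subspace_of_def closed_span_def
  proof (simp, safe)
    fix v u assume v: "v \<in> car E" and u: "\<forall>n. u n \<in> span (y ` {..<m})" "converges_to E u v"
    have 0: "coord E y n v = 0" if "n \<ge> m" for n
    proof -
      have "norm (coord E y n v) \<le> D n * qnorm E (u j - v)" for j
      proof -
        have "coord E y n (u j - v) = - coord E y n v"
          using span0[of "u j"] u(1) v that by (simp add: coord_diff[OF y])
        then show ?thesis using bound[of "u j - v" n] span0[of "u j"] u(1) v by simp
      qed
      moreover have "(\<lambda>j. D n * qnorm E (u j - v)) \<longlonglongrightarrow> D n * 0"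
        using u(2) unfolding converges_to_def by (intro tendsto_intros)
      ultimately have "norm (coord E y n v) \<le> D n * 0"
        by (intro tendsto_lowerbound[of _ _ sequentially]) auto
      then show ?thesis by simp
    qed
    show "v = (\<Sum>n<m. smul E (coord E y n v) (y n))"
    proof (rule converges_to_unique)
      show "converges_to E (\<lambda>N. \<Sum>n<N. smul E (coord E y n v) (y n)) v"
        using coord_expansion[OF y v] by (simp add: expansion_def)
      show "converges_to E (\<lambda>N. \<Sum>n<N. smul E (coord E y n v) (y n)) (\<Sum>n<m. smul E (coord E y n v) (y n))"
      proof (rule converges_to_eventually_const[OF expansion_car[OF B]])
        fix N assume "m \<le> N"
        then show "(\<Sum>n<N. smul E (coord E y n v) (y n)) = (\<Sum>n<m. smul E (coord E y n v) (y n))"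
          by (intro sum.mono_neutral_right) (auto simp: 0 not_less)
      qed
    qed (auto intro: expansion_car[OF B] v)
  next
    fix v assume v: "v \<in> car E" "v = (\<Sum>n<m. smul E (coord E y n v) (y n))"
    have "v \<in> span (y ` {..<m})"
      by (subst v(2)) (intro span_sum span_scale span_base, auto)
    then show "\<exists>u. (\<forall>n. u n \<in> span (y ` {..<m})) \<and> converges_to E u v"
      using v(1) by (intro exI[of _ "\<lambda>_. v"]) auto
  qed
qed

lemma coord_proj_finite:
  assumes "finite A"
  shows "coord_proj E y A v = (\<Sum>n\<in>A. smul E (coord E y n v) (y n))"
  unfolding coord_proj_def using assms by (intro sum.mono_neutral_left) auto

lemma coord_proj_initial:
  assumes y: "schauder_basis E y" and v: "v \<in> car E" "v = (\<Sum>n<m. smul E (coord E y n v) (y n))"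
  shows "coord_proj E y A v = (\<Sum>n\<in>A \<inter> {..<m}. smul E (coord E y n v) (y n))"
proof -
  have "coord E y n v = 0" if "n \<ge> m" for n
    using coord_finite[OF y, of "{..<m}" n "\<lambda>n. coord E y n v"] v(2) that by simp
  then have "{n. n \<in> A \<and> coord E y n v \<noteq> 0} \<subseteq> A \<inter> {..<m}" by (force simp: not_le[symmetric])
  then show ?thesis
    unfolding coord_proj_def by (intro sum.mono_neutral_left) auto
qed

text \<open>Witnessed by the normalised first basis vector and the full index set. It is used to
  absorb additive constants and the finitely many small m into multiplicative constants.\<close>

lemma k_tilde_ge_one:
  assumes y: "schauder_basis E y"
    and bound: "\<And>n v. v \<in> car E \<Longrightarrow> norm (coord E y n v) \<le> D n * qnorm E v" and m: "1 \<le> m"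
  shows "1 \<le> k_tilde E y m"
proof -
  have yc: "y 0 \<in> car E" using basis_car[OF y] by auto
  have pos: "0 < qnorm E (y 0)"
    using qnorm_nonneg[OF yc] qnorm_eq_0[OF yc] basis_nonzero[OF y, of 0] by linarith
  define c where "c = (of_real (1 / qnorm E (y 0)) :: 'k)"
  define f where "f = smul E c (y 0)"
  have fc: "f \<in> car E" using yc by (simp add: f_def)
  have "norm c = 1 / qnorm E (y 0)" unfolding c_def norm_of_real using pos by simp
  then have fn: "qnorm E f = 1" unfolding f_def qnorm_scale[OF yc] using pos by (simp del: qnorm_eq_0)
  have "coord E y n f = (if n = 0 then c else 0)" for n
    using coord_scale[OF y yc, of n c] coord_basis[OF y, of n 0] by (simp add: f_def)
  then have "(\<Sum>n<m. smul E (coord E y n f) (y n)) = (\<Sum>n\<in>{0}. smul E c (y n))"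
    using m by (intro sum.mono_neutral_cong_right) auto
  then have eq: "f = (\<Sum>n<m. smul E (coord E y n f) (y n))" by (simp add: f_def)
  have "car (initial_space E y m) = {v \<in> car E. v = (\<Sum>n<m. smul E (coord E y n v) (y n))}"
    by (rule car_initial_space[OF y bound])
  then have "f \<in> car (initial_space E y m)"
    by (elim ssubst) (rule CollectI, rule conjI[OF fc eq])
  moreover have "coord_proj E y UNIV f = f"
    using coord_proj_initial[OF y fc eq, of UNIV] eq by simp
  ultimately show ?thesis
    unfolding k_tilde_def using fn by (intro SUP_upper2[of "(f, UNIV)"]) auto
qed

end

text \<open>Subsymmetry is formulated with increasing maps on all of \<open>nat\<close>, whereas the
  arguments only provide maps on finite sets.\<close>

lemma extend_strict_mono:
  assumes "strict_mono_on {..<d} (g :: nat \<Rightarrow> nat)"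
  obtains g' where "strict_mono g'" "\<And>n. n < d \<Longrightarrow> g' n = g n"
proof
  define M where "M = Max (insert 0 (g ` {..<d}))"
  have M: "g n \<le> M" if "n < d" for n using that by (simp add: M_def)
  show "strict_mono (\<lambda>n. if n < d then g n else Suc (M + n))"
  proof (rule strict_monoI)
    fix m n :: nat assume "m < n"
    then show "(if m < d then g m else Suc (M + m)) < (if n < d then g n else Suc (M + n))"
      using M[of m] strict_mono_onD[OF assms, of m n] by auto
  qed
qed auto

section \<open>Unconditionality and spreading from subsymmetry\<close>

locale subsym_space =
  fixes S :: "('k::real_or_complex, nat \<Rightarrow> 'k) qspace"
  assumes subsym: "subsymmetric S"
begin

lemma banach: "banach_space S" and qbanach: "quasi_banach S" and basis: "schauder_basis S unit_seq"
  using subsym by (auto simp: subsymmetric_def sequence_space_def banach_space_def)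

sublocale quasi_normed S
  using qbanach by unfold_locales (auto simp: quasi_banach_def)

lemma triangle: "u \<in> car S \<Longrightarrow> v \<in> car S \<Longrightarrow> qnorm S (u + v) \<le> qnorm S u + qnorm S v"
  using banach by (auto simp: banach_space_def)

lemma unit_car [simp]: "unit_seq n \<in> car S"
  using basis_car[OF basis] by auto

definition comb :: "nat set \<Rightarrow> (nat \<Rightarrow> 'k) \<Rightarrow> nat \<Rightarrow> 'k" where
  "comb A a = (\<Sum>n\<in>A. smul S (a n) (unit_seq n))"

lemma comb_car [simp]: "comb A a \<in> car S"
  unfolding comb_def by (intro car_sum car_scale unit_car)

lemma comb_add: "comb A (\<lambda>n. a n + b n) = comb A a + comb A b"
  by (simp add: comb_def scale_left_distrib sum.distrib)

lemma comb_scale: "comb A (\<lambda>n. c * a n) = smul S c (comb A a)"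
  by (simp add: comb_def scale_sum_right)

lemma comb_cong: "(\<And>n. n \<in> A \<Longrightarrow> a n = b n) \<Longrightarrow> comb A a = comb A b"
  by (simp add: comb_def)

lemma comb_neutral: "finite B \<Longrightarrow> A \<subseteq> B \<Longrightarrow> (\<And>n. n \<in> B - A \<Longrightarrow> a n = 0) \<Longrightarrow> comb B a = comb A a"
  unfolding comb_def by (rule sum.mono_neutral_right) auto

lemma isometry_ex:
  assumes "w \<in> car S" "expansion S unit_seq a w" "\<And>n. norm (\<epsilon> n) = 1" "strict_mono \<phi>"
  obtains g where "g \<in> car S" "expansion S (\<lambda>n. unit_seq (\<phi> n)) (\<lambda>n. \<epsilon> n * a n) g"
    "qnorm S g = qnorm S w"
  using subsym assms unfolding subsymmetric_def by blast

lemma qnorm_isometry: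
  assumes "finite A" "strict_mono \<phi>" "\<And>n. norm (\<epsilon> n) = 1"
  shows "qnorm S (\<Sum>n\<in>A. smul S (\<epsilon> n * a n) (unit_seq (\<phi> n))) = qnorm S (comb A a)"
proof -
  let ?a = "\<lambda>n. if n \<in> A then a n else 0"
  have "expansion S unit_seq ?a (\<Sum>n\<in>A. smul S (?a n) (unit_seq n))"
    using assms(1) by (intro expansion_finite basis_car[OF basis]) auto
  then have e: "expansion S unit_seq ?a (comb A a)"
    by (simp add: comb_def)
  obtain g where g: "g \<in> car S" "expansion S (\<lambda>n. unit_seq (\<phi> n)) (\<lambda>n. \<epsilon> n * ?a n) g"
    "qnorm S g = qnorm S (comb A a)"
    by (rule isometry_ex[OF comb_car e assms(3,2)])
  have r: "range (\<lambda>n. unit_seq (\<phi> n)) \<subseteq> car S" by auto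
  have "expansion S (\<lambda>n. unit_seq (\<phi> n)) (\<lambda>n. \<epsilon> n * ?a n) (\<Sum>n\<in>A. smul S (\<epsilon> n * ?a n) (unit_seq (\<phi> n)))"
    using assms(1) by (intro expansion_finite r) auto
  then have "g = (\<Sum>n\<in>A. smul S (\<epsilon> n * ?a n) (unit_seq (\<phi> n)))"
    using g(1,2) expansion_car[OF r] unfolding expansion_def
    by (intro converges_to_unique[OF _ g(1)]) (auto intro: car_sum)
  then show ?thesis using g(3) by simp
qed

text \<open>An increasing map on A that lowers some index has no increasing extension to
  \<open>nat\<close>. Therefore A and its image are both compared with the initial segment of length
  \<open>card A\<close>, whose enumerations do extend.\<close>

lemma qnorm_spread:
  assumes "finite A" "strict_mono_on A f"
  shows "qnorm S (\<Sum>n\<in>A. smul S (a n) (unit_seq (f n))) = qnorm S (comb A a)"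
proof -
  obtain g where g: "strict_mono_on {..<card A} g" "\<forall>n<card A. g n \<in> A"
    using finite_enumerate[OF assms(1)] by blast
  have inj: "inj_on g {..<card A}" using g(1) by (rule strict_mono_on_imp_inj_on)
  have im: "g ` {..<card A} = A"
    using g assms(1) inj by (intro card_subset_eq) (auto simp: card_image)
  have fg: "strict_mono_on {..<card A} (\<lambda>n. f (g n))"
    using g assms(2) by (auto simp: strict_mono_on_def)
  have *: "qnorm S (\<Sum>n<card A. smul S (b n) (unit_seq (h n))) = qnorm S (comb {..<card A} b)"
    if h: "strict_mono_on {..<card A} h" for h b
  proof -
    obtain h' where h': "strict_mono h'" "\<And>n. n < card A \<Longrightarrow> h' n = h n"
      using extend_strict_mono[OF h] by blast
    show ?thesis using qnorm_isometry[OF _ h'(1), of "{..<card A}" "\<lambda>_. 1" b] h'(2) by simp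
  qed
  have re: "(\<Sum>n\<in>A. smul S (a n) (unit_seq (h n))) = (\<Sum>n<card A. smul S (a (g n)) (unit_seq (h (g n))))" for h
    by (subst im[symmetric], subst sum.reindex[OF inj]) (simp add: im)
  show ?thesis
    unfolding comb_def re[of f] re[of "\<lambda>n. n"] by (simp add: *[OF fg] *[OF g(1)])
qed

definition nu :: "nat set \<Rightarrow> (nat \<Rightarrow> real) \<Rightarrow> real" where
  "nu A a = qnorm S (comb A (\<lambda>n. of_real (a n)))"

lemma qnorm_sign:
  assumes "finite A" "\<And>n. n \<in> A \<Longrightarrow> norm (\<epsilon> n) = 1"
  shows "qnorm S (comb A (\<lambda>n. \<epsilon> n * a n)) = qnorm S (comb A a)"
proof -
  let ?e = "\<lambda>n. if n \<in> A then \<epsilon> n else 1"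
  have "comb A (\<lambda>n. \<epsilon> n * a n) = comb A (\<lambda>n. ?e n * a n)" by (rule comb_cong) simp
  then show ?thesis
    using qnorm_isometry[OF assms(1), of "\<lambda>n. n" ?e a] assms(2) by (simp add: comb_def strict_mono_def)
qed

lemma qnorm_comb:
  assumes "finite A"
  shows "qnorm S (comb A a) = nu A (\<lambda>n. norm (a n))"
proof -
  let ?e = "\<lambda>n. if a n = 0 then 1 else a n / of_real (norm (a n))"
  have "comb A a = comb A (\<lambda>n. ?e n * of_real (norm (a n)))" by (rule comb_cong) simp
  then show ?thesis
    using qnorm_sign[OF assms, of ?e] by (simp add: nu_def norm_divide)
qed

lemma nu_abs: "finite A \<Longrightarrow> nu A (\<lambda>n. \<bar>a n\<bar>) = nu A a"
  using qnorm_comb[of A "\<lambda>n. of_real (a n)"] by (simp add: nu_def[of A a])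

text \<open>The factor \<open>\<theta>\<close> is the convex combination of 1 and -1 with weights
  \<open>(1 + \<theta>) / 2\<close> and \<open>(1 - \<theta>) / 2\<close>, and changing the sign of
  one coefficient is isometric.\<close>

lemma qnorm_shrink_one:
  assumes "finite A" "k \<in> A" "0 \<le> \<theta>" "\<theta> \<le> (1::real)"
  shows "qnorm S (comb A (\<lambda>n. if n = k then of_real \<theta> * c n else c n)) \<le> qnorm S (comb A c)"
proof -
  let ?e = "\<lambda>n. if n = k then - 1 else (1 :: 'k)"
  let ?u = "of_real ((1 + \<theta>) / 2) :: 'k" and ?v = "of_real ((1 - \<theta>) / 2) :: 'k"
  have uv: "?u + ?v = 1" "?u - ?v = of_real \<theta>"
    by (simp_all flip: of_real_add of_real_diff add: field_simps)
  have "comb A (\<lambda>n. if n = k then of_real \<theta> * c n else c n) = comb A (\<lambda>n. ?u * c n + ?v * (?e n * c n))"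
  proof (rule comb_cong)
    fix n
    have "?u * c k + ?v * (- 1 * c k) = (?u - ?v) * c k" "?u * c n + ?v * c n = (?u + ?v) * c n"
      by (simp_all only: algebra_simps) simp
    then show "(if n = k then of_real \<theta> * c n else c n) = ?u * c n + ?v * (?e n * c n)"
      unfolding uv by simp
  qed
  also have "\<dots> = smul S ?u (comb A c) + smul S ?v (comb A (\<lambda>n. ?e n * c n))"
    unfolding comb_add comb_scale[of A ?u c] comb_scale[of A ?v] ..
  finally have eq: "comb A (\<lambda>n. if n = k then of_real \<theta> * c n else c n)
      = smul S ?u (comb A c) + smul S ?v (comb A (\<lambda>n. ?e n * c n))" .
  have "qnorm S (comb A (\<lambda>n. if n = k then of_real \<theta> * c n else c n))
      \<le> qnorm S (smul S ?u (comb A c)) + qnorm S (smul S ?v (comb A (\<lambda>n. ?e n * c n)))"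
    unfolding eq by (intro triangle car_scale comb_car)
  also have "\<dots> = norm ?u * qnorm S (comb A c) + norm ?v * qnorm S (comb A (\<lambda>n. ?e n * c n))"
    by (simp only: qnorm_scale comb_car)
  also have "qnorm S (comb A (\<lambda>n. ?e n * c n)) = qnorm S (comb A c)"
    using assms(1) by (intro qnorm_sign) auto
  also have "norm ?u * qnorm S (comb A c) + norm ?v * qnorm S (comb A c) = qnorm S (comb A c)"
    unfolding norm_of_real using assms(3,4) by (simp flip: distrib_right add: field_simps)
  finally show ?thesis .
qed

lemma qnorm_shrink:
  assumes "finite A" "B \<subseteq> A" "\<And>n. n \<in> B \<Longrightarrow> 0 \<le> \<theta> n \<and> \<theta> n \<le> (1::real)"
  shows "qnorm S (comb A (\<lambda>n. if n \<in> B then of_real (\<theta> n) * c n else c n)) \<le> qnorm S (comb A c)"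
proof -
  have "finite B" using assms finite_subset by blast
  from this assms(2,3) show ?thesis
  proof (induction B rule: finite_induct)
    case (insert k B)
    let ?c = "\<lambda>n. if n \<in> B then of_real (\<theta> n) * c n else c n"
    have "comb A (\<lambda>n. if n \<in> insert k B then of_real (\<theta> n) * c n else c n)
        = comb A (\<lambda>n. if n = k then of_real (\<theta> k) * ?c n else ?c n)"
      using insert.hyps by (intro comb_cong) auto
    moreover have "qnorm S (comb A (\<lambda>n. if n = k then of_real (\<theta> k) * ?c n else ?c n)) \<le> qnorm S (comb A ?c)"
      using insert.prems assms(1) by (intro qnorm_shrink_one) auto
    moreover have "qnorm S (comb A ?c) \<le> qnorm S (comb A c)"
      using insert by auto
    ultimately show ?case by simp
  qed simp
qed

lemma nu_dominated:
  assumes "finite A" "finite B" "\<And>n. n \<in> A \<Longrightarrow> \<bar>a n\<bar> \<le> (if n \<in> B then \<bar>b n\<bar> else 0)"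
  shows "nu A a \<le> nu B b"
proof -
  let ?U = "A \<union> B"
  let ?b = "\<lambda>n. if n \<in> B then b n else 0"
  \<comment> \<open>Division by zero yields 0, which is the right factor: where \<open>b n\<close>
    vanishes, the hypothesis forces \<open>a n = 0\<close>.\<close>
  let ?\<theta> = "\<lambda>n. if n \<in> A then \<bar>a n\<bar> / \<bar>b n\<bar> else 0"
  have U: "finite ?U" using assms by simp
  have "nu A a = nu A (\<lambda>n. \<bar>a n\<bar>)"
    by (simp add: nu_abs assms(1))
  also have "\<dots> = qnorm S (comb ?U (\<lambda>n. of_real (?\<theta> n) * of_real \<bar>?b n\<bar>))"
  proof -
    have "comb ?U (\<lambda>n. of_real (?\<theta> n) * of_real \<bar>?b n\<bar>) = comb A (\<lambda>n. of_real (?\<theta> n) * of_real \<bar>?b n\<bar>)"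
      using U by (intro comb_neutral) auto
    also have "\<dots> = comb A (\<lambda>n. of_real \<bar>a n\<bar>)"
    proof (rule comb_cong)
      fix n assume "n \<in> A"
      then show "of_real (?\<theta> n) * of_real \<bar>?b n\<bar> = (of_real \<bar>a n\<bar> :: 'k)"
        using assms(3)[of n] by (cases "b n = 0") (auto split: if_splits)
    qed
    finally show ?thesis by (simp add: nu_def)
  qed
  also have "\<dots> \<le> qnorm S (comb ?U (\<lambda>n. of_real \<bar>?b n\<bar>))"
  proof -
    have "qnorm S (comb ?U (\<lambda>n. if n \<in> ?U then of_real (?\<theta> n) * of_real \<bar>?b n\<bar> else of_real \<bar>?b n\<bar>))
      \<le> qnorm S (comb ?U (\<lambda>n. of_real \<bar>?b n\<bar>))"
    proof (rule qnorm_shrink[OF U order_refl])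
      fix n
      show "0 \<le> ?\<theta> n \<and> ?\<theta> n \<le> 1"
        using assms(3)[of n] by (auto simp: divide_le_eq_1 split: if_splits)
    qed
    moreover have "comb ?U (\<lambda>n. of_real (?\<theta> n) * of_real \<bar>?b n\<bar>)
        = comb ?U (\<lambda>n. if n \<in> ?U then of_real (?\<theta> n) * of_real \<bar>?b n\<bar> else of_real \<bar>?b n\<bar>)"
      by (rule comb_cong) simp
    ultimately show ?thesis by simp
  qed
  also have "comb ?U (\<lambda>n. of_real \<bar>?b n\<bar>) = comb B (\<lambda>n. of_real \<bar>b n\<bar>)"
  proof -
    have "comb ?U (\<lambda>n. of_real \<bar>?b n\<bar>) = comb B (\<lambda>n. of_real \<bar>?b n\<bar>)"
      using U by (intro comb_neutral) auto
    also have "\<dots> = comb B (\<lambda>n. of_real \<bar>b n\<bar>)" by (rule comb_cong) simp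
    finally show ?thesis .
  qed
  also have "qnorm S \<dots> = nu B b"
    using nu_abs[OF assms(2), of b] by (simp add: nu_def[of B "\<lambda>n. \<bar>b n\<bar>"])
  finally show ?thesis .
qed

text \<open>The mean of w and its image under the sign change off A is the projection of w onto A.
  Both vectors have the norm of w, so the projection does not increase the norm.\<close>

lemma qnorm_coord_comb:
  assumes w: "w \<in> car S" and "finite A"
  shows "qnorm S (comb A (\<lambda>n. coord S unit_seq n w)) \<le> qnorm S w"
proof -
  let ?a = "\<lambda>n. coord S unit_seq n w" and ?e = "\<lambda>n. if n \<in> A then 1 else - 1 :: 'k"
  note aw = coord_expansion[OF basis w]
  have "strict_mono (\<lambda>n::nat. n)" "norm (?e n) = 1" for n by (auto simp: strict_mono_def)
  note * = this
  obtain g where g: "g \<in> car S" "expansion S unit_seq (\<lambda>n. ?e n * ?a n) g" "qnorm S g = qnorm S w"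
    by (rule isometry_ex[OF w aw *(2,1)])
  have e: "expansion S unit_seq (\<lambda>n. ?a n + ?e n * ?a n) (w + g)"
    by (rule expansion_add[OF basis_car[OF basis] w g(1) aw g(2)])
  have "expansion S unit_seq (\<lambda>n. ?a n + ?e n * ?a n) (comb A (\<lambda>n. ?a n + ?e n * ?a n))"
    unfolding comb_def using assms(2) by (intro expansion_finite basis_car[OF basis]) auto
  then have "w + g = comb A (\<lambda>n. ?a n + ?e n * ?a n)"
    using w g(1) by (intro converges_to_unique[OF expansion_car[OF basis_car[OF basis]] _ _ e[unfolded expansion_def]])
      (auto simp: expansion_def)
  also have "\<dots> = comb A (\<lambda>n. 2 * ?a n)" by (rule comb_cong) simp
  finally have "qnorm S (w + g) = 2 * qnorm S (comb A ?a)"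
    unfolding comb_scale by (simp add: qnorm_scale)
  then show ?thesis using triangle[OF w g(1)] g(3) by simp
qed

lemma supp_comb: "finite A \<Longrightarrow> supp S (comb A a) \<subseteq> A"
  unfolding supp_def comb_def by (auto simp: coord_finite[OF basis])

lemma disjoint_combs:
  assumes "disjoint_family_on F {..<n}" "\<And>i. i < n \<Longrightarrow> finite (F i)"
  shows "disjoint_family_in S n (\<lambda>i. comb (F i) a)"
    and "(\<Sum>i<n. comb (F i) a) = comb (\<Union>i<n. F i) a"
proof -
  show "disjoint_family_in S n (\<lambda>i. comb (F i) a)"
    unfolding disjoint_family_in_def
  proof (intro conjI allI impI comb_car)
    show "disjoint_family_on (\<lambda>j. supp S (comb (F j) a)) {..<n}"
      unfolding disjoint_family_on_def
    proof (intro ballI impI)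
      fix i j assume "i \<in> {..<n}" "j \<in> {..<n}" "i \<noteq> j"
      then show "supp S (comb (F i) a) \<inter> supp S (comb (F j) a) = {}"
        using supp_comb[of "F i" a] supp_comb[of "F j" a] assms unfolding disjoint_family_on_def by blast
    qed
  qed
  show "(\<Sum>i<n. comb (F i) a) = comb (\<Union>i<n. F i) a"
    unfolding comb_def using assms by (subst sum.UNION_disjoint) (auto simp: disjoint_family_on_def)
qed

lemma subsym_functional:
  assumes "1 < s" "1 < q" "upper_estimate s S" "lower_estimate q S"
  obtains Cs Cq where "subsym_functional nu s q Cs Cq"
proof -
  obtain C where C: "\<And>n f. disjoint_family_in S n f \<Longrightarrow>
     qnorm S (\<Sum>j<n. f j) \<le> C * (\<Sum>j<n. qnorm S (f j) powr s) powr (1 / s)"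
    using assms(3) unfolding upper_estimate_def by blast
  obtain D where D: "\<And>n f. disjoint_family_in S n f \<Longrightarrow>
     (\<Sum>j<n. qnorm S (f j) powr q) powr (1 / q) \<le> D * qnorm S (\<Sum>j<n. f j)"
    using assms(4) unfolding lower_estimate_def by blast
  have "subsym_functional nu s q (max 1 C) (max 1 D)"
  proof
    show "nu A a \<le> nu B b" if "finite A" "finite B" "\<And>n. n \<in> A \<Longrightarrow> \<bar>a n\<bar> \<le> (if n \<in> B then \<bar>b n\<bar> else 0)"
      for A B a b using nu_dominated[OF that] .
    show "nu A (\<lambda>n. a n + b n) \<le> nu A a + nu A b" for A a b
      unfolding nu_def of_real_add comb_add by (intro triangle comb_car)
    show "nu A (\<lambda>n. c * a n) = \<bar>c\<bar> * nu A a" for A c a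
      unfolding nu_def of_real_mult comb_scale by (simp add: qnorm_scale)
    show "nu (f ` A) a = nu A (\<lambda>n. a (f n))" if "finite A" "strict_mono_on A f" for A f a
    proof -
      have "comb (f ` A) (\<lambda>n. of_real (a n)) = (\<Sum>n\<in>A. smul S (of_real (a (f n))) (unit_seq (f n)))"
        unfolding comb_def by (subst sum.reindex) (use that strict_mono_on_imp_inj_on in auto)
      then show ?thesis unfolding nu_def using qnorm_spread[OF that] by simp
    qed
    have "unit_seq 0 \<noteq> (0 :: nat \<Rightarrow> 'k)" using basis_nonzero[OF basis] .
    then show "0 < nu {0} (\<lambda>_. 1)"
      using qnorm_nonneg[of "unit_seq 0"] qnorm_eq_0[of "unit_seq 0"] 
      by (simp add: nu_def comb_def less_le del: qnorm_nonneg qnorm_eq_0)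
    fix F :: "nat \<Rightarrow> nat set" and n a
    assume F: "disjoint_family_on F {..<n}" "\<And>i. i < n \<Longrightarrow> finite (F i)"
    have d: "disjoint_family_in S n (\<lambda>i. comb (F i) (\<lambda>n. of_real (a n)))"
      "(\<Sum>i<n. comb (F i) (\<lambda>n. of_real (a n))) = comb (\<Union>i<n. F i) (\<lambda>n. of_real (a n))"
      using F by (auto intro!: disjoint_combs)
    show "nu (\<Union>i<n. F i) a \<le> max 1 C * (\<Sum>i<n. nu (F i) a powr s) powr (1 / s)"
      using C[OF d(1)] unfolding d(2) nu_def by (rule order_trans) (auto intro: mult_right_mono)
    show "(\<Sum>i<n. nu (F i) a powr q) powr (1 / q) \<le> max 1 D * nu (\<Union>i<n. F i) a"
      using D[OF d(1)] unfolding d(2) nu_def by (rule order_trans) (auto intro: mult_right_mono)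
  qed (use assms in auto)
  then show thesis by (rule that)
qed

end

section \<open>Pieces, averages and the transfer operators\<close>

definition block_index :: "(nat \<Rightarrow> nat) \<Rightarrow> nat \<Rightarrow> nat" where
  "block_index f n = (LEAST k. n < f (Suc k))"

lemma block_index_bounds:
  assumes "strict_mono f" "f 0 = (0::nat)"
  shows "f (block_index f n) \<le> n" "n < f (Suc (block_index f n))"
proof -
  have "n < f (Suc n)" using strict_mono_imp_increasing[OF assms(1), of "Suc n"] by simp
  then show "n < f (Suc (block_index f n))" unfolding block_index_def by (rule LeastI)
  show "f (block_index f n) \<le> n"
  proof (cases "block_index f n")
    case (Suc k)
    then have "\<not> n < f (Suc k)"
      using not_less_Least[of k "\<lambda>k. n < f (Suc k)"] by (simp add: block_index_def)
    then show ?thesis using Suc by simp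
  qed (simp add: assms(2))
qed

lemma block_index_eq:
  assumes "strict_mono f" "f 0 = (0::nat)" "f k \<le> n" "n < f (Suc k)"
  shows "block_index f n = k"
proof -
  note b = block_index_bounds[OF assms(1,2), of n]
  have "f (block_index f n) < f (Suc k)" "f k < f (Suc (block_index f n))"
    using b assms by linarith+
  then show ?thesis using strict_mono_less[OF assms(1)] by (simp add: less_Suc_eq_le)
qed

text \<open>The positions \<open>{R k..<R (Suc k)}\<close> form round \<open>k\<close>, which is cut into consecutive pieces of lengths
  \<open>len 0, ..., len k\<close>. Its last piece \<open>sg k\<close> will carry the vector \<open>x k\<close>; \<open>up\<close> maps each piece onto the
  piece of the same length in the next round and \<open>dn\<close> inverts it off the last pieces.\<close>

locale piece_sizes =
  fixes len :: "nat \<Rightarrow> nat"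
  assumes len_pos: "0 < len j"
begin

definition N :: "nat \<Rightarrow> nat" where "N k = (\<Sum>j<k. len j)"
definition R :: "nat \<Rightarrow> nat" where "R k = (\<Sum>i<k. N (Suc i))"

lemma N_0 [simp]: "N 0 = 0" and R_0 [simp]: "R 0 = 0"
  and N_Suc: "N (Suc k) = N k + len k" and R_Suc: "R (Suc k) = R k + N (Suc k)"
  by (simp_all add: N_def R_def)

lemma strict_mono_N: "strict_mono N"
  using len_pos by (intro strict_mono_Suc_iff[THEN iffD2]) (simp add: N_Suc)

lemma strict_mono_R: "strict_mono R"
  using len_pos by (intro strict_mono_Suc_iff[THEN iffD2]) (simp add: R_Suc N_Suc)

lemma N_le_iff: "N i \<le> N j \<longleftrightarrow> i \<le> j" and N_less_iff: "N i < N j \<longleftrightarrow> i < j"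
  and R_le_iff: "R i \<le> R j \<longleftrightarrow> i \<le> j" and R_less_iff: "R i < R j \<longleftrightarrow> i < j"
  using strict_mono_less_eq[OF strict_mono_N] strict_mono_less[OF strict_mono_N]
    strict_mono_less_eq[OF strict_mono_R] strict_mono_less[OF strict_mono_R] by auto

lemma R_ge: "k \<le> R k"
  by (rule strict_mono_imp_increasing[OF strict_mono_R])

text \<open>A position is a round together with an offset. The cut of a round is an initial part of
  the cut of every later round, so the piece number \<open>pc\<close> depends on the offset alone,
  and keeping the offset while changing the round keeps the piece number.\<close>

definition rnd :: "nat \<Rightarrow> nat" where "rnd n = block_index R n"
definition off :: "nat \<Rightarrow> nat" where "off n = n - R (rnd n)"
definition pc :: "nat \<Rightarrow> nat" where "pc n = block_index N (off n)"
definition lo :: "nat \<Rightarrow> nat" where "lo n = R (rnd n) + N (pc n)"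
definition wd :: "nat \<Rightarrow> nat" where "wd n = len (pc n)"
definition P :: "nat \<Rightarrow> nat set" where "P n = {lo n..<lo n + wd n}"
definition up :: "nat \<Rightarrow> nat" where "up n = R (Suc (rnd n)) + off n"
text \<open>The truncated \<open>rnd n - 1\<close> is harmless: off the last pieces
  \<open>pc n < rnd n\<close>, so the round is positive.\<close>

definition dn :: "nat \<Rightarrow> nat" where "dn n = R (rnd n - 1) + off n"
definition diag :: "nat \<Rightarrow> bool" where "diag n \<longleftrightarrow> pc n = rnd n"

lemma rnd_bounds: "R (rnd n) \<le> n" "n < R (Suc (rnd n))"
  unfolding rnd_def by (rule block_index_bounds[OF strict_mono_R R_0])+

lemma split_pos: "n = R (rnd n) + off n"
  using rnd_bounds[of n] by (simp add: off_def)

lemma off_less: "off n < N (Suc (rnd n))"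
  using rnd_bounds[of n] by (simp add: off_def R_Suc)

lemma pc_bounds: "N (pc n) \<le> off n" "off n < N (Suc (pc n))"
  unfolding pc_def by (rule block_index_bounds[OF strict_mono_N N_0])+

lemma pc_le: "pc n \<le> rnd n"
proof -
  have "N (pc n) < N (Suc (rnd n))" using pc_bounds(1)[of n] off_less[of n] by linarith
  then show ?thesis by (simp add: N_less_iff)
qed

lemma pos_eqs:
  assumes "i < N (Suc k)"
  shows "rnd (R k + i) = k" "off (R k + i) = i"
proof -
  show r: "rnd (R k + i) = k"
    unfolding rnd_def by (rule block_index_eq[OF strict_mono_R R_0]) (use assms in \<open>auto simp: R_Suc\<close>)
  then show "off (R k + i) = i" by (simp add: off_def)
qed

lemma pc_eq: "N j \<le> off n \<Longrightarrow> off n < N (Suc j) \<Longrightarrow> pc n = j"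
  unfolding pc_def by (rule block_index_eq[OF strict_mono_N N_0])

lemma lo_wd: "lo n + wd n = R (rnd n) + N (Suc (pc n))"
  by (simp add: lo_def wd_def N_Suc)

lemma mem_P: "n \<in> P n"
  using split_pos[of n] pc_bounds[of n] unfolding P_def atLeastLessThan_iff lo_wd by (simp add: lo_def)

lemma same_piece:
  assumes "m \<in> P n" shows "rnd m = rnd n" "pc m = pc n"
proof -
  obtain i where i: "m = R (rnd n) + i" "N (pc n) \<le> i" "i < N (Suc (pc n))"
  proof
    show "m = R (rnd n) + (m - R (rnd n))" "N (pc n) \<le> m - R (rnd n)" "m - R (rnd n) < N (Suc (pc n))"
      using assms lo_wd[of n] by (auto simp: P_def lo_def)
  qed
  have "i < N (Suc (rnd n))"
    using i(3) pc_le[of n] N_le_iff[of "Suc (pc n)" "Suc (rnd n)"] by simp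
  note e = pos_eqs[OF this]
  show "rnd m = rnd n" using e i by simp
  show "pc m = pc n" by (rule pc_eq) (use e i in auto)
qed

lemma P_eq: "m \<in> P n \<Longrightarrow> P m = P n" and lo_eq: "m \<in> P n \<Longrightarrow> lo m = lo n" and wd_eq: "m \<in> P n \<Longrightarrow> wd m = wd n"
  and diag_eq: "m \<in> P n \<Longrightarrow> diag m = diag n"
  using same_piece[of m n] by (auto simp: P_def lo_def wd_def diag_def)

lemma card_P: "card (P n) = wd n" and wd_pos: "0 < wd n"
  by (auto simp: P_def wd_def len_pos)

lemma P_subset: "n < R K \<Longrightarrow> P n \<subseteq> {..<R K}"
proof
  fix m assume n: "n < R K" "m \<in> P n"
  have "R (rnd n) < R K" using rnd_bounds[of n] n by linarith
  then have "R (Suc (rnd n)) \<le> R K" by (simp add: R_le_iff R_less_iff)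
  then show "m \<in> {..<R K}" using rnd_bounds[of m] same_piece[OF n(2)] by simp
qed

lemma
  shows rnd_up: "rnd (up n) = Suc (rnd n)" and off_up: "off (up n) = off n" and pc_up: "pc (up n) = pc n"
proof -
  have "off n < N (Suc (Suc (rnd n)))"
    using off_less[of n] by (simp add: N_Suc)
  note e = pos_eqs[OF this]
  show "rnd (up n) = Suc (rnd n)" "off (up n) = off n" "pc (up n) = pc n"
    using e by (auto simp: up_def pc_def)
qed

text \<open>Monotonicity is what lets subsymmetry move averages along the chains without changing
  norms.\<close>

lemma strict_mono_up: "strict_mono up"
proof (rule strict_monoI)
  fix m n :: nat assume "m < n"
  have "rnd m \<le> rnd n"
  proof -
    have "R (rnd m) < R (Suc (rnd n))" using rnd_bounds[of m] rnd_bounds[of n] \<open>m < n\<close> by linarith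
    then show ?thesis by (simp add: R_less_iff)
  qed
  then consider "rnd m = rnd n" | "rnd (up m) < rnd (up n)" by (force simp: rnd_up)
  then show "up m < up n"
  proof cases
    case 1
    then show ?thesis using \<open>m < n\<close> split_pos[of m] split_pos[of n] by (simp add: up_def)
  next
    case 2
    then have "R (Suc (rnd (up m))) \<le> R (rnd (up n))" by (simp add: R_le_iff)
    then show ?thesis using rnd_bounds[of "up m"] rnd_bounds[of "up n"] by linarith
  qed
qed

lemma not_diag_up: "\<not> diag (up n)"
  using pc_le[of n] by (simp add: diag_def rnd_up pc_up)

lemma dn_up [simp]: "dn (up n) = n"
  using split_pos[of n] by (simp add: dn_def rnd_up off_up)

lemma up_dn:
  assumes "\<not> diag n" shows "up (dn n) = n"
proof -
  have lt: "pc n < rnd n" using assms pc_le[of n] by (simp add: diag_def)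
  then obtain k where k: "rnd n = Suc k" by (cases "rnd n") auto
  have "off n < N (Suc k)" using pc_bounds(2)[of n] lt k N_le_iff[of "Suc (pc n)" "Suc k"] by simp
  note e = pos_eqs[OF this]
  show ?thesis using e k split_pos[of n] by (simp add: dn_def up_def)
qed

lemma up_less: "n < R K \<Longrightarrow> up n < R (Suc K)"
proof -
  assume "n < R K"
  then have "R (rnd n) < R K" using rnd_bounds[of n] by linarith
  then have "R (Suc (rnd (up n))) \<le> R (Suc K)" by (simp add: R_le_iff R_less_iff rnd_up)
  then show ?thesis using rnd_bounds[of "up n"] by linarith
qed

lemma dn_less: assumes "\<not> diag n" shows "dn n < n"
proof -
  have "dn n < up (dn n)"
    unfolding up_def using rnd_bounds(2)[of "dn n"] by linarith
  then show ?thesis using up_dn[OF assms] by simp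
qed

lemma P_up: "P (up n) = up ` P n"
proof -
  have "up m = m + N (Suc (rnd n))" if "m \<in> P n" for m
    using split_pos[of m] same_piece[OF that] by (simp add: up_def R_Suc)
  then have "up ` P n = (\<lambda>m. m + N (Suc (rnd n))) ` P n" by (intro image_cong) auto
  also have "\<dots> = P (up n)"
    unfolding P_def lo_def wd_def rnd_up pc_up R_Suc[of "rnd n"] by (simp add: add_ac)
  finally show ?thesis by simp
qed

lemma wd_up: "wd (up n) = wd n"
  by (simp add: wd_def pc_up)

definition sg :: "nat \<Rightarrow> nat set" where "sg k = {R k + N k..<R (Suc k)}"

lemma finite_sg [simp]: "finite (sg k)" and card_sg [simp]: "card (sg k) = len k"
  by (simp_all add: sg_def R_Suc N_Suc)

lemma mem_sg: "n \<in> sg k \<longleftrightarrow> diag n \<and> rnd n = k"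
proof
  assume n: "n \<in> sg k"
  define i where "i = n - R k"
  have i: "n = R k + i" "N k \<le> i" "i < N (Suc k)" using n by (auto simp: sg_def i_def R_Suc)
  note e = pos_eqs[OF i(3)]
  then have "pc n = k" using i by (intro pc_eq) auto
  then show "diag n \<and> rnd n = k" using e i by (simp add: diag_def)
next
  assume "diag n \<and> rnd n = k"
  then show "n \<in> sg k"
    using pc_bounds[of n] split_pos[of n] by (auto simp: diag_def sg_def R_Suc)
qed

lemma P_sg: "n \<in> sg k \<Longrightarrow> P n = sg k" and wd_sg: "n \<in> sg k \<Longrightarrow> wd n = len k"
proof -
  assume "n \<in> sg k"
  then have d: "diag n" "rnd n = k" by (auto simp: mem_sg)
  show "wd n = len k" using d by (simp add: wd_def diag_def)
  show "P n = sg k" using d by (simp only: P_def lo_wd) (simp add: lo_def sg_def diag_def R_Suc)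
qed

lemma sg_subset: "k < K \<Longrightarrow> sg k \<subseteq> {..<R K}"
  using R_le_iff[of "Suc k" K] by (auto simp: sg_def)

lemma sg_disjoint: "n \<in> sg k \<Longrightarrow> n \<in> sg k' \<Longrightarrow> k = k'"
  by (simp add: mem_sg)

section \<open>Piece averages and the transfer operators\<close>

definition av :: "(nat \<Rightarrow> 'k::real_normed_field) \<Rightarrow> nat \<Rightarrow> 'k" where
  "av a n = (\<Sum>m\<in>P n. a m) / of_nat (wd n)"

text \<open>\<open>T\<close> removes the averages over the pieces and replaces them by those one round later. It
  vanishes on sequences that are constant on each \<open>sg k\<close> and zero elsewhere, and \<open>V\<close> is the
  right inverse of \<open>T\<close> whose values have mean zero on every \<open>sg k\<close>.\<close>

definition T :: "(nat \<Rightarrow> 'k::real_normed_field) \<Rightarrow> nat \<Rightarrow> 'k" where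
  "T a n = a n - av a n + av a (up n)"

definition V :: "(nat \<Rightarrow> 'k::real_normed_field) \<Rightarrow> nat \<Rightarrow> 'k" where
  "V a n = a n - av a n + (if diag n then 0 else av a (dn n))"

lemma av_add: "av (\<lambda>n. a n + b n) n = av a n + av b n"
  by (simp add: av_def sum.distrib add_divide_distrib)

lemma av_diff: "av (\<lambda>n. a n - b n) n = av a n - av b n"
  by (simp add: av_def sum_subtractf diff_divide_distrib)

lemma av_scale: "av (\<lambda>n. c * a n) n = c * av a n"
  by (simp add: av_def flip: sum_distrib_left)

lemma av_const: "(\<And>m. m \<in> P n \<Longrightarrow> b m = c) \<Longrightarrow> av b n = c"
  using wd_pos[of n] by (simp add: av_def card_P)

lemma av_piece: "m \<in> P n \<Longrightarrow> av a m = av a n"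
  by (simp add: av_def P_eq wd_eq)

lemma av_up: "av (\<lambda>m. a (up m)) n = av a (up n)"
  unfolding av_def P_up wd_up
  by (subst sum.reindex) (auto simp: inj_on_def strict_mono_eq[OF strict_mono_up])

lemma T_add: "T (\<lambda>n. a n + b n) n = T a n + T b n"
  by (simp add: T_def av_add)

lemma T_scale: "T (\<lambda>n. c * a n) n = c * T a n"
  by (simp add: T_def av_scale algebra_simps)

lemma V_add: "V (\<lambda>n. a n + b n) n = V a n + V b n"
  by (simp add: V_def av_add)

lemma V_scale: "V (\<lambda>n. c * a n) n = c * V a n"
  by (simp add: V_def av_scale algebra_simps)

lemma T_zero [simp]: "T (\<lambda>n. 0) n = 0"
  using T_scale[of 0 "\<lambda>n. 0" n] by simp

lemma T_sum: "T (\<lambda>n. \<Sum>i\<in>I. a i n) n = (\<Sum>i\<in>I. T (a i) n)"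
  by (induction I rule: infinite_finite_induct) (simp_all add: T_add)

lemma av_av: "av (av a) n = av a n"
  by (rule av_const) (rule av_piece)

lemma av_V: "av (V a) n = (if diag n then 0 else av a (dn n))"
proof -
  have "av (\<lambda>n. if diag n then 0 else av a (dn n)) n = (if diag n then 0 else av a (dn n))"
  proof (rule av_const)
    fix m assume m: "m \<in> P n"
    show "(if diag m then 0 else av a (dn m)) = (if diag n then 0 else av a (dn n))"
    proof (cases "diag n")
      case False
      then have "up (dn m) \<in> P (up (dn n))" using m by (simp add: up_dn diag_eq)
      then have "dn m \<in> P (dn n)" 
        by (simp add: P_up inj_image_mem_iff strict_mono_imp_inj_on[OF strict_mono_up])
      then show ?thesis using m by (simp add: diag_eq av_piece)
    qed (use m in \<open>simp add: diag_eq\<close>)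
  qed
  moreover have "av (V a) n = av a n - av (av a) n + av (\<lambda>n. if diag n then 0 else av a (dn n)) n"
  proof -
    have "V a = (\<lambda>n. a n - av a n + (if diag n then 0 else av a (dn n)))" by (rule ext) (rule V_def)
    then show ?thesis by (simp only: av_add av_diff)
  qed
  ultimately show ?thesis by (simp only: av_av) simp
qed

text \<open>\<open>V a\<close> has on the piece after that of n the average which \<open>a\<close>
  has on the piece of n. Hence the average that \<open>T\<close> brings back from one round later is
  exactly the one that \<open>V\<close> removed.\<close>

lemma T_V: "T (V a) n = a n"
  unfolding T_def av_V by (simp add: not_diag_up V_def)

lemma av_T: "av (T a) n = av a (up n)"
proof -
  have "T a = (\<lambda>n. a n - av a n + av a (up n))" by (rule ext) (rule T_def)
  then have "av (T a) n = av a n - av (av a) n + av (\<lambda>n. av a (up n)) n"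
    by (simp only: av_add av_diff)
  then show ?thesis by (simp only: av_av av_up) simp
qed

lemma V_T: "V (T a) n = a n - (if diag n then av a n else 0)"
  unfolding V_def av_T by (simp add: T_def up_dn)

text \<open>Averaging fixes such a sequence, and \<open>up n\<close> never lies in a last piece, so
  the average brought back is zero.\<close>

lemma T_diag_const:
  assumes "\<And>n. a n = (if diag n then c (rnd n) else 0)"
  shows "T a n = 0"
proof -
  have "av a n = a n" for n
    by (rule av_const) (simp add: assms diag_eq same_piece)
  then show ?thesis using not_diag_up[of n] by (simp add: T_def assms)
qed

lemma sum_V_sg: "(\<Sum>n\<in>sg k. V a n) = 0"
proof -
  define n where "n = R k + N k"
  have n: "n \<in> sg k" using len_pos[of k] by (simp add: n_def sg_def R_Suc N_Suc)
  then have "av (V a) n = 0" by (simp add: av_V mem_sg)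
  then show ?thesis using n wd_pos[of n] by (simp add: av_def P_sg)
qed

lemma av_outside: "(\<And>n. R K \<le> n \<Longrightarrow> a n = 0) \<Longrightarrow> R K \<le> n \<Longrightarrow> av a n = 0"
proof (rule av_const)
  fix m assume a: "\<And>n. R K \<le> n \<Longrightarrow> a n = 0" and n: "R K \<le> n" "m \<in> P n"
  have "K \<le> rnd m" using n(1) rnd_bounds[of n] R_less_iff[of K "Suc (rnd n)"] same_piece[OF n(2)] by simp
  then have "R K \<le> R (rnd m)" by (simp add: R_le_iff)
  then show "a m = 0" using a rnd_bounds[of m] by simp
qed

lemma T_outside:
  assumes "\<And>n. R K \<le> n \<Longrightarrow> a n = 0" "R K \<le> n" shows "T a n = 0"
proof -
  have "R K \<le> up n" using strict_mono_imp_increasing[OF strict_mono_up, of n] assms(2) by linarith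
  then show ?thesis using assms av_outside[OF assms(1)] by (simp add: T_def)
qed

end

locale subsym_pieces = subsym_functional nu s q Cs Cq + piece_sizes len
  for nu s q Cs Cq len
begin

lemma nu_av:
  fixes a :: "nat \<Rightarrow> 'k::real_normed_field"
  shows "nu {..<R K} (\<lambda>n. norm (av a n)) \<le> 2 * nu {..<R K} (\<lambda>n. norm (a n))"
proof -
  have "nu {..<R K} (\<lambda>n. norm (av a n)) \<le> nu {..<R K} (\<lambda>n. (\<Sum>m = lo n..<lo n + wd n. \<bar>norm (a m)\<bar>) / real (wd n))"
  proof (rule nu_abs_mono)
    fix n
    have "norm (av a n) \<le> (\<Sum>m\<in>P n. norm (a m)) / real (wd n)"
      unfolding av_def norm_divide using norm_sum[of a "P n"] by (simp add: divide_right_mono)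
    also have "\<dots> \<le> \<bar>(\<Sum>m = lo n..<lo n + wd n. \<bar>norm (a m)\<bar>) / real (wd n)\<bar>"
      unfolding P_def[symmetric] by (simp add: sum_nonneg)
    finally show "\<bar>norm (av a n)\<bar> \<le> \<bar>(\<Sum>m = lo n..<lo n + wd n. \<bar>norm (a m)\<bar>) / real (wd n)\<bar>"
      by simp
  qed simp
  also have "\<dots> \<le> 2 * nu {..<R K} (\<lambda>n. norm (a n))"
  proof (rule nu_average)
    fix n assume "n \<in> {..<R K}"
    then show "{lo n..<lo n + wd n} \<subseteq> {..<R K} \<and> n \<in> {lo n..<lo n + wd n}"
      using P_subset[of n K] mem_P[of n] unfolding P_def by auto
  next
    fix m n assume "m \<in> {lo n..<lo n + wd n}"
    then show "lo m = lo n \<and> wd m = wd n" using lo_eq wd_eq unfolding P_def by blast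
  qed simp
  finally show ?thesis .
qed

lemma nu_norm_add3:
  fixes a b c :: "nat \<Rightarrow> 'k::real_normed_field"
  assumes "finite F"
  shows "nu F (\<lambda>n. norm (a n - b n + c n))
    \<le> nu F (\<lambda>n. norm (a n)) + nu F (\<lambda>n. norm (b n)) + nu F (\<lambda>n. norm (c n))"
proof -
  have "nu F (\<lambda>n. norm (a n - b n + c n)) \<le> nu F (\<lambda>n. (norm (a n) + norm (b n)) + norm (c n))"
    using assms
  proof (intro nu_abs_mono)
    fix n
    show "\<bar>norm (a n - b n + c n)\<bar> \<le> \<bar>norm (a n) + norm (b n) + norm (c n)\<bar>"
      using norm_triangle_ineq[of "a n - b n" "c n"] norm_triangle_ineq4[of "a n" "b n"] by simp
  qed
  also have "\<dots> \<le> nu F (\<lambda>n. norm (a n) + norm (b n)) + nu F (\<lambda>n. norm (c n))"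
    by (rule nu_add[OF assms])
  also have "\<dots> \<le> nu F (\<lambda>n. norm (a n)) + nu F (\<lambda>n. norm (b n)) + nu F (\<lambda>n. norm (c n))"
    using nu_add[OF assms] by simp
  finally show ?thesis .
qed

text \<open>Here 5 is 1 + 2 + 2: the sequence, its averages, and its averages moved by
  \<open>dn\<close>, which is increasing off the last pieces and stays below
  \<open>R K\<close>.\<close>

lemma nu_V:
  fixes a :: "nat \<Rightarrow> 'k::real_normed_field"
  shows "nu {..<R K} (\<lambda>n. norm (V a n)) \<le> 5 * nu {..<R K} (\<lambda>n. norm (a n))"
proof -
  let ?O = "{n. n < R K \<and> \<not> diag n}"
  have fO: "finite ?O" by simp
  have sm: "strict_mono_on ?O dn"
  proof (rule strict_mono_onI)
    fix m n assume "m \<in> ?O" "n \<in> ?O" "m < n"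
    then have "up (dn m) < up (dn n)" by (simp add: up_dn)
    then show "dn m < dn n" by (simp add: strict_mono_less[OF strict_mono_up])
  qed
  have "nu {..<R K} (\<lambda>n. norm (if diag n then 0 else av a (dn n))) \<le> nu ?O (\<lambda>n. norm (av a (dn n)))"
    by (rule nu_mono) auto
  also have "\<dots> = nu (dn ` ?O) (\<lambda>n. norm (av a n))"
    using nu_spread[OF fO sm] by simp
  also have "\<dots> \<le> nu {..<R K} (\<lambda>n. norm (av a n))"
    by (rule nu_subset) (use dn_less less_trans in auto)
  finally show ?thesis
    using nu_norm_add3[of "{..<R K}" a "av a" "\<lambda>n. if diag n then 0 else av a (dn n)"] nu_av[of K a]
    unfolding V_def by simp
qed

text \<open>The right-hand side needs one more round because the averages are fetched from the
  following round.\<close>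

lemma nu_T:
  fixes a :: "nat \<Rightarrow> 'k::real_normed_field"
  shows "nu {..<R K} (\<lambda>n. norm (T a n)) \<le> 5 * nu {..<R (Suc K)} (\<lambda>n. norm (a n))"
proof -
  have "nu {..<R K} (\<lambda>n. norm (av a (up n))) = nu (up ` {..<R K}) (\<lambda>n. norm (av a n))"
    using nu_spread[of "{..<R K}" up "\<lambda>n. norm (av a n)"] strict_mono_up
    by (simp add: strict_mono_on_def strict_mono_def)
  also have "\<dots> \<le> nu {..<R (Suc K)} (\<lambda>n. norm (av a n))"
    by (rule nu_subset) (use up_less in auto)
  also have "\<dots> \<le> 2 * nu {..<R (Suc K)} (\<lambda>n. norm (a n))" by (rule nu_av)
  finally have 1: "nu {..<R K} (\<lambda>n. norm (av a (up n))) \<le> 2 * nu {..<R (Suc K)} (\<lambda>n. norm (a n))" .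
  have "nu {..<R K} (\<lambda>n. norm (a n)) \<le> nu {..<R (Suc K)} (\<lambda>n. norm (a n))"
    by (rule nu_subset) (auto simp: R_Suc)
  with 1 show ?thesis
    using nu_norm_add3[of "{..<R K}" a "av a" "\<lambda>n. av a (up n)"] nu_av[of K a]
    unfolding T_def by simp
qed

lemma nu_T_supp:
  fixes a :: "nat \<Rightarrow> 'k::real_normed_field"
  assumes "finite D" "\<And>n. n \<notin> D \<Longrightarrow> a n = 0"
  shows "nu {..<R K} (\<lambda>n. norm (T a n)) \<le> 5 * nu D (\<lambda>n. norm (a n))"
proof -
  have "nu {..<R (Suc K)} (\<lambda>n. norm (a n)) \<le> nu D (\<lambda>n. norm (a n))"
    by (rule nu_mono) (use assms in auto)
  then show ?thesis using nu_T[of K a] by simp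
qed

end

section \<open>The new basis and its norm estimates\<close>

context subsym_space
begin

lemma comb_sum: "comb A (\<lambda>n. \<Sum>i\<in>I. f i n) = (\<Sum>i\<in>I. comb A (f i))"
  unfolding comb_def by (subst sum.swap) (simp add: scale_sum_left)

end

context subsym_functional
begin

lemma Lam_le_mult:
  assumes "1 \<le> m" "real d \<le> c * real m" "1 \<le> c"
  shows "Lam d \<le> 2 * Cs * c * Lam m"
proof (cases "m \<le> d")
  case True
  have "(real d / real m) powr (1 / s) \<le> c powr (1 / s)"
    using assms s_gt by (intro powr_mono2) (auto simp: field_simps)
  also have "\<dots> \<le> c powr 1" using assms s_gt by (intro powr_mono) auto
  also have "\<dots> = c" using assms by simp
  finally have "2 * Cs * (real d / real m) powr (1 / s) * Lam m \<le> 2 * Cs * c * Lam m"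
    using Cs_ge by (intro mult_right_mono mult_left_mono Lam_nonneg) auto
  then show ?thesis using Lam_upper[OF assms(1) True] by linarith
next
  case False
  have "1 * 1 \<le> (2 * Cs) * c" using Cs_ge assms(3) by (intro mult_mono) auto
  then have "1 * Lam m \<le> 2 * Cs * c * Lam m" by (intro mult_right_mono Lam_nonneg) simp
  then show ?thesis using Lam_mono[of d m] False by linarith
qed

end

text \<open>Here \<open>x\<close> is normalised, \<open>xi\<close> are its coordinate functionals
  and \<open>Kx\<close> is its basis constant. The decay enters twice: \<open>lam_growth\<close>
  says that block norms grow geometrically, and \<open>lam_ratio\<close> that a set whose size is at
  most comparable with an earlier block r has, in block k, a contribution decaying in
  \<open>k - r\<close>. The condition \<open>R_le\<close> bounds everything up to the end of a round
  by its last piece.\<close>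

locale block_construction = X: quasi_normed X + S: subsym_space S +
  subsym_pieces "subsym_space.nu S" s q Cs Cq len
  for X :: "('k::real_or_complex, 'v::ab_group_add) qspace" and S :: "('k, nat \<Rightarrow> 'k) qspace" and s q Cs Cq :: real and len +
  fixes x :: "nat \<Rightarrow> 'v" and xi :: "nat \<Rightarrow> 'v \<Rightarrow> 'k" and p Kx Cp \<theta> Cg Cr :: real
  assumes x_car [simp]: "x k \<in> car X" and x_norm: "qnorm X (x k) = 1"
    and xi_add: "u \<in> car X \<Longrightarrow> v \<in> car X \<Longrightarrow> xi k (u + v) = xi k u + xi k v"
    and xi_scale: "v \<in> car X \<Longrightarrow> xi k (smul X c v) = c * xi k v"
    and xi_x: "xi k (x m) = (if k = m then 1 else 0)"
    and xi_partial: "v \<in> car X \<Longrightarrow> qnorm X (\<Sum>k<n. smul X (xi k v) (x k)) \<le> Kx * qnorm X v"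
    and xi_expansion: "v \<in> car X \<Longrightarrow> expansion X x (\<lambda>k. xi k v) v"
    and p_sum: "finite (I :: nat set) \<Longrightarrow> (\<And>i. i \<in> I \<Longrightarrow> f i \<in> car X) \<Longrightarrow>
      qnorm X (\<Sum>i\<in>I. f i) powr p \<le> Cp * (\<Sum>i\<in>I. qnorm X (f i) powr p)"
    and p_pos: "0 < p" and p_le: "p \<le> 1" and Kx_ge: "1 \<le> Kx" and Cp_ge: "1 \<le> Cp"
    and \<theta>_pos: "0 < \<theta>" and \<theta>_less: "\<theta> < 1" and Cg_ge: "1 \<le> Cg" and Cr_ge: "1 \<le> Cr"
    and lam_growth: "j \<le> k \<Longrightarrow> Lam (len j) \<le> Cg * \<theta> ^ (k - j) * Lam (len k)"
    and lam_ratio: "r \<le> k \<Longrightarrow> 1 \<le> d \<Longrightarrow> d \<le> len k \<Longrightarrow> real d \<le> Cr * real (len r) \<Longrightarrow>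
      Lam (len k) / real (len k) * real d \<le> Cg * \<theta> ^ (k - r) * Lam d"
    and len_mono: "j \<le> k \<Longrightarrow> len j \<le> len k"
    and R_le: "real (R (Suc k)) \<le> Cr * real (len k)"
begin

abbreviation nu where "nu \<equiv> S.nu"

definition lam :: "nat \<Rightarrow> real" where "lam k = Lam (len k)"

lemma lam_pos: "0 < lam k"
  unfolding lam_def by (rule Lam_pos) (rule len_pos)

lemma lam_nz [simp]: "lam k \<noteq> 0"
  using lam_pos[of k] by simp

lemma lam_growth': "j \<le> k \<Longrightarrow> lam j \<le> Cg * \<theta> ^ (k - j) * lam k"
  unfolding lam_def by (rule lam_growth)

lemma lam_unbounded: "\<exists>k. B < lam k"
proof -
  have "(\<lambda>k. (Cg * B) * \<theta> ^ k) \<longlonglongrightarrow> (Cg * B) * 0"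
    using \<theta>_pos \<theta>_less by (intro tendsto_intros LIMSEQ_power_zero) simp
  then have "eventually (\<lambda>k. (Cg * B) * \<theta> ^ k < lam 0) sequentially"
    using lam_pos[of 0] by (intro order_tendstoD(2)) auto
  then obtain k where k: "(Cg * B) * \<theta> ^ k < lam 0" unfolding eventually_sequentially by blast
  have "lam 0 \<le> Cg * \<theta> ^ k * lam k" using lam_growth'[of 0 k] by simp
  with k have "(Cg * \<theta> ^ k) * B < (Cg * \<theta> ^ k) * lam k" by (simp add: mult_ac)
  then have "B < lam k" using Cg_ge \<theta>_pos by simp
  then show ?thesis ..
qed

lemma len_unbounded: "\<exists>k. m \<le> len k"
proof -
  obtain k where "Lam m < lam k" using lam_unbounded by blast
  then have "m \<le> len k" unfolding lam_def using Lam_mono[of "len k" m] by linarith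
  then show ?thesis ..
qed

text \<open>With truncated subtraction, \<open>(k - r) + (r - k)\<close> is the distance between k
  and r; one formula thus covers decay on both sides of a centre.\<close>

lemma geometric_le:
  assumes t: "0 < t" "t < (1::real)" and K: "finite K"
  shows "(\<Sum>k\<in>K. t ^ ((k - r) + (r - k))) \<le> 2 / (1 - t)"
proof -
  have geo: "(\<Sum>k<m. t ^ k) \<le> 1 / (1 - t)" for m
  proof -
    have "(\<Sum>k<m. t ^ k) = (1 - t ^ m) / (1 - t)" using t by (subst sum_gp_strict) auto
    also have "\<dots> \<le> 1 / (1 - t)" using t by (intro divide_right_mono) auto
    finally show ?thesis .
  qed
  obtain M where M: "K \<subseteq> {..<r + M}"
    using finite_nat_iff_bounded[of K] K by (metis add.commute le_add1 lessThan_subset_iff order_trans)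
  have "(\<Sum>k\<in>K. t ^ ((k - r) + (r - k))) \<le> (\<Sum>k<r + M. t ^ ((k - r) + (r - k)))"
    using M t by (intro sum_mono2) auto
  also have "{..<r + M} = {..<r} \<union> {r..<r + M}" by auto
  also have "(\<Sum>k\<in>{..<r} \<union> {r..<r + M}. t ^ ((k - r) + (r - k)))
      = (\<Sum>k<r. t ^ (r - k)) + (\<Sum>k\<in>{r..<r + M}. t ^ (k - r))"
    by (subst sum.union_disjoint) auto
  also have "(\<Sum>k\<in>{r..<r + M}. t ^ (k - r)) = (\<Sum>k<M. t ^ k)"
    using sum.shift_bounds_nat_ivl[of "\<lambda>k. t ^ (k - r)" 0 r M] by (simp add: atLeast0LessThan add.commute)
  also have "(\<Sum>k<r. t ^ (r - k)) = (\<Sum>k<r. t ^ Suc k)"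
    by (subst sum.nat_diff_reindex[symmetric]) (auto intro!: sum.cong simp: Suc_diff_Suc)
  also have "\<dots> \<le> (\<Sum>k<r. t ^ k)" using t by (intro sum_mono) (simp add: mult_left_le_one_le)
  finally show ?thesis using geo[of r] geo[of M] by simp
qed

definition Cx :: real where "Cx = (Cp * (2 / (1 - \<theta> powr p))) powr (1 / p)"

lemma \<theta>p: "0 < \<theta> powr p" "\<theta> powr p < 1"
  using \<theta>_pos \<theta>_less p_pos powr_less_mono2[of p \<theta> 1] by auto

lemma Cx_pos: "0 < Cx"
  using \<theta>p Cp_ge unfolding Cx_def by (simp add: zero_less_mult_iff)

lemma powr_p_le_iff: "0 \<le> a \<Longrightarrow> 0 \<le> b \<Longrightarrow> a powr p \<le> b powr p \<longleftrightarrow> a \<le> b"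
  using p_pos by (meson linorder_not_le powr_less_mono2 powr_mono2 less_imp_le)

lemma sum_x_car [simp]: "(\<Sum>k\<in>K. smul X (z k) (x k)) \<in> car X"
  by (intro X.car_sum X.car_scale x_car)

lemma qnorm_x: "qnorm X (smul X c (x k)) = norm c"
  by (simp add: X.qnorm_scale x_norm)

text \<open>This is how a conditional \<open>x\<close> is handled: when coefficients decay
  geometrically away from some block r, the p-th powers of the terms form a geometric series with
  ratio \<open>\<theta> powr p\<close>, and p-convexity sums them without any use of the basis
  property.\<close>

lemma sum_x_geometric:
  assumes "finite K" "0 \<le> B" "\<And>k. k \<in> K \<Longrightarrow> norm (z k) \<le> B * \<theta> ^ ((k - r) + (r - k))"
  shows "qnorm X (\<Sum>k\<in>K. smul X (z k) (x k)) \<le> Cx * B"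
proof -
  have "qnorm X (\<Sum>k\<in>K. smul X (z k) (x k)) powr p \<le> Cp * (\<Sum>k\<in>K. norm (z k) powr p)"
    using p_sum[OF assms(1), of "\<lambda>k. smul X (z k) (x k)"] by (simp add: qnorm_x)
  also have "(\<Sum>k\<in>K. norm (z k) powr p) \<le> (\<Sum>k\<in>K. B powr p * (\<theta> powr p) ^ ((k - r) + (r - k)))"
  proof (rule sum_mono)
    fix k assume "k \<in> K"
    then have "norm (z k) powr p \<le> (B * \<theta> ^ ((k - r) + (r - k))) powr p"
      using assms p_pos by (intro powr_mono2) auto
    also have "\<dots> = B powr p * (\<theta> powr p) ^ ((k - r) + (r - k))"
      using assms(2) \<theta>_pos by (simp add: powr_mult powr_powr mult.commute flip: powr_realpow)
    finally show "norm (z k) powr p \<le> B powr p * (\<theta> powr p) ^ ((k - r) + (r - k))" .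
  qed
  also have "\<dots> \<le> B powr p * (2 / (1 - \<theta> powr p))"
    unfolding sum_distrib_left[symmetric]
    by (intro mult_left_mono geometric_le \<theta>p assms) auto
  finally have "qnorm X (\<Sum>k\<in>K. smul X (z k) (x k)) powr p \<le> Cp * (B powr p * (2 / (1 - \<theta> powr p)))"
    using Cp_ge by (simp add: mult_left_mono)
  also have "\<dots> = (Cx * B) powr p"
    using Cp_ge \<theta>p assms(2) p_pos unfolding Cx_def by (simp add: powr_mult powr_powr)
  finally show ?thesis
    using Cx_pos assms(2) by (subst (asm) powr_p_le_iff) auto
qed

definition Kc :: real where "Kc = 2 * X.kap * Kx"

lemma Kc_pos: "0 < Kc"
  using X.kap_ge Kx_ge by (simp add: Kc_def)

lemma xi_bound: assumes "v \<in> car X" shows "norm (xi k v) \<le> Kc * qnorm X v"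
proof -
  have "norm (xi k v) = qnorm X ((\<Sum>k<Suc k. smul X (xi k v) (x k)) - (\<Sum>k<k. smul X (xi k v) (x k)))"
    by (simp add: qnorm_x)
  also have "\<dots> \<le> X.kap * (qnorm X (\<Sum>k<Suc k. smul X (xi k v) (x k)) + qnorm X (\<Sum>k<k. smul X (xi k v) (x k)))"
    by (intro X.qnorm_diff sum_x_car)
  also have "\<dots> \<le> X.kap * (Kx * qnorm X v + Kx * qnorm X v)"
    using X.kap_ge by (intro mult_left_mono add_mono xi_partial assms) auto
  finally show ?thesis by (simp add: Kc_def)
qed

lemma block_mean:
  assumes E: "E \<subseteq> sg k"
  shows "lam k / real (len k) * (\<Sum>n\<in>E. \<bar>a n\<bar>) \<le> 2 * nu E a"
proof -
  have fE: "finite E" using E finite_subset finite_sg by blast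
  let ?a = "\<lambda>n. if n \<in> E then a n else 0"
  have "(\<Sum>n\<in>sg k. \<bar>?a n\<bar>) * Lam (card (sg k)) \<le> 2 * real (card (sg k)) * nu (sg k) ?a"
    by (rule sum_le_nu) simp
  also have "(\<Sum>n\<in>sg k. \<bar>?a n\<bar>) = (\<Sum>n\<in>E. \<bar>a n\<bar>)"
    using E by (intro sum.mono_neutral_cong_right) auto
  finally have 1: "(\<Sum>n\<in>E. \<bar>a n\<bar>) * lam k \<le> 2 * real (len k) * nu (sg k) ?a" by (simp add: lam_def)
  have "nu (sg k) ?a \<le> nu E a" by (rule nu_mono) (use fE in auto)
  then have "2 * real (len k) * nu (sg k) ?a \<le> 2 * real (len k) * nu E a" by (intro mult_left_mono) auto
  with 1 have "(\<Sum>n\<in>E. \<bar>a n\<bar>) * lam k \<le> 2 * real (len k) * nu E a" by linarith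
  then show ?thesis using len_pos[of k] by (simp add: field_simps)
qed

text \<open>The norm of summation over E is taken relative to the size d of E instead of the block
  length. Then \<open>d / Lam d\<close> meets the weight \<open>lam k / len k\<close>, and
  \<open>lam_ratio\<close> turns the product into a power of \<open>\<theta>\<close>.\<close>

lemma block_mean_ratio:
  assumes E: "E \<subseteq> sg k" and "r \<le> k" "real (card E) \<le> Cr * real (len r)"
  shows "lam k / real (len k) * (\<Sum>n\<in>E. \<bar>a n\<bar>) \<le> 2 * Cg * \<theta> ^ (k - r) * nu E a"
proof (cases "E = {}")
  case True
  then show ?thesis using nu_zero[of "{}" a] by simp
next
  case False
  have fE: "finite E" using E finite_subset finite_sg by blast
  define d where "d = card E"
  have d: "1 \<le> d" using False fE by (simp add: d_def Suc_le_eq card_gt_0_iff)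
  have dk: "d \<le> len k" using card_mono[OF finite_sg E] by (simp add: d_def)
  have L: "0 < Lam d" using d by (intro Lam_pos) simp
  have "lam k / real (len k) * (\<Sum>n\<in>E. \<bar>a n\<bar>) * Lam d \<le> lam k / real (len k) * (2 * real d * nu E a)"
    using sum_le_nu[OF fE, of a] lam_pos[of k] unfolding d_def mult.assoc
    by (intro mult_left_mono) (auto simp: mult_ac)
  also have "\<dots> = (lam k / real (len k) * real d) * (2 * nu E a)" by simp
  also have "\<dots> \<le> (Cg * \<theta> ^ (k - r) * Lam d) * (2 * nu E a)"
    using lam_ratio[OF assms(2) d dk] assms(3) nu_nonneg[OF fE]
    by (intro mult_right_mono) (auto simp: lam_def d_def)
  also have "\<dots> = (2 * Cg * \<theta> ^ (k - r) * nu E a) * Lam d"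
    by (simp add: mult_ac)
  finally show ?thesis using L by (simp only: mult_le_cancel_right_pos)
qed

section \<open>The basis vectors and their coordinate functionals\<close>

abbreviation eta :: "(nat \<Rightarrow> 'k) \<Rightarrow> nat \<Rightarrow> 'k" where "eta w n \<equiv> coord S unit_seq n w"

text \<open>The image of the m-th unit sequence under \<open>T\<close>. The cut-off loses nothing,
  because \<open>T\<close> moves mass only within the piece of m and to the preceding piece of its
  chain.\<close>

definition be :: "nat \<Rightarrow> nat \<Rightarrow> 'k" where
  "be m = S.comb {..<R (Suc (rnd m))} (T (unit_seq m))"

definition bx :: "nat \<Rightarrow> 'v" where
  "bx m = (if diag m then smul X (of_real (lam (rnd m) / real (len (rnd m)))) (x (rnd m)) else 0)"

definition b :: "nat \<Rightarrow> 'v \<times> (nat \<Rightarrow> 'k)" where "b m = (bx m, be m)"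

definition uw :: "(nat \<Rightarrow> 'k) \<Rightarrow> nat \<Rightarrow> 'k" where "uw w n = V (eta w) n"

definition cc :: "'v \<Rightarrow> nat \<Rightarrow> 'k" where
  "cc y n = (if diag n then xi (rnd n) y / of_real (lam (rnd n)) else 0)"

text \<open>These are the coordinates of \<open>(y, w)\<close> in the new basis. \<open>uw w\<close>
  lifts w through \<open>T\<close> and has mean zero on every last piece; adding constants there
  prescribes the X-part y and is invisible to \<open>T\<close>.\<close>

definition g :: "'v \<Rightarrow> (nat \<Rightarrow> 'k) \<Rightarrow> nat \<Rightarrow> 'k" where "g y w n = uw w n + cc y n"

lemma be_car [simp]: "be m \<in> car S" by (simp add: be_def)
lemma bx_car [simp]: "bx m \<in> car X" by (simp add: bx_def)

text \<open>Any sufficiently late cut-off gives the same vector, so a finite combination of the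
  \<open>be m\<close> can be written with one common cut-off.\<close>

lemma be_eq:
  assumes "m < R K" shows "be m = S.comb {..<R K} (T (unit_seq m))"
proof -
  have "R (Suc (rnd m)) \<le> R K"
    using assms rnd_bounds[of m] R_less_iff[of "rnd m" K] by (simp add: R_le_iff)
  moreover have "T (unit_seq m) n = 0" if "R (Suc (rnd m)) \<le> n" for n
    by (rule T_outside[OF _ that]) (use rnd_bounds(2)[of m] in \<open>auto simp: unit_seq_def\<close>)
  ultimately show ?thesis unfolding be_def
    by (intro S.comb_neutral[symmetric]) auto
qed

abbreviation rs :: "nat set \<Rightarrow> (nat \<Rightarrow> 'k) \<Rightarrow> nat \<Rightarrow> 'k" where
  "rs D a \<equiv> \<lambda>n. if n \<in> D then a n else 0"

lemma sum_be:
  assumes "D \<subseteq> {..<R K}"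
  shows "(\<Sum>m\<in>D. smul S (a m) (be m)) = S.comb {..<R K} (T (rs D a))"
proof -
  have fD: "finite D" using assms finite_subset by blast
  have eq: "rs D a = (\<lambda>n. \<Sum>m\<in>D. a m * unit_seq m n)"
    using fD by (auto simp: unit_seq_def fun_eq_iff sum.delta' if_distrib cong: if_cong)
  have "(\<Sum>m\<in>D. smul S (a m) (be m)) = (\<Sum>m\<in>D. S.comb {..<R K} (\<lambda>n. a m * T (unit_seq m) n))"
    unfolding S.comb_scale by (intro sum.cong refl) (use be_eq assms in auto)
  also have "\<dots> = S.comb {..<R K} (\<lambda>n. \<Sum>m\<in>D. a m * T (unit_seq m) n)"
    by (rule S.comb_sum[symmetric])
  also have "(\<lambda>n. \<Sum>m\<in>D. a m * T (unit_seq m) n) = T (rs D a)"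
    unfolding eq by (rule ext) (simp add: T_sum T_scale)
  finally show ?thesis .
qed

lemma sum_bx:
  assumes "D \<subseteq> {..<R K}"
  shows "(\<Sum>m\<in>D. smul X (a m) (bx m))
    = (\<Sum>k<K. smul X (of_real (lam k / real (len k)) * (\<Sum>n\<in>D \<inter> sg k. a n)) (x k))"
proof -
  have fD: "finite D" using assms finite_subset by blast
  have "(\<Sum>m\<in>D. smul X (a m) (bx m)) = (\<Sum>m\<in>(\<Union>k<K. D \<inter> sg k). smul X (a m) (bx m))"
  proof (rule sum.mono_neutral_right[OF fD])
    show "\<forall>i\<in>D - (\<Union>k<K. D \<inter> sg k). smul X (a i) (bx i) = 0"
    proof
      fix i assume i: "i \<in> D - (\<Union>k<K. D \<inter> sg k)"
      have "R (rnd i) < R K" using i assms rnd_bounds[of i] by force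
      then have "rnd i < K" by (simp add: R_less_iff)
      then have "\<not> diag i" using i by (auto simp: mem_sg)
      then show "smul X (a i) (bx i) = 0" by (simp add: bx_def)
    qed
  qed auto
  also have "\<dots> = (\<Sum>k<K. \<Sum>m\<in>D \<inter> sg k. smul X (a m) (bx m))"
    by (rule sum.UNION_disjoint) (auto simp: fD dest: sg_disjoint)
  also have "\<dots> = (\<Sum>k<K. smul X (of_real (lam k / real (len k)) * (\<Sum>n\<in>D \<inter> sg k. a n)) (x k))"
  proof (intro sum.cong refl)
    fix k
    have "(\<Sum>m\<in>D \<inter> sg k. smul X (a m) (bx m))
        = (\<Sum>m\<in>D \<inter> sg k. smul X (of_real (lam k / real (len k)) * a m) (x k))"
      by (intro sum.cong refl) (auto simp: bx_def mem_sg mult.commute)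
    then show "(\<Sum>m\<in>D \<inter> sg k. smul X (a m) (bx m))
        = smul X (of_real (lam k / real (len k)) * (\<Sum>n\<in>D \<inter> sg k. a n)) (x k)"
      by (simp add: X.scale_sum_left[symmetric] sum_distrib_left)
  qed
  finally show ?thesis .
qed

lemma sub_R: "finite D \<Longrightarrow> \<exists>K. D \<subseteq> {..<R K}"
  using finite_nat_iff_bounded[of D] R_ge by (meson lessThan_subset_iff order_trans)

lemma qnorm_T_bound:
  assumes "finite D" "\<And>n. n \<notin> D \<Longrightarrow> a n = 0"
  shows "qnorm S (S.comb {..<R K} (T a)) \<le> 5 * nu D (\<lambda>n. norm (a n))"
  using nu_T_supp[OF assms, where K = K] by (simp add: S.qnorm_comb)

lemma qnorm_sum_be:
  assumes "finite D"
  shows "qnorm S (\<Sum>m\<in>D. smul S (a m) (be m)) \<le> 5 * nu D (\<lambda>n. norm (a n))"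
proof -
  obtain K where K: "D \<subseteq> {..<R K}" using sub_R[OF assms] by blast
  have "qnorm S (S.comb {..<R K} (T (rs D a))) \<le> 5 * nu D (\<lambda>n. norm (rs D a n))"
    by (rule qnorm_T_bound) (use assms in auto)
  also have "nu D (\<lambda>n. norm (rs D a n)) = nu D (\<lambda>n. norm (a n))"
    using assms by (intro nu_cong) auto
  finally show ?thesis unfolding sum_be[OF K] .
qed

lemma nu_uw:
  assumes "w \<in> car S" "finite D"
  shows "nu D (\<lambda>n. norm (uw w n)) \<le> 5 * qnorm S w"
proof -
  obtain K where K: "D \<subseteq> {..<R K}" using sub_R[OF assms(2)] by blast
  have "nu D (\<lambda>n. norm (uw w n)) \<le> nu {..<R K} (\<lambda>n. norm (V (eta w) n))"
    unfolding uw_def using K by (intro nu_subset) auto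
  also have "\<dots> \<le> 5 * nu {..<R K} (\<lambda>n. norm (eta w n))" by (rule nu_V)
  also have "\<dots> \<le> 5 * qnorm S w"
    using S.qnorm_coord_comb[OF assms(1), of "{..<R K}"] by (simp add: S.qnorm_comb)
  finally show ?thesis .
qed

lemma cc_bound:
  assumes "y \<in> car X" "n \<in> sg k" shows "norm (cc y n) * lam k \<le> Kc * qnorm X y"
proof -
  have "norm (cc y n) * lam k = norm (xi k y)"
    using assms(2) lam_pos[of k] by (simp add: cc_def mem_sg norm_divide)
  then show ?thesis using xi_bound[OF assms(1)] by simp
qed

text \<open>The max-norm on the sum is split into its two components throughout, since the estimates
  in X and in S rest on different arguments.\<close>

definition small :: "'v \<Rightarrow> (nat \<Rightarrow> 'k) \<Rightarrow> real \<Rightarrow> bool" where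
  "small y w G \<longleftrightarrow> y \<in> car X \<and> w \<in> car S \<and> qnorm X y \<le> G \<and> qnorm S w \<le> G"

definition bnd :: "nat set \<Rightarrow> (nat \<Rightarrow> 'k) \<Rightarrow> real \<Rightarrow> bool" where
  "bnd D a B \<longleftrightarrow> qnorm X (\<Sum>m\<in>D. smul X (a m) (bx m)) \<le> B \<and> qnorm S (\<Sum>m\<in>D. smul S (a m) (be m)) \<le> B"

lemma small_nonneg: "small y w G \<Longrightarrow> 0 \<le> G"
  unfolding small_def using X.qnorm_nonneg[of y] by linarith

lemma small_uw: "small y w G \<Longrightarrow> finite D \<Longrightarrow> nu D (\<lambda>n. norm (uw w n)) \<le> 5 * G"
  using nu_uw[of w D] by (auto simp: small_def)

lemma small_cc: "small y w G \<Longrightarrow> n \<in> sg k \<Longrightarrow> norm (cc y n) * lam k \<le> Kc * G"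
  using cc_bound[of y n k] Kc_pos mult_left_mono[of "qnorm X y" G Kc] unfolding small_def by linarith

section \<open>Democracy of the new basis\<close>

lemma geo1: "0 < 2 / (1 - \<theta>)" "finite K \<Longrightarrow> (\<Sum>k\<in>K. \<theta> ^ ((k - r) + (r - k))) \<le> 2 / (1 - \<theta>)"
  using geometric_le[OF \<theta>_pos \<theta>_less] \<theta>_less by auto

lemma fundamental_upper:
  "\<exists>C\<ge>0. \<forall>A a t m. finite A \<and> card A \<le> m \<and> 0 \<le> t \<and> (\<forall>n\<in>A. norm (a n) \<le> t) \<longrightarrow> bnd A a (C * (t * Lam m))"
proof -
  define C where "C = max 5 (Cx * (Cg / \<theta>))"
  have main: "bnd A a (C * (t * Lam m))"
    if A: "finite A" "card A \<le> m" and t: "0 \<le> t" "\<And>n. n \<in> A \<Longrightarrow> norm (a n) \<le> t" for A a t m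
  proof (cases "m = 0")
    case True
    then show ?thesis using A by (simp add: bnd_def Lam_0)
  next
    case False
    have tL: "0 \<le> t * Lam m" using t Lam_nonneg by simp
    have "qnorm S (\<Sum>m\<in>A. smul S (a m) (be m)) \<le> 5 * nu A (\<lambda>n. norm (a n))"
      by (rule qnorm_sum_be[OF A(1)])
    also have "\<dots> \<le> 5 * (t * Lam m)"
      using nu_le_const[OF A(1), of "\<lambda>n. norm (a n)" t m] A t by simp
    finally have S: "qnorm S (\<Sum>m\<in>A. smul S (a m) (be m)) \<le> 5 * (t * Lam m)" .
    obtain K where K: "A \<subseteq> {..<R K}" using sub_R[OF A(1)] by blast
    \<comment> \<open>The centre of the geometric series: the first block of length at least m.
      Shorter blocks are compared with block \<open>r - 1\<close>, whose length is below m; the step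
      from r to \<open>r - 1\<close> is the origin of \<open>1 / \<theta>\<close> in C.\<close>
    define r where "r = (LEAST k. m \<le> len k)"
    have r: "m \<le> len r" unfolding r_def by (rule LeastI_ex) (rule len_unbounded)
    have r': "len k < m" if "k < r" for k
      using not_less_Least[of k "\<lambda>k. m \<le> len k"] that by (simp add: r_def)
    define z where "z k = of_real (lam k / real (len k)) * (\<Sum>n\<in>A \<inter> sg k. a n)" for k
    have z: "norm (z k) \<le> lam k / real (len k) * (t * real (card (A \<inter> sg k)))" for k
    proof -
      have "norm (\<Sum>n\<in>A \<inter> sg k. a n) \<le> t * real (card (A \<inter> sg k))"
        using sum_norm_le[of "A \<inter> sg k" a "\<lambda>_. t"] t(2) by (simp add: mult.commute)
      then show ?thesis unfolding z_def norm_mult norm_of_real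
        using lam_pos[of k] by (simp add: divide_right_mono mult_left_mono)
    qed
    have "norm (z k) \<le> (Cg / \<theta> * (t * Lam m)) * \<theta> ^ ((k - r) + (r - k))" for k
    proof (cases "r \<le> k")
      case True
      have "card (A \<inter> sg k) \<le> m" using card_mono[OF A(1), of "A \<inter> sg k"] A(2) by simp
      then have "norm (z k) \<le> lam k / real (len k) * (t * real m)"
        using z[of k] lam_pos[of k] t
        by (elim order_trans) (intro mult_left_mono, auto)
      also have "\<dots> = (lam k / real (len k) * real m) * t" by simp
      also have "\<dots> \<le> (Cg * \<theta> ^ (k - r) * Lam m) * t"
      proof (intro mult_right_mono t)
        have "real m \<le> Cr * real (len r)"
          using r Cr_ge mult_right_mono[of 1 Cr "real (len r)"] by simp
        then show "lam k / real (len k) * real m \<le> Cg * \<theta> ^ (k - r) * Lam m"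
          unfolding lam_def using False r len_mono[OF True] by (intro lam_ratio True) auto
      qed
      also have "\<dots> = (Cg * (t * Lam m)) * \<theta> ^ (k - r)" by simp
      also have "\<dots> \<le> (Cg / \<theta> * (t * Lam m)) * \<theta> ^ (k - r)"
      proof (intro mult_right_mono tL)
        have "Cg * \<theta> \<le> Cg" using Cg_ge \<theta>_less mult_left_mono[of \<theta> 1 Cg] by simp
        then show "Cg \<le> Cg / \<theta>" using \<theta>_pos by (simp add: field_simps)
      qed (use \<theta>_pos in simp)
      finally show ?thesis using True by simp
    next
      case False
      have "card (A \<inter> sg k) \<le> len k" using card_mono[of "sg k" "A \<inter> sg k"] by simp
      then have "norm (z k) \<le> lam k / real (len k) * (t * real (len k))"
        using z[of k] lam_pos[of k] t
        by (elim order_trans) (intro mult_left_mono, auto)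
      also have "\<dots> = t * lam k" using len_pos[of k] by simp
      also have "\<dots> \<le> t * (Cg * \<theta> ^ (r - 1 - k) * lam (r - 1))"
        using False t by (intro mult_left_mono lam_growth') auto
      also have "\<dots> \<le> t * (Cg * \<theta> ^ (r - 1 - k) * Lam m)"
        using r'[of "r - 1"] False t Cg_ge \<theta>_pos unfolding lam_def
        by (intro mult_left_mono Lam_mono) auto
      also have "\<theta> ^ (r - 1 - k) = \<theta> ^ (r - k) / \<theta>"
      proof -
        have "r - k = Suc (r - 1 - k)" using False by simp
        then show ?thesis using \<theta>_pos by simp
      qed
      finally show ?thesis using False by (simp add: mult_ac)
    qed
    then have "qnorm X (\<Sum>k<K. smul X (z k) (x k)) \<le> Cx * (Cg / \<theta> * (t * Lam m))"
      using tL Cg_ge \<theta>_pos by (intro sum_x_geometric[where r = r]) auto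
    then have Xb: "qnorm X (\<Sum>m\<in>A. smul X (a m) (bx m)) \<le> (Cx * (Cg / \<theta>)) * (t * Lam m)"
      unfolding sum_bx[OF K] z_def by (simp add: mult_ac)
    show ?thesis unfolding bnd_def C_def
      using S Xb mult_right_mono[OF _ tL, of 5 "max 5 (Cx * (Cg / \<theta>))"]
        mult_right_mono[OF _ tL, of "Cx * (Cg / \<theta>)" "max 5 (Cx * (Cg / \<theta>))"] by auto
  qed
  have "0 \<le> C" by (simp add: C_def)
  note C_nonneg = this
  show ?thesis by (intro exI[of _ C] conjI allI impI; (elim conjE)?; (rule C_nonneg | rule main); auto)
qed

text \<open>Where the lift \<open>uw\<close> carries half of t, its norm bounds t directly.
  Elsewhere the block constant exceeds \<open>t / 2\<close>, so \<open>t * lam k\<close> is at most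
  a multiple of G; the last such block M dominates, because earlier blocks are geometrically smaller
  even if counted in full.\<close>

lemma weak_lower:
  "\<exists>C\<ge>0. \<forall>y w G D t. small y w G \<and> finite D \<and> 0 \<le> t \<and> (\<forall>n\<in>D. t \<le> norm (g y w n)) \<longrightarrow> t * Lam (card D) \<le> C * G"
proof -
  define C where "C = 10 + Cg * (2 / (1 - \<theta>)) * (2 * Kc)"
  have main: "t * Lam (card D) \<le> C * G"
    if sm: "small y w G" and D: "finite D" and t: "0 \<le> t" "\<And>n. n \<in> D \<Longrightarrow> t \<le> norm (g y w n)" for y w G D t
  proof -
    have G: "0 \<le> G" using small_nonneg[OF sm] .
    define D1 where "D1 = {n \<in> D. t / 2 \<le> norm (uw w n)}"
    define D2 where "D2 = D - D1"
    have f: "finite D1" "finite D2" and un: "D = D1 \<union> D2" using D by (auto simp: D1_def D2_def)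
    have cc2: "t / 2 \<le> norm (cc y n)" "diag n \<and> 0 < t" if "n \<in> D2" for n
    proof -
      have n: "n \<in> D" "norm (uw w n) < t / 2" using that by (auto simp: D2_def D1_def)
      then show a: "t / 2 \<le> norm (cc y n)"
        using t(2)[OF n(1)] norm_triangle_ineq[of "uw w n" "cc y n"] unfolding g_def by linarith
      have "0 < t" using n(2) norm_ge_zero[of "uw w n"] by linarith
      then show "diag n \<and> 0 < t" using a by (auto simp: cc_def split: if_splits)
    qed
    have 1: "nu D1 (\<lambda>_. t) \<le> 10 * G"
    proof -
      have "nu D1 (\<lambda>_. t) \<le> nu D1 (\<lambda>n. 2 * norm (uw w n))"
        using f t(1) by (intro nu_abs_mono) (auto simp: D1_def)
      also have "\<dots> = 2 * nu D1 (\<lambda>n. norm (uw w n))" using nu_scale[OF f(1), of 2] by simp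
      finally show ?thesis using small_uw[OF sm f(1)] by simp
    qed
    have 2: "nu D2 (\<lambda>_. t) \<le> Cg * (2 / (1 - \<theta>)) * (2 * Kc) * G"
    proof (cases "D2 = {}")
      case True
      then show ?thesis using nu_zero[of "{}"] G Cg_ge geo1(1) Kc_pos by simp
    next
      case False
      define K where "K = rnd ` D2"
      have fK: "finite K" "K \<noteq> {}" using f False by (auto simp: K_def)
      define M where "M = Max K"
      obtain n where n: "n \<in> D2" "rnd n = M" using Max_in[OF fK] by (auto simp: K_def M_def)
      have tM: "t * lam M \<le> 2 * Kc * G"
      proof -
        have "n \<in> sg M" using cc2[OF n(1)] n(2) by (simp add: mem_sg)
        moreover have "t / 2 * lam M \<le> norm (cc y n) * lam M"
          using cc2[OF n(1)] lam_pos[of M] by (intro mult_right_mono) auto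
        ultimately show ?thesis using small_cc[OF sm, of n M] by linarith
      qed
      have "nu D2 (\<lambda>_. t) \<le> nu (\<Union>k\<in>K. sg k) (\<lambda>_. t)"
        using fK(1) cc2 by (intro nu_subset finite_UN_I) (auto simp: K_def mem_sg)
      also have "\<dots> \<le> (\<Sum>k\<in>K. nu (sg k) (\<lambda>_. t))" using fK by (intro nu_Union) auto
      also have "\<dots> = (\<Sum>k\<in>K. t * lam k)" using t(1) by (simp add: nu_const lam_def)
      also have "\<dots> \<le> (\<Sum>k\<in>K. t * (Cg * \<theta> ^ ((k - M) + (M - k)) * lam M))"
      proof (intro sum_mono mult_left_mono t(1))
        fix k assume "k \<in> K"
        then have "k \<le> M" using fK by (simp add: M_def)
        then show "lam k \<le> Cg * \<theta> ^ ((k - M) + (M - k)) * lam M" using lam_growth'[of k M] by simp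
      qed
      also have "\<dots> = Cg * (\<Sum>k\<in>K. \<theta> ^ ((k - M) + (M - k))) * (t * lam M)"
        by (simp add: sum_distrib_left sum_distrib_right mult_ac)
      also have "\<dots> \<le> Cg * (2 / (1 - \<theta>)) * (2 * Kc * G)"
      proof (rule mult_mono[OF _ tM])
        show "Cg * (\<Sum>k\<in>K. \<theta> ^ ((k - M) + (M - k))) \<le> Cg * (2 / (1 - \<theta>))"
          using geo1(2)[OF fK(1)] Cg_ge by (intro mult_left_mono) auto
        show "0 \<le> Cg * (2 / (1 - \<theta>))" using Cg_ge geo1(1) by simp
        show "0 \<le> t * lam M" using t(1) lam_pos[of M] by simp
      qed
      finally show ?thesis by (simp add: mult_ac)
    qed
    have "t * Lam (card D) = nu D (\<lambda>_. t)" using D t(1) by (simp add: nu_const)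
    also have "\<dots> \<le> nu D1 (\<lambda>_. t) + nu D2 (\<lambda>_. t)" unfolding un by (rule nu_union[OF f])
    also have "\<dots> \<le> C * G" using 1 2 by (simp add: C_def algebra_simps)
    finally show ?thesis .
  qed
  have "0 \<le> C" using Cg_ge geo1(1) Kc_pos by (simp add: C_def)
  note C_nonneg = this
  show ?thesis by (intro exI[of _ C] conjI allI impI; (elim conjE)?; (rule C_nonneg | rule main); auto)
qed


section \<open>Partial sums and greedy projections\<close>

lemma block_split:
  assumes D: "D \<subseteq> {..<R K}"
  shows "S.comb {..<R K} (T (rs D (cc y))) = S.comb {..<R K} (T (\<lambda>n. rs D (cc y) n - (if rnd n \<in> J then cc y n else 0)))"
proof (rule S.comb_cong)
  fix n
  have "T (\<lambda>n. - 1 * (if rnd n \<in> J then cc y n else 0)) n = - 1 * T (\<lambda>n. if rnd n \<in> J then cc y n else 0) n"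
    by (rule T_scale)
  also have "T (\<lambda>n. if rnd n \<in> J then cc y n else 0) n = 0"
    by (rule T_diag_const[where c = "\<lambda>k. if k \<in> J then xi k y / of_real (lam k) else 0"]) (auto simp: cc_def)
  finally show "T (rs D (cc y)) n = T (\<lambda>n. rs D (cc y) n - (if rnd n \<in> J then cc y n else 0)) n"
    using T_add[of "rs D (cc y)" "\<lambda>n. - 1 * (if rnd n \<in> J then cc y n else 0)" n] by simp
qed

text \<open>The blocks in \<open>J\<close> may be replaced by their complements, because constants on blocks are
  annihilated.\<close>

lemma qnorm_be_cc:
  assumes D: "finite D" and J: "finite J"
  shows "qnorm S (\<Sum>m\<in>D. smul S (cc y m) (be m))
    \<le> 5 * nu ({n \<in> D. rnd n \<notin> J} \<union> {n. rnd n \<in> J \<and> n \<notin> D \<and> diag n}) (\<lambda>n. norm (cc y n))"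
proof -
  obtain K where K: "D \<subseteq> {..<R K}" using sub_R[OF D] by blast
  let ?E = "{n \<in> D. rnd n \<notin> J} \<union> {n. rnd n \<in> J \<and> n \<notin> D \<and> diag n}"
  let ?a = "\<lambda>n. rs D (cc y) n - (if rnd n \<in> J then cc y n else 0)"
  have "{n. rnd n \<in> J \<and> n \<notin> D \<and> diag n} \<subseteq> (\<Union>k\<in>J. sg k)" by (auto simp: mem_sg)
  then have "finite {n. rnd n \<in> J \<and> n \<notin> D \<and> diag n}"
    by (rule finite_subset) (use J in simp)
  then have fE: "finite ?E" using D by simp
  have "qnorm S (S.comb {..<R K} (T ?a)) \<le> 5 * nu ?E (\<lambda>n. norm (?a n))"
    by (rule qnorm_T_bound[OF fE]) (auto simp: cc_def)
  also have "nu ?E (\<lambda>n. norm (?a n)) = nu ?E (\<lambda>n. norm (cc y n))"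
    by (rule nu_cong[OF fE]) auto
  finally show ?thesis unfolding sum_be[OF K] block_split[OF K, of y J] .
qed

text \<open>The lift \<open>uw\<close> contributes \<open>25 = 5 * 5\<close>, one factor each for
  \<open>V\<close> and \<open>T\<close>, on any finite set. Only the block constants depend on the
  shape of D.\<close>

lemma qnorm_be_g:
  assumes sm: "small y w G" and D: "finite D"
  shows "qnorm S (\<Sum>m\<in>D. smul S (g y w m) (be m)) \<le> 25 * G + qnorm S (\<Sum>m\<in>D. smul S (cc y m) (be m))"
proof -
  have eq: "(\<Sum>m\<in>D. smul S (g y w m) (be m)) = (\<Sum>m\<in>D. smul S (uw w m) (be m)) + (\<Sum>m\<in>D. smul S (cc y m) (be m))"
    by (simp add: g_def S.scale_left_distrib sum.distrib)
  have "qnorm S (\<Sum>m\<in>D. smul S (g y w m) (be m)) \<le> qnorm S (\<Sum>m\<in>D. smul S (uw w m) (be m)) + qnorm S (\<Sum>m\<in>D. smul S (cc y m) (be m))"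
    unfolding eq by (intro S.triangle S.car_sum S.car_scale be_car)
  then show ?thesis
    using qnorm_sum_be[OF D, of "uw w"] small_uw[OF sm D] by linarith
qed

lemma nu_cc_le:
  assumes "finite E" "finite J" "E \<subseteq> (\<Union>k\<in>J. sg k)"
  shows "nu E (\<lambda>n. norm (cc y n)) \<le> (\<Sum>k\<in>J. norm (xi k y) / lam k * Lam (card (E \<inter> sg k)))"
proof -
  have "nu E (\<lambda>n. norm (cc y n)) = nu (\<Union>k\<in>J. E \<inter> sg k) (\<lambda>n. norm (cc y n))"
    using assms(3) by (intro arg_cong[of _ _ "\<lambda>E. nu E (\<lambda>n. norm (cc y n))"]) auto
  also have "\<dots> \<le> (\<Sum>k\<in>J. nu (E \<inter> sg k) (\<lambda>n. norm (cc y n)))"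
    using assms by (intro nu_Union) auto
  also have "\<dots> \<le> (\<Sum>k\<in>J. norm (xi k y) / lam k * Lam (card (E \<inter> sg k)))"
  proof (intro sum_mono nu_le_const)
    fix k n assume "n \<in> E \<inter> sg k"
    then show "\<bar>norm (cc y n)\<bar> \<le> norm (xi k y) / lam k"
      using lam_pos[of k] by (auto simp: cc_def mem_sg norm_divide)
  qed (use assms lam_pos in \<open>auto simp: less_imp_le\<close>)
  finally show ?thesis .
qed

lemma le_Cr_len: assumes "d \<le> len r" shows "real d \<le> Cr * real (len r)"
proof -
  have "real d \<le> 1 * real (len r)" using assms by simp
  also have "\<dots> \<le> Cr * real (len r)" using Cr_ge by (intro mult_right_mono) auto
  finally show ?thesis .
qed

lemma small_xi: "small y w G \<Longrightarrow> norm (xi k y) \<le> Kc * G"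
  using xi_bound[of y k] mult_left_mono[of "qnorm X y" G Kc] Kc_pos unfolding small_def by linarith

lemma sum_g_sg: "of_real (lam k / real (len k)) * (\<Sum>n\<in>sg k. g y w n) = xi k y"
proof -
  have "(\<Sum>n\<in>sg k. g y w n) = (\<Sum>n\<in>sg k. cc y n)"
    using sum_V_sg[of "eta w" k] by (simp add: g_def sum.distrib uw_def)
  also have "\<dots> = (\<Sum>n\<in>sg k. xi k y / of_real (lam k))"
    by (intro sum.cong) (auto simp: cc_def mem_sg)
  also have "\<dots> = of_nat (len k) * (xi k y / of_real (lam k))" by simp
  finally show ?thesis using len_pos[of k] lam_pos[of k] by (simp add: of_real_divide)
qed

text \<open>A cut at n goes through at most one block. Complete blocks vanish in S and give a
  partial sum of y in X, bounded by the basis constant; the one cut block is bounded separately,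
  with \<open>10 = 2 * 5\<close> coming from the block mean of \<open>uw\<close>.\<close>

lemma partial_sums:
  "\<exists>C\<ge>0. \<forall>y w G n. small y w G \<longrightarrow> bnd {..<n} (g y w) (C * G)"
proof -
  define C where "C = max (25 + 5 * Kc) (X.kap * (Kx + (10 + Kc)))"
  have "bnd {..<n} (g y w) (C * G)" if sm: "small y w G" for y w G n
  proof -
    have G: "0 \<le> G" using small_nonneg[OF sm] .
    have y: "y \<in> car X" "qnorm X y \<le> G" using sm by (auto simp: small_def)
    define r where "r = rnd n"
    have r: "R r \<le> n" "n < R (Suc r)" using rnd_bounds[of n] by (auto simp: r_def)
    have below: "k < r" if "m \<in> sg k" "m < n" "m \<notin> sg r" for k m
    proof -
      have "R (rnd m) < R (Suc r)" using that(2) r rnd_bounds(1)[of m] by linarith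
      then have "R k < R (Suc r)" using that(1) by (simp add: mem_sg)
      then have "k \<le> r" by (simp add: R_less_iff)
      then show "k < r" using that by (cases "k = r") auto
    qed
    have full: "sg k \<subseteq> {..<n}" if "k < r" for k
      using sg_subset[OF that] r by auto
    have S: "qnorm S (\<Sum>m<n. smul S (g y w m) (be m)) \<le> (25 + 5 * Kc) * G"
    proof -
      let ?E = "{m \<in> {..<n}. rnd m \<notin> {..<r}} \<union> {m. rnd m \<in> {..<r} \<and> m \<notin> {..<n} \<and> diag m}"
      have "m < n" if "rnd m < r" "diag m" for m
        using full[OF that(1)] that(2) mem_sg[of m "rnd m"] by auto
      then have "{m. rnd m \<in> {..<r} \<and> m \<notin> {..<n} \<and> diag m} = {}" by auto
      then have fE: "finite ?E" by (simp only: Un_empty_right) simp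
      have "nu ?E (\<lambda>m. norm (cc y m)) \<le> nu (sg r) (\<lambda>m. norm (cc y m))"
      proof (rule nu_mono[OF fE])
        fix m assume m: "m \<in> ?E"
        show "\<bar>norm (cc y m)\<bar> \<le> (if m \<in> sg r then \<bar>norm (cc y m)\<bar> else 0)"
        proof -
          have "diag m \<longrightarrow> m \<in> sg r"
          proof (rule ccontr)
            assume "\<not> (diag m \<longrightarrow> m \<in> sg r)"
            then have d: "diag m" "m \<in> sg (rnd m)" "m \<notin> sg r" by (auto simp: mem_sg)
            show False
              using m d below[OF d(2) _ d(3)] full[of "rnd m"] by auto
          qed
          then show ?thesis by (cases "diag m") (auto simp: cc_def)
        qed
      qed simp
      also have "\<dots> \<le> (\<Sum>k\<in>{r}. norm (xi k y) / lam k * Lam (card (sg r \<inter> sg k)))"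
        by (rule nu_cc_le) auto
      also have "\<dots> \<le> Kc * G" using small_xi[OF sm] by (simp flip: lam_def)
      finally have "qnorm S (\<Sum>m<n. smul S (cc y m) (be m)) \<le> 5 * (Kc * G)"
        using qnorm_be_cc[of "{..<n}" "{..<r}" y] by simp
      then show ?thesis using qnorm_be_g[OF sm, of "{..<n}"] by (simp add: algebra_simps)
    qed
    have Xb: "qnorm X (\<Sum>m<n. smul X (g y w m) (bx m)) \<le> X.kap * (Kx + (10 + Kc)) * G"
    proof -
      define z where "z k = of_real (lam k / real (len k)) * (\<Sum>m\<in>{..<n} \<inter> sg k. g y w m)" for k
      have "(\<Sum>m<n. smul X (g y w m) (bx m)) = (\<Sum>k<Suc r. smul X (z k) (x k))"
        unfolding z_def by (rule sum_bx) (use r in auto)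
      also have "\<dots> = (\<Sum>k<r. smul X (xi k y) (x k)) + smul X (z r) (x r)"
      proof -
        have "z k = xi k y" if "k < r" for k
          using full[OF that] by (simp only: z_def Int_absorb1 sum_g_sg)
        then show ?thesis by simp
      qed
      finally have eq: "(\<Sum>m<n. smul X (g y w m) (bx m)) = (\<Sum>k<r. smul X (xi k y) (x k)) + smul X (z r) (x r)" .
      have "qnorm X (\<Sum>m<n. smul X (g y w m) (bx m))
          \<le> X.kap * (qnorm X (\<Sum>k<r. smul X (xi k y) (x k)) + norm (z r))"
        unfolding eq using X.qnorm_add[OF sum_x_car X.car_scale[OF x_car]] by (simp add: qnorm_x)
      moreover have "qnorm X (\<Sum>k<r. smul X (xi k y) (x k)) \<le> Kx * G"
        using xi_partial[OF y(1), of r] y(2) Kx_ge mult_left_mono[of "qnorm X y" G Kx] by linarith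
      moreover have "norm (z r) \<le> (10 + Kc) * G"
      proof -
        let ?E = "{..<n} \<inter> sg r"
        have "norm (z r) \<le> lam r / real (len r) * (\<Sum>m\<in>?E. norm (uw w m) + norm (cc y m))"
          unfolding z_def norm_mult norm_of_real g_def
          using lam_pos[of r] by (intro mult_mono order_trans[OF norm_sum] sum_mono norm_triangle_ineq) auto
        also have "\<dots> = lam r / real (len r) * (\<Sum>m\<in>?E. \<bar>norm (uw w m)\<bar>) + lam r / real (len r) * (\<Sum>m\<in>?E. norm (cc y m))"
          by (simp add: sum.distrib algebra_simps)
        also have "lam r / real (len r) * (\<Sum>m\<in>?E. \<bar>norm (uw w m)\<bar>) \<le> 2 * nu ?E (\<lambda>m. norm (uw w m))"
          by (rule block_mean) simp
        also have "nu ?E (\<lambda>m. norm (uw w m)) \<le> 5 * G" by (rule small_uw[OF sm]) simp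
        also have "lam r / real (len r) * (\<Sum>m\<in>?E. norm (cc y m)) \<le> Kc * G"
        proof -
          have "(\<Sum>m\<in>?E. norm (cc y m)) \<le> (\<Sum>m\<in>sg r. norm (cc y m))" by (intro sum_mono2) auto
          also have "\<dots> \<le> (\<Sum>m\<in>sg r. Kc * G / lam r)"
            using small_cc[OF sm] lam_pos[of r] by (intro sum_mono) (auto simp: field_simps)
          also have "\<dots> = real (len r) * (Kc * G / lam r)" by simp
          finally have "lam r / real (len r) * (\<Sum>m\<in>?E. norm (cc y m)) \<le> lam r / real (len r) * (real (len r) * (Kc * G / lam r))"
            using lam_pos[of r] by (intro mult_left_mono) auto
          then show ?thesis using lam_pos[of r] len_pos[of r] by simp
        qed
        finally show ?thesis by (simp add: algebra_simps)
      qed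
      ultimately have "qnorm X (\<Sum>m<n. smul X (g y w m) (bx m)) \<le> X.kap * (Kx * G + (10 + Kc) * G)"
        using X.kap_ge by (elim order_trans) (intro mult_left_mono add_mono, auto)
      then show ?thesis by (simp add: algebra_simps)
    qed
    show ?thesis unfolding bnd_def C_def
      using S Xb mult_right_mono[OF max.cobounded1 G, of "25 + 5 * Kc" "X.kap * (Kx + (10 + Kc))"]
        mult_right_mono[OF max.cobounded2 G, of "X.kap * (Kx + (10 + Kc))" "25 + 5 * Kc"] by auto
  qed
  note main = this
  have "0 \<le> C" using Kc_pos by (simp add: C_def le_max_iff_disj)
  note C_nonneg = this
  show ?thesis by (intro exI[of _ C] conjI allI impI; (elim conjE)?; (rule C_nonneg | rule main); auto)
qed

text \<open>Let \<open>c\<close> be the mean over a block. If \<open>\<bar>c\<bar>\<close> is at most half the threshold \<open>t\<close>, the mean-free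
  part dominates \<open>c\<close> on the greedy set; if it is at least \<open>2 * t\<close>, it does so on the complement. In
  the remaining blocks \<open>t * lam k\<close> is controlled by the norm, and these numbers grow geometrically.\<close>

lemma greedy_projection:
  "\<exists>C\<ge>0. \<forall>y w G D t. small y w G \<and> finite D \<and> 0 < t \<and> (\<forall>n\<in>D. t \<le> norm (g y w n)) \<and>
     (\<forall>n. n \<notin> D \<longrightarrow> norm (g y w n) \<le> t) \<longrightarrow> bnd D (g y w) (C * G)"
proof -
  \<comment> \<open>Both entries are used in blocks with \<open>C0 * G < t * lam k\<close>:
    \<open>2 * Kc\<close> makes the block constant at most \<open>t / 2\<close>, and 10 makes the
    part of D in the block shorter than \<open>len r\<close>.\<close>
  define C0 where "C0 = max (2 * Kc) 10"
  define Z where "Z = 2 * (Cg * (2 / (1 - \<theta>)) * (2 * Kc))"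
  define CS where "CS = 25 + 5 * (5 + 10 + Z)"
  define BX where "BX = max (20 * Cg) (Cg * C0 / \<theta>)"
  define CX where "CX = X.kap * (Kx + Cx * BX)"
  define C where "C = max CS CX"
  have C0: "0 < C0" "2 * Kc \<le> C0" "10 \<le> C0" by (auto simp: C0_def)
  have "bnd D (g y w) (C * G)"
    if sm: "small y w G" and D: "finite D" and t: "0 < t"
      and big: "\<And>n. n \<in> D \<Longrightarrow> t \<le> norm (g y w n)" and lit: "\<And>n. n \<notin> D \<Longrightarrow> norm (g y w n) \<le> t"
    for y w G D t
  proof -
    have G: "0 \<le> G" using small_nonneg[OF sm] .
    have y: "y \<in> car X" "qnorm X y \<le> G" using sm by (auto simp: small_def)
    define c where "c k = norm (xi k y) / lam k" for k
    have ccc: "norm (cc y n) = c k" if "n \<in> sg k" for n k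
      using that lam_pos[of k] by (simp add: cc_def mem_sg norm_divide c_def)
    have clam: "c k * lam k \<le> Kc * G" for k
      using small_xi[OF sm, of k] by (simp add: c_def)
    have S: "qnorm S (\<Sum>m\<in>D. smul S (g y w m) (be m)) \<le> CS * G"
    proof -
      define K where "K = rnd ` D"
      define K2 where "K2 = {k\<in>K. 2 * t \<le> c k}"
      define K3 where "K3 = {k\<in>K. t / 2 < c k \<and> c k < 2 * t}"
      have fK: "finite K" "finite K2" "finite K3" using D by (auto simp: K_def K2_def K3_def)
      let ?E = "{n \<in> D. rnd n \<notin> K2} \<union> {n. rnd n \<in> K2 \<and> n \<notin> D \<and> diag n}"
      define E1 where "E1 = {n \<in> D. rnd n \<notin> K2 \<and> rnd n \<notin> K3}"
      define E2 where "E2 = {n. rnd n \<in> K2 \<and> n \<notin> D \<and> diag n}"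
      define E3 where "E3 = {n \<in> D. rnd n \<in> K3 \<and> diag n}"
      define E4 where "E4 = {n \<in> D. rnd n \<in> K3 \<and> \<not> diag n}"
      have fE: "finite E1" "finite E3" "finite E4" using D by (auto simp: E1_def E3_def E4_def)
      have "E2 \<subseteq> (\<Union>k\<in>K2. sg k)" by (auto simp: E2_def mem_sg)
      then have fE2: "finite E2" by (rule finite_subset) (use fK in simp)
      have E1: "nu E1 (\<lambda>n. norm (cc y n)) \<le> 5 * G"
      proof -
        have "norm (cc y n) \<le> norm (uw w n)" if "n \<in> E1" for n
        proof (cases "diag n")
          case True
          then have n: "n \<in> sg (rnd n)" by (simp add: mem_sg)
          have "n \<in> D" "c (rnd n) \<le> t / 2"
            using that t by (auto simp: E1_def K2_def K3_def K_def not_le not_less)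
          then show ?thesis
            using big[of n] norm_triangle_ineq[of "uw w n" "cc y n"] ccc[OF n] unfolding g_def by linarith
        qed (simp add: cc_def)
        then have "nu E1 (\<lambda>n. norm (cc y n)) \<le> nu E1 (\<lambda>n. norm (uw w n))"
          using fE by (intro nu_abs_mono) auto
        then show ?thesis using small_uw[OF sm fE(1)] by linarith
      qed
      have E2: "nu E2 (\<lambda>n. norm (cc y n)) \<le> 10 * G"
      proof -
        have "norm (cc y n) \<le> 2 * norm (uw w n)" if "n \<in> E2" for n
        proof -
          have n: "n \<in> sg (rnd n)" "n \<notin> D" "2 * t \<le> c (rnd n)"
            using that by (auto simp: E2_def K2_def mem_sg)
          then show ?thesis
            using lit[of n] norm_triangle_ineq4[of "g y w n" "uw w n"] ccc[OF n(1)] unfolding g_def by simp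
        qed
        then have "nu E2 (\<lambda>n. norm (cc y n)) \<le> nu E2 (\<lambda>n. 2 * norm (uw w n))"
          using fE2 by (intro nu_abs_mono) auto
        also have "\<dots> = 2 * nu E2 (\<lambda>n. norm (uw w n))" using nu_scale[OF fE2, of 2] by simp
        finally show ?thesis using small_uw[OF sm fE2] by linarith
      qed
      have E4: "nu E4 (\<lambda>n. norm (cc y n)) = 0"
        by (rule nu_zero) (use fE in \<open>auto simp: E4_def cc_def\<close>)
      have E3: "nu E3 (\<lambda>n. norm (cc y n)) \<le> Z * G"
      proof (cases "K3 = {}")
        case True
        then have "E3 = {}" by (simp add: E3_def)
        then show ?thesis using nu_zero[of "{}"] G Cg_ge geo1(1) Kc_pos by (simp add: Z_def)
      next
        case False
        define M where "M = Max K3"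
        have M: "M \<in> K3" using Max_in[OF fK(3) False] by (simp add: M_def)
        have tM: "t * lam M \<le> 2 * Kc * G"
        proof -
          have "t / 2 * lam M \<le> c M * lam M" using M lam_pos[of M] by (intro mult_right_mono) (auto simp: K3_def)
          then show ?thesis using clam[of M] by linarith
        qed
        have "nu E3 (\<lambda>n. norm (cc y n)) \<le> (\<Sum>k\<in>K3. c k * Lam (card (E3 \<inter> sg k)))"
          unfolding c_def using fE fK by (intro nu_cc_le) (auto simp: E3_def mem_sg)
        also have "\<dots> \<le> (\<Sum>k\<in>K3. (2 * t) * (Cg * \<theta> ^ ((k - M) + (M - k)) * lam M))"
        proof (intro sum_mono mult_mono Lam_nonneg)
          fix k assume k: "k \<in> K3"
          then show "c k \<le> 2 * t" by (simp add: K3_def)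
          have "k \<le> M" using k fK by (simp add: M_def)
          moreover have "card (E3 \<inter> sg k) \<le> len k" using card_mono[of "sg k" "E3 \<inter> sg k"] by simp
          ultimately show "Lam (card (E3 \<inter> sg k)) \<le> Cg * \<theta> ^ ((k - M) + (M - k)) * lam M"
            using lam_growth'[of k M] Lam_mono[of "card (E3 \<inter> sg k)" "len k"] by (simp add: lam_def)
        qed (use t in auto)
        also have "\<dots> = Cg * (\<Sum>k\<in>K3. \<theta> ^ ((k - M) + (M - k))) * (2 * (t * lam M))"
          by (simp add: sum_distrib_left sum_distrib_right mult_ac)
        also have "\<dots> \<le> Cg * (2 / (1 - \<theta>)) * (2 * (2 * Kc * G))"
        proof (rule mult_mono)
          show "Cg * (\<Sum>k\<in>K3. \<theta> ^ ((k - M) + (M - k))) \<le> Cg * (2 / (1 - \<theta>))"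
            using geo1(2)[OF fK(3)] Cg_ge by (intro mult_left_mono) auto
          show "0 \<le> Cg * (2 / (1 - \<theta>))" using Cg_ge geo1(1) by simp
          show "2 * (t * lam M) \<le> 2 * (2 * Kc * G)" using tM by linarith
          show "0 \<le> 2 * (t * lam M)" using t lam_pos[of M] by simp
        qed
        finally show ?thesis by (simp add: Z_def mult_ac)
      qed
      have "nu ?E (\<lambda>n. norm (cc y n)) \<le> nu ((E1 \<union> E2) \<union> (E3 \<union> E4)) (\<lambda>n. norm (cc y n))"
        using fE fE2 by (intro nu_subset) (auto simp: E1_def E2_def E3_def E4_def)
      also have "\<dots> \<le> nu E1 (\<lambda>n. norm (cc y n)) + nu E2 (\<lambda>n. norm (cc y n)) + (nu E3 (\<lambda>n. norm (cc y n)) + nu E4 (\<lambda>n. norm (cc y n)))"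
        using nu_union[of E1 E2 "\<lambda>n. norm (cc y n)"] nu_union[of E3 E4 "\<lambda>n. norm (cc y n)"]
          nu_union[of "E1 \<union> E2" "E3 \<union> E4" "\<lambda>n. norm (cc y n)"] fE fE2 by simp
      finally have "nu ?E (\<lambda>n. norm (cc y n)) \<le> (5 + 10 + Z) * G"
        using E1 E2 E3 E4 by (simp add: algebra_simps)
      then show ?thesis
        using qnorm_be_cc[OF D fK(2), of y] qnorm_be_g[OF sm D] unfolding CS_def by (simp add: algebra_simps)
    qed
    have Xb: "qnorm X (\<Sum>m\<in>D. smul X (g y w m) (bx m)) \<le> CX * G"
    proof -
      obtain K where K: "D \<subseteq> {..<R K}" using sub_R[OF D] by blast
      \<comment> \<open>In X the blocks are divided by the size of \<open>t * lam k\<close> against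
        G and not by their constants: below r the block is short enough for a term-by-term bound by
        t, from r on the mean-free part dominates on D.\<close>
      define r where "r = (LEAST k. C0 * G < t * lam k)"
      have "\<exists>k. C0 * G < t * lam k"
        using lam_unbounded[of "C0 * G / t"] t by (auto simp: field_simps)
      then have r: "C0 * G < t * lam r" unfolding r_def by (rule LeastI_ex)
      have r': "t * lam k \<le> C0 * G" if "k < r" for k
        using not_less_Least[of k "\<lambda>k. C0 * G < t * lam k"] that by (simp add: r_def)
      define z where "z k = of_real (lam k / real (len k)) * (\<Sum>n\<in>D \<inter> sg k. g y w n)" for k
      \<comment> \<open>Below r the block coefficient is that of y minus the contribution of the
        indices outside D, where coordinates are at most t. The coefficients of y assemble to a
        partial sum; the errors \<open>z'\<close> decay away from r on both sides.\<close>
      define z' where "z' k = (if k < r then - (of_real (lam k / real (len k)) * (\<Sum>n\<in>sg k - D. g y w n)) else z k)" for k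
      have zz: "z k = (if k < r then xi k y else 0) + z' k" for k
      proof (cases "k < r")
        case True
        have "(\<Sum>n\<in>sg k. g y w n) = (\<Sum>n\<in>D \<inter> sg k. g y w n) + (\<Sum>n\<in>sg k - D. g y w n)"
          by (subst sum.union_disjoint[symmetric]) (auto intro: sum.cong)
        then have "xi k y = z k + of_real (lam k / real (len k)) * (\<Sum>n\<in>sg k - D. g y w n)"
          unfolding z_def sum_g_sg[of k y w, symmetric] by (simp only: distrib_left)
        then show ?thesis using True by (simp add: z'_def)
      qed (simp add: z'_def)
      have z'b: "norm (z' k) \<le> BX * G * \<theta> ^ ((k - r) + (r - k))" for k
      proof (cases "k < r")
        case True
        have "norm (\<Sum>n\<in>sg k - D. g y w n) \<le> real (card (sg k - D)) * t"
          using sum_norm_le[of "sg k - D" "g y w" "\<lambda>_. t"] lit by simp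
        also have "\<dots> \<le> real (len k) * t"
          using t card_mono[of "sg k" "sg k - D"] by (intro mult_right_mono) auto
        finally have "norm (z' k) \<le> lam k / real (len k) * (real (len k) * t)"
          using True lam_pos[of k] unfolding z'_def
          by (simp add: norm_mult norm_divide divide_right_mono mult_left_mono del: times_divide_eq_left)
        also have "\<dots> = t * lam k" using len_pos[of k] by simp
        also have "\<dots> \<le> t * (Cg * \<theta> ^ (r - 1 - k) * lam (r - 1))"
          using True t by (intro mult_left_mono lam_growth') auto
        also have "\<dots> = Cg * \<theta> ^ (r - 1 - k) * (t * lam (r - 1))" by simp
        also have "\<dots> \<le> Cg * \<theta> ^ (r - 1 - k) * (C0 * G)"
          using r'[of "r - 1"] True Cg_ge \<theta>_pos by (intro mult_left_mono) auto
        also have "\<theta> ^ (r - 1 - k) = \<theta> ^ (r - k) / \<theta>"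
        proof -
          have "r - k = Suc (r - 1 - k)" using True by simp
          then show ?thesis using \<theta>_pos by simp
        qed
        also have "Cg * (\<theta> ^ (r - k) / \<theta>) * (C0 * G) = (Cg * C0 / \<theta>) * (G * \<theta> ^ (r - k))" by simp
        also have "\<dots> \<le> BX * (G * \<theta> ^ (r - k))"
          using G \<theta>_pos by (intro mult_right_mono) (auto simp: BX_def)
        finally show ?thesis using True by (simp add: mult_ac)
      next
        case False
        then have rk: "r \<le> k" by simp
        let ?E = "D \<inter> sg k"
        have fE: "finite ?E" using D by simp
        have lk: "C0 * G < t * lam k"
        proof -
          have "lam r \<le> lam k" unfolding lam_def by (intro Lam_mono len_mono rk)
          then show ?thesis using r t by (meson less_le_trans mult_left_mono less_imp_le)
        qed
        have ck: "c k \<le> t / 2"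
        proof -
          have "c k * lam k \<le> Kc * G" by (rule clam)
          also have "2 * (Kc * G) \<le> C0 * G" using C0(2) G mult_right_mono by fastforce
          finally have "c k * lam k \<le> (t / 2) * lam k" using lk by simp
          then show ?thesis using lam_pos[of k] by simp
        qed
        have u: "norm (g y w n) \<le> 2 * norm (uw w n)" "t / 2 \<le> norm (uw w n)" if "n \<in> ?E" for n
          using that big[of n] ccc[of n k] ck norm_triangle_ineq[of "uw w n" "cc y n"] unfolding g_def by auto
        have nuE: "nu ?E (\<lambda>n. norm (uw w n)) \<le> 5 * G" by (rule small_uw[OF sm fE])
        have "card ?E < len r"
        proof -
          have "t / 2 * Lam (card ?E) \<le> nu ?E (\<lambda>n. norm (uw w n))"
            using u(2) t by (intro nu_ge_const fE) auto
          then have "t * Lam (card ?E) \<le> 10 * G" using nuE by linarith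
          also have "\<dots> \<le> C0 * G" using C0(3) G by (intro mult_right_mono)
          finally have "t * Lam (card ?E) < t * lam r" using r by linarith
          then have "Lam (card ?E) < Lam (len r)" using t by (simp add: lam_def)
          then show ?thesis using Lam_mono[of "len r" "card ?E"] by (meson not_le)
        qed
        then have "real (card ?E) \<le> Cr * real (len r)"
          by (intro le_Cr_len) simp
        then have br: "lam k / real (len k) * (\<Sum>n\<in>?E. \<bar>norm (uw w n)\<bar>) \<le> 2 * Cg * \<theta> ^ (k - r) * nu ?E (\<lambda>n. norm (uw w n))"
          by (intro block_mean_ratio rk) auto
        have "norm (z k) \<le> lam k / real (len k) * (\<Sum>n\<in>?E. 2 * norm (uw w n))"
          unfolding z_def norm_mult norm_of_real
          using lam_pos[of k] by (intro mult_mono order_trans[OF norm_sum] sum_mono u) auto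
        also have "\<dots> = 2 * (lam k / real (len k) * (\<Sum>n\<in>?E. \<bar>norm (uw w n)\<bar>))"
          by (simp add: sum_distrib_left mult_ac)
        also have "\<dots> \<le> 2 * (2 * Cg * \<theta> ^ (k - r) * nu ?E (\<lambda>n. norm (uw w n)))"
          using br by simp
        also have "\<dots> \<le> 2 * (2 * Cg * \<theta> ^ (k - r) * (5 * G))"
          using nuE Cg_ge \<theta>_pos by (intro mult_left_mono) auto
        also have "\<dots> = 20 * Cg * (G * \<theta> ^ (k - r))" by simp
        also have "\<dots> \<le> BX * (G * \<theta> ^ (k - r))"
          using G \<theta>_pos by (intro mult_right_mono) (auto simp: BX_def)
        finally show ?thesis using False rk by (simp add: z'_def mult_ac)
      qed
      have BX: "0 \<le> BX * G" using G Cg_ge by (auto simp: BX_def le_max_iff_disj)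
      have "(\<Sum>k<K. smul X (if k < r then xi k y else 0) (x k)) = (\<Sum>k<min r K. smul X (xi k y) (x k))"
        by (intro sum.mono_neutral_cong_right) auto
      then have eq: "(\<Sum>m\<in>D. smul X (g y w m) (bx m)) = (\<Sum>k<min r K. smul X (xi k y) (x k)) + (\<Sum>k<K. smul X (z' k) (x k))"
        unfolding sum_bx[OF K] z_def[symmetric] zz by (simp add: X.scale_left_distrib sum.distrib)
      have "qnorm X (\<Sum>m\<in>D. smul X (g y w m) (bx m))
          \<le> X.kap * (qnorm X (\<Sum>k<min r K. smul X (xi k y) (x k)) + qnorm X (\<Sum>k<K. smul X (z' k) (x k)))"
        unfolding eq by (intro X.qnorm_add sum_x_car)
      also have "\<dots> \<le> X.kap * (Kx * G + Cx * (BX * G))"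
      proof (intro mult_left_mono add_mono)
        show "qnorm X (\<Sum>k<min r K. smul X (xi k y) (x k)) \<le> Kx * G"
          using xi_partial[OF y(1), of "min r K"] y(2) Kx_ge mult_left_mono[of "qnorm X y" G Kx] by linarith
        show "qnorm X (\<Sum>k<K. smul X (z' k) (x k)) \<le> Cx * (BX * G)"
          using z'b BX by (intro sum_x_geometric[where r = r]) auto
      qed (use X.kap_ge in auto)
      finally show ?thesis by (simp add: CX_def algebra_simps)
    qed
    show ?thesis unfolding bnd_def C_def
      using S Xb mult_right_mono[OF max.cobounded1 G, of CS CX]
        mult_right_mono[OF max.cobounded2 G, of CX CS] by auto
  qed
  note main = this
  have "0 \<le> CS" using Kc_pos Cg_ge geo1(1) by (simp add: CS_def Z_def)
  then have "0 \<le> C" by (simp add: C_def le_max_iff_disj)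
  note C_nonneg = this
  show ?thesis by (intro exI[of _ C] conjI allI impI; (elim conjE)?; (rule C_nonneg | rule main); auto)
qed


text \<open>Let r be the first block met by A. An index of A in that block exceeds
  \<open>card A\<close>, so \<open>R_le\<close> bounds \<open>card A\<close> by a multiple of
  \<open>len r\<close>. Hence A is short relative to every block that it meets, and the
  contributions decay in \<open>k - r\<close> in both components.\<close>

lemma asymptotic_projection:
  "\<exists>C\<ge>0. \<forall>y w G A. small y w G \<and> finite A \<and> (\<forall>n\<in>A. card A \<le> n) \<longrightarrow> bnd A (g y w) (C * G)"
proof -
  define L where "L = 2 * Cs * Cr"
  define CS where "CS = 25 + 5 * (Kc * L * (Cg * (2 / (1 - \<theta>))))"
  define CX where "CX = Cx * (10 * Cg + Kc * Cg)"
  define C where "C = max CS CX"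
  have L: "0 < L" using Cs_ge Cr_ge by (simp add: L_def)
  have main: "bnd A (g y w) (C * G)"
    if sm: "small y w G" and A: "finite A" and min: "\<And>n. n \<in> A \<Longrightarrow> card A \<le> n" for y w G A
  proof -
    have G: "0 \<le> G" using small_nonneg[OF sm] .
    define J where "J = rnd ` {n \<in> A. diag n}"
    have fJ: "finite J" using A by (simp add: J_def)
    \<comment> \<open>The default 0 is arbitrary: if A meets no last piece, all sums over blocks are
      empty.\<close>
    define r where "r = (if J = {} then 0 else Min J)"
    have empty: "A \<inter> sg k = {}" if "k \<notin> J" for k using that by (auto simp: J_def mem_sg)
    have rJ: "r \<le> k" if "k \<in> J" for k using that fJ by (auto simp: r_def)
    have cardA: "real (card A) \<le> Cr * real (len r)" if "J \<noteq> {}"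
    proof -
      have "r \<in> J" using that fJ Min_in by (auto simp: r_def)
      then obtain n where n: "n \<in> A" "rnd n = r" by (auto simp: J_def)
      have "card A \<le> R (Suc r)" using min[OF n(1)] rnd_bounds(2)[of n] n(2) by simp
      then show ?thesis using R_le[of r] by linarith
    qed
    have cE: "real (card (A \<inter> sg k)) \<le> Cr * real (len r)" if "k \<in> J" for k
    proof -
      have "card (A \<inter> sg k) \<le> card A" using A by (intro card_mono) auto
      then show ?thesis using cardA that by fastforce
    qed
    have S: "qnorm S (\<Sum>m\<in>A. smul S (g y w m) (be m)) \<le> CS * G"
    proof -
      let ?A = "{n \<in> A. diag n}"
      have "nu A (\<lambda>n. norm (cc y n)) \<le> nu ?A (\<lambda>n. norm (cc y n))"
        using A by (intro nu_mono) (auto simp: cc_def)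
      also have "\<dots> \<le> (\<Sum>k\<in>J. norm (xi k y) / lam k * Lam (card (?A \<inter> sg k)))"
        using A fJ by (intro nu_cc_le) (auto simp: J_def mem_sg)
      also have "\<dots> \<le> (\<Sum>k\<in>J. Kc * G * L * Cg * \<theta> ^ ((k - r) + (r - k)))"
      proof (intro sum_mono)
        fix k assume k: "k \<in> J"
        have "real (card (?A \<inter> sg k)) \<le> real (card (A \<inter> sg k))" using A by (intro of_nat_mono card_mono) auto
        then have "Lam (card (?A \<inter> sg k)) \<le> L * lam r"
          unfolding L_def lam_def using cE[OF k] len_pos[of r] Cr_ge by (intro Lam_le_mult) auto
        also have "\<dots> \<le> L * (Cg * \<theta> ^ (k - r) * lam k)"
          using L lam_growth'[OF rJ[OF k]] by (intro mult_left_mono) auto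
        finally have "norm (xi k y) / lam k * Lam (card (?A \<inter> sg k)) \<le> (Kc * G) / lam k * (L * (Cg * \<theta> ^ (k - r) * lam k))"
          using small_xi[OF sm, of k] lam_pos[of k] Kc_pos G
          by (intro mult_mono divide_right_mono Lam_nonneg) auto
        then show "norm (xi k y) / lam k * Lam (card (?A \<inter> sg k)) \<le> Kc * G * L * Cg * \<theta> ^ ((k - r) + (r - k))"
          using lam_pos[of k] rJ[OF k] by (simp add: mult_ac)
      qed
      also have "\<dots> = Kc * G * L * Cg * (\<Sum>k\<in>J. \<theta> ^ ((k - r) + (r - k)))" by (simp add: sum_distrib_left)
      also have "\<dots> \<le> Kc * G * L * Cg * (2 / (1 - \<theta>))"
        using geo1(2)[OF fJ] Kc_pos G L Cg_ge by (intro mult_left_mono) auto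
      also have "\<dots> = Kc * L * (Cg * (2 / (1 - \<theta>))) * G" by simp
      finally have "5 * nu A (\<lambda>n. norm (cc y n)) \<le> 5 * (Kc * L * (Cg * (2 / (1 - \<theta>)))) * G"
        unfolding mult.assoc[of 5] by (intro mult_left_mono) auto
      then show ?thesis
        using qnorm_sum_be[OF A, of "cc y"] qnorm_be_g[OF sm A] unfolding CS_def distrib_right by linarith
    qed
    have Xb: "qnorm X (\<Sum>m\<in>A. smul X (g y w m) (bx m)) \<le> CX * G"
    proof -
      obtain K where K: "A \<subseteq> {..<R K}" using sub_R[OF A] by blast
      have z: "norm (of_real (lam k / real (len k)) * (\<Sum>n\<in>A \<inter> sg k. g y w n))
          \<le> (10 * Cg + Kc * Cg) * G * \<theta> ^ ((k - r) + (r - k))" for k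
      proof (cases "A \<inter> sg k = {}")
        case True
        then show ?thesis using G Cg_ge Kc_pos \<theta>_pos by simp
      next
        case False
        then have k: "k \<in> J" using empty by blast
        let ?E = "A \<inter> sg k"
        have fE: "finite ?E" using A by simp
        have d: "1 \<le> card ?E" "card ?E \<le> len k"
          using False fE card_mono[of "sg k" ?E] by (auto simp: Suc_le_eq card_gt_0_iff)
        have u: "lam k / real (len k) * (\<Sum>n\<in>?E. \<bar>norm (uw w n)\<bar>) \<le> 10 * Cg * G * \<theta> ^ (k - r)"
        proof -
          have "lam k / real (len k) * (\<Sum>n\<in>?E. \<bar>norm (uw w n)\<bar>) \<le> 2 * Cg * \<theta> ^ (k - r) * nu ?E (\<lambda>n. norm (uw w n))"
            by (rule block_mean_ratio) (use rJ cE k in auto)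
          also have "\<dots> \<le> 2 * Cg * \<theta> ^ (k - r) * (5 * G)"
            using small_uw[OF sm fE] Cg_ge \<theta>_pos by (intro mult_left_mono) auto
          finally show ?thesis by (simp add: mult_ac)
        qed
        have c: "lam k / real (len k) * (\<Sum>n\<in>?E. norm (cc y n)) \<le> Kc * Cg * G * \<theta> ^ (k - r)"
        proof -
          have "lam k / real (len k) * real (card ?E) \<le> Cg * \<theta> ^ (k - r) * Lam (card ?E)"
            unfolding lam_def by (rule lam_ratio) (use rJ cE k d in auto)
          also have "\<dots> \<le> Cg * \<theta> ^ (k - r) * lam k"
            unfolding lam_def using d Cg_ge \<theta>_pos by (intro mult_left_mono Lam_mono) auto
          finally have "lam k * (real (card ?E) / real (len k)) \<le> lam k * (Cg * \<theta> ^ (k - r))"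
            by (simp add: mult_ac)
          then have *: "real (card ?E) / real (len k) \<le> Cg * \<theta> ^ (k - r)"
            using lam_pos[of k] by (simp only: mult_le_cancel_left_pos)
          have "(\<Sum>n\<in>?E. norm (cc y n)) \<le> (\<Sum>n\<in>?E. Kc * G / lam k)"
            using small_cc[OF sm] lam_pos[of k] by (intro sum_mono) (auto simp: field_simps)
          then have "lam k / real (len k) * (\<Sum>n\<in>?E. norm (cc y n)) \<le> lam k / real (len k) * (\<Sum>n\<in>?E. Kc * G / lam k)"
            using lam_pos[of k] by (intro mult_left_mono) auto
          also have "\<dots> = (real (card ?E) / real (len k)) * (Kc * G)" using lam_pos[of k] by simp
          also have "\<dots> \<le> (Cg * \<theta> ^ (k - r)) * (Kc * G)"
            using * Kc_pos G by (intro mult_right_mono) auto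
          finally show ?thesis by (simp add: mult_ac)
        qed
        have "norm (of_real (lam k / real (len k)) * (\<Sum>n\<in>?E. g y w n))
            \<le> lam k / real (len k) * (\<Sum>m\<in>?E. norm (uw w m) + norm (cc y m))"
          unfolding norm_mult norm_of_real g_def
          using lam_pos[of k] by (intro mult_mono order_trans[OF norm_sum] sum_mono norm_triangle_ineq) auto
        also have "\<dots> = lam k / real (len k) * (\<Sum>m\<in>?E. \<bar>norm (uw w m)\<bar>) + lam k / real (len k) * (\<Sum>m\<in>?E. norm (cc y m))"
          by (simp add: sum.distrib algebra_simps)
        also have "\<dots> \<le> 10 * Cg * G * \<theta> ^ (k - r) + Kc * Cg * G * \<theta> ^ (k - r)"
          by (intro add_mono u c)
        finally show ?thesis using rJ[OF k] by (simp add: algebra_simps)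
      qed
      have "qnorm X (\<Sum>m\<in>A. smul X (g y w m) (bx m)) \<le> Cx * ((10 * Cg + Kc * Cg) * G)"
        unfolding sum_bx[OF K]
        by (rule sum_x_geometric[where r = r]) (use z G Cg_ge Kc_pos in auto)
      then show ?thesis by (simp add: CX_def mult_ac)
    qed
    show ?thesis unfolding bnd_def C_def
      using S Xb mult_right_mono[OF max.cobounded1 G, of CS CX]
        mult_right_mono[OF max.cobounded2 G, of CX CS] by auto
  qed
  have "0 \<le> CX" using Kc_pos Cg_ge Cx_pos by (simp add: CX_def)
  then have C_nonneg: "0 \<le> C" by (simp add: C_def le_max_iff_disj)
  show ?thesis by (intro exI[of _ C] conjI allI impI; (elim conjE)?; (rule C_nonneg | rule main); auto)
qed

section \<open>Multipliers and arbitrary projections on initial segments\<close>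

lemma binary_digits:
  assumes "\<And>k. 0 \<le> th k \<and> th k \<le> (1::real)"
  shows "\<exists>J \<rho>. (\<forall>k. 0 \<le> \<rho> k \<and> \<rho> k \<le> 1) \<and>
    (\<forall>k. th k = (\<Sum>i<n. (1 / 2) ^ Suc i * (if k \<in> J i then 1 else 0)) + (1 / 2) ^ n * \<rho> k)"
proof (induction n)
  case 0
  show ?case using assms by (intro exI[of _ "\<lambda>_. {}"] exI[of _ th]) simp
next
  case (Suc n)
  then obtain J :: "nat \<Rightarrow> 'a set" and \<rho> where J: "\<And>k. 0 \<le> \<rho> k \<and> \<rho> k \<le> (1::real)"
    "\<And>k. th k = (\<Sum>i<n. (1 / 2) ^ Suc i * (if k \<in> J i then 1 else 0)) + (1 / 2) ^ n * \<rho> k"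
    by blast
  \<comment> \<open>The next digit is read off for all k at once, so each digit position is the
    indicator of one index set.\<close>
  define J' where "J' = J(n := {k. 1 / 2 \<le> \<rho> k})"
  define \<rho>' where "\<rho>' k = 2 * \<rho> k - (if 1 / 2 \<le> \<rho> k then 1 else 0)" for k
  have "0 \<le> \<rho>' k \<and> \<rho>' k \<le> 1" for k using J(1)[of k] by (auto simp: \<rho>'_def)
  moreover have "th k = (\<Sum>i<Suc n. (1 / 2) ^ Suc i * (if k \<in> J' i then 1 else 0)) + (1 / 2) ^ Suc n * \<rho>' k" for k
  proof -
    have "(\<Sum>i<n. (1 / 2) ^ Suc i * (if k \<in> J' i then 1 else 0)) = (\<Sum>i<n. (1 / 2::real) ^ Suc i * (if k \<in> J i then 1 else 0))"
      by (intro sum.cong) (auto simp: J'_def)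
    then show ?thesis by (simp add: J(2)[of k] J'_def \<rho>'_def algebra_simps)
  qed
  ultimately show ?case by blast
qed

text \<open>Binary digits write a multiplier as a series of projections with geometric weights. The
  series is cut off where the crude coordinatewise bound of the remainder is small.\<close>

lemma multiplier_bound:
  assumes v: "v \<in> car X" and kr: "1 \<le> kr" and proj: "\<And>J. J \<subseteq> {..<r} \<Longrightarrow> qnorm X (\<Sum>k\<in>J. smul X (xi k v) (x k)) \<le> kr * qnorm X v"
    and th: "\<And>k. 0 \<le> th k \<and> th k \<le> (1::real)"
  shows "qnorm X (\<Sum>k<r. smul X (of_real (th k) * xi k v) (x k)) \<le> (Cp * (1 / (1 - (1 / 2) powr p) + 1)) powr (1 / p) * kr * qnorm X v"
proof -
  let ?h = "(1 / 2 :: real) powr p"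
  have h: "0 < ?h" "?h < 1" using p_pos powr_less_mono2[of p "1 / 2" 1] by auto
  define Q where "Q = qnorm X v"
  have Q: "0 \<le> Q" using v by (simp add: Q_def)
  have "(\<lambda>n. real r * Kc powr p * ?h ^ n) \<longlonglongrightarrow> real r * Kc powr p * 0"
    using h by (intro tendsto_intros LIMSEQ_power_zero) auto
  then have "eventually (\<lambda>n. real r * Kc powr p * ?h ^ n < 1) sequentially"
    by (intro order_tendstoD(2)) auto
  then obtain n where n: "real r * Kc powr p * ?h ^ n < 1" unfolding eventually_sequentially by blast
  have hp: "((1 / 2 :: real) ^ i) powr p = ?h ^ i" for i
    by (simp add: powr_powr mult.commute flip: powr_realpow)
  obtain J \<rho> where JJ: "(\<forall>k. 0 \<le> \<rho> k \<and> \<rho> k \<le> (1::real)) \<and>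
    (\<forall>k. th k = (\<Sum>i<n. (1 / 2) ^ Suc i * (if k \<in> J i then 1 else 0)) + (1 / 2) ^ n * \<rho> k)"
    using binary_digits[of th n, OF th] by (elim exE) (rule that)
  have J: "0 \<le> \<rho> k \<and> \<rho> k \<le> 1"
    "th k = (\<Sum>i<n. (1 / 2) ^ Suc i * (if k \<in> J i then 1 else 0)) + (1 / 2) ^ n * \<rho> k" for k
    using JJ[THEN conjunct1, rule_format, of k] JJ[THEN conjunct2, rule_format, of k] by auto
  \<comment> \<open>The n weighted projections and the r remainder terms are put into one family, so
    p-convexity is applied once. The first part sums to a geometric series, and n was chosen so that
    the second contributes at most 1; hence the two terms in the constant.\<close>
  define u where "u i = (if i < n then smul X (of_real ((1 / 2) ^ Suc i)) (\<Sum>k\<in>J i \<inter> {..<r}. smul X (xi k v) (x k))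
      else smul X (of_real ((1 / 2) ^ n * \<rho> (i - n)) * xi (i - n) v) (x (i - n)))" for i
  have eq: "(\<Sum>k<r. smul X (of_real (th k) * xi k v) (x k)) = (\<Sum>i<n + r. u i)"
  proof -
    have "smul X (of_real (th k) * xi k v) (x k)
        = (\<Sum>i<n. smul X (of_real ((1 / 2) ^ Suc i * (if k \<in> J i then 1 else 0)) * xi k v) (x k))
          + smul X (of_real ((1 / 2) ^ n * \<rho> k) * xi k v) (x k)" for k
      unfolding J(2)[of k] of_real_add of_real_sum distrib_right X.scale_left_distrib sum_distrib_right X.scale_sum_left ..
    then have "(\<Sum>k<r. smul X (of_real (th k) * xi k v) (x k))
        = (\<Sum>i<n. \<Sum>k<r. smul X (of_real ((1 / 2) ^ Suc i * (if k \<in> J i then 1 else 0)) * xi k v) (x k))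
          + (\<Sum>k<r. u (n + k))"
      by (subst sum.swap) (simp add: sum.distrib u_def)
    also have "(\<Sum>i<n. \<Sum>k<r. smul X (of_real ((1 / 2) ^ Suc i * (if k \<in> J i then 1 else 0)) * xi k v) (x k)) = (\<Sum>i<n. u i)"
    proof (intro sum.cong refl)
      fix i assume "i \<in> {..<n}"
      then have "u i = (\<Sum>k\<in>J i \<inter> {..<r}. smul X (of_real ((1 / 2) ^ Suc i) * xi k v) (x k))"
        by (simp add: u_def X.scale_sum_right del: power_Suc of_real_power)
      also have "\<dots> = (\<Sum>k<r. smul X (of_real ((1 / 2) ^ Suc i * (if k \<in> J i then 1 else 0)) * xi k v) (x k))"
        by (intro sum.mono_neutral_cong_left) auto
      finally show "(\<Sum>k<r. smul X (of_real ((1 / 2) ^ Suc i * (if k \<in> J i then 1 else 0)) * xi k v) (x k)) = u i" ..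
    qed
    also have "(\<Sum>i<n. u i) + (\<Sum>k<r. u (n + k)) = (\<Sum>i<n + r. u i)"
      by (induction r) (simp_all add: add.assoc[symmetric])
    finally show ?thesis .
  qed
  have uc: "u i \<in> car X" for i by (simp add: u_def)
  have u1: "qnorm X (u i) powr p \<le> ?h ^ i * (kr * Q) powr p" if "i < n" for i
  proof -
    have "qnorm X (u i) = (1 / 2) ^ Suc i * qnorm X (\<Sum>k\<in>J i \<inter> {..<r}. smul X (xi k v) (x k))"
      using that by (simp add: u_def X.qnorm_scale norm_mult norm_power norm_divide)
    also have "\<dots> \<le> (1 / 2) ^ i * (kr * Q)"
      using proj[of "J i \<inter> {..<r}"] X.qnorm_nonneg[OF sum_x_car] unfolding Q_def
      by (intro mult_mono) auto
    finally have "qnorm X (u i) powr p \<le> ((1 / 2) ^ i * (kr * Q)) powr p"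
      using p_pos uc by (intro powr_mono2) auto
    then show ?thesis using Q kr by (simp only: powr_mult hp)
  qed
  have u2: "qnorm X (u i) powr p \<le> ?h ^ n * (Kc * Q) powr p" if "n \<le> i" for i
  proof -
    have "qnorm X (u i) = (1 / 2) ^ n * \<rho> (i - n) * norm (xi (i - n) v)"
      using that J(1)[of "i - n"] by (simp add: u_def qnorm_x norm_mult norm_power norm_divide)
    also have "\<dots> \<le> (1 / 2) ^ n * 1 * (Kc * Q)"
      using xi_bound[OF v, of "i - n"] J(1)[of "i - n"] unfolding Q_def by (intro mult_mono) auto
    finally have "qnorm X (u i) powr p \<le> ((1 / 2) ^ n * (Kc * Q)) powr p"
      using p_pos uc by (intro powr_mono2) auto
    then show ?thesis using Q Kc_pos by (simp only: powr_mult hp)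
  qed
  have "(\<Sum>i<n + r. qnorm X (u i) powr p) = (\<Sum>i<n. qnorm X (u i) powr p) + (\<Sum>k<r. qnorm X (u (n + k)) powr p)"
    by (induction r) (simp_all add: add.assoc[symmetric])
  also have "\<dots> \<le> (\<Sum>i<n. ?h ^ i * (kr * Q) powr p) + (\<Sum>k<r. ?h ^ n * (Kc * Q) powr p)"
    by (intro add_mono sum_mono u1 u2) auto
  also have "\<dots> = (\<Sum>i<n. ?h ^ i) * (kr * Q) powr p + (real r * Kc powr p * ?h ^ n) * Q powr p"
    using Kc_pos Q unfolding sum_distrib_right by (simp add: powr_mult mult_ac)
  also have "\<dots> \<le> (1 / (1 - ?h)) * (kr * Q) powr p + 1 * (kr * Q) powr p"
  proof (intro add_mono mult_right_mono mult_mono)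
    have "(\<Sum>i<n. ?h ^ i) = (1 - ?h ^ n) / (1 - ?h)" using h by (subst sum_gp_strict) auto
    also have "\<dots> \<le> 1 / (1 - ?h)" using h by (intro divide_right_mono) auto
    finally show "(\<Sum>i<n. ?h ^ i) \<le> 1 / (1 - ?h)" .
    show "Q powr p \<le> (kr * Q) powr p"
      using kr Q p_pos mult_right_mono[of 1 kr Q] by (intro powr_mono2) auto
  qed (use n in auto)
  finally have le: "(\<Sum>i<n + r. qnorm X (u i) powr p) \<le> (1 / (1 - ?h) + 1) * (kr * Q) powr p"
    by (simp only: distrib_right)
  have "qnorm X (\<Sum>i<n + r. u i) powr p \<le> Cp * (\<Sum>i<n + r. qnorm X (u i) powr p)"
    by (rule p_sum) (use uc in auto)
  also have "\<dots> \<le> Cp * ((1 / (1 - ?h) + 1) * (kr * Q) powr p)"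
    using le Cp_ge by (intro mult_left_mono) auto
  also have "\<dots> = ((Cp * (1 / (1 - ?h) + 1)) powr (1 / p) * kr * Q) powr p"
  proof -
    have "0 \<le> Cp * (1 / (1 - ?h) + 1)" using h Cp_ge by simp
    moreover have "(W powr (1 / p) * kr * Q) powr p = W * (kr * Q) powr p" if "0 \<le> W" for W
      using that kr Q p_pos by (simp add: powr_mult powr_powr)
    ultimately show ?thesis by (simp only: mult.assoc)
  qed
  finally have "qnorm X (\<Sum>i<n + r. u i) \<le> (Cp * (1 / (1 - ?h) + 1)) powr (1 / p) * kr * Q"
    using kr Q uc X.qnorm_nonneg[OF X.car_sum[of "{..<n + r}" u]] by (subst (asm) powr_p_le_iff) auto
  then show ?thesis unfolding eq Q_def .
qed

text \<open>Hoelder's inequality between the exponents p and q, obtained from Young's inequality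
  with weights \<open>p / q\<close> and \<open>1 - p / q\<close> against the mean M of the q-th
  powers. The case \<open>M = 0\<close> is separate because the argument divides by a power of
  M.\<close>

lemma power_mean:
  assumes "\<And>k. k < r \<Longrightarrow> 0 \<le> \<tau> k" "1 \<le> r"
  shows "(\<Sum>k<r. \<tau> k powr p) powr (1 / p) \<le> real r powr (1 / p - 1 / q) * (\<Sum>k<r. \<tau> k powr q) powr (1 / q)"
proof -
  define \<alpha> where "\<alpha> = p / q"
  have \<alpha>: "0 < \<alpha>" "\<alpha> < 1" using p_pos p_le q_gt by (auto simp: \<alpha>_def)
  define M where "M = (\<Sum>k<r. \<tau> k powr q) / real r"
  have M: "0 \<le> M" by (simp add: M_def sum_nonneg)
  have "(\<Sum>k<r. \<tau> k powr p) \<le> real r * M powr \<alpha>"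
  proof (cases "M = 0")
    case True
    then have "(\<Sum>k<r. \<tau> k powr q) = 0" using assms by (simp add: M_def)
    then have "\<tau> k = 0" if "k < r" for k using that by (subst (asm) sum_nonneg_eq_0_iff) auto
    then show ?thesis using True by simp
  next
    case False
    with M have M: "0 < M" by simp
    have "\<tau> k powr p * M powr (1 - \<alpha>) \<le> \<alpha> * \<tau> k powr q + (1 - \<alpha>) * M" if "k < r" for k
    proof -
      have "\<tau> k powr p = (\<tau> k powr q) powr \<alpha>" using q_gt by (simp add: powr_powr \<alpha>_def)
      then show ?thesis
        using Youngs_inequality_0[of \<alpha> "1 - \<alpha>" "\<tau> k powr q" M] \<alpha> M by (cases "\<tau> k = 0") auto
    qed
    then have "(\<Sum>k<r. \<tau> k powr p * M powr (1 - \<alpha>)) \<le> (\<Sum>k<r. \<alpha> * \<tau> k powr q + (1 - \<alpha>) * M)"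
      by (intro sum_mono) auto
    also have "\<dots> = \<alpha> * (real r * M) + (1 - \<alpha>) * (real r * M)"
      using assms by (simp add: sum.distrib M_def flip: sum_distrib_left)
    also have "\<dots> = real r * M powr \<alpha> * M powr (1 - \<alpha>)"
      using M by (simp add: algebra_simps flip: powr_add)
    finally have "(\<Sum>k<r. \<tau> k powr p) * M powr (1 - \<alpha>) \<le> (real r * M powr \<alpha>) * M powr (1 - \<alpha>)"
      by (simp add: sum_distrib_right)
    then show ?thesis using M by simp
  qed
  then have "(\<Sum>k<r. \<tau> k powr p) powr (1 / p) \<le> (real r * M powr \<alpha>) powr (1 / p)"
    using p_pos by (intro powr_mono2) (auto intro: sum_nonneg)
  also have "\<dots> = real r powr (1 / p) * M powr (1 / q)"
    using M p_pos by (simp add: powr_mult powr_powr \<alpha>_def)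
  also have "M powr (1 / q) = (\<Sum>k<r. \<tau> k powr q) powr (1 / q) / real r powr (1 / q)"
    unfolding M_def by (rule powr_divide)
  finally show ?thesis by (simp add: powr_diff mult_ac)
qed

text \<open>The index bound \<open>R r + N r\<close> ends just before block r, so only r blocks can
  be cut. Their constants have norm at most \<open>Kc * G\<close> each, and the upper s-estimate
  adds them in S. In X, cutting multiplies the coefficients of y by the fractions
  \<open>th k\<close>, which costs the projection constant \<open>kr\<close>; the means of the lift
  lie in l_q by the lower q-estimate and are summed by p-convexity, which costs
  \<open>r powr (1 / p - 1 / q)\<close>.\<close>

lemma projection_upper:
  "\<exists>C\<ge>0. \<forall>r kr y w G A. 1 \<le> r \<and> 1 \<le> kr \<and> small y w G \<and> A \<subseteq> {..<R r + N r} \<and>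
     (\<forall>J\<subseteq>{..<r}. qnorm X (\<Sum>k\<in>J. smul X (xi k y) (x k)) \<le> kr * qnorm X y) \<longrightarrow>
     bnd A (g y w) (C * (kr + real r powr (1 / s) + real r powr (1 / p - 1 / q)) * G)"
proof -
  define Cm where "Cm = (Cp * (1 / (1 - (1 / 2) powr p) + 1)) powr (1 / p)"
  define Cq' where "Cq' = Cp powr (1 / p) * 2 * (Cq * 5)"
  define CS where "CS = 25 + 5 * (Cs * Kc)"
  define CX where "CX = X.kap * (Cq' + Cm)"
  define C where "C = CS + CX"
  have pos: "0 \<le> Cm" "0 \<le> Cq'" "0 \<le> CS" using Cq_ge Cs_ge Kc_pos by (auto simp: Cm_def Cq'_def CS_def)
  have CX0: "0 \<le> CX" using pos X.kap_ge by (auto simp: CX_def)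
  have main: "bnd A (g y w) (C * (kr + real r powr (1 / s) + real r powr (1 / p - 1 / q)) * G)"
    if r: "1 \<le> r" and kr: "1 \<le> kr" and sm: "small y w G" and AR: "A \<subseteq> {..<R r + N r}"
      and proj: "\<And>J. J \<subseteq> {..<r} \<Longrightarrow> qnorm X (\<Sum>k\<in>J. smul X (xi k y) (x k)) \<le> kr * qnorm X y"
    for r kr y w G A
  proof -
    define \<Theta> where "\<Theta> = kr + real r powr (1 / s) + real r powr (1 / p - 1 / q)"
    have G: "0 \<le> G" using small_nonneg[OF sm] .
    have y: "y \<in> car X" "qnorm X y \<le> G" using sm by (auto simp: small_def)
    have A: "finite A" using AR finite_subset by blast
    have empty: "A \<inter> sg k = {}" if "r \<le> k" for k
    proof -
      have "R r + N r \<le> R k + N k" using that by (intro add_mono) (simp_all add: R_le_iff N_le_iff)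
      then show ?thesis using AR by (fastforce simp: sg_def)
    qed
    have T1: "kr \<le> \<Theta>" "real r powr (1 / s) \<le> \<Theta>" "real r powr (1 / p - 1 / q) \<le> \<Theta>"
      using kr by (auto simp: \<Theta>_def)
    have T2: "1 \<le> \<Theta>" using T1(1) kr by linarith
    have S: "qnorm S (\<Sum>m\<in>A. smul S (g y w m) (be m)) \<le> CS * (\<Theta> * G)"
    proof -
      have dj: "disjoint_family_on sg {..<r}"
        unfolding disjoint_family_on_def using sg_disjoint by blast
      have "nu A (\<lambda>n. norm (cc y n)) \<le> nu (\<Union>k<r. sg k) (\<lambda>n. norm (cc y n))"
      proof (rule nu_mono[OF A])
        fix n assume n: "n \<in> A"
        show "\<bar>norm (cc y n)\<bar> \<le> (if n \<in> (\<Union>k<r. sg k) then \<bar>norm (cc y n)\<bar> else 0)"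
        proof (cases "diag n")
          case True
          then have "n \<in> sg (rnd n)" by (simp add: mem_sg)
          moreover have "rnd n < r" using empty[of "rnd n"] n calculation by (meson disjoint_iff not_le)
          ultimately show ?thesis by auto
        qed (simp add: cc_def)
      qed simp
      also have "\<dots> \<le> Cs * (\<Sum>k<r. nu (sg k) (\<lambda>n. norm (cc y n)) powr s) powr (1 / s)"
        by (rule nu_upper[OF dj]) simp
      also have "\<dots> \<le> Cs * (\<Sum>k<r. (Kc * G) powr s) powr (1 / s)"
      proof (intro mult_left_mono powr_mono2 sum_mono)
        fix k
        have "nu (sg k) (\<lambda>n. norm (cc y n)) \<le> Kc * G / lam k * Lam (len k)"
        proof (rule nu_le_const)
          fix n assume "n \<in> sg k"
          then show "\<bar>norm (cc y n)\<bar> \<le> Kc * G / lam k"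
            using small_cc[OF sm, of n k] lam_pos[of k] by (simp add: field_simps)
        qed (use Kc_pos G lam_pos[of k] in auto)
        then show "nu (sg k) (\<lambda>n. norm (cc y n)) \<le> Kc * G" by (simp flip: lam_def)
      qed (use s_gt Cs_ge nu_nonneg in \<open>auto intro: sum_nonneg\<close>)
      also have "\<dots> = Cs * Kc * (real r powr (1 / s) * G)"
        using s_gt Kc_pos G by (simp add: powr_mult powr_powr)
      also have "\<dots> \<le> Cs * Kc * (\<Theta> * G)"
        using T1 G Cs_ge Kc_pos by (intro mult_left_mono mult_right_mono) auto
      finally have "5 * nu A (\<lambda>n. norm (cc y n)) \<le> 5 * (Cs * Kc) * (\<Theta> * G)" by simp
      moreover have "25 * G \<le> 25 * (\<Theta> * G)" using T2 G mult_right_mono[of 1 \<Theta> G] by simp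
      ultimately show ?thesis
        using qnorm_sum_be[OF A, of "cc y"] qnorm_be_g[OF sm A] unfolding CS_def distrib_right by linarith
    qed
    have Xb: "qnorm X (\<Sum>m\<in>A. smul X (g y w m) (bx m)) \<le> CX * (\<Theta> * G)"
    proof -
      have AK: "A \<subseteq> {..<R (Suc r)}" using AR by (auto simp: R_Suc N_Suc)
      define z1 where "z1 k = of_real (lam k / real (len k)) * (\<Sum>n\<in>A \<inter> sg k. uw w n)" for k
      define th where "th k = real (card (A \<inter> sg k)) / real (len k)" for k
      have th: "0 \<le> th k \<and> th k \<le> 1" for k
        using card_mono[of "sg k" "A \<inter> sg k"] by (auto simp: th_def divide_le_eq_1)
      have z: "of_real (lam k / real (len k)) * (\<Sum>n\<in>A \<inter> sg k. g y w n) = z1 k + of_real (th k) * xi k y" for k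
      proof -
        have "(\<Sum>n\<in>A \<inter> sg k. cc y n) = (\<Sum>n\<in>A \<inter> sg k. xi k y / of_real (lam k))"
          by (intro sum.cong) (auto simp: cc_def mem_sg)
        also have "\<dots> = of_nat (card (A \<inter> sg k)) * (xi k y / of_real (lam k))" by simp
        finally have "of_real (lam k / real (len k)) * (\<Sum>n\<in>A \<inter> sg k. cc y n) = of_real (th k) * xi k y"
          using len_pos[of k] lam_pos[of k] by (simp add: th_def of_real_divide)
        then show ?thesis by (simp only: g_def sum.distrib distrib_left z1_def)
      qed
      have eq: "(\<Sum>m\<in>A. smul X (g y w m) (bx m)) = (\<Sum>k<r. smul X (z1 k) (x k)) + (\<Sum>k<r. smul X (of_real (th k) * xi k y) (x k))"
      proof -
        have "z1 r = 0" "th r = 0" by (simp_all add: z1_def th_def empty)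
        then show ?thesis
          unfolding sum_bx[OF AK] z by (simp add: X.scale_left_distrib sum.distrib)
      qed
      have b1: "qnorm X (\<Sum>k<r. smul X (z1 k) (x k)) \<le> Cq' * (real r powr (1 / p - 1 / q) * G)"
      proof -
        define \<tau> where "\<tau> k = nu (A \<inter> sg k) (\<lambda>n. norm (uw w n))" for k
        have \<tau>: "0 \<le> \<tau> k" for k using A by (simp add: \<tau>_def nu_nonneg)
        have z1\<tau>: "norm (z1 k) \<le> 2 * \<tau> k" for k
        proof -
          have "norm (z1 k) \<le> lam k / real (len k) * (\<Sum>n\<in>A \<inter> sg k. \<bar>norm (uw w n)\<bar>)"
            unfolding z1_def norm_mult norm_of_real
            using lam_pos[of k] by (intro mult_mono order_trans[OF norm_sum] sum_mono) auto
          also have "\<dots> \<le> 2 * \<tau> k" unfolding \<tau>_def by (rule block_mean) simp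
          finally show ?thesis .
        qed
        have "(\<Sum>k<r. \<tau> k powr q) powr (1 / q) \<le> Cq * nu (\<Union>k<r. A \<inter> sg k) (\<lambda>n. norm (uw w n))"
          unfolding \<tau>_def
        proof (rule nu_lower)
          show "disjoint_family_on (\<lambda>k. A \<inter> sg k) {..<r}"
            unfolding disjoint_family_on_def using sg_disjoint by blast
        qed (use A in auto)
        also have "\<dots> \<le> Cq * (5 * G)"
          using small_uw[OF sm, of "\<Union>k<r. A \<inter> sg k"] Cq_ge by (intro mult_left_mono) auto
        finally have lq: "(\<Sum>k<r. \<tau> k powr q) powr (1 / q) \<le> Cq * (5 * G)" .
        have "qnorm X (\<Sum>k<r. smul X (z1 k) (x k)) powr p \<le> Cp * (\<Sum>k<r. norm (z1 k) powr p)"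
          using p_sum[of "{..<r}" "\<lambda>k. smul X (z1 k) (x k)"] by (simp add: qnorm_x)
        also have "\<dots> \<le> Cp * (\<Sum>k<r. (2 * \<tau> k) powr p)"
          using Cp_ge p_pos z1\<tau> by (intro mult_left_mono sum_mono powr_mono2) auto
        also have "\<dots> = Cp * 2 powr p * (\<Sum>k<r. \<tau> k powr p)"
          using \<tau> by (simp add: powr_mult sum_distrib_left mult_ac)
        finally have "(qnorm X (\<Sum>k<r. smul X (z1 k) (x k)) powr p) powr (1 / p) \<le> (Cp * 2 powr p * (\<Sum>k<r. \<tau> k powr p)) powr (1 / p)"
          using p_pos by (intro powr_mono2) auto
        then have "qnorm X (\<Sum>k<r. smul X (z1 k) (x k)) \<le> Cp powr (1 / p) * 2 * (\<Sum>k<r. \<tau> k powr p) powr (1 / p)"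
          using p_pos Cp_ge by (simp add: powr_powr powr_mult sum_nonneg)
        also have "\<dots> \<le> Cp powr (1 / p) * 2 * (real r powr (1 / p - 1 / q) * (\<Sum>k<r. \<tau> k powr q) powr (1 / q))"
          using power_mean[of r \<tau>] \<tau> r by (intro mult_left_mono) auto
        also have "\<dots> \<le> Cp powr (1 / p) * 2 * (real r powr (1 / p - 1 / q) * (Cq * (5 * G)))"
          using lq by (intro mult_left_mono) auto
        finally show ?thesis by (simp add: Cq'_def mult_ac)
      qed
      have b2: "qnorm X (\<Sum>k<r. smul X (of_real (th k) * xi k y) (x k)) \<le> Cm * (kr * G)"
      proof -
        have "qnorm X (\<Sum>k<r. smul X (of_real (th k) * xi k y) (x k)) \<le> Cm * kr * qnorm X y"
          unfolding Cm_def by (rule multiplier_bound[OF y(1) kr proj th])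
        also have "\<dots> \<le> Cm * kr * G" using y(2) pos kr by (intro mult_left_mono) auto
        finally show ?thesis by simp
      qed
      have "qnorm X (\<Sum>m\<in>A. smul X (g y w m) (bx m))
          \<le> X.kap * (qnorm X (\<Sum>k<r. smul X (z1 k) (x k)) + qnorm X (\<Sum>k<r. smul X (of_real (th k) * xi k y) (x k)))"
        unfolding eq by (intro X.qnorm_add sum_x_car)
      also have "\<dots> \<le> X.kap * (Cq' * (\<Theta> * G) + Cm * (\<Theta> * G))"
      proof (intro mult_left_mono add_mono)
        show "qnorm X (\<Sum>k<r. smul X (z1 k) (x k)) \<le> Cq' * (\<Theta> * G)"
          using b1 T1(3) G pos by (elim order_trans) (intro mult_left_mono mult_right_mono)
        show "qnorm X (\<Sum>k<r. smul X (of_real (th k) * xi k y) (x k)) \<le> Cm * (\<Theta> * G)"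
          using b2 T1(1) G pos by (elim order_trans) (intro mult_left_mono mult_right_mono)
      qed (use X.kap_ge in auto)
      also have "\<dots> = CX * (\<Theta> * G)" by (simp add: CX_def algebra_simps)
      finally show ?thesis .
    qed
    have TG: "0 \<le> \<Theta> * G" using T2 G by simp
    have "CS * (\<Theta> * G) \<le> C * \<Theta> * G" "CX * (\<Theta> * G) \<le> C * \<Theta> * G"
      using pos CX0 TG unfolding C_def by (simp_all add: mult.assoc distrib_right)
    then show ?thesis using S Xb unfolding bnd_def \<Theta>_def[symmetric] by linarith
  qed
  have C_nonneg: "0 \<le> C" using pos CX0 by (simp add: C_def)
  show ?thesis by (intro exI[of _ C] conjI allI impI; (elim conjE)?; (rule C_nonneg | rule main); auto)
qed

end

section \<open>The Schauder basis of the direct sum\<close>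

lemma quasi_normed_direct_sum:
  assumes "quasi_normed E" "quasi_normed F"
  shows "quasi_normed (E \<oplus>\<^sub>q F)"
proof -
  interpret E: quasi_normed E by fact
  interpret F: quasi_normed F by fact
  have vs: "vector_space (smul (E \<oplus>\<^sub>q F))"
    by unfold_locales
      (auto simp: direct_sum_def E.scale_right_distrib F.scale_right_distrib E.scale_left_distrib F.scale_left_distrib)
  show ?thesis
  proof
    show "lin_space (E \<oplus>\<^sub>q F)"
      unfolding lin_space_def
    proof (intro conjI vs)
      have m: "module (smul (E \<oplus>\<^sub>q F))" using vs by (simp add: module_iff_vector_space)
      show "module.subspace (smul (E \<oplus>\<^sub>q F)) (car (E \<oplus>\<^sub>q F))"
        by (rule module.subspaceI[OF m]) (auto simp: direct_sum_def zero_prod_def)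
    qed
    let ?k = "E.kap + F.kap"
    show "quasi_norm_on (E \<oplus>\<^sub>q F) (qnorm (E \<oplus>\<^sub>q F))"
      unfolding quasi_norm_on_def
    proof (intro conjI exI[of _ ?k] ballI allI)
      fix v assume v: "v \<in> car (E \<oplus>\<^sub>q F)"
      then obtain a c where ac: "v = (a, c)" "a \<in> car E" "c \<in> car F" by (auto simp: direct_sum_def)
      show "0 \<le> qnorm (E \<oplus>\<^sub>q F) v" using ac by (simp add: direct_sum_def le_max_iff_disj)
      show "(qnorm (E \<oplus>\<^sub>q F) v = 0) = (v = 0)"
      proof -
        have "max s t = 0 \<longleftrightarrow> s = 0 \<and> t = 0" if "0 \<le> s" "0 \<le> t" for s t :: real
          using that by (auto simp: max_def)
        then show ?thesis using ac by (simp add: direct_sum_def zero_prod_def)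
      qed
      show "qnorm (E \<oplus>\<^sub>q F) (smul (E \<oplus>\<^sub>q F) t v) = norm t * qnorm (E \<oplus>\<^sub>q F) v" for t
        using ac by (simp add: direct_sum_def E.qnorm_scale F.qnorm_scale max_mult_distrib_left)
    next
      fix u v assume "u \<in> car (E \<oplus>\<^sub>q F)" "v \<in> car (E \<oplus>\<^sub>q F)"
      then obtain a c a' c' where ac: "u = (a, c)" "v = (a', c')" "a \<in> car E" "c \<in> car F" "a' \<in> car E" "c' \<in> car F"
        by (auto simp: direct_sum_def)
      have k: "0 \<le> E.kap" "0 \<le> F.kap" using E.kap_ge F.kap_ge by auto
      let ?M = "max (qnorm E a) (qnorm F c) + max (qnorm E a') (qnorm F c')"
      have "0 \<le> ?M" using ac by (intro add_nonneg_nonneg) (auto simp: le_max_iff_disj)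
      then have "E.kap * ?M \<le> ?k * ?M" "F.kap * ?M \<le> ?k * ?M" using k by (auto intro!: mult_right_mono)
      moreover have "qnorm E (a + a') \<le> E.kap * ?M"
        using k by (intro order_trans[OF E.qnorm_add[OF ac(3,5)]] mult_left_mono add_mono) auto
      moreover have "qnorm F (c + c') \<le> F.kap * ?M"
        using k by (intro order_trans[OF F.qnorm_add[OF ac(4,6)]] mult_left_mono add_mono) auto
      ultimately show "qnorm (E \<oplus>\<^sub>q F) (u + v) \<le> ?k * (qnorm (E \<oplus>\<^sub>q F) u + qnorm (E \<oplus>\<^sub>q F) v)"
        using ac by (simp add: direct_sum_def)
    qed
  qed
qed

context piece_sizes
begin

text \<open>The position \<open>R r + N r\<close> is where the last piece of round r starts. It is a
  boundary of pieces, so truncation there commutes with averaging.\<close>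

lemma P_subset_end:
  assumes "n < R r + N r" shows "P n \<subseteq> {..<R r + N r}"
proof (cases "n < R r")
  case True
  then show ?thesis using P_subset by fastforce
next
  case False
  then have n: "n = R r + (n - R r)" "n - R r < N (Suc r)" "n - R r < N r"
    using assms by (auto simp: N_Suc)
  have "rnd n = r" "off n = n - R r" using pos_eqs[OF n(2)] n(1) by auto
  moreover have "N (Suc (pc n)) \<le> N r"
    using pc_bounds(1)[of n] n(3) calculation N_less_iff[of "pc n" r] by (simp add: N_le_iff)
  ultimately show ?thesis unfolding P_def lo_wd by auto
qed

lemma av_outside_end:
  assumes "\<And>n. R r + N r \<le> n \<Longrightarrow> a n = 0" "R r + N r \<le> n" shows "av a n = 0"
proof (rule av_const)
  fix m assume m: "m \<in> P n"
  have "\<not> m < R r + N r"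
  proof
    assume "m < R r + N r"
    then show False using P_subset_end[of m r] P_eq[OF m] mem_P[of n] assms(2) by auto
  qed
  then show "a m = 0" using assms(1) by simp
qed

lemma T_outside_end:
  assumes "\<And>n. R r + N r \<le> n \<Longrightarrow> a n = 0" "R r + N r \<le> n" shows "T a n = 0"
proof -
  have "R r + N r \<le> up n" using strict_mono_imp_increasing[OF strict_mono_up, of n] assms(2) by linarith
  then show ?thesis
    unfolding T_def using assms av_outside_end[OF assms(1), where n = n] av_outside_end[OF assms(1), where n = "up n"] by simp
qed

lemma diag_before_end:
  assumes "n < R r + N r" "diag n" shows "rnd n < r"
proof (rule ccontr)
  assume "\<not> rnd n < r"
  then have "R r + N r \<le> R (rnd n) + N (rnd n)" by (intro add_mono) (simp_all add: R_le_iff N_le_iff)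
  then show False using assms mem_sg[of n "rnd n"] by (simp add: sg_def)
qed

text \<open>\<open>V\<close> moves averages one round forward. From below \<open>R r\<close> it can
  reach round r, but only pieces having a predecessor, and these all precede the last piece of the
  round.\<close>

lemma V_outside_end:
  assumes "\<And>n. R r \<le> n \<Longrightarrow> a n = 0" "R r + N r \<le> n" shows "V a n = 0"
proof -
  have n: "R r \<le> n" using assms(2) by simp
  have "av a (dn n) = 0" if nd: "\<not> diag n"
  proof (rule av_outside[OF assms(1)])
    show "R r \<le> dn n"
    proof (rule ccontr)
      assume "\<not> R r \<le> dn n"
      then have "R (rnd (dn n)) < R r" using rnd_bounds[of "dn n"] by simp
      then have "Suc (rnd (dn n)) \<le> r" by (simp add: R_less_iff)
      moreover have "rnd n = Suc (rnd (dn n))" using rnd_up[of "dn n"] up_dn[OF nd] by simp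
      ultimately have "rnd n \<le> r" by simp
      moreover have "off n < N (rnd n)"
        using pc_bounds(2)[of n] nd pc_le[of n] N_le_iff[of "Suc (pc n)" "rnd n"] by (simp add: diag_def)
      ultimately have "n < R r + N r"
        using split_pos[of n] R_le_iff[of "rnd n" r] N_le_iff[of "rnd n" r] by simp
      then show False using assms(2) by simp
    qed
  qed
  then show ?thesis using assms(1)[OF n] av_outside[OF assms(1) n] by (simp add: V_def)
qed

end

context block_construction
begin

abbreviation D where "D \<equiv> X \<oplus>\<^sub>q S"

sublocale D: quasi_normed D
  by (rule quasi_normed_direct_sum) unfold_locales

lemma car_D: "car D = car X \<times> car S" and smul_D: "smul D c (v, w) = (smul X c v, smul S c w)"
  and qnorm_D: "qnorm D (v, w) = max (qnorm X v) (qnorm S w)"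
  by (simp_all add: direct_sum_def)

lemma sum_D: "(\<Sum>m\<in>A. smul D (a m) (b m)) = (\<Sum>m\<in>A. smul X (a m) (bx m), \<Sum>m\<in>A. smul S (a m) (be m))"
  by (rule prod_eqI) (simp_all add: fst_sum snd_sum b_def smul_D)

lemma b_car [simp]: "b m \<in> car D"
  by (simp add: b_def car_D)

lemma sum_b_car [simp]: "(\<Sum>m\<in>A. smul D (a m) (b m)) \<in> car D"
  by (intro D.car_sum D.car_scale b_car)

lemma bnd_D: "bnd A a B \<longleftrightarrow> qnorm D (\<Sum>m\<in>A. smul D (a m) (b m)) \<le> B"
  by (simp add: sum_D bnd_def qnorm_D)

lemma small_D: "y \<in> car X \<Longrightarrow> w \<in> car S \<Longrightarrow> small y w (qnorm D (y, w))"
  by (simp add: small_def qnorm_D)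

definition gD :: "nat \<Rightarrow> 'v \<times> (nat \<Rightarrow> 'k) \<Rightarrow> 'k" where "gD n f = g (fst f) (snd f) n"

lemma xi_sum: "finite F \<Longrightarrow> xi j (\<Sum>k\<in>F. smul X (z k) (x k)) = (if j \<in> F then z j else 0)"
proof (induction F rule: finite_induct)
  case empty
  show ?case using xi_scale[of 0 j 0] by simp
next
  case (insert k F)
  then show ?case by (auto simp: xi_add xi_scale xi_x)
qed

lemma eta_comb: "finite F \<Longrightarrow> eta (S.comb F a) n = (if n \<in> F then a n else 0)"
  unfolding S.comb_def by (rule S.coord_finite[OF S.basis])

lemma gD_add: "f \<in> car D \<Longrightarrow> f' \<in> car D \<Longrightarrow> gD n (f + f') = gD n f + gD n f'"
proof -
  assume "f \<in> car D" "f' \<in> car D"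
  then have c: "fst f \<in> car X" "snd f \<in> car S" "fst f' \<in> car X" "snd f' \<in> car S" by (auto simp: car_D)
  have "eta (snd f + snd f') = (\<lambda>n. eta (snd f) n + eta (snd f') n)"
    using c by (simp add: fun_eq_iff S.coord_add[OF S.basis])
  then show ?thesis
    using c by (simp add: gD_def g_def uw_def cc_def V_add xi_add add_divide_distrib)
qed

lemma gD_scale: "f \<in> car D \<Longrightarrow> gD n (smul D c f) = c * gD n f"
proof -
  assume "f \<in> car D"
  then obtain y w where f: "f = (y, w)" "y \<in> car X" "w \<in> car S" by (auto simp: car_D)
  have "eta (smul S c w) = (\<lambda>n. c * eta w n)"
    using f by (simp add: fun_eq_iff S.coord_scale[OF S.basis])
  then show ?thesis
    using f by (simp add: gD_def g_def uw_def cc_def V_scale xi_scale smul_D algebra_simps)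
qed

lemma gD_bound: "f \<in> car D \<Longrightarrow> norm (gD n f) \<le> (5 / Lam 1 + Kc / lam (rnd n)) * qnorm D f"
proof -
  assume "f \<in> car D"
  then obtain y w where f: "f = (y, w)" "y \<in> car X" "w \<in> car S" by (auto simp: car_D)
  note sm = small_D[OF f(2,3)]
  have L: "0 < Lam 1" by (rule Lam_pos) simp
  have "norm (uw w n) * Lam 1 \<le> nu {n} (\<lambda>n. norm (uw w n))"
    using nu_ge_const[of "{n}" "norm (uw w n)" "\<lambda>n. norm (uw w n)"] by simp
  also have "\<dots> \<le> 5 * qnorm D f" using small_uw[OF sm, of "{n}"] f(1) by simp
  finally have 1: "norm (uw w n) \<le> 5 / Lam 1 * qnorm D f" using L by (simp add: field_simps)
  have 2: "norm (cc y n) \<le> Kc / lam (rnd n) * qnorm D f"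
  proof -
    have "norm (cc y n) * lam (rnd n) \<le> Kc * qnorm D f"
    proof (cases "diag n")
      case True
      then show ?thesis using small_cc[OF sm, of n "rnd n"] f(1) by (simp add: mem_sg)
    next
      case False
      then show ?thesis using Kc_pos f by (simp add: cc_def car_D)
    qed
    then show ?thesis using lam_pos[of "rnd n"] by (simp add: field_simps)
  qed
  show ?thesis
    using norm_triangle_ineq[of "uw w n" "cc y n"] 1 2 f by (simp add: gD_def g_def distrib_right)
qed

lemma eta_be: "eta (be m) = T (unit_seq m)"
proof
  fix n
  have "T (unit_seq m) n = (0 :: 'k)" if "R (Suc (rnd m)) \<le> n"
    by (rule T_outside[OF _ that]) (use rnd_bounds(2)[of m] in \<open>auto simp: unit_seq_def\<close>)
  then show "eta (be m) n = T (unit_seq m) n"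
    by (auto simp: be_def eta_comb not_less)
qed

text \<open>By \<open>V_T\<close> the lift recovers the unit sequence except for its average on a
  last piece, and exactly this average is the value that \<open>cc\<close> produces from
  \<open>bx m\<close>.\<close>

lemma gD_b: "gD n (b m) = (if n = m then 1 else 0)"
proof (cases "diag n")
  case True
  let ?k = "rnd n"
  have n: "n \<in> sg ?k" using True by (simp add: mem_sg)
  have av: "av (unit_seq m) n = (if m \<in> sg ?k then 1 / of_nat (len ?k) else (0 :: 'k))"
    using n by (simp add: av_def P_sg wd_sg unit_seq_def)
  have "cc (bx m) n = (if m \<in> sg ?k then 1 / of_nat (len ?k) else 0)"
    using True lam_pos[of ?k] xi_scale[of 0 ?k 0]
    by (auto simp: cc_def bx_def mem_sg xi_scale xi_x of_real_divide)
  then show ?thesis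
    using True av by (simp add: gD_def g_def b_def uw_def eta_be V_T unit_seq_def)
next
  case False
  then show ?thesis by (simp add: gD_def g_def b_def uw_def eta_be V_T cc_def unit_seq_def)
qed

text \<open>In S this is \<open>T_V\<close> together with the vanishing of \<open>T\<close> on block
  constants, in X the evaluation of complete blocks. The identity is exact, so it serves both as the
  dense set for convergence and as a description of initial spans.\<close>

lemma reconstruction:
  assumes y: "y = (\<Sum>k<r. smul X (xi k y) (x k))" and w: "w = S.comb {..<R r} (eta w)"
    and M: "R r + N r \<le> M"
  shows "(\<Sum>n<M. smul D (gD n (y, w)) (b n)) = (y, w)"
proof -
  have eta0: "eta w n = 0" if "R r \<le> n" for n
    using eta_comb[of "{..<R r}" n "\<lambda>n. eta w n"] w that by simp
  have xi0: "xi k y = 0" if "r \<le> k" for k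
    using xi_sum[of "{..<r}" k "\<lambda>k. xi k y"] y that by simp
  have g0: "g y w n = 0" if "M \<le> n" for n
  proof -
    have n: "R r + N r \<le> n" using that M by simp
    have "V (eta w) n = 0" by (rule V_outside_end[OF eta0 n])
    moreover have "cc y n = 0"
    proof (cases "diag n")
      case True
      have "R r < R (Suc (rnd n))" using n rnd_bounds(2)[of n] by linarith
      then have "r \<le> rnd n" by (simp add: R_less_iff)
      then show ?thesis using xi0 by (simp add: cc_def)
    qed (simp add: cc_def)
    ultimately show ?thesis by (simp add: g_def uw_def)
  qed
  obtain K where K: "{..<M} \<subseteq> {..<R K}" using sub_R[of "{..<M}"] by auto
  have rK: "R r \<le> R K" using M K by auto
  have "(\<Sum>n<M. smul S (g y w n) (be n)) = S.comb {..<R K} (T (rs {..<M} (g y w)))" by (rule sum_be[OF K])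
  also have "rs {..<M} (g y w) = (\<lambda>n. V (eta w) n + cc y n)"
    using g0 by (auto simp: fun_eq_iff g_def uw_def not_less)
  also have "T \<dots> = eta w"
  proof
    fix n
    have "T (cc y) n = 0"
      by (rule T_diag_const[where c = "\<lambda>k. xi k y / of_real (lam k)"]) (simp add: cc_def)
    moreover have "T (V (eta w)) n = eta w n" by (rule T_V)
    ultimately show "T (\<lambda>n. V (eta w) n + cc y n) n = eta w n"
      using T_add[of "V (eta w)" "cc y" n] by simp
  qed
  also have "S.comb {..<R K} (eta w) = w"
  proof -
    have "S.comb {..<R K} (eta w) = S.comb {..<R r} (eta w)"
      using rK eta0 by (intro S.comb_neutral) auto
    then show ?thesis using w by simp
  qed
  finally have 1: "(\<Sum>n<M. smul S (g y w n) (be n)) = w" .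
  have "(\<Sum>n<M. smul X (g y w n) (bx n)) = (\<Sum>k<K. smul X (xi k y) (x k))"
  proof -
    have "(\<Sum>n\<in>{..<M} \<inter> sg k. g y w n) = (\<Sum>n\<in>sg k. g y w n)" for k
      using g0 by (intro sum.mono_neutral_left) (auto simp: not_le[symmetric])
    then show ?thesis unfolding sum_bx[OF K] by (simp only: sum_g_sg)
  qed
  also have "\<dots> = (\<Sum>k<r. smul X (xi k y) (x k))"
    using rK xi0 by (intro sum.mono_neutral_right) (auto simp: R_le_iff not_less)
  finally have 2: "(\<Sum>n<M. smul X (g y w n) (bx n)) = y" using y by simp
  show ?thesis unfolding sum_D using 1 2 by (simp add: gD_def)
qed

text \<open>Uniformly bounded partial sums together with exact reconstruction on a dense set: f is
  approximated by \<open>(y', w')\<close> of finite support, and the error is controlled through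
  \<open>f - (y', w')\<close> alone.\<close>

lemma expansion_b:
  assumes f: "f \<in> car D"
  shows "expansion D b (\<lambda>n. gD n f) f"
proof -
  obtain y w where yw: "f = (y, w)" "y \<in> car X" "w \<in> car S" using f by (auto simp: car_D)
  obtain C where C: "0 \<le> C" "\<And>y w G n. small y w G \<Longrightarrow> bnd {..<n} (g y w) (C * G)"
    using partial_sums by blast
  have step: "qnorm D ((\<Sum>n<M. smul D (gD n f) (b n)) - f) \<le> D.kap * (C * qnorm D (f - f') + qnorm D (f - f'))"
    if f': "f' \<in> car D" and rec: "(\<Sum>n<M. smul D (gD n f') (b n)) = f'" for f' M
  proof -
    let ?S = "\<lambda>f. \<Sum>n<M. smul D (gD n f) (b n)"
    have d: "f - f' \<in> car D" using f f' by simp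
    have "?S (f' + (f - f')) = ?S f' + ?S (f - f')"
      by (subst gD_add[OF f' d]) (simp add: D.scale_left_distrib sum.distrib)
    then have eq: "?S f - f = ?S (f - f') - (f - f')" using rec by simp
    have "small (fst (f - f')) (snd (f - f')) (qnorm D (f - f'))"
      using small_D[of "fst (f - f')" "snd (f - f')"] d by (simp add: car_D mem_Times_iff prod.collapse del: fst_diff snd_diff)
    from C(2)[OF this, of M] have "qnorm D (?S (f - f')) \<le> C * qnorm D (f - f')"
      by (simp add: bnd_D gD_def)
    then have "D.kap * (qnorm D (?S (f - f')) + qnorm D (f - f')) \<le> D.kap * (C * qnorm D (f - f') + qnorm D (f - f'))"
      using D.kap_ge by (intro mult_left_mono add_right_mono) auto
    then show ?thesis unfolding eq
      by (rule order_trans[OF D.qnorm_diff[OF sum_b_car d]])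
  qed
  show ?thesis
    unfolding expansion_def converges_to_def
  proof (rule LIMSEQ_I)
    fix e :: real assume e: "0 < e"
    define \<epsilon> where "\<epsilon> = e / (D.kap * (C + 1) + 1)"
    have kC: "0 < D.kap * (C + 1) + 1" using D.kap_ge C(1) by (simp add: add_nonneg_pos)
    have \<epsilon>: "0 < \<epsilon>" using e kC by (simp add: \<epsilon>_def)
    have "(\<lambda>n. qnorm X ((\<Sum>k<n. smul X (xi k y) (x k)) - y)) \<longlonglongrightarrow> 0"
      using xi_expansion[OF yw(2)] by (simp add: expansion_def converges_to_def)
    then have "eventually (\<lambda>n. qnorm X ((\<Sum>k<n. smul X (xi k y) (x k)) - y) < \<epsilon>) sequentially"
      using \<epsilon> by (intro order_tendstoD(2)) auto
    then obtain n1 where n1: "\<And>n. n1 \<le> n \<Longrightarrow> qnorm X ((\<Sum>k<n. smul X (xi k y) (x k)) - y) < \<epsilon>"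
      unfolding eventually_sequentially by blast
    have "(\<lambda>n. qnorm S ((\<Sum>k<n. smul S (eta w k) (unit_seq k)) - w)) \<longlonglongrightarrow> 0"
      using S.coord_expansion[OF S.basis yw(3)] by (simp add: expansion_def converges_to_def)
    then have "eventually (\<lambda>n. qnorm S ((\<Sum>k<n. smul S (eta w k) (unit_seq k)) - w) < \<epsilon>) sequentially"
      using \<epsilon> by (intro order_tendstoD(2)) auto
    then obtain n2 where n2: "\<And>n. n2 \<le> n \<Longrightarrow> qnorm S ((\<Sum>k<n. smul S (eta w k) (unit_seq k)) - w) < \<epsilon>"
      unfolding eventually_sequentially by blast
    define r where "r = max n1 n2"
    define y' where "y' = (\<Sum>k<r. smul X (xi k y) (x k))"
    define w' where "w' = S.comb {..<R r} (eta w)"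
    have c: "y' \<in> car X" "w' \<in> car S" by (simp_all add: y'_def w'_def)
    have "xi k y' = (if k < r then xi k y else 0)" for k
      unfolding y'_def by (simp add: xi_sum)
    then have y'r: "y' = (\<Sum>k<r. smul X (xi k y') (x k))" by (simp add: y'_def)
    have "eta w' n = (if n < R r then eta w n else 0)" for n
      unfolding w'_def by (simp add: eta_comb)
    then have w'r: "w' = S.comb {..<R r} (eta w')"
      unfolding w'_def by (intro S.comb_cong) simp
    have "qnorm X (y - y') < \<epsilon>" using n1[of r] X.qnorm_commute[OF yw(2) c(1)] by (simp add: y'_def r_def)
    moreover have "qnorm S (w - w') < \<epsilon>"
      using n2[of "R r"] R_ge[of r] S.qnorm_commute[OF yw(3) c(2)] by (simp add: w'_def r_def S.comb_def)
    ultimately have small': "qnorm D (f - (y', w')) < \<epsilon>" by (simp add: yw(1) qnorm_D)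
    have "norm (qnorm D ((\<Sum>n<M. smul D (gD n f) (b n)) - f) - 0) < e" if "R r + N r \<le> M" for M
    proof -
      let ?q = "qnorm D (f - (y', w'))"
      have fc: "(y', w') \<in> car D" using c by (simp add: car_D)
      have q0: "0 \<le> ?q" using f fc by simp
      have "qnorm D ((\<Sum>n<M. smul D (gD n f) (b n)) - f) \<le> D.kap * (C * ?q + ?q)"
        by (rule step[OF fc reconstruction[OF y'r w'r that]])
      also have "\<dots> \<le> (D.kap * (C + 1) + 1) * ?q" using q0 by (simp add: algebra_simps)
      also have "\<dots> < (D.kap * (C + 1) + 1) * \<epsilon>" using small' kC by (intro mult_strict_left_mono)
      also have "\<dots> = e" using kC by (simp add: \<epsilon>_def)
      finally show ?thesis using f by simp
    qed
    then show "\<exists>no. \<forall>n\<ge>no. norm (qnorm D ((\<Sum>n<n. smul D (gD n f) (b n)) - f) - 0) < e" by blast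
  qed
qed

lemma schauder_basis_b: "schauder_basis D b" and coord_b: "f \<in> car D \<Longrightarrow> coord D b n f = gD n f"
proof -
  have r: "range b \<subseteq> car D" by auto
  show "schauder_basis D b" "f \<in> car D \<Longrightarrow> coord D b n f = gD n f" for f n
  using D.schauder_basis_functionals[OF r gD_add gD_scale gD_bound gD_b expansion_b]
    D.coord_functionals[OF r gD_add gD_scale gD_bound gD_b expansion_b] by blast+
qed

end

section \<open>Greedy-type properties, local structure and conditionality\<close>

lemma op_norm_le:
  assumes "\<And>v. v \<in> car E \<Longrightarrow> qnorm E v \<le> 1 \<Longrightarrow> qnorm F (T v) \<le> C"
  shows "op_norm E F T \<le> ennreal C"
  unfolding op_norm_def by (rule SUP_least) (use assms in \<open>auto intro: ennreal_leI\<close>)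

context block_construction
begin

section \<open>Almost greediness and the fundamental function\<close>

lemma small_car: "f \<in> car D \<Longrightarrow> small (fst f) (snd f) (qnorm D f)"
  using small_D[of "fst f" "snd f"] by (simp add: car_D mem_Times_iff)

lemma coord_proj_b:
  "f \<in> car D \<Longrightarrow> finite A \<Longrightarrow> coord_proj D b A f = (\<Sum>n\<in>A. smul D (gD n f) (b n))"
  by (simp add: D.coord_proj_finite coord_b)

text \<open>Put \<open>f' = f - P_B f\<close>. Then \<open>f - P_A f\<close> equals
  \<open>f' - P_(A-B) f' + P_(B-A) f\<close>. The set \<open>A - B\<close> is greedy for
  \<open>f'\<close> with the same threshold t, so its projection is bounded. On \<open>B - A\<close>
  the coefficients of f are at most t, and \<open>card (B - A) \<le> card (A - B)\<close>; hence the
  last term is at most a multiple of \<open>t * Lam (card (A - B))\<close>, which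
  \<open>weak_lower\<close> bounds by the norm of \<open>f'\<close>.\<close>

lemma almost_greedy_b: "almost_greedy D b"
proof -
  obtain Cf where Cf: "0 \<le> Cf" "\<forall>A a t m. finite A \<and> card A \<le> m \<and> 0 \<le> t \<and> (\<forall>n\<in>A. norm (a n) \<le> t) \<longrightarrow>
      bnd A a (Cf * (t * Lam m))"
    using fundamental_upper by (elim exE conjE) (rule that)
  obtain Cw where Cw: "0 \<le> Cw" "\<forall>y w G F t. small y w G \<and> finite F \<and> 0 \<le> t \<and> (\<forall>n\<in>F. t \<le> norm (g y w n)) \<longrightarrow>
      t * Lam (card F) \<le> Cw * G"
    using weak_lower by (elim exE conjE) (rule that)
  obtain Cg where Cg: "0 \<le> Cg" "\<forall>y w G F t. small y w G \<and> finite F \<and> 0 < t \<and> (\<forall>n\<in>F. t \<le> norm (g y w n)) \<and>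
      (\<forall>n. n \<notin> F \<longrightarrow> norm (g y w n) \<le> t) \<longrightarrow> bnd F (g y w) (Cg * G)"
    using greedy_projection by (elim exE conjE) (rule that)
  let ?P = "\<lambda>A f. \<Sum>n\<in>A. smul D (gD n f) (b n)"
  define C where "C = D.kap * (D.kap * (1 + Cg) + Cf * Cw)"
  have k: "0 \<le> D.kap" using D.kap_ge by simp
  have C0: "0 \<le> C" using k Cf Cw Cg by (simp add: C_def)
  have "qnorm D (f - ?P A f) \<le> C * qnorm D (f - ?P B f)"
    if f: "f \<in> car D" and A: "finite A" and gr: "\<And>j k. j \<in> A \<Longrightarrow> k \<notin> A \<Longrightarrow> norm (gD k f) \<le> norm (gD j f)"
      and B: "finite B" "card B \<le> card A" for f A B
  proof (cases "A = {}")
    case True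
    then have "B = {}" using B by simp
    have "qnorm D f \<le> C * qnorm D f"
    proof -
      have "1 * 1 \<le> D.kap * (D.kap * (1 + Cg))" using D.kap_ge Cg(1) mult_mono[of 1 D.kap 1 "1 + Cg"]
        by (intro mult_mono) auto
      also have "\<dots> \<le> C" unfolding C_def using k Cf Cw by (intro mult_left_mono) auto
      finally show ?thesis using f mult_right_mono[of 1 C "qnorm D f"] by simp
    qed
    then show ?thesis using True \<open>B = {}\<close> by simp
  next
    case False
    define t where "t = Min ((\<lambda>n. norm (gD n f)) ` A)"
    have tA: "t \<le> norm (gD n f)" if "n \<in> A" for n using that A by (simp add: t_def)
    have "t \<in> (\<lambda>n. norm (gD n f)) ` A" unfolding t_def using A False by (intro Min_in) auto
    then obtain j where j: "j \<in> A" "t = norm (gD j f)" by blast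
    have toff: "norm (gD n f) \<le> t" if "n \<notin> A" for n using gr[OF j(1) that] j(2) by simp
    define f' where "f' = f - ?P B f"
    have Pc: "?P A f \<in> car D" for A f by simp
    have f': "f' \<in> car D" using f by (simp add: f'_def del: sum_b_car) (rule D.car_diff[OF f sum_b_car])
    have coord': "gD n f' = (if n \<in> B then 0 else gD n f)" for n
    proof -
      have "f' = f + smul D (- 1) (?P B f)" by (simp add: f'_def)
      then have "gD n f' = gD n f + gD n (smul D (- 1) (?P B f))"
        by (simp only: gD_add[OF f D.car_scale[OF sum_b_car]])
      also have "gD n (smul D (- 1) (?P B f)) = - 1 * gD n (?P B f)" by (rule gD_scale[OF sum_b_car])
      also have "gD n (?P B f) = (if n \<in> B then gD n f else 0)"
        using D.coord_finite[OF schauder_basis_b B(1), of n "\<lambda>n. gD n f"] coord_b[OF sum_b_car] by simp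
      finally show ?thesis by simp
    qed
    have key: "f - ?P A f = f' - ?P (A - B) f' + ?P (B - A) f"
    proof -
      have "?P (A - B) f' = ?P (A - B) f" using coord' by simp
      moreover have "?P A f = ?P (A - B) f + ?P (A \<inter> B) f"
        using A by (subst sum.union_disjoint[symmetric]) (auto intro: sum.cong)
      moreover have "?P B f = ?P (B - A) f + ?P (A \<inter> B) f"
        using B by (subst sum.union_disjoint[symmetric]) (auto intro: sum.cong)
      ultimately show ?thesis by (simp add: f'_def algebra_simps)
    qed
    define G where "G = qnorm D f'"
    have G: "0 \<le> G" using f' by (simp add: G_def)
    note sm = small_car[OF f', folded G_def]
    show ?thesis
    proof (cases "t = 0")
      \<comment> \<open>A zero threshold is excluded from the greedy estimate; here all coordinates
        off A vanish and f is its own projection.\<close>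
      case True
      have "f = ?P A f"
      proof (rule D.converges_to_unique[OF D.expansion_car])
        show "range b \<subseteq> car D" by auto
        show "converges_to D (\<lambda>N. \<Sum>n<N. smul D (gD n f) (b n)) f"
          using expansion_b[OF f] by (simp add: expansion_def)
        show "converges_to D (\<lambda>N. \<Sum>n<N. smul D (gD n f) (b n)) (?P A f)"
        proof -
          have "range b \<subseteq> car D" by auto
          from D.expansion_finite[OF this A, of "\<lambda>n. gD n f"] show ?thesis
            using toff True by (simp add: expansion_def)
        qed
      qed (use f in auto)
      then show ?thesis using C0 D.qnorm_nonneg[OF f'] f' by (simp flip: f'_def)
    next
      case False
      then have t: "0 < t" using j(2) by simp
      have "bnd (A - B) (g (fst f') (snd f')) (Cg * G)"
      proof (rule Cg(2)[rule_format], intro conjI)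
        show "small (fst f') (snd f') G" "finite (A - B)" "0 < t" using sm A t by auto
        show "\<forall>n\<in>A - B. t \<le> norm (g (fst f') (snd f') n)" using tA coord' by (simp flip: gD_def)
        show "\<forall>n. n \<notin> A - B \<longrightarrow> norm (g (fst f') (snd f') n) \<le> t" using toff coord' t by (simp flip: gD_def)
      qed
      then have 1: "qnorm D (?P (A - B) f') \<le> Cg * G" by (simp add: bnd_D gD_def)
      have cd: "card (B - A) \<le> card (A - B)"
        using A B by (simp add: card_Diff_subset_Int Int_commute)
      have "bnd (B - A) (g (fst f) (snd f)) (Cf * (t * Lam (card (A - B))))"
        using B cd t toff by (intro Cf(2)[rule_format] conjI) (auto simp flip: gD_def)
      then have "qnorm D (?P (B - A) f) \<le> Cf * (t * Lam (card (A - B)))" by (simp add: bnd_D gD_def)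
      also have "\<dots> \<le> Cf * (Cw * G)"
      proof (intro mult_left_mono Cf(1))
        show "t * Lam (card (A - B)) \<le> Cw * G"
        proof (rule Cw(2)[rule_format], intro conjI)
          show "small (fst f') (snd f') G" "finite (A - B)" "0 \<le> t" using sm A t by auto
          show "\<forall>n\<in>A - B. t \<le> norm (g (fst f') (snd f') n)" using tA coord' by (simp flip: gD_def)
        qed
      qed
      finally have 2: "qnorm D (?P (B - A) f) \<le> Cf * (Cw * G)" .
      have d: "f' - ?P (A - B) f' \<in> car D" by (rule D.car_diff[OF f' sum_b_car])
      have "D.kap * (qnorm D f' + qnorm D (?P (A - B) f')) \<le> D.kap * (G + Cg * G)"
        using 1 k by (intro mult_left_mono add_mono) (auto simp: G_def)
      then have "qnorm D (f' - ?P (A - B) f') \<le> D.kap * (G + Cg * G)"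
        by (rule order_trans[OF D.qnorm_diff[OF f' sum_b_car]])
      then have "D.kap * (qnorm D (f' - ?P (A - B) f') + qnorm D (?P (B - A) f)) \<le> D.kap * (D.kap * (G + Cg * G) + Cf * (Cw * G))"
        using 2 k by (intro mult_left_mono add_mono) auto
      then have "qnorm D (f - ?P A f) \<le> D.kap * (D.kap * (G + Cg * G) + Cf * (Cw * G))"
        unfolding key by (rule order_trans[OF D.qnorm_add[OF d sum_b_car]])
      also have "\<dots> = C * G" by (simp add: C_def algebra_simps)
      finally show ?thesis by (simp add: G_def f'_def)
    qed
  qed
  note main = this
  show ?thesis
    unfolding almost_greedy_def
  proof (intro exI[of _ C] ballI allI impI, elim conjE)
    fix f A and B :: "nat set" assume f: "f \<in> car D" and gs: "greedy_set D b f A" and B: "finite B" "card B \<le> card A"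
    have A: "finite A" using gs by (simp add: greedy_set_def)
    have "norm (gD k f) \<le> norm (gD j f)" if "j \<in> A" "k \<notin> A" for j k
      using gs that by (simp add: greedy_set_def coord_b[OF f])
    then have "qnorm D (f - ?P A f) \<le> C * qnorm D (f - ?P B f)"
      by (intro main f A B)
    then show "qnorm D (f - coord_proj D b A f) \<le> C * qnorm D (f - coord_proj D b B f)"
      by (simp add: coord_proj_b f A B)
  qed
qed

lemma Lambda_eq: "\<Lambda> S m = ennreal (Lam m)"
  by (simp add: \<Lambda>_def Lam_def S.nu_def S.comb_def)

lemma fundamental_b: "equivalent {1..} (fundamental_function D b) (\<Lambda> S)"
  unfolding equivalent_def lesssim_def
proof (intro conjI)
  obtain Cf where Cf: "0 \<le> Cf" "\<forall>A a t m. finite A \<and> card A \<le> m \<and> 0 \<le> t \<and> (\<forall>n\<in>A. norm (a n) \<le> t) \<longrightarrow>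
      bnd A a (Cf * (t * Lam m))"
    using fundamental_upper by (elim exE conjE) (rule that)
  show "\<exists>C. \<forall>m\<in>{1..}. fundamental_function D b m \<le> ennreal C * \<Lambda> S m"
  proof (intro exI[of _ Cf] ballI)
    fix m
    have "fundamental_function D b m \<le> ennreal (Cf * Lam m)"
      unfolding fundamental_function_def
    proof (rule SUP_least, clarify)
      fix A :: "nat set" and \<epsilon> :: "nat \<Rightarrow> 'k" assume "finite A" "card A \<le> m" "\<forall>n\<in>A. norm (\<epsilon> n) = 1"
      then have "bnd A \<epsilon> (Cf * (1 * Lam m))" by (intro Cf(2)[rule_format] conjI) auto
      then show "ennreal (qnorm D (\<Sum>n\<in>A. smul D (\<epsilon> n) (b n))) \<le> ennreal (Cf * Lam m)"
        by (intro ennreal_leI) (simp add: bnd_D)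
    qed
    then show "fundamental_function D b m \<le> ennreal Cf * \<Lambda> S m"
      using Cf(1) Lam_nonneg by (simp add: Lambda_eq ennreal_mult')
  qed
  obtain Cw where Cw: "0 \<le> Cw" "\<forall>y w G F t. small y w G \<and> finite F \<and> 0 \<le> t \<and> (\<forall>n\<in>F. t \<le> norm (g y w n)) \<longrightarrow>
      t * Lam (card F) \<le> Cw * G"
    using weak_lower by (elim exE conjE) (rule that)
  show "\<exists>C. \<forall>m\<in>{1..}. \<Lambda> S m \<le> ennreal C * fundamental_function D b m"
  proof (intro exI[of _ Cw] ballI)
    fix m
    let ?f = "\<Sum>n<m. smul D 1 (b n)"
    have "gD n ?f = 1" if "n < m" for n
    proof -
      have "coord D b n ?f = 1"
        using D.coord_finite[OF schauder_basis_b, of "{..<m}" n "\<lambda>_. 1"] that by simp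
      moreover have "coord D b n ?f = gD n ?f" by (rule coord_b[OF sum_b_car])
      ultimately show ?thesis by simp
    qed
    moreover have sm: "small (fst ?f) (snd ?f) (qnorm D ?f)" by (rule small_car) (rule sum_b_car)
    ultimately have "\<forall>n\<in>{..<m}. 1 \<le> norm (g (fst ?f) (snd ?f) n)" by (simp add: gD_def)
    then have "1 * Lam (card {..<m}) \<le> Cw * qnorm D ?f"
      using sm by (intro Cw(2)[rule_format] conjI) auto
    then have "\<Lambda> S m \<le> ennreal Cw * ennreal (qnorm D ?f)"
      using Cw(1) by (simp add: Lambda_eq ennreal_leI flip: ennreal_mult')
    also have "ennreal (qnorm D ?f) \<le> fundamental_function D b m"
      unfolding fundamental_function_def
      by (rule SUP_upper2[of "({..<m}, \<lambda>_. 1)"]) auto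
    finally show "\<Lambda> S m \<le> ennreal Cw * fundamental_function D b m" by (simp add: mult_left_mono)
  qed
qed

lemma asymptotic_b: "asymptotically_suppression_unconditional D b"
proof -
  obtain C where C: "0 \<le> C" "\<forall>y w G A. small y w G \<and> finite A \<and> (\<forall>n\<in>A. card A \<le> n) \<longrightarrow> bnd A (g y w) (C * G)"
    using asymptotic_projection by (elim exE conjE) (rule that)
  show ?thesis
    unfolding asymptotically_suppression_unconditional_def
  proof (intro exI[of _ C] allI impI op_norm_le, elim conjE)
    fix A f assume A: "finite A" "A \<noteq> {}" "card A < Suc (Min A)" and f: "f \<in> car D" "qnorm D f \<le> 1"
    have "\<forall>n\<in>A. card A \<le> n" using A Min_le[OF A(1)] by fastforce
    then have "bnd A (g (fst f) (snd f)) (C * qnorm D f)"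
      using small_car[OF f(1)] A(1) by (intro C(2)[rule_format] conjI)
    then have "qnorm D (coord_proj D b A f) \<le> C * qnorm D f"
      by (simp add: coord_proj_b f A bnd_D gD_def)
    also have "\<dots> \<le> C * 1" using f(2) C(1) by (intro mult_left_mono)
    finally show "qnorm D (coord_proj D b A f) \<le> C" by simp
  qed
qed

text \<open>Chosen so that the first \<open>Lr r\<close> indices contain exactly the blocks of the
  first r vectors of X in full, and room for the lift of every sequence supported below
  \<open>R r\<close>.\<close>

definition Lr :: "nat \<Rightarrow> nat" where "Lr r = R r + N r"

lemma car_initial_b: "car (initial_space D b m) = {f \<in> car D. f = (\<Sum>n<m. smul D (gD n f) (b n))}"
proof -
  have "car (initial_space D b m) = {f \<in> car D. f = (\<Sum>n<m. smul D (coord D b n f) (b n))}"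
  proof (rule D.car_initial_space[OF schauder_basis_b])
    fix n f assume "f \<in> car D"
    then show "norm (coord D b n f) \<le> (5 / Lam 1 + Kc / lam (rnd n)) * qnorm D f"
      using gD_bound coord_b by simp
  qed
  also have "\<dots> = {f \<in> car D. f = (\<Sum>n<m. smul D (gD n f) (b n))}"
    by (intro Collect_cong conj_cong refl) (simp only: coord_b)
  finally show ?thesis .
qed

lemma car_initial_S: "car (initial_space S unit_seq m) = {w \<in> car S. w = S.comb {..<m} (eta w)}"
  unfolding S.comb_def
proof (rule S.car_initial_space[OF S.basis])
  fix n w assume w: "w \<in> car S"
  have L: "0 < Lam 1" by (rule Lam_pos) simp
  have "norm (eta w n) * Lam 1 \<le> nu {n} (\<lambda>n. norm (eta w n))"
    using nu_ge_const[of "{n}" "norm (eta w n)" "\<lambda>n. norm (eta w n)"] by simp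
  also have "\<dots> \<le> qnorm S w" using S.qnorm_coord_comb[OF w, of "{n}"] by (simp add: S.qnorm_comb)
  finally show "norm (eta w n) \<le> (1 / Lam 1) * qnorm S w" using L by (simp add: field_simps)
qed

text \<open>Below \<open>Lr r\<close> no block of a later vector of X is touched, and
  \<open>T\<close> keeps supports below \<open>Lr r\<close> because that position is a boundary of
  pieces.\<close>

lemma initial_b:
  assumes f: "f \<in> car D" and eq: "f = (\<Sum>n<m. smul D (gD n f) (b n))" and m: "m \<le> Lr r"
  shows "fst f = (\<Sum>k<r. smul X (xi k (fst f)) (x k))" "snd f = S.comb {..<Lr r} (eta (snd f))"
proof -
  let ?a = "g (fst f) (snd f)"
  have eq': "f = (\<Sum>n<m. smul X (?a n) (bx n), \<Sum>n<m. smul S (?a n) (be n))"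
    using eq by (simp only: sum_D gD_def)
  obtain K where K: "{..<Lr r} \<subseteq> {..<R K}" using sub_R[of "{..<Lr r}"] by auto
  have mK: "{..<m} \<subseteq> {..<R K}" using K m by auto
  have LK: "Lr r \<le> R K" using K by simp
  have rK: "r \<le> K" using LK R_le_iff[of r K] by (simp add: Lr_def)
  define z where "z k = of_real (lam k / real (len k)) * (\<Sum>n\<in>{..<m} \<inter> sg k. ?a n)" for k
  have z0: "z k = 0" if "r \<le> k" for k
  proof -
    have "{..<m} \<inter> sg k = {}"
    proof (rule ccontr)
      assume "{..<m} \<inter> sg k \<noteq> {}"
      then obtain n where n: "n < m" "n \<in> sg k" by blast
      then have "diag n" "rnd n = k" by (auto simp: mem_sg)
      with n(1) show False using diag_before_end[of n r] m that by (simp add: Lr_def)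
    qed
    then show ?thesis by (simp add: z_def)
  qed
  have "fst f = (\<Sum>k<K. smul X (z k) (x k))"
    by (subst eq') (simp add: sum_bx[OF mK] z_def)
  also have "\<dots> = (\<Sum>k<r. smul X (z k) (x k))"
    using rK z0 by (intro sum.mono_neutral_right) (auto simp: not_less)
  finally have 1: "fst f = (\<Sum>k<r. smul X (z k) (x k))" .
  have "xi k (fst f) = z k" if "k < r" for k using that unfolding 1 by (simp add: xi_sum)
  then show "fst f = (\<Sum>k<r. smul X (xi k (fst f)) (x k))" using 1 by simp
  let ?T = "T (rs {..<m} ?a)"
  have "snd f = S.comb {..<R K} ?T" by (subst eq') (simp add: sum_be[OF mK])
  also have "\<dots> = S.comb {..<Lr r} ?T"
  proof (rule S.comb_neutral)
    fix n assume "n \<in> {..<R K} - {..<Lr r}"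
    then show "?T n = 0" using m unfolding Lr_def by (intro T_outside_end[of r]) auto
  qed (use LK in auto)
  finally have 2: "snd f = S.comb {..<Lr r} ?T" .
  have "eta (snd f) n = ?T n" if "n < Lr r" for n
    using arg_cong[OF 2, of "\<lambda>w. eta w n"] that by (simp only: eta_comb finite_lessThan lessThan_iff if_True)
  then have "S.comb {..<Lr r} (eta (snd f)) = S.comb {..<Lr r} ?T" by (intro S.comb_cong) simp
  with 2 show "snd f = S.comb {..<Lr r} (eta (snd f))" by (simp only:)
qed

end

lemma uniformly_complementedI:
  assumes J: "\<And>r. 1 \<le> r \<Longrightarrow> linear_op (U r) (W r) (J r)" "\<And>r. 1 \<le> r \<Longrightarrow> op_norm (U r) (W r) (J r) \<le> ennreal C"
    and T: "\<And>r. 1 \<le> r \<Longrightarrow> linear_op (W r) (U r) (T r)" "\<And>r. 1 \<le> r \<Longrightarrow> op_norm (W r) (U r) (T r) \<le> ennreal C'"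
    and TJ: "\<And>r u. 1 \<le> r \<Longrightarrow> u \<in> car (U r) \<Longrightarrow> T r (J r u) = u"
  shows "uniformly_complemented U W"
  unfolding uniformly_complemented_def
proof (intro exI[of _ J] exI[of _ T] conjI allI impI ballI)
  fix r :: nat assume r: "1 \<le> r"
  show "bounded_op (U r) (W r) (J r)" "bounded_op (W r) (U r) (T r)"
    using J(1)[OF r] T(1)[OF r] order_le_less_trans[OF J(2)[OF r]] order_le_less_trans[OF T(2)[OF r]]
    by (auto simp: bounded_op_def)
  show "T r (J r u) = u" if "u \<in> car (U r)" for u by (rule TJ[OF r that])
next
  have "(SUP r\<in>{1..}. op_norm (U r) (W r) (J r) * op_norm (W r) (U r) (T r)) \<le> ennreal C * ennreal C'"
    by (rule SUP_least) (auto intro!: mult_mono J T)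
  also have "\<dots> < \<infinity>" by (simp add: ennreal_mult_less_top)
  finally show "(SUP r\<in>{1..}. op_norm (U r) (W r) (J r) * op_norm (W r) (U r) (T r)) < \<infinity>" .
qed

text \<open>The given basis is \<open>x0\<close>, and \<open>x\<close> is its normalisation.
  Corresponding terms of the two expansions agree, so initial spans and coordinate projections of
  both are the same.\<close>

locale block_construction_basis = block_construction +
  fixes x0 :: "nat \<Rightarrow> 'b" and Dx :: "nat \<Rightarrow> real"
  assumes x0: "schauder_basis X x0"
    and x0_xi: "v \<in> car X \<Longrightarrow> smul X (coord X x0 k v) (x0 k) = smul X (xi k v) (x k)"
    and x0_bound: "v \<in> car X \<Longrightarrow> norm (coord X x0 k v) \<le> Dx k * qnorm X v"
begin

section \<open>Local structure and conditionality of the new basis\<close>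

lemma car_initial_X: "car (initial_space X x0 r) = {v \<in> car X. v = (\<Sum>k<r. smul X (xi k v) (x k))}"
proof -
  have "car (initial_space X x0 r) = {v \<in> car X. v = (\<Sum>k<r. smul X (coord X x0 k v) (x0 k))}"
    by (rule X.car_initial_space[OF x0 x0_bound])
  also have "\<dots> = {v \<in> car X. v = (\<Sum>k<r. smul X (xi k v) (x k))}"
    by (intro Collect_cong conj_cong refl) (simp only: x0_xi)
  finally show ?thesis .
qed

lemma initial_simps [simp]:
  "smul (initial_space E y m) = smul E" "qnorm (initial_space E y m) = qnorm E"
  by (simp_all add: initial_space_def subspace_of_def)

lemma sum_simps:
  "car (E \<oplus>\<^sub>q F) = car E \<times> car F" "smul (E \<oplus>\<^sub>q F) = (\<lambda>c (v, w). (smul E c v, smul F c w))"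
  "qnorm (E \<oplus>\<^sub>q F) = (\<lambda>(v, w). max (qnorm E v) (qnorm F w))"
  by (simp_all add: direct_sum_def)

lemma comb_eta_add: "w \<in> car S \<Longrightarrow> w' \<in> car S \<Longrightarrow> S.comb A (eta (w + w')) = S.comb A (eta w) + S.comb A (eta w')"
  using S.comb_add[of A "eta w" "eta w'"] by (simp add: S.coord_add[OF S.basis])

lemma comb_eta_scale: "w \<in> car S \<Longrightarrow> S.comb A (eta (smul S c w)) = smul S c (S.comb A (eta w))"
  using S.comb_scale[of A c "eta w"] by (simp add: S.coord_scale[OF S.basis])

text \<open>The initial span at \<open>Lr r\<close> lies between the sums with the first
  \<open>R r\<close> and the first \<open>Lr r\<close> unit vectors of S. Both embeddings are
  inclusions. The first is complemented by truncation in S, a contraction, the second by the partial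
  sum projection of the new basis.\<close>

lemma local_structure_b: "same_local_structure X x0 S b"
  unfolding same_local_structure_def
proof (intro exI conjI)
  show "strict_mono R" by (rule strict_mono_R)
  show "strict_mono Lr"
    using strict_mono_R strict_mono_N by (auto simp: Lr_def strict_mono_def intro: add_strict_mono)
  then show "strict_mono Lr" .
  let ?W = "\<lambda>r. initial_space D b (Lr r)"
  have WX: "y \<in> car (initial_space X x0 r)" "w \<in> car (initial_space S unit_seq (Lr r))" "(y, w) \<in> car D"
    if "(y, w) \<in> car (?W r)" for y w r
  proof -
    have f: "(y, w) \<in> car D" "(y, w) = (\<Sum>n<Lr r. smul D (gD n (y, w)) (b n))"
      using that unfolding car_initial_b by blast+
    from initial_b[OF f order_refl] f(1) show "y \<in> car (initial_space X x0 r)"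
      "w \<in> car (initial_space S unit_seq (Lr r))" "(y, w) \<in> car D"
      unfolding car_initial_X car_initial_S by (simp_all add: car_D)
  qed
  show "uniformly_complemented (\<lambda>r. initial_space X x0 r \<oplus>\<^sub>q initial_space S unit_seq (R r)) ?W"
  proof (rule uniformly_complementedI)
    fix r :: nat
    let ?U = "initial_space X x0 r \<oplus>\<^sub>q initial_space S unit_seq (R r)"
    let ?T = "\<lambda>f :: 'b \<times> (nat \<Rightarrow> 'a). (fst f, S.comb {..<R r} (eta (snd f)))"
    have UW: "(y, w) \<in> car (?W r)" "y \<in> car X" "w \<in> car S" "w = S.comb {..<R r} (eta w)" if "(y, w) \<in> car ?U" for y w
    proof -
      have y: "y \<in> car X" "y = (\<Sum>k<r. smul X (xi k y) (x k))"
        and w: "w \<in> car S" "w = S.comb {..<R r} (eta w)"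
        using that unfolding sum_simps car_initial_X car_initial_S by auto
      have "(\<Sum>n<Lr r. smul D (gD n (y, w)) (b n)) = (y, w)"
        by (rule reconstruction[OF y(2) w(2)]) (simp add: Lr_def)
      then show "(y, w) \<in> car (?W r)" unfolding car_initial_b using y w by (simp add: car_D)
      show "y \<in> car X" "w \<in> car S" "w = S.comb {..<R r} (eta w)" by fact+
    qed
    show "linear_op ?U (?W r) (\<lambda>f. f)"
      unfolding linear_op_def
    proof (intro conjI ballI allI subsetI)
      fix f assume "f \<in> (\<lambda>f. f) ` car ?U"
      then show "f \<in> car (?W r)" using UW(1)[of "fst f" "snd f"] by simp
    qed (auto simp: sum_simps)
    show "op_norm ?U (?W r) (\<lambda>f. f) \<le> ennreal 1"
      by (rule op_norm_le) (auto simp: sum_simps)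
    show "linear_op (?W r) ?U ?T"
      unfolding linear_op_def
    proof (intro conjI ballI allI)
      show "?T ` car (?W r) \<subseteq> car ?U"
      proof (rule image_subsetI)
        fix f assume f: "f \<in> car (?W r)"
        have "fst f \<in> car (initial_space X x0 r)" using WX(1)[of "fst f" "snd f" r] f by simp
        moreover have "S.comb {..<R r} (eta (S.comb {..<R r} (eta (snd f)))) = S.comb {..<R r} (eta (snd f))"
          by (intro S.comb_cong) (simp add: eta_comb)
        ultimately show "?T f \<in> car ?U" by (simp add: sum_simps(1) car_initial_S)
      qed
      fix u v assume u: "u \<in> car (?W r)" and v: "v \<in> car (?W r)"
      then have "snd u \<in> car S" "snd v \<in> car S"
        using WX(3)[of "fst u" "snd u" r] WX(3)[of "fst v" "snd v" r] by (auto simp: car_D)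
      then show "?T (u + v) = ?T u + ?T v" by (simp add: comb_eta_add)
    next
      fix c u assume u: "u \<in> car (?W r)"
      then have "snd u \<in> car S" using WX(3)[of "fst u" "snd u" r] by (auto simp: car_D)
      then show "?T (smul (?W r) c u) = smul ?U c (?T u)"
        by (cases u) (simp add: sum_simps comb_eta_scale)
    qed
    show "op_norm (?W r) ?U ?T \<le> ennreal 1"
    proof (rule op_norm_le)
      fix f assume f: "f \<in> car (?W r)" "qnorm (?W r) f \<le> 1"
      obtain y w where yw: "f = (y, w)" by (cases f)
      have w: "w \<in> car S" using WX(3)[of y w r] f(1) yw by (simp add: car_D)
      show "qnorm ?U (?T f) \<le> 1"
        using f(2) S.qnorm_coord_comb[OF w, of "{..<R r}"] yw by (simp add: sum_simps)
    qed
    show "?T u = u" if "u \<in> car ?U" for u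
      using UW(4)[of "fst u" "snd u"] that by (simp add: prod_eq_iff)
  qed
  show "uniformly_complemented ?W (\<lambda>r. initial_space X x0 r \<oplus>\<^sub>q initial_space S unit_seq (Lr r))"
  proof -
    obtain C where C: "0 \<le> C" "\<And>y w G n. small y w G \<Longrightarrow> bnd {..<n} (g y w) (C * G)"
      using partial_sums by blast
    show ?thesis
    proof (rule uniformly_complementedI)
      fix r :: nat
      let ?U = "initial_space X x0 r \<oplus>\<^sub>q initial_space S unit_seq (Lr r)"
      let ?T = "\<lambda>f. \<Sum>n<Lr r. smul D (gD n f) (b n)"
      have UD: "u \<in> car D" if "u \<in> car ?U" for u
        using that by (auto simp: sum_simps(1) car_initial_X car_initial_S)
      show "linear_op (?W r) ?U (\<lambda>f. f)"
        unfolding linear_op_def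
      proof (intro conjI ballI allI subsetI)
        fix f assume "f \<in> (\<lambda>f. f) ` car (?W r)"
        then show "f \<in> car ?U" using WX(1,2)[of "fst f" "snd f" r] by (simp add: sum_simps(1) mem_Times_iff)
      qed (auto simp: sum_simps)
      show "op_norm (?W r) ?U (\<lambda>f. f) \<le> ennreal 1"
        by (rule op_norm_le) (auto simp: sum_simps)
      show "linear_op ?U (?W r) ?T"
        unfolding linear_op_def
      proof (intro conjI ballI allI)
        show "?T ` car ?U \<subseteq> car (?W r)"
        proof (rule image_subsetI)
          fix f
          have "gD n (?T f) = (if n < Lr r then gD n f else 0)" for n
          proof -
            have "coord D b n (?T f) = (if n \<in> {..<Lr r} then gD n f else 0)"
              by (rule D.coord_finite[OF schauder_basis_b]) simp
            moreover have "coord D b n (?T f) = gD n (?T f)" by (rule coord_b) simp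
            ultimately show ?thesis by simp
          qed
          then have "?T f = (\<Sum>n<Lr r. smul D (gD n (?T f)) (b n))" by simp
          then show "?T f \<in> car (?W r)" unfolding car_initial_b by (simp only: mem_Collect_eq sum_b_car)
        qed
        fix u v assume "u \<in> car ?U" "v \<in> car ?U"
        then show "?T (u + v) = ?T u + ?T v"
          using UD by (simp add: gD_add D.scale_left_distrib sum.distrib)
      next
        fix c u assume u: "u \<in> car ?U"
        have "smul ?U c u = smul D c u" by (simp add: sum_simps)
        then show "?T (smul ?U c u) = smul (?W r) c (?T u)"
          using UD[OF u] by (simp add: gD_scale D.scale_sum_right)
      qed
      show "op_norm ?U (?W r) ?T \<le> ennreal C"
      proof (rule op_norm_le)
        fix f assume f: "f \<in> car ?U" "qnorm ?U f \<le> 1"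
        have q: "qnorm D f \<le> 1" using f(2) by (simp add: sum_simps)
        have "qnorm D (?T f) \<le> C * qnorm D f"
          using C(2)[OF small_car[OF UD[OF f(1)]], of "Lr r"] by (simp add: bnd_D gD_def)
        also have "\<dots> \<le> C * 1" using q C(1) by (intro mult_left_mono)
        finally show "qnorm (?W r) (?T f) \<le> C" by simp
      qed
      show "?T u = u" if "u \<in> car (?W r)" for u
        using that unfolding car_initial_b by simp
    qed
  qed
qed

lemma coord_proj_X:
  assumes "y \<in> car (initial_space X x0 r)"
  shows "coord_proj X x0 A y = (\<Sum>k\<in>A \<inter> {..<r}. smul X (xi k y) (x k))"
proof -
  have y: "y \<in> car X" "y = (\<Sum>k<r. smul X (xi k y) (x k))" using assms unfolding car_initial_X by blast+
  have "y = (\<Sum>k<r. smul X (coord X x0 k y) (x0 k))" using y(2) by (simp only: x0_xi[OF y(1)])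
  from X.coord_proj_initial[OF x0 y(1) this] show ?thesis by (simp only: x0_xi[OF y(1)])
qed

lemma k_tilde_ge:
  assumes "y \<in> car (initial_space X x0 r)" "qnorm X y \<le> 1"
  shows "ennreal (qnorm X (\<Sum>k\<in>A \<inter> {..<r}. smul X (xi k y) (x k))) \<le> k_tilde X x0 r"
  unfolding k_tilde_def using assms coord_proj_X[OF assms(1), of A]
  by (intro SUP_upper2[of "(y, A)"]) auto

lemma k_tilde_ge_1: "1 \<le> r \<Longrightarrow> 1 \<le> k_tilde X x0 r"
  by (rule X.k_tilde_ge_one[OF x0 x0_bound])

lemma k_tilde_proj:
  assumes kr: "k_tilde X x0 r = ennreal kr" "0 \<le> kr" and y: "y \<in> car (initial_space X x0 r)" and J: "J \<subseteq> {..<r}"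
  shows "qnorm X (\<Sum>k\<in>J. smul X (xi k y) (x k)) \<le> kr * qnorm X y"
proof (cases "y = 0")
  case True
  then show ?thesis using xi_scale[of 0 _ 0] by simp
next
  case False
  have yc: "y \<in> car X" "y = (\<Sum>k<r. smul X (xi k y) (x k))" using y unfolding car_initial_X by blast+
  have pos: "0 < qnorm X y" using False yc(1) X.qnorm_nonneg[OF yc(1)] X.qnorm_eq_0[OF yc(1)] by linarith
  let ?c = "of_real (1 / qnorm X y) :: 'a"
  let ?y = "smul X ?c y"
  have nc: "norm ?c = 1 / qnorm X y" unfolding norm_of_real using pos by simp
  have xi': "xi k ?y = ?c * xi k y" for k using yc(1) by (rule xi_scale)
  have s: "(\<Sum>k\<in>A. smul X (xi k ?y) (x k)) = smul X ?c (\<Sum>k\<in>A. smul X (xi k y) (x k))" for A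
    by (simp only: xi' X.scale_sum_right X.scale_scale)
  have "?y = (\<Sum>k<r. smul X (xi k ?y) (x k))" unfolding s using yc(2) by simp
  then have "?y \<in> car (initial_space X x0 r)" unfolding car_initial_X using yc(1) by simp
  moreover have "qnorm X ?y \<le> 1" using pos by (simp only: X.qnorm_scale[OF yc(1)] nc) simp
  ultimately have "ennreal (qnorm X (\<Sum>k\<in>J \<inter> {..<r}. smul X (xi k ?y) (x k))) \<le> ennreal kr"
    using k_tilde_ge kr(1) by metis
  moreover have "J \<inter> {..<r} = J" using J by auto
  ultimately have "qnorm X (\<Sum>k\<in>J. smul X (xi k ?y) (x k)) \<le> kr"
    using kr(2) by simp
  then show ?thesis
    unfolding s X.qnorm_scale[OF sum_x_car] nc using pos by (simp add: field_simps)
qed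

text \<open>Test vectors \<open>(y, 0)\<close>: their coordinates are constant on each block and
  zero elsewhere. Selecting the complete blocks with number in A projects y onto its coordinates in
  A.\<close>

lemma k_tilde_lower:
  assumes "Lr r \<le> m"
  shows "k_tilde X x0 r \<le> k_tilde D b m"
  unfolding k_tilde_def[of X]
proof (rule SUP_least, clarify)
  fix y A assume y: "y \<in> car (initial_space X x0 r)" "qnorm X y \<le> 1"
  have yc: "y \<in> car X" "y = (\<Sum>k<r. smul X (xi k y) (x k))" using y(1) unfolding car_initial_X by blast+
  let ?y = "\<Sum>k\<in>A \<inter> {..<r}. smul X (xi k y) (x k)"
  let ?B = "{n. diag n \<and> rnd n \<in> A}"
  have xi0: "xi k y = 0" if "r \<le> k" for k
    using xi_sum[of "{..<r}" k "\<lambda>k. xi k y"] yc(2) that by simp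
  have eta0: "eta 0 n = 0" for n using S.coord_scale[OF S.basis, of 0 n 0] by simp
  have w0: "(0 :: nat \<Rightarrow> 'a) = S.comb {..<R r} (eta 0)"
    by (simp add: eta0 S.comb_def)
  have V0: "uw 0 n = 0" for n using V_scale[of 0 "eta 0" n] by (simp add: uw_def eta0)
  have m: "R r + N r \<le> m" using assms by (simp add: Lr_def)
  have xiy: "xi k ?y = (if k \<in> A then xi k y else 0)" for k
    using xi0[of k] by (auto simp: xi_sum)
  have yA: "?y = (\<Sum>k<r. smul X (xi k ?y) (x k))"
    unfolding xiy by (intro sum.mono_neutral_cong_left) auto
  have f: "(y, 0) \<in> car (initial_space D b m)"
    unfolding car_initial_b using reconstruction[OF yc(2) w0 m] yc(1) by (simp add: car_D)
  then have fD: "(y, 0) \<in> car D" "(y, 0) = (\<Sum>n<m. smul D (coord D b n (y, 0)) (b n))"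
    unfolding car_initial_b by (auto simp only: mem_Collect_eq coord_b)
  have "coord_proj D b ?B (y, 0) = (\<Sum>n\<in>?B \<inter> {..<m}. smul D (gD n (y, 0)) (b n))"
    unfolding D.coord_proj_initial[OF schauder_basis_b fD] by (simp only: coord_b[OF fD(1)])
  also have "\<dots> = (\<Sum>n<m. smul D (gD n (?y, 0)) (b n))"
  proof (rule sum.mono_neutral_cong_left)
    have "gD n (?y, 0) = (if n \<in> ?B then gD n (y, 0) else 0)" for n
      by (simp only: gD_def g_def fst_conv snd_conv V0 cc_def xiy) auto
    then show "\<forall>i\<in>{..<m} - ?B \<inter> {..<m}. smul D (gD i (?y, 0)) (b i) = 0"
      "\<And>n. n \<in> ?B \<inter> {..<m} \<Longrightarrow> smul D (gD n (y, 0)) (b n) = smul D (gD n (?y, 0)) (b n)" by auto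
  qed auto
  also have "\<dots> = (?y, 0)" by (rule reconstruction[OF yA w0 m])
  finally have "qnorm D (coord_proj D b ?B (y, 0)) = qnorm X ?y"
    using X.qnorm_nonneg[OF sum_x_car] by (simp add: qnorm_D)
  moreover have "qnorm D (y, 0) \<le> 1" using y(2) by (simp add: qnorm_D)
  ultimately show "ennreal (qnorm X (coord_proj X x0 A y)) \<le> k_tilde D b m"
    unfolding k_tilde_def coord_proj_X[OF y(1)] using f
    by (intro SUP_upper2[of "((y, 0), ?B)"]) auto
qed

lemma k_tilde_upper:
  "\<exists>C\<ge>0. \<forall>r m kr. 1 \<le> r \<and> m \<le> Lr r \<and> k_tilde X x0 r = ennreal kr \<and> 0 \<le> kr \<longrightarrow>
     k_tilde D b m \<le> ennreal (C * (kr + real r powr (1 / s) + real r powr (1 / p - 1 / q)))"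
proof -
  obtain C where C: "0 \<le> C" "\<forall>r kr y w G A. 1 \<le> r \<and> 1 \<le> kr \<and> small y w G \<and> A \<subseteq> {..<R r + N r} \<and>
     (\<forall>J\<subseteq>{..<r}. qnorm X (\<Sum>k\<in>J. smul X (xi k y) (x k)) \<le> kr * qnorm X y) \<longrightarrow>
     bnd A (g y w) (C * (kr + real r powr (1 / s) + real r powr (1 / p - 1 / q)) * G)"
    using projection_upper by (elim exE conjE) (rule that)
  show ?thesis
  proof (intro exI[of _ C] conjI C(1) allI impI, elim conjE)
    fix r m kr assume r: "1 \<le> r" and m: "m \<le> Lr r" and kr: "k_tilde X x0 r = ennreal kr" "0 \<le> kr"
    let ?Q = "kr + real r powr (1 / s) + real r powr (1 / p - 1 / q)"
    have kr1: "1 \<le> kr" using k_tilde_ge_1[OF r] kr by simp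
    show "k_tilde D b m \<le> ennreal (C * ?Q)"
      unfolding k_tilde_def[of D]
    proof (rule SUP_least, clarify)
      fix y w A assume f: "(y, w) \<in> car (initial_space D b m)" "qnorm D (y, w) \<le> 1"
      then have fD: "(y, w) \<in> car D" "(y, w) = (\<Sum>n<m. smul D (gD n (y, w)) (b n))"
        unfolding car_initial_b by blast+
      have y: "y \<in> car (initial_space X x0 r)"
        using initial_b(1)[OF fD m] fD(1) unfolding car_initial_X by (simp add: car_D)
      have "bnd (A \<inter> {..<m}) (g y w) (C * ?Q * qnorm D (y, w))"
      proof (rule C(2)[rule_format], intro conjI allI impI)
        show "small y w (qnorm D (y, w))" using small_car[OF fD(1)] by simp
        show "A \<inter> {..<m} \<subseteq> {..<R r + N r}" using m by (auto simp: Lr_def)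
        show "qnorm X (\<Sum>k\<in>J. smul X (xi k y) (x k)) \<le> kr * qnorm X y" if "J \<subseteq> {..<r}" for J
          by (rule k_tilde_proj[OF kr y that])
      qed (use r kr1 in auto)
      then have le: "qnorm D (\<Sum>n\<in>A \<inter> {..<m}. smul D (gD n (y, w)) (b n)) \<le> C * ?Q * qnorm D (y, w)"
        by (simp add: bnd_D gD_def)
      have "(y, w) = (\<Sum>n<m. smul D (coord D b n (y, w)) (b n))"
        using fD(2) by (simp only: coord_b[OF fD(1)])
      from D.coord_proj_initial[OF schauder_basis_b fD(1) this]
      have "coord_proj D b A (y, w) = (\<Sum>n\<in>A \<inter> {..<m}. smul D (gD n (y, w)) (b n))"
        by (simp only: coord_b[OF fD(1)])
      with le have "qnorm D (coord_proj D b A (y, w)) \<le> C * ?Q * qnorm D (y, w)" by simp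
      also have "\<dots> \<le> C * ?Q * 1" using f(2) C(1) kr1 by (intro mult_left_mono mult_nonneg_nonneg add_nonneg_nonneg) auto
      finally show "ennreal (qnorm D (coord_proj D b A (y, w))) \<le> ennreal (C * ?Q)" by (intro ennreal_leI) simp
    qed
  qed
qed

text \<open>One additional coordinate costs a constant factor. This is needed because m lies between
  \<open>Lr r\<close> and \<open>Lr (Suc r)\<close>, while the lower and the upper bound refer to
  different ends.\<close>

lemma k_tilde_Suc:
  assumes r: "1 \<le> r" and kr: "k_tilde X x0 r = ennreal kr" "0 \<le> kr"
  shows "k_tilde X x0 (Suc r) \<le> ennreal (X.kap * (Kx + Kc) * kr)"
  unfolding k_tilde_def[of X x0 "Suc r"]
proof (rule SUP_least, clarify)
  fix y A assume y: "y \<in> car (initial_space X x0 (Suc r))" "qnorm X y \<le> 1"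
  have kr1: "1 \<le> kr" using k_tilde_ge_1[OF r] kr by simp
  have yc: "y \<in> car X" using y(1) unfolding car_initial_X by blast
  define y' where "y' = (\<Sum>k<r. smul X (xi k y) (x k))"
  have xi': "xi k y' = xi k y" if "k < r" for k using that by (simp add: y'_def xi_sum)
  have y': "y' \<in> car (initial_space X x0 r)" unfolding car_initial_X using xi' by (simp add: y'_def)
  have "qnorm X y' \<le> Kx * qnorm X y" unfolding y'_def by (rule xi_partial[OF yc])
  also have "\<dots> \<le> Kx * 1" using y(2) Kx_ge by (intro mult_left_mono) auto
  finally have ny': "qnorm X y' \<le> Kx" by simp
  have "coord_proj X x0 A y = (\<Sum>k\<in>A \<inter> {..<Suc r}. smul X (xi k y) (x k))" by (rule coord_proj_X[OF y(1)])
  also have "\<dots> = (\<Sum>k\<in>A \<inter> {..<r}. smul X (xi k y') (x k)) + smul X (if r \<in> A then xi r y else 0) (x r)"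
  proof (cases "r \<in> A")
    case True
    then have "A \<inter> {..<Suc r} = insert r (A \<inter> {..<r})" by auto
    then show ?thesis using True xi' by (simp add: add.commute)
  next
    case False
    then have "A \<inter> {..<Suc r} = A \<inter> {..<r}" by (auto simp: less_Suc_eq)
    then show ?thesis using False xi' by simp
  qed
  finally have "qnorm X (coord_proj X x0 A y)
      \<le> X.kap * (qnorm X (\<Sum>k\<in>A \<inter> {..<r}. smul X (xi k y') (x k)) + norm (if r \<in> A then xi r y else 0))"
    using X.qnorm_add[OF sum_x_car X.car_scale[OF x_car]] by (simp add: qnorm_x)
  also have "\<dots> \<le> X.kap * (kr * Kx + Kc * 1)"
  proof (intro mult_left_mono add_mono)
    have "qnorm X (\<Sum>k\<in>A \<inter> {..<r}. smul X (xi k y') (x k)) \<le> kr * qnorm X y'"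
      by (rule k_tilde_proj[OF kr y']) auto
    also have "\<dots> \<le> kr * Kx" using ny' kr by (intro mult_left_mono)
    finally show "qnorm X (\<Sum>k\<in>A \<inter> {..<r}. smul X (xi k y') (x k)) \<le> kr * Kx" .
    have "norm (xi r y) \<le> Kc * 1"
      using xi_bound[OF yc, of r] y(2) Kc_pos mult_left_mono[of "qnorm X y" 1 Kc] by linarith
    then show "norm (if r \<in> A then xi r y else 0) \<le> Kc * 1" using Kc_pos by auto
  qed (use X.kap_ge in auto)
  also have "\<dots> \<le> X.kap * (kr * Kx + Kc * kr)"
    using kr1 Kc_pos X.kap_ge by (intro mult_left_mono add_left_mono) auto
  finally show "ennreal (qnorm X (coord_proj X x0 A y)) \<le> ennreal (X.kap * (Kx + Kc) * kr)"
    by (intro ennreal_leI) (simp add: algebra_simps)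
qed

end

text \<open>Both cases of the theorem use this with different lengths. What remains open is only the
  relation between m and the number of blocks, recorded by \<open>L\<close> being comparable with
  \<open>len\<close>.\<close>

lemma almost_greedy_basis_for_sizes:
  fixes X :: "('k::real_or_complex, 'v::ab_group_add) qspace"
    and x :: "nat \<Rightarrow> 'v"
    and S :: "('k, nat \<Rightarrow> 'k) qspace"
  assumes X: "quasi_banach X" "schauder_basis X x" and S: "subsymmetric S"
    and p: "0 < p" "p \<le> 1" "p_convex p X"
    and s: "1 < s" "upper_estimate s S" and q: "1 < q" "lower_estimate q S"
    and len: "\<And>j. 0 < len j" "\<And>j k. j \<le> k \<Longrightarrow> len j \<le> len k"
    and \<eta>: "0 < \<eta>" "\<eta> < 1" and C0: "1 \<le> C0"
    and growth: "\<And>j k. j \<le> k \<Longrightarrow> real (len j) \<le> C0 * \<eta> ^ (k - j) * real (len k)"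
  obtains b L C where "schauder_basis (X \<oplus>\<^sub>q S) b" "almost_greedy (X \<oplus>\<^sub>q S) b"
    "equivalent {1..} (fundamental_function (X \<oplus>\<^sub>q S) b) (\<Lambda> S)"
    "asymptotically_suppression_unconditional (X \<oplus>\<^sub>q S) b"
    "same_local_structure X x S b"
    "strict_mono L" "L 0 = 0" "1 \<le> C"
    "\<And>r. len r \<le> L (Suc r)" "\<And>r. real (L (Suc r)) \<le> C * real (len r)"
    "\<And>m. 1 \<le> m \<Longrightarrow> 1 \<le> k_tilde (X \<oplus>\<^sub>q S) b m"
    "\<And>r m. L r \<le> m \<Longrightarrow> k_tilde X x r \<le> k_tilde (X \<oplus>\<^sub>q S) b m"
    "\<And>r m k. 1 \<le> r \<Longrightarrow> m \<le> L r \<Longrightarrow> k_tilde X x r = ennreal k \<Longrightarrow> 0 \<le> k \<Longrightarrow>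
      k_tilde (X \<oplus>\<^sub>q S) b m \<le> ennreal (C * (k + real r powr (1 / s) + real r powr (1 / p - 1 / q)))"
    "\<And>r k. 1 \<le> r \<Longrightarrow> k_tilde X x r = ennreal k \<Longrightarrow> 0 \<le> k \<Longrightarrow> k_tilde X x (Suc r) \<le> ennreal (C * k)"
proof -
  interpret Xq: quasi_normed X
    using X(1) by unfold_locales (auto simp: quasi_banach_def)
  interpret Sq: subsym_space S using S by unfold_locales
  interpret piece_sizes len using len(1) by unfold_locales
  obtain N' c0 c1 where N': "quasi_norm_on X N'" "c0 > 0" "c1 > 0"
    "\<forall>v\<in>car X. c0 * qnorm X v \<le> N' v \<and> N' v \<le> c1 * qnorm X v"
    "\<forall>u\<in>car X. \<forall>v\<in>car X. N' (u + v) powr p \<le> N' u powr p + N' v powr p"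
    using p(3) unfolding p_convex_def by blast
  interpret Xp: p_normed X N' p c0 c1
    using N' p(1) by unfold_locales auto
  obtain Kx where Kx: "1 \<le> Kx"
    "\<And>v n. v \<in> car X \<Longrightarrow> qnorm X (\<Sum>k<n. smul X (coord X x k v) (x k)) \<le> Kx * qnorm X v"
    using Xp.partial_sums_bounded[OF X] by blast
  obtain Cs Cq where F: "subsym_functional Sq.nu s q Cs Cq"
    using Sq.subsym_functional[OF s(1) q(1) s(2) q(2)] by blast
  interpret Fq: subsym_functional Sq.nu s q Cs Cq by (rule F)

  have xc: "x k \<in> car X" for k using Xq.basis_car[OF X(2)] by auto
  have nx: "0 < qnorm X (x k)" for k
    using Xq.qnorm_nonneg[OF xc] Xq.qnorm_eq_0[OF xc] Xq.basis_nonzero[OF X(2), of k] by (metis less_eq_real_def)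
  define xn where "xn k = smul X (of_real (1 / qnorm X (x k))) (x k)" for k
  define xi where "xi k v = of_real (qnorm X (x k)) * coord X x k v" for k v
  have term_eq: "smul X (xi k v) (xn k) = smul X (coord X x k v) (x k)" for k v
  proof -
    have "xi k v * of_real (1 / qnorm X (x k)) = coord X x k v" using nx[of k] by (simp add: xi_def)
    then show ?thesis by (simp only: xn_def Xq.scale_scale)
  qed
  have coord_bd: "norm (coord X x k v) \<le> (2 * Xq.kap * Kx / qnorm X (x k)) * qnorm X v" if v: "v \<in> car X" for k v
  proof -
    let ?P = "\<lambda>n. \<Sum>k<n. smul X (coord X x k v) (x k)"
    have Pc: "?P n \<in> car X" for n by (rule Xq.expansion_car[OF Xq.basis_car[OF X(2)]])
    have "norm (coord X x k v) * qnorm X (x k) = qnorm X (?P (Suc k) - ?P k)"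
      using xc by (simp add: Xq.qnorm_scale)
    also have "\<dots> \<le> Xq.kap * (qnorm X (?P (Suc k)) + qnorm X (?P k))" by (rule Xq.qnorm_diff[OF Pc Pc])
    also have "\<dots> \<le> Xq.kap * (Kx * qnorm X v + Kx * qnorm X v)"
      using Xq.kap_ge by (intro mult_left_mono add_mono Kx(2) v) auto
    finally show ?thesis using nx[of k] by (simp add: field_simps)
  qed

  \<comment> \<open>Summing the geometric growth of the lengths once bounds the pieces of one round
    by the last one, and summing again bounds all rounds; hence \<open>Cr\<close> is
    \<open>c2\<close> squared.\<close>
  define c2 where "c2 = C0 / (1 - \<eta>)"
  have c2: "1 \<le> c2" using C0 \<eta> by (simp add: c2_def le_divide_eq)
  have lensum: "(\<Sum>j<Suc k. real (len j)) \<le> c2 * real (len k)" for k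
  proof -
    have "(\<Sum>j<Suc k. real (len j)) \<le> (\<Sum>j<Suc k. C0 * \<eta> ^ (k - j) * real (len k))"
      by (intro sum_mono growth) auto
    also have "\<dots> = C0 * real (len k) * (\<Sum>j<Suc k. \<eta> ^ (k - j))"
      unfolding sum_distrib_left by (intro sum.cong) auto
    also have "(\<Sum>j<Suc k. \<eta> ^ (k - j)) = (\<Sum>j<Suc k. \<eta> ^ j)"
      using sum.nat_diff_reindex[of "\<lambda>j. \<eta> ^ j" "Suc k"] by simp
    also have "C0 * real (len k) * (\<Sum>j<Suc k. \<eta> ^ j) \<le> C0 * real (len k) * (1 / (1 - \<eta>))"
    proof (intro mult_left_mono)
      have "(\<Sum>j<Suc k. \<eta> ^ j) = (1 - \<eta> ^ Suc k) / (1 - \<eta>)" using \<eta> by (subst sum_gp_strict) auto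
      also have "\<dots> \<le> 1 / (1 - \<eta>)" using \<eta> by (intro divide_right_mono) auto
      finally show "(\<Sum>j<Suc k. \<eta> ^ j) \<le> 1 / (1 - \<eta>)" .
    qed (use C0 in simp)
    finally show ?thesis by (simp add: c2_def mult_ac)
  qed
  have N_le: "real (N (Suc k)) \<le> c2 * real (len k)" for k
    using lensum[of k] by (simp add: N_def)
  have R_le: "real (R (Suc k)) \<le> c2 * c2 * real (len k)" for k
  proof -
    have "real (R (Suc k)) = (\<Sum>i<Suc k. real (N (Suc i)))" by (simp add: R_def)
    also have "\<dots> \<le> (\<Sum>i<Suc k. c2 * real (len i))" by (intro sum_mono N_le)
    also have "\<dots> = c2 * (\<Sum>i<Suc k. real (len i))" by (simp only: sum_distrib_left)
    also have "\<dots> \<le> c2 * (c2 * real (len k))" using lensum[of k] c2 by (intro mult_left_mono) auto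
    finally show ?thesis by simp
  qed
  define Cr where "Cr = c2 * c2"
  have Cr: "1 \<le> Cr" using c2 mult_mono[of 1 c2 1 c2] by (simp add: Cr_def)

  \<comment> \<open>The rates of \<open>lam_growth\<close> and \<open>lam_ratio\<close>: the first
    comes from the lower q-estimate, the second from \<open>(d / len k) powr (1 - 1 / s)\<close>,
    where \<open>s > 1\<close> keeps the exponent positive.\<close>
  define \<theta>1 where "\<theta>1 = \<eta> powr (1 / q)"
  define \<theta>2 where "\<theta>2 = \<eta> powr (1 - 1 / s)"
  define \<theta> where "\<theta> = max \<theta>1 \<theta>2"
  have \<theta>: "0 < \<theta>" "\<theta> < 1"
    using \<eta> s(1) q(1) powr_less_mono2[of "1 / q" \<eta> 1] powr_less_mono2[of "1 - 1 / s" \<eta> 1]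
    by (auto simp: \<theta>_def \<theta>1_def \<theta>2_def less_max_iff_disj)
  have \<theta>i: "\<theta>1 ^ n \<le> \<theta> ^ n" "\<theta>2 ^ n \<le> \<theta> ^ n" for n
    by (auto intro!: power_mono simp: \<theta>_def \<theta>1_def \<theta>2_def)
  define Cg where "Cg = max (2 * Cq * C0) (2 * Cs * (Cr * C0))"
  have Cg: "1 \<le> Cg"
  proof -
    have "1 * 1 \<le> (2 * Cq) * C0" using Fq.Cq_ge C0 by (intro mult_mono) auto
    then show ?thesis by (simp add: Cg_def le_max_iff_disj)
  qed
  have powr_pow: "(a * \<eta> ^ n) powr e \<le> a * (\<eta> powr e) ^ n" if "1 \<le> a" "0 \<le> e" "e \<le> 1" for a e n
  proof -
    have "(a * \<eta> ^ n) powr e = a powr e * (\<eta> powr e) ^ n"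
      using that \<eta> by (simp add: powr_mult powr_powr mult.commute flip: powr_realpow)
    moreover have "a powr e \<le> a" using that powr_mono[of e 1 a] by simp
    ultimately show ?thesis using \<eta> by (simp add: mult_right_mono)
  qed
  have growth_lam: "Fq.Lam (len j) \<le> Cg * \<theta> ^ (k - j) * Fq.Lam (len k)" if jk: "j \<le> k" for j k
  proof -
    have pos: "0 < real (len j)" "0 < real (len k)" using len(1) by simp_all
    have "(real (len k) / real (len j)) powr (1 / q) * Fq.Lam (len j) \<le> 2 * Cq * Fq.Lam (len k)"
      using len(1)[of j] len(2)[OF jk] by (intro Fq.Lam_lower) auto
    then have "(real (len j) / real (len k)) powr (1 / q) * ((real (len k) / real (len j)) powr (1 / q) * Fq.Lam (len j))
        \<le> (real (len j) / real (len k)) powr (1 / q) * (2 * Cq * Fq.Lam (len k))"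
      by (intro mult_left_mono) auto
    moreover have "(real (len j) / real (len k)) powr (1 / q) * (real (len k) / real (len j)) powr (1 / q) = 1"
      using pos by (simp flip: powr_mult)
    ultimately have "Fq.Lam (len j) \<le> (real (len j) / real (len k)) powr (1 / q) * (2 * Cq * Fq.Lam (len k))"
      by (simp only: mult.assoc[symmetric] mult_1 mult_1_left)
    also have "\<dots> \<le> (C0 * \<theta> ^ (k - j)) * (2 * Cq * Fq.Lam (len k))"
    proof (intro mult_right_mono mult_nonneg_nonneg Fq.Lam_nonneg)
      have "(real (len j) / real (len k)) powr (1 / q) \<le> (C0 * \<eta> ^ (k - j)) powr (1 / q)"
        using growth[OF jk] pos q(1) by (intro powr_mono2) (auto simp: field_simps)
      also have "\<dots> \<le> C0 * \<theta>1 ^ (k - j)" unfolding \<theta>1_def using C0 q(1) by (intro powr_pow) auto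
      also have "\<dots> \<le> C0 * \<theta> ^ (k - j)" using \<theta>i C0 by (intro mult_left_mono) auto
      finally show "(real (len j) / real (len k)) powr (1 / q) \<le> C0 * \<theta> ^ (k - j)" .
    qed (use Fq.Cq_ge in auto)
    also have "\<dots> = (2 * Cq * C0) * (\<theta> ^ (k - j) * Fq.Lam (len k))" by simp
    also have "\<dots> \<le> Cg * (\<theta> ^ (k - j) * Fq.Lam (len k))"
      using \<theta> Fq.Lam_nonneg by (intro mult_right_mono) (auto simp: Cg_def)
    finally show ?thesis by (simp add: mult.assoc)
  qed
  have ratio: "Fq.Lam (len k) / real (len k) * real d \<le> Cg * \<theta> ^ (k - r) * Fq.Lam d"
    if rk: "r \<le> k" and d: "1 \<le> d" "d \<le> len k" "real d \<le> Cr * real (len r)" for r k d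
  proof -
    have pos: "0 < real (len k)" "0 < real d" using len(1) d by simp_all
    have "Fq.Lam (len k) / real (len k) * real d = (real d / real (len k)) * Fq.Lam (len k)" by simp
    also have "\<dots> \<le> (real d / real (len k)) * (2 * Cs * (real (len k) / real d) powr (1 / s) * Fq.Lam d)"
      using d by (intro mult_left_mono Fq.Lam_upper) auto
    also have "\<dots> = (2 * Cs) * ((real d / real (len k)) powr (1 - 1 / s) * Fq.Lam d)"
    proof -
      have "(real d / real (len k)) * (real (len k) / real d) powr (1 / s) = (real d / real (len k)) powr (1 - 1 / s)"
        using pos by (simp add: powr_diff powr_divide)
      then show ?thesis by (simp add: mult_ac)
    qed
    also have "\<dots> \<le> (2 * Cs) * ((Cr * C0 * \<theta> ^ (k - r)) * Fq.Lam d)"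
    proof (intro mult_left_mono mult_right_mono Fq.Lam_nonneg)
      have CC: "1 \<le> Cr * C0" using mult_mono[of 1 Cr 1 C0] Cr C0 by simp
      have "real d \<le> Cr * (C0 * \<eta> ^ (k - r) * real (len k))"
        using d(3) growth[OF rk] Cr by (elim order_trans) (intro mult_left_mono, auto)
      then have "(real d / real (len k)) powr (1 - 1 / s) \<le> (Cr * C0 * \<eta> ^ (k - r)) powr (1 - 1 / s)"
        using pos s(1) by (intro powr_mono2) (auto simp: field_simps)
      also have "\<dots> \<le> Cr * C0 * \<theta>2 ^ (k - r)" unfolding \<theta>2_def using CC s(1) by (intro powr_pow) auto
      also have "\<dots> \<le> Cr * C0 * \<theta> ^ (k - r)" using \<theta>i CC by (intro mult_left_mono) auto
      finally show "(real d / real (len k)) powr (1 - 1 / s) \<le> Cr * C0 * \<theta> ^ (k - r)" .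
    qed (use Fq.Cs_ge in auto)
    also have "\<dots> = (2 * Cs * (Cr * C0)) * (\<theta> ^ (k - r) * Fq.Lam d)" by simp
    also have "\<dots> \<le> Cg * (\<theta> ^ (k - r) * Fq.Lam d)"
      using \<theta> Fq.Lam_nonneg by (intro mult_right_mono) (auto simp: Cg_def)
    finally show ?thesis by (simp add: mult.assoc)
  qed

  interpret B: block_construction_basis X S s q Cs Cq len xn xi p Kx "max 1 ((c1 / c0) powr p)" \<theta> Cg Cr x
    "\<lambda>k. 2 * Xq.kap * Kx / qnorm X (x k)"
  proof unfold_locales
    show "xn k \<in> car X" for k using xc by (simp add: xn_def)
    show "qnorm X (xn k) = 1" for k
      unfolding xn_def Xq.qnorm_scale[OF xc] norm_of_real using nx[of k] by simp
    show "xi k (u + v) = xi k u + xi k v" if "u \<in> car X" "v \<in> car X" for u v k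
      using that by (simp add: xi_def Xq.coord_add[OF X(2)] distrib_left)
    show "xi k (smul X c v) = c * xi k v" if "v \<in> car X" for v k c
      using that by (simp add: xi_def Xq.coord_scale[OF X(2)])
    show "xi k (xn m) = (if k = m then 1 else 0)" for k m
      using nx[of k] nx[of m] unfolding xi_def xn_def Xq.coord_scale[OF X(2) xc] Xq.coord_basis[OF X(2)] by auto
    show "qnorm X (\<Sum>k<n. smul X (xi k v) (xn k)) \<le> Kx * qnorm X v" if "v \<in> car X" for v n
      unfolding term_eq by (rule Kx(2)[OF that])
    show "expansion X xn (\<lambda>k. xi k v) v" if "v \<in> car X" for v
      using Xq.coord_expansion[OF X(2) that] unfolding expansion_def term_eq .
    show "qnorm X (\<Sum>i\<in>I. f i) powr p \<le> max 1 ((c1 / c0) powr p) * (\<Sum>i\<in>I. qnorm X (f i) powr p)"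
      if "finite I" "\<And>i. i \<in> I \<Longrightarrow> f i \<in> car X" for I :: "nat set" and f
      by (rule order_trans[OF Xp.qnorm_sum_powr[OF that]]) (auto intro!: mult_right_mono sum_nonneg)
    show "smul X (coord X x k v) (x k) = smul X (xi k v) (xn k)" for v k by (simp only: term_eq)
    show "norm (coord X x k v) \<le> 2 * Xq.kap * Kx / qnorm X (x k) * qnorm X v" if "v \<in> car X" for k v
      by (rule coord_bd[OF that])
    show "real (R (Suc k)) \<le> Cr * real (len k)" for k using R_le[of k] by (simp add: Cr_def)
  qed (use p Kx Cg Cr \<theta> growth_lam ratio len X(2) in auto)

  obtain Cu where Cu: "0 \<le> Cu" "\<forall>r m kr. 1 \<le> r \<and> m \<le> B.Lr r \<and> k_tilde X x r = ennreal kr \<and> 0 \<le> kr \<longrightarrow>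
     k_tilde (X \<oplus>\<^sub>q S) B.b m \<le> ennreal (Cu * (kr + real r powr (1 / s) + real r powr (1 / p - 1 / q)))"
    using B.k_tilde_upper by (elim exE conjE) (rule that)
  define C where "C = max (max (2 * Cr) Cu) (Xq.kap * (Kx + B.Kc))"
  have CC: "2 * Cr \<le> C" "Cu \<le> C" "Xq.kap * (Kx + B.Kc) \<le> C" by (auto simp: C_def)
  show thesis
  proof (rule that[of B.b B.Lr C])
    show "schauder_basis (X \<oplus>\<^sub>q S) B.b" by (rule B.schauder_basis_b)
    show "almost_greedy (X \<oplus>\<^sub>q S) B.b" by (rule B.almost_greedy_b)
    show "equivalent {1..} (fundamental_function (X \<oplus>\<^sub>q S) B.b) (\<Lambda> S)" by (rule B.fundamental_b)
    show "asymptotically_suppression_unconditional (X \<oplus>\<^sub>q S) B.b" by (rule B.asymptotic_b)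
    show "same_local_structure X x S B.b" by (rule B.local_structure_b)
    show "strict_mono B.Lr"
      using strict_mono_R strict_mono_N by (auto simp: B.Lr_def strict_mono_def intro: add_strict_mono)
    show "B.Lr 0 = 0" by (simp add: B.Lr_def)
    show "1 \<le> C" using CC(1) Cr by linarith
    show "len r \<le> B.Lr (Suc r)" for r by (simp add: B.Lr_def N_Suc)
    show "real (B.Lr (Suc r)) \<le> C * real (len r)" for r
    proof -
      have "real (B.Lr (Suc r)) \<le> 2 * real (R (Suc r))" by (simp add: B.Lr_def R_Suc)
      also have "\<dots> \<le> (2 * Cr) * real (len r)" using R_le[of r] by (simp add: Cr_def)
      also have "\<dots> \<le> C * real (len r)" using CC(1) by (intro mult_right_mono) auto
      finally show ?thesis .
    qed
    show "1 \<le> k_tilde (X \<oplus>\<^sub>q S) B.b m" if "1 \<le> m" for m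
    proof (rule B.D.k_tilde_ge_one[OF B.schauder_basis_b _ that])
      fix n f assume "f \<in> car (X \<oplus>\<^sub>q S)"
      then show "norm (coord (X \<oplus>\<^sub>q S) B.b n f) \<le> (5 / Fq.Lam 1 + B.Kc / B.lam (rnd n)) * qnorm (X \<oplus>\<^sub>q S) f"
        using B.gD_bound B.coord_b by simp
    qed
    show "k_tilde X x r \<le> k_tilde (X \<oplus>\<^sub>q S) B.b m" if "B.Lr r \<le> m" for r m
      by (rule B.k_tilde_lower[OF that])
    show "k_tilde (X \<oplus>\<^sub>q S) B.b m \<le> ennreal (C * (k + real r powr (1 / s) + real r powr (1 / p - 1 / q)))"
      if "1 \<le> r" "m \<le> B.Lr r" "k_tilde X x r = ennreal k" "0 \<le> k" for r m k
    proof -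
      have "k_tilde (X \<oplus>\<^sub>q S) B.b m \<le> ennreal (Cu * (k + real r powr (1 / s) + real r powr (1 / p - 1 / q)))"
        using that by (intro Cu(2)[rule_format] conjI)
      also have "\<dots> \<le> ennreal (C * (k + real r powr (1 / s) + real r powr (1 / p - 1 / q)))"
        using that(4) CC(2) by (intro ennreal_leI mult_right_mono add_nonneg_nonneg) auto
      finally show ?thesis .
    qed
    show "k_tilde X x (Suc r) \<le> ennreal (C * k)" if "1 \<le> r" "k_tilde X x r = ennreal k" "0 \<le> k" for r k
    proof -
      have "k_tilde X x (Suc r) \<le> ennreal (Xq.kap * (Kx + B.Kc) * k)" by (rule B.k_tilde_Suc[OF that])
      also have "\<dots> \<le> ennreal (C * k)" using that(3) CC(3) by (intro ennreal_leI mult_right_mono)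
      finally show ?thesis .
    qed
  qed
qed

section \<open>Choice of the block lengths\<close>

text \<open>Slopes of chords of a concave function decrease: the slope beyond u is at most that from
  0 to u, which is at most that from 0 to 1 since \<open>1 \<le> u\<close>.\<close>

lemma concave_increment:
  fixes \<phi> :: "real \<Rightarrow> real"
  assumes c: "concave_on {0..} \<phi>" and "1 \<le> u" "0 \<le> \<kappa>"
  shows "\<phi> (u + \<kappa>) \<le> \<phi> u + \<kappa> * (\<phi> 1 - \<phi> 0)"
proof (cases "\<kappa> = 0")
  case False
  then have k: "0 < \<kappa>" using assms by simp
  have conc: "(1 - l) * \<phi> a + l * \<phi> b \<le> \<phi> ((1 - l) * a + l * b)" if "0 \<le> l" "l \<le> 1" "0 \<le> a" "0 \<le> b" for l a b
    using concave_onD[OF c, of l a b] that by simp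
  have "(1 - 1 / u) * \<phi> 0 + 1 / u * \<phi> u \<le> \<phi> 1"
    using conc[of "1 / u" 0 u] assms by simp
  then have "u * ((1 - 1 / u) * \<phi> 0 + 1 / u * \<phi> u) \<le> u * \<phi> 1" using assms by (intro mult_left_mono) auto
  then have 1: "\<phi> u - \<phi> 0 \<le> u * (\<phi> 1 - \<phi> 0)" using assms by (simp add: algebra_simps)
  have pos: "0 < u + \<kappa>" using assms k by simp
  have "(1 - u / (u + \<kappa>)) * \<phi> 0 + u / (u + \<kappa>) * \<phi> (u + \<kappa>) \<le> \<phi> u"
    using conc[of "u / (u + \<kappa>)" 0 "u + \<kappa>"] assms pos by simp
  then have "(u + \<kappa>) * ((1 - u / (u + \<kappa>)) * \<phi> 0 + u / (u + \<kappa>) * \<phi> (u + \<kappa>)) \<le> (u + \<kappa>) * \<phi> u"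
    using pos by (intro mult_left_mono) auto
  moreover have "(u + \<kappa>) * ((1 - u / (u + \<kappa>)) * \<phi> 0 + u / (u + \<kappa>) * \<phi> (u + \<kappa>)) = \<kappa> * \<phi> 0 + u * \<phi> (u + \<kappa>)"
  proof -
    have "(u + \<kappa>) * (1 - u / (u + \<kappa>)) = \<kappa>" "(u + \<kappa>) * (u / (u + \<kappa>)) = u"
      using pos by (simp_all add: right_diff_distrib)
    then show ?thesis by (simp only: distrib_left mult.assoc[symmetric])
  qed
  ultimately have "u * (\<phi> (u + \<kappa>) - \<phi> u) \<le> \<kappa> * (\<phi> u - \<phi> 0)" by (simp add: algebra_simps)
  also have "\<dots> \<le> \<kappa> * (u * (\<phi> 1 - \<phi> 0))" using 1 k by (intro mult_left_mono) auto
  finally have "u * (\<phi> (u + \<kappa>) - \<phi> u) \<le> u * (\<kappa> * (\<phi> 1 - \<phi> 0))" by (simp add: mult_ac)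
  then have "\<phi> (u + \<kappa>) - \<phi> u \<le> \<kappa> * (\<phi> 1 - \<phi> 0)" using assms(2) by (simp add: mult_le_cancel_left_pos)
  then show ?thesis by simp
qed simp

text \<open>The points \<open>t k\<close> form a discrete inverse of \<open>\<phi>\<close> at
  unit-spaced levels. Since increments of \<open>\<phi>\<close> have slope at most
  \<open>\<phi> 1 - \<phi> 0\<close>, gaining one level takes at least the reciprocal of this slope;
  this gap later gives geometric growth of the lengths.\<close>

lemma concave_levels:
  fixes \<phi> :: "real \<Rightarrow> real"
  assumes c: "concave_on {0..} \<phi>" and m: "strict_mono_on {0..} \<phi>" and lim: "filterlim \<phi> at_top at_top"
  obtains t h where "0 < h" "\<And>k. 1 \<le> t k" "\<And>k. \<phi> (t k) = \<phi> 1 + real k" "\<And>k. t k + h \<le> t (Suc k)"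
proof -
  \<comment> \<open>A concave function on the closed half-line may jump at 0, so continuity is
    claimed only on the open one and the levels are sought from 1 on.\<close>
  have "convex_on {0<..} (\<lambda>x. - \<phi> x)"
    using c unfolding concave_on_def by (rule convex_on_subset) auto
  then have "continuous_on {0<..} (\<lambda>x. - \<phi> x)" by (intro convex_on_continuous) auto
  then have "continuous_on {0<..} (\<lambda>x. - (- \<phi> x))" by (rule continuous_on_minus)
  then have cont: "continuous_on {0<..} \<phi>" by simp
  have ex: "\<exists>u\<ge>1. \<phi> u = \<phi> 1 + real k" for k
  proof -
    have "eventually (\<lambda>u. \<phi> 1 + real k \<le> \<phi> u) at_top"
      using lim by (simp add: filterlim_at_top)
    then obtain U where U: "\<And>u. U \<le> u \<Longrightarrow> \<phi> 1 + real k \<le> \<phi> u" unfolding eventually_at_top_linorder by blast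
    have "\<exists>u\<ge>1. u \<le> max 1 U \<and> \<phi> u = \<phi> 1 + real k"
      by (rule IVT') (use U[of "max 1 U"] in \<open>auto intro: continuous_on_subset[OF cont]\<close>)
    then show ?thesis by blast
  qed
  then obtain t where t: "\<And>k. 1 \<le> t k" "\<And>k. \<phi> (t k) = \<phi> 1 + real k" by metis
  define \<sigma> where "\<sigma> = \<phi> 1 - \<phi> 0"
  have \<sigma>: "0 < \<sigma>" using strict_mono_onD[OF m, of 0 1] by (simp add: \<sigma>_def)
  have "t k + 1 / \<sigma> \<le> t (Suc k)" for k
  proof -
    have lt: "t k < t (Suc k)"
    proof (rule ccontr)
      assume "\<not> t k < t (Suc k)"
      then have "\<phi> (t (Suc k)) \<le> \<phi> (t k)"
        using strict_mono_on_leD[OF m, of "t (Suc k)" "t k"] t(1)[of k] t(1)[of "Suc k"] by simp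
      then show False by (simp add: t(2))
    qed
    have "\<phi> (t k + (t (Suc k) - t k)) \<le> \<phi> (t k) + (t (Suc k) - t k) * \<sigma>"
      unfolding \<sigma>_def using lt by (intro concave_increment[OF c t(1)]) simp
    then have "1 \<le> (t (Suc k) - t k) * \<sigma>" by (simp add: t(2))
    then show ?thesis using \<sigma> by (simp add: field_simps)
  qed
  moreover have "0 < 1 / \<sigma>" using \<sigma> by simp
  ultimately show thesis using that[of "1 / \<sigma>" t] t by blast
qed

theorem theorem4p1:
  fixes X :: "('k::real_or_complex, 'v::ab_group_add) qspace"
    and x :: "nat \<Rightarrow> 'v"
    and S :: "('k, nat \<Rightarrow> 'k) qspace"
    and \<delta> \<phi> :: "real \<Rightarrow> real"
    and p s q :: real
  assumes "quasi_banach X" and "schauder_basis X x"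
    and "subsymmetric S" and "superreflexive S"
    and "\<And>t. 0 \<le> t \<Longrightarrow> 0 \<le> \<delta> t" and "mono_on {0..} \<delta>"
    and "\<And>m. 1 \<le> m \<Longrightarrow> k_tilde X x m = ennreal (\<delta> (real m))"
    and "0 < p" and "p \<le> 1" and "p_convex p X"
    and "1 < s" and "upper_estimate s S"
    and "1 < q" and "lower_estimate q S"
    and "\<And>t. 0 \<le> t \<Longrightarrow> 1 \<le> \<phi> t" and "concave_on {0..} \<phi>" and "strict_mono_on {0..} \<phi>"
    and "filterlim \<phi> at_top at_top"
  shows
    "(\<exists>b. schauder_basis (X \<oplus>\<^sub>q S) b \<and> almost_greedy (X \<oplus>\<^sub>q S) b \<and>
        equivalent {1..} (fundamental_function (X \<oplus>\<^sub>q S) b) (\<Lambda> S) \<and>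
        asymptotically_suppression_unconditional (X \<oplus>\<^sub>q S) b \<and>
        same_local_structure X x S b \<and>
        lesssim {2..} (\<lambda>m. ennreal (\<delta> (ln (real m)))) (k_tilde (X \<oplus>\<^sub>q S) b)) \<and>
     (lesssim {1..} (\<lambda>m. ennreal (real m powr max (1 / s) (1 / p - 1 / q))) (k_tilde X x) \<longrightarrow>
      (\<exists>b. schauder_basis (X \<oplus>\<^sub>q S) b \<and> almost_greedy (X \<oplus>\<^sub>q S) b \<and>
        equivalent {1..} (fundamental_function (X \<oplus>\<^sub>q S) b) (\<Lambda> S) \<and>
        asymptotically_suppression_unconditional (X \<oplus>\<^sub>q S) b \<and>
        same_local_structure X x S b \<and>
        equivalent {1..} (k_tilde (X \<oplus>\<^sub>q S) b) (\<lambda>m. ennreal (\<delta> (\<phi> (ln (real m)))))))"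
proof -
  note X = assms(1,2) and S = assms(3) and \<delta>_nonneg = assms(5) and \<delta>_mono = assms(6) and k\<delta> = assms(7)
    and p = assms(8-10) and s = assms(11,12) and q = assms(13,14)
    and \<phi>_ge = assms(15) and \<phi>_conc = assms(16) and \<phi>_mono = assms(17) and \<phi>_lim = assms(18)
  have \<delta>le: "\<delta> a \<le> \<delta> b" if "0 \<le> a" "a \<le> b" for a b using mono_onD[OF \<delta>_mono] that by auto
  show ?thesis
  proof (intro conjI impI)
    \<comment> \<open>The base 2 lies below e. With \<open>r = \<lceil>ln m\<rceil>\<close> the
      bound for \<open>L r\<close> is of order \<open>m powr ln 2\<close>, which leaves room for the
      unknown constant C when m is large.\<close>
    define len :: "nat \<Rightarrow> nat" where "len k = 2 ^ k" for k
    have gr: "real (len j) \<le> (1 / 2) ^ (k - j) * real (len k)" if "j \<le> k" for j k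
    proof -
      have "(2::real) ^ k = 2 ^ (k - j) * 2 ^ j" using that by (simp flip: power_add)
      then show ?thesis by (simp add: len_def power_divide)
    qed
    have len1: "0 < len j" "j \<le> k \<Longrightarrow> len j \<le> len k" for j k by (simp_all add: len_def)
    obtain b L C where b: "schauder_basis (X \<oplus>\<^sub>q S) b" "almost_greedy (X \<oplus>\<^sub>q S) b"
      "equivalent {1..} (fundamental_function (X \<oplus>\<^sub>q S) b) (\<Lambda> S)"
      "asymptotically_suppression_unconditional (X \<oplus>\<^sub>q S) b"
      "same_local_structure X x S b"
      and L: "1 \<le> C" "\<And>r. real (L (Suc r)) \<le> C * real (len r)"
      and k1: "\<And>m. 1 \<le> m \<Longrightarrow> 1 \<le> k_tilde (X \<oplus>\<^sub>q S) b m"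
      and low: "\<And>r m. L r \<le> m \<Longrightarrow> k_tilde X x r \<le> k_tilde (X \<oplus>\<^sub>q S) b m"
      by (rule almost_greedy_basis_for_sizes[OF X S p s q len1, where \<eta> = "1 / 2" and ?C0.0 = 1]) (auto intro: gr)
    have ln2: "ln 2 < (1::real)" using ln_less_self[of "2::real"] ln_2_less_1 by simp
    have "lesssim {2..} (\<lambda>m. ennreal (\<delta> (ln (real m)))) (k_tilde (X \<oplus>\<^sub>q S) b)"
    proof -
      \<comment> \<open>From M on, \<open>m powr (1 - ln 2)\<close> is at least
        \<open>2 * C\<close>, hence \<open>C * m powr ln 2\<close> is at most m.\<close>
      define M where "M = (2 * C) powr (1 / (1 - ln 2))"
      have "ennreal (\<delta> (ln (real m))) \<le> ennreal (max 1 (\<delta> (max 0 (ln M)))) * k_tilde (X \<oplus>\<^sub>q S) b m" if m: "2 \<le> m" for m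
      proof (cases "M \<le> real m")
        case True
        define r where "r = nat \<lceil>ln (real m)\<rceil>"
        have lm: "0 < ln (real m)" using m by simp
        then have r: "1 \<le> r" "ln (real m) \<le> real r" "real r < ln (real m) + 1" unfolding r_def by linarith+
        have "real (L r) \<le> real m"
        proof -
          obtain r' where r': "r = Suc r'" using r(1) by (cases r) auto
          have "real (L r) \<le> C * 2 ^ r'" using L(2)[of r'] by (simp add: r' len_def)
          also have "(2::real) ^ r' = exp (real r' * ln 2)" by (simp add: exp_of_nat_mult)
          also have "\<dots> \<le> exp (ln (real m) * ln 2)"
            using r(3) by (simp add: r')
          also have "\<dots> = real m powr ln 2" using m by (simp add: powr_def mult.commute)
          also have "C * real m powr ln 2 \<le> real m powr (1 - ln 2) * real m powr ln 2"
          proof (intro mult_right_mono)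
            have "2 * C = M powr (1 - ln 2)" using L(1) ln2 by (simp add: M_def powr_powr)
            also have "\<dots> \<le> real m powr (1 - ln 2)" using True ln2 by (intro powr_mono2) (auto simp: M_def)
            finally show "C \<le> real m powr (1 - ln 2)" using L(1) by simp
          qed simp
          also have "\<dots> = real m" using m by (simp flip: powr_add)
          finally show ?thesis using L(1) by simp
        qed
        then have "ennreal (\<delta> (ln (real m))) \<le> k_tilde (X \<oplus>\<^sub>q S) b m"
          using low[of r m] k\<delta>[OF r(1)] \<delta>le[of "ln (real m)" "real r"] r(2) lm
          by (auto intro: order_trans[OF ennreal_leI])
        also have "\<dots> = ennreal 1 * k_tilde (X \<oplus>\<^sub>q S) b m" by simp
        also have "\<dots> \<le> ennreal (max 1 (\<delta> (max 0 (ln M)))) * k_tilde (X \<oplus>\<^sub>q S) b m"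
          by (intro mult_right_mono ennreal_leI) auto
        finally show ?thesis .
      next
        \<comment> \<open>Only finitely many m remain; there \<open>k_tilde\<close> is at least 1
          and the bounded values of \<open>\<delta>\<close> go into the constant.\<close>
        case False
        have lm: "0 \<le> ln (real m)" using m by simp
        have "ln (real m) \<le> max 0 (ln M)" using False m by (simp add: le_max_iff_disj)
        then have "ennreal (\<delta> (ln (real m))) \<le> ennreal (max 1 (\<delta> (max 0 (ln M)))) * 1"
          using \<delta>le[OF lm] by (auto intro!: ennreal_leI simp: le_max_iff_disj)
        also have "\<dots> \<le> ennreal (max 1 (\<delta> (max 0 (ln M)))) * k_tilde (X \<oplus>\<^sub>q S) b m"
          using k1[of m] m by (intro mult_left_mono) auto
        finally show ?thesis .
      qed
      then show ?thesis unfolding lesssim_def by (intro exI[of _ "max 1 (\<delta> (max 0 (ln M)))"]) auto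
    qed
    with b show "\<exists>b. schauder_basis (X \<oplus>\<^sub>q S) b \<and> almost_greedy (X \<oplus>\<^sub>q S) b \<and>
        equivalent {1..} (fundamental_function (X \<oplus>\<^sub>q S) b) (\<Lambda> S) \<and>
        asymptotically_suppression_unconditional (X \<oplus>\<^sub>q S) b \<and>
        same_local_structure X x S b \<and>
        lesssim {2..} (\<lambda>m. ennreal (\<delta> (ln (real m)))) (k_tilde (X \<oplus>\<^sub>q S) b)" by blast
  next
    assume "lesssim {1..} (\<lambda>m. ennreal (real m powr max (1 / s) (1 / p - 1 / q))) (k_tilde X x)"
    then obtain C1 where C1': "\<And>m. 1 \<le> m \<Longrightarrow> ennreal (real m powr max (1 / s) (1 / p - 1 / q)) \<le> ennreal C1 * k_tilde X x m"
      unfolding lesssim_def by auto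
    \<comment> \<open>The constant in \<open>lesssim\<close> may be negative, in which case
      \<open>ennreal\<close> reads it as 0.\<close>
    define Ch where "Ch = max 0 C1"
    have Ch: "real m powr max (1 / s) (1 / p - 1 / q) \<le> Ch * \<delta> (real m)" if "1 \<le> m" for m
    proof -
      have "ennreal (real m powr max (1 / s) (1 / p - 1 / q)) \<le> ennreal C1 * ennreal (\<delta> (real m))"
        using C1'[OF that] k\<delta>[OF that] by simp
      also have "\<dots> \<le> ennreal Ch * ennreal (\<delta> (real m))" by (intro mult_right_mono ennreal_leI) (auto simp: Ch_def)
      also have "\<dots> = ennreal (Ch * \<delta> (real m))" by (simp add: ennreal_mult' Ch_def)
      finally show ?thesis using \<delta>_nonneg[of "real m"] by (simp add: Ch_def)
    qed
    obtain t h where h: "0 < h" and t1: "\<And>k. 1 \<le> t k" and t\<phi>: "\<And>k. \<phi> (t k) = \<phi> 1 + real k"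
      and th: "\<And>k. t k + h \<le> t (Suc k)"
      by (rule concave_levels[OF \<phi>_conc \<phi>_mono \<phi>_lim]) (rule that)
    have tgap: "t j + real (k - j) * h \<le> t k" if "j \<le> k" for j k
      using that
    proof (induction k rule: dec_induct)
      case (step k)
      then show ?case using th[of k] by (simp add: Suc_diff_le algebra_simps)
    qed simp
    \<comment> \<open>At m comparable with \<open>len k\<close>, the value
      \<open>\<phi> (ln m)\<close> differs from k by a bounded amount. Rounding up costs at most a
      factor 2, because \<open>exp (t k)\<close> is at least 1.\<close>
    define len where "len k = nat \<lceil>exp (t k)\<rceil>" for k
    have len_ge: "exp (t k) \<le> real (len k)" for k unfolding len_def by (simp add: of_nat_ceiling)
    have len_le: "real (len k) \<le> 2 * exp (t k)" for k
    proof -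
      have "real (len k) \<le> exp (t k) + 1" unfolding len_def using exp_gt_zero[of "t k"] by linarith
      moreover have "1 \<le> exp (t k)" using t1[of k] by simp
      ultimately show ?thesis by linarith
    qed
    have len0: "0 < len j" for j using len_ge[of j] exp_gt_zero[of "t j"] by (metis of_nat_0_less_iff order_less_le_trans)
    have lenm: "len j \<le> len k" if "j \<le> k" for j k
    proof -
      have "t j \<le> t k" using tgap[OF that] h mult_nonneg_nonneg[of "real (k - j)" h] by linarith
      then show ?thesis unfolding len_def by (intro nat_mono ceiling_mono) simp
    qed
    have gr: "real (len j) \<le> 2 * exp (- h) ^ (k - j) * real (len k)" if "j \<le> k" for j k
    proof -
      have "exp (t j) \<le> exp (- h) ^ (k - j) * exp (t k)"
        using tgap[OF that] by (simp flip: exp_of_nat_mult exp_add)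
      also have "\<dots> \<le> exp (- h) ^ (k - j) * real (len k)" using len_ge[of k] by (intro mult_left_mono) auto
      finally show ?thesis using len_le[of j] by simp
    qed
    have eh: "0 < exp (- h)" "exp (- h) < 1" using h by simp_all
    obtain b L C where b: "schauder_basis (X \<oplus>\<^sub>q S) b" "almost_greedy (X \<oplus>\<^sub>q S) b"
      "equivalent {1..} (fundamental_function (X \<oplus>\<^sub>q S) b) (\<Lambda> S)"
      "asymptotically_suppression_unconditional (X \<oplus>\<^sub>q S) b"
      "same_local_structure X x S b"
      and L: "strict_mono L" "L 0 = 0" "1 \<le> C" "\<And>r. len r \<le> L (Suc r)" "\<And>r. real (L (Suc r)) \<le> C * real (len r)"
      and k1: "\<And>m. 1 \<le> m \<Longrightarrow> 1 \<le> k_tilde (X \<oplus>\<^sub>q S) b m"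
      and low: "\<And>r m. L r \<le> m \<Longrightarrow> k_tilde X x r \<le> k_tilde (X \<oplus>\<^sub>q S) b m"
      and upp: "\<And>r m k. 1 \<le> r \<Longrightarrow> m \<le> L r \<Longrightarrow> k_tilde X x r = ennreal k \<Longrightarrow> 0 \<le> k \<Longrightarrow>
        k_tilde (X \<oplus>\<^sub>q S) b m \<le> ennreal (C * (k + real r powr (1 / s) + real r powr (1 / p - 1 / q)))"
      and stp: "\<And>r k. 1 \<le> r \<Longrightarrow> k_tilde X x r = ennreal k \<Longrightarrow> 0 \<le> k \<Longrightarrow> k_tilde X x (Suc r) \<le> ennreal (C * k)"
      by (rule almost_greedy_basis_for_sizes[OF X S p s q len0 lenm eh, where ?C0.0 = 2]) (auto intro: gr)
    have step: "\<delta> (real (Suc r)) \<le> C * \<delta> (real r)" if "1 \<le> r" for r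
      using stp[OF that k\<delta>[OF that]] k\<delta>[of "Suc r"] \<delta>_nonneg[of "real r"] L(3) by simp
    have steps: "\<delta> (real (r + n)) \<le> C ^ n * \<delta> (real r)" if "1 \<le> r" for r n
    proof (induction n)
      case (Suc n)
      have "\<delta> (real (r + Suc n)) \<le> C * \<delta> (real (r + n))" using step[of "r + n"] that by simp
      also have "\<dots> \<le> C * (C ^ n * \<delta> (real r))" using Suc L(3) by (intro mult_left_mono) auto
      finally show ?case by simp
    qed simp
    \<comment> \<open>From \<open>m \<le> C * len r\<close> and the rounding factor 2 it follows
      that \<open>ln m \<le> t r + \<kappa>\<close>.\<close>
    define \<kappa> where "\<kappa> = ln (2 * C)"
    have \<kappa>: "0 \<le> \<kappa>" using L(3) by (simp add: \<kappa>_def)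
    \<comment> \<open>The additive \<open>\<kappa>\<close> in the argument raises
      \<open>\<phi>\<close> by a bounded amount only. Together with the starting level
      \<open>\<phi> 1\<close> this bounds the excess of \<open>\<phi> (ln m)\<close> over r.\<close>
    define n1 where "n1 = nat \<lceil>\<phi> 1 + \<kappa> * (\<phi> 1 - \<phi> 0)\<rceil>"
    have loc: "\<exists>r. L r \<le> m \<and> m \<le> L (Suc r) \<and> real r \<le> \<phi> (ln (real m)) \<and> \<phi> (ln (real m)) \<le> real (r + n1)"
      if m: "1 \<le> m" for m
    proof -
      define r where "r = block_index L m"
      have r: "L r \<le> m" "m < L (Suc r)" unfolding r_def by (rule block_index_bounds[OF L(1,2)])+
      have lm: "0 \<le> ln (real m)" using m by simp
      have \<phi>le: "\<phi> a \<le> \<phi> c" if "0 \<le> a" "a \<le> c" for a c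
        using strict_mono_on_leD[OF \<phi>_mono, of a c] that by simp
      have "real r \<le> \<phi> (ln (real m))"
      proof (cases r)
        case 0
        then show ?thesis using \<phi>_ge[OF lm] by simp
      next
        case (Suc r')
        have "exp (t r') \<le> real m" using len_ge[of r'] L(4)[of r'] r(1) Suc by (simp add: order_trans)
        then have "t r' \<le> ln (real m)" using m by (simp add: ln_ge_iff)
        then have "\<phi> (t r') \<le> \<phi> (ln (real m))" using t1[of r'] by (intro \<phi>le) auto
        then show ?thesis using t\<phi>[of r'] \<phi>_ge[of 1] Suc by simp
      qed
      moreover have "\<phi> (ln (real m)) \<le> real (r + n1)"
      proof -
        have "real m \<le> C * real (len r)" using r(2) L(5)[of r] by linarith
        also have "\<dots> \<le> C * (2 * exp (t r))" using len_le[of r] L(3) by (intro mult_left_mono) auto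
        finally have "real m \<le> 2 * C * exp (t r)" by simp
        then have "ln (real m) \<le> ln (2 * C * exp (t r))" using m by (subst ln_le_cancel_iff) auto
        also have "\<dots> = t r + \<kappa>" using L(3) by (simp add: \<kappa>_def ln_mult)
        finally have "\<phi> (ln (real m)) \<le> \<phi> (t r + \<kappa>)" using lm by (intro \<phi>le)
        also have "\<dots> \<le> \<phi> (t r) + \<kappa> * (\<phi> 1 - \<phi> 0)" by (rule concave_increment[OF \<phi>_conc t1 \<kappa>])
        also have "\<dots> \<le> real r + real n1" unfolding t\<phi> n1_def by linarith
        finally show ?thesis by simp
      qed
      ultimately show ?thesis using r by (intro exI[of _ r]) auto
    qed
    have upper: "lesssim {1..} (k_tilde (X \<oplus>\<^sub>q S) b) (\<lambda>m. ennreal (\<delta> (\<phi> (ln (real m)))))"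
    proof -
      define K where "K = C * (1 + 2 * Ch) * C"
      have Ch0: "0 \<le> Ch" by (simp add: Ch_def)
      have "k_tilde (X \<oplus>\<^sub>q S) b m \<le> ennreal K * ennreal (\<delta> (\<phi> (ln (real m))))" if m: "1 \<le> m" for m
      proof -
        obtain r where r: "L r \<le> m" "m \<le> L (Suc r)" "real r \<le> \<phi> (ln (real m))" using loc[OF m] by blast
        have lm: "0 \<le> ln (real m)" using m by simp
        let ?r = "real (Suc r)"
        have d0: "0 \<le> \<delta> ?r" by (intro \<delta>_nonneg) simp
        have "k_tilde (X \<oplus>\<^sub>q S) b m \<le> ennreal (C * (\<delta> ?r + ?r powr (1 / s) + ?r powr (1 / p - 1 / q)))"
          using r(2) d0 by (intro upp k\<delta>) auto
        also have "\<dots> \<le> ennreal (C * ((1 + 2 * Ch) * \<delta> ?r))"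
        proof (intro ennreal_leI mult_left_mono)
          have "?r powr (1 / s) \<le> ?r powr max (1 / s) (1 / p - 1 / q)"
            "?r powr (1 / p - 1 / q) \<le> ?r powr max (1 / s) (1 / p - 1 / q)"
            by (intro powr_mono; simp)+
          then show "\<delta> ?r + ?r powr (1 / s) + ?r powr (1 / p - 1 / q) \<le> (1 + 2 * Ch) * \<delta> ?r"
            using Ch[of "Suc r"] by (simp add: algebra_simps)
        qed (use L(3) in simp)
        also have "\<dots> \<le> ennreal (K * \<delta> (\<phi> (ln (real m))))"
        proof (intro ennreal_leI)
          \<comment> \<open>The upper bound refers to \<open>Suc r\<close>, while only r is known to
            lie below \<open>\<phi> (ln m)\<close>. For \<open>r = 0\<close> the bound
            \<open>1 \<le> \<phi>\<close> suffices; otherwise one step of the growth bound for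
            \<open>\<delta>\<close> is used.\<close>
          have "\<delta> ?r \<le> C * \<delta> (\<phi> (ln (real m)))"
          proof (cases "r = 0")
            case True
            have "\<delta> ?r \<le> \<delta> (\<phi> (ln (real m)))" using True \<phi>_ge[OF lm] by (intro \<delta>le) auto
            also have "1 * \<delta> (\<phi> (ln (real m))) \<le> C * \<delta> (\<phi> (ln (real m)))"
              using L(3) \<phi>_ge[OF lm] by (intro mult_right_mono \<delta>_nonneg) auto
            finally show ?thesis by simp
          next
            case False
            have "\<delta> ?r \<le> C * \<delta> (real r)" using step[of r] False by simp
            also have "\<dots> \<le> C * \<delta> (\<phi> (ln (real m)))" using r(3) L(3) by (intro mult_left_mono \<delta>le) auto
            finally show ?thesis .
          qed
          then have "(C * (1 + 2 * Ch)) * \<delta> ?r \<le> (C * (1 + 2 * Ch)) * (C * \<delta> (\<phi> (ln (real m))))"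
            using L(3) Ch0 by (intro mult_left_mono) auto
          then show "C * ((1 + 2 * Ch) * \<delta> ?r) \<le> K * \<delta> (\<phi> (ln (real m)))" by (simp add: K_def mult.assoc)
        qed
        also have "\<dots> = ennreal K * ennreal (\<delta> (\<phi> (ln (real m))))"
          using L(3) Ch0 by (intro ennreal_mult') (auto simp: K_def)
        finally show ?thesis .
      qed
      then show ?thesis unfolding lesssim_def by (intro exI[of _ K]) auto
    qed
    have lower: "lesssim {1..} (\<lambda>m. ennreal (\<delta> (\<phi> (ln (real m))))) (k_tilde (X \<oplus>\<^sub>q S) b)"
    proof -
      \<comment> \<open>The power of C covers the \<open>n1\<close> steps from r upwards when
        \<open>r \<ge> 1\<close>. For \<open>r = 0\<close> there is no value of
        \<open>k_tilde X x\<close> tied to \<open>\<delta>\<close>; then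
        \<open>\<delta> (real n1)\<close> is the bound, against
        \<open>k_tilde \<ge> 1\<close>.\<close>
      define K where "K = max (C ^ n1) (\<delta> (real n1))"
      have K: "0 \<le> K" using L(3) by (simp add: K_def le_max_iff_disj)
      have "ennreal (\<delta> (\<phi> (ln (real m)))) \<le> ennreal K * k_tilde (X \<oplus>\<^sub>q S) b m" if m: "1 \<le> m" for m
      proof -
        obtain r where r: "L r \<le> m" "\<phi> (ln (real m)) \<le> real (r + n1)" using loc[OF m] by blast
        have lm: "0 \<le> ln (real m)" using m by simp
        have le: "\<delta> (\<phi> (ln (real m))) \<le> \<delta> (real (r + n1))"
          using \<phi>_ge[OF lm] r(2) by (intro \<delta>le) auto
        show ?thesis
        proof (cases "r = 0")
          case True
          have "ennreal (\<delta> (\<phi> (ln (real m)))) \<le> ennreal K * 1"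
            using le True by (auto intro!: ennreal_leI simp: K_def le_max_iff_disj)
          also have "\<dots> \<le> ennreal K * k_tilde (X \<oplus>\<^sub>q S) b m" using k1[OF m] by (intro mult_left_mono) auto
          finally show ?thesis .
        next
          case False
          then have r1: "1 \<le> r" by simp
          have "\<delta> (\<phi> (ln (real m))) \<le> C ^ n1 * \<delta> (real r)" using le steps[OF r1, of n1] by linarith
          also have "\<dots> \<le> K * \<delta> (real r)" by (intro mult_right_mono \<delta>_nonneg) (auto simp: K_def)
          finally have "ennreal (\<delta> (\<phi> (ln (real m)))) \<le> ennreal (K * \<delta> (real r))" by (rule ennreal_leI)
          also have "\<dots> = ennreal K * k_tilde X x r" unfolding k\<delta>[OF r1] by (rule ennreal_mult'[OF K])
          also have "\<dots> \<le> ennreal K * k_tilde (X \<oplus>\<^sub>q S) b m" by (intro mult_left_mono low r(1)) auto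
          finally show ?thesis .
        qed
      qed
      then show ?thesis unfolding lesssim_def by (intro exI[of _ K]) auto
    qed
    from b upper lower show "\<exists>b. schauder_basis (X \<oplus>\<^sub>q S) b \<and> almost_greedy (X \<oplus>\<^sub>q S) b \<and>
        equivalent {1..} (fundamental_function (X \<oplus>\<^sub>q S) b) (\<Lambda> S) \<and>
        asymptotically_suppression_unconditional (X \<oplus>\<^sub>q S) b \<and>
        same_local_structure X x S b \<and>
        equivalent {1..} (k_tilde (X \<oplus>\<^sub>q S) b) (\<lambda>m. ennreal (\<delta> (\<phi> (ln (real m)))))"
      unfolding equivalent_def by blast
  qed
qed

end
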